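(* Let $0<\alpha<1$, $p\in(1,\infty)$, $s\in(1/p,1)$ and $g\in W^{s,p}(0,T;L^2(\Omega))$. Let $u_h:(0,T]\to X_h$ be the solution of the spatially semidiscrete problem $${}_0\partial_t^\alpha u_h(t)-\Delta_h u_h(t)=P_hg(t),\quad t\in(0,T],\qquad u_h(0)=0,$$ and let $U_h^n\in X_h$, $n=0,\dots,N$, be the solution of the fully discrete problem $${}_0\bar\partial_\tau^\alpha U_h^n-\Delta_hU_h^n=P_hg(t_n),\quad n=1,\dots,N,\qquad U_h^0=0,$$ where ${}_0\bar\partial_\tau^\alpha$ is given by either the L1 scheme or backward Euler convolution quadrature. Then $$\Big(\tau\sum_{n=1}^N\|U_h^n-u_h(t_n)\|_{L^2(\Omega)}^p\Big)^{1/p}\le c\,\tau^{\min(1/p+\alpha,\,s)}\,\|g\|_{W^{s,p}(0,T;L^2(\Omega))}.$$ Moreover, if $p>1/\alpha$ is so large that $\alpha\in(0,1/p')$, where $1/p+1/p'=1$, then (for $g\in W^{1/p+\alpha,p}(0,T;L^2(\Omega))$) $$\max_{1\le n\le N}\|U_h^n-u_h(t_n)\|_{L^2(\Omega)}\le c\,\tau^{\alpha}\,\|g\|_{W^{1/p+\alpha,p}(0,T;L^2(\Omega))}.$$ The constants $c$ are independent of $h$, $\tau$ and $g$.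
   Context: $T>0$ is fixed and $\Omega\subset\mathbb R^d$ ($d=1,2,3$) is a convex polyhedral domain. The left-sided Riemann–Liouville derivative is ${}_0\partial_t^\alpha u(t)=\frac{1}{\Gamma(1-\alpha)}\frac{d}{dt}\int_0^t(t-s)^{-\alpha}u(s)\,ds$. For $0<s<1$, $W^{s,p}(0,T;L^2(\Omega))$ carries the Sobolev–Slobodeckij norm $\|v\|_{W^{s,p}}^p=\|v\|_{L^p(0,T;L^2(\Omega))}^p+\int_0^T\int_0^T\frac{\|v(t)-v(\xi)\|_{L^2(\Omega)}^p}{|t-\xi|^{1+ps}}dt\,d\xi$. For $s>1/p$ its elements have continuous representatives on $[0,T]$, which are used for pointwise evaluation. Space discretization. $\mathcal T_h$ is a shape-regular, quasi-uniform triangulation of $\Omega$ into $d$-simplices with mesh size $h$; $X_h\subset H^1_0(\Omega)$ is the space of continuous functions that are linear on each $K\in\mathcal T_h$; $P_h:L^2(\Omega)\to X_h$ is the $L^2(\Omega)$-orthogonal projection; the discrete Laplacian $\Delta_h:X_h\to X_h$ is defined by $-(\Delta_h\varphi_h,\chi_h)=(\nabla\varphi_h,\nabla\chi_h)$ for all $\varphi_h,\chi_h\in X_h$, with $(\cdot,\cdot)$ the $L^2(\Omega)$ inner product. Time discretization. $t_n=n\tau$, $n=0,\dots,N$, $\tau=T/N\le1$, and ${}_0\bar\partial_\tau^\alpha\varphi^n=\tau^{-\alpha}\sum_{j=0}^n\beta_{n-j}\varphi^j$, where - L1 scheme: $\beta_0=\frac{1}{\Gamma(2-\alpha)}$ and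 $\beta_j=\frac{1}{\Gamma(2-\alpha)}\big[(j+1)^{1-\alpha}-2j^{1-\alpha}+(j-1)^{1-\alpha}\big]$ for $j\ge1$; - backward Euler convolution quadrature: $\beta_0=1$ and $\beta_j=-\beta_{j-1}(\alpha-j+1)/j$ for $j\ge1$. *)

theory Defs
  imports "HOL-Analysis.Analysis"
begin

section \<open>The space $L^2(\Omega)$\<close>

text \<open>
  Elements of $L^2(\Omega)$ are represented by functions, so equality in $L^2(\Omega)$ is equality
  almost everywhere on $\Omega$.  A function of time with values in $L^2(\Omega)$ is a curried
  function of $t$ and $x$.
\<close>

definition L2 :: "'a::euclidean_space set \<Rightarrow> ('a \<Rightarrow> real) set" where
  "L2 \<Omega> = {f. f \<in> borel_measurable (lebesgue_on \<Omega>) \<and> integrable (lebesgue_on \<Omega>) (\<lambda>x. (f x)\<^sup>2)}"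

definition L2_inner :: "'a::euclidean_space set \<Rightarrow> ('a \<Rightarrow> real) \<Rightarrow> ('a \<Rightarrow> real) \<Rightarrow> real" where
  "L2_inner \<Omega> f g = (LINT x|lebesgue_on \<Omega>. f x * g x)"

definition L2_norm :: "'a::euclidean_space set \<Rightarrow> ('a \<Rightarrow> real) \<Rightarrow> real" where
  "L2_norm \<Omega> f = sqrt (L2_inner \<Omega> f f)"


section \<open>Sobolev--Slobodeckij spaces of functions with values in $L^2(\Omega)$\<close>

definition bochner_measurable ::
    "real \<Rightarrow> 'a::euclidean_space set \<Rightarrow> (real \<Rightarrow> 'a \<Rightarrow> real) \<Rightarrow> bool" where
  "bochner_measurable T \<Omega> g \<longleftrightarrow>
     (AE t in lebesgue_on {0<..<T}. g t \<in> L2 \<Omega>) \<and>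
     (\<exists>\<sigma>. (\<forall>n::nat. simple_function (lebesgue_on {0<..<T}) (\<sigma> n) \<and>
                      (\<forall>t\<in>{0<..<T}. \<sigma> n t \<in> L2 \<Omega>)) \<and>
          (AE t in lebesgue_on {0<..<T}.
             (\<lambda>n. L2_norm \<Omega> (\<lambda>x. \<sigma> n t x - g t x)) \<longlonglongrightarrow> 0))"

text \<open>
  The \<open>p\<close>-th power of the norm, with values in $[0,\infty]$.  On the null set $t = \xi$ the
  integrand is \<open>0 / 0 = 0\<close>.
\<close>

definition W_energy ::
    "real \<Rightarrow> real \<Rightarrow> real \<Rightarrow> 'a::euclidean_space set \<Rightarrow> (real \<Rightarrow> 'a \<Rightarrow> real) \<Rightarrow> ennreal" where
  "W_energy s p T \<Omega> g =
     (\<integral>\<^sup>+t. ennreal (L2_norm \<Omega> (g t) powr p) \<partial>lebesgue_on {0<..<T}) +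
     (\<integral>\<^sup>+\<xi>. (\<integral>\<^sup>+t. ennreal (L2_norm \<Omega> (\<lambda>x. g t x - g \<xi> x) powr p / \<bar>t - \<xi>\<bar> powr (1 + p * s))
        \<partial>lebesgue_on {0<..<T}) \<partial>lebesgue_on {0<..<T})"

definition W_space ::
    "real \<Rightarrow> real \<Rightarrow> real \<Rightarrow> 'a::euclidean_space set \<Rightarrow> (real \<Rightarrow> 'a \<Rightarrow> real) set" where
  "W_space s p T \<Omega> = {g. bochner_measurable T \<Omega> g \<and> W_energy s p T \<Omega> g < \<infinity>}"

definition W_norm ::
    "real \<Rightarrow> real \<Rightarrow> real \<Rightarrow> 'a::euclidean_space set \<Rightarrow> (real \<Rightarrow> 'a \<Rightarrow> real) \<Rightarrow> real" where
  "W_norm s p T \<Omega> g = enn2real (W_energy s p T \<Omega> g) powr (1 / p)"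

definition L2_continuous ::
    "real \<Rightarrow> 'a::euclidean_space set \<Rightarrow> (real \<Rightarrow> 'a \<Rightarrow> real) \<Rightarrow> bool" where
  "L2_continuous T \<Omega> v \<longleftrightarrow>
     (\<forall>t\<in>{0..T}. v t \<in> L2 \<Omega> \<and>
        ((\<lambda>r. L2_norm \<Omega> (\<lambda>x. v r x - v t x)) \<longlongrightarrow> 0) (at t within {0..T}))"

definition continuous_representative ::
    "real \<Rightarrow> 'a::euclidean_space set \<Rightarrow> (real \<Rightarrow> 'a \<Rightarrow> real) \<Rightarrow> (real \<Rightarrow> 'a \<Rightarrow> real) \<Rightarrow> bool" where
  "continuous_representative T \<Omega> g gc \<longleftrightarrow>
     L2_continuous T \<Omega> gc \<and>
     (AE t in lebesgue_on {0<..<T}. AE x in lebesgue_on \<Omega>. gc t x = g t x)"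


section \<open>Finite elements\<close>

definition convex_polyhedral_domain :: "'a::euclidean_space set \<Rightarrow> bool" where
  "convex_polyhedral_domain \<Omega> \<longleftrightarrow> \<Omega> \<noteq> {} \<and> open \<Omega> \<and> convex \<Omega> \<and> polytope (closure \<Omega>)"

definition fe_triangulation :: "'a::euclidean_space set \<Rightarrow> 'a set set \<Rightarrow> bool" where
  "fe_triangulation \<Omega> \<T> \<longleftrightarrow>
     triangulation \<T> \<and> (\<forall>K\<in>\<T>. int DIM('a) simplex K) \<and> \<Union>\<T> = closure \<Omega>"

definition mesh_size :: "'a::euclidean_space set set \<Rightarrow> real" where
  "mesh_size \<T> = Max (diameter ` \<T>)"

definition inball_diameter :: "'a::euclidean_space set \<Rightarrow> real" where
  "inball_diameter K = Sup {2 * r | r. r \<ge> 0 \<and> (\<exists>x. cball x r \<subseteq> K)}"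

text \<open>
  A family of triangulations is shape-regular and quasi-uniform if the following two predicates
  hold for all its members with constants common to the whole family.
\<close>

definition shape_regular :: "real \<Rightarrow> 'a::euclidean_space set set \<Rightarrow> bool" where
  "shape_regular \<kappa> \<T> \<longleftrightarrow> (\<forall>K\<in>\<T>. diameter K \<le> \<kappa> * inball_diameter K)"

definition quasi_uniform :: "real \<Rightarrow> 'a::euclidean_space set set \<Rightarrow> bool" where
  "quasi_uniform \<kappa> \<T> \<longleftrightarrow> (\<forall>K\<in>\<T>. mesh_size \<T> \<le> \<kappa> * diameter K)"

text \<open>
  For a continuous piecewise linear function, membership in $H^1_0(\Omega)$ means that it vanishes
  on $\partial\Omega$.  The functions are extended by zero outside $\Omega$, so that an element of
  $X_h$ has exactly one representative.
\<close>

definition fe_space :: "'a::euclidean_space set \<Rightarrow> 'a set set \<Rightarrow> ('a \<Rightarrow> real) set" where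
  "fe_space \<Omega> \<T> =
     {v. continuous_on (closure \<Omega>) v \<and> (\<forall>x. x \<notin> \<Omega> \<longrightarrow> v x = 0) \<and>
         (\<forall>K\<in>\<T>. \<exists>a b. \<forall>x\<in>K. v x = a \<bullet> x + b)}"

text \<open>
  The gradient of a finite element function exists classically off the null set formed by the
  faces of the simplices and agrees there with the weak gradient.
\<close>

definition grad :: "('a::euclidean_space \<Rightarrow> real) \<Rightarrow> 'a \<Rightarrow> 'a" where
  "grad v x = (if \<exists>D. GDERIV v x :> D then THE D. GDERIV v x :> D else 0)"

definition grad_inner :: "'a::euclidean_space set \<Rightarrow> ('a \<Rightarrow> real) \<Rightarrow> ('a \<Rightarrow> real) \<Rightarrow> real" where
  "grad_inner \<Omega> v w = (LINT x|lebesgue_on \<Omega>. grad v x \<bullet> grad w x)"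

definition L2_projection ::
    "'a::euclidean_space set \<Rightarrow> 'a set set \<Rightarrow> ('a \<Rightarrow> real) \<Rightarrow> 'a \<Rightarrow> real" where
  "L2_projection \<Omega> \<T> f =
     (THE w. w \<in> fe_space \<Omega> \<T> \<and> (\<forall>\<psi>\<in>fe_space \<Omega> \<T>. L2_inner \<Omega> w \<psi> = L2_inner \<Omega> f \<psi>))"

definition discrete_laplacian ::
    "'a::euclidean_space set \<Rightarrow> 'a set set \<Rightarrow> ('a \<Rightarrow> real) \<Rightarrow> 'a \<Rightarrow> real" where
  "discrete_laplacian \<Omega> \<T> \<phi> =
     (THE w. w \<in> fe_space \<Omega> \<T> \<and> (\<forall>\<psi>\<in>fe_space \<Omega> \<T>. - L2_inner \<Omega> w \<psi> = grad_inner \<Omega> \<phi> \<psi>))"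


section \<open>The semidiscrete problem\<close>

text \<open>
  The derivative is taken within $[0,T]$, so it is one-sided at $t = T$.  At $r = s$ the kernel has
  the value \<open>0 powr (- \<alpha>) = 0\<close>.
\<close>

definition has_RL_derivative :: "real \<Rightarrow> real \<Rightarrow> (real \<Rightarrow> real) \<Rightarrow> real \<Rightarrow> real \<Rightarrow> bool" where
  "has_RL_derivative \<alpha> T v D t \<longleftrightarrow>
     ((\<lambda>r. 1 / Gamma (1 - \<alpha>) * (LINT s:{0..r}|lborel. (r - s) powr (- \<alpha>) * v s))
        has_real_derivative D) (at t within {0..T})"

text \<open>
  The initial condition \<open>u(0) = 0\<close> is attained continuously; without this it would not exclude the
  solutions of the homogeneous equation that behave like $t^{\alpha-1}$ at $t = 0$.  As $X_h$ is
  finite dimensional, the time derivative may be taken pointwise in \<open>x\<close>.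
\<close>

definition semidiscrete_solution ::
    "real \<Rightarrow> real \<Rightarrow> 'a::euclidean_space set \<Rightarrow> 'a set set \<Rightarrow>
      (real \<Rightarrow> 'a \<Rightarrow> real) \<Rightarrow> (real \<Rightarrow> 'a \<Rightarrow> real) \<Rightarrow> bool" where
  "semidiscrete_solution \<alpha> T \<Omega> \<T> g u \<longleftrightarrow>
     (\<forall>t\<in>{0..T}. u t \<in> fe_space \<Omega> \<T>) \<and> L2_continuous T \<Omega> u \<and> u 0 = (\<lambda>_. 0) \<and>
     (\<forall>t\<in>{0<..T}. \<forall>x. \<exists>D. has_RL_derivative \<alpha> T (\<lambda>r. u r x) D t \<and>
        D - discrete_laplacian \<Omega> \<T> (u t) x = L2_projection \<Omega> \<T> (g t) x)"


section \<open>The fully discrete problem\<close>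

definition L1_weight :: "real \<Rightarrow> nat \<Rightarrow> real" where
  "L1_weight \<alpha> j =
     (if j = 0 then 1 / Gamma (2 - \<alpha>)
      else 1 / Gamma (2 - \<alpha>) *
        (real (j + 1) powr (1 - \<alpha>) - 2 * real j powr (1 - \<alpha>) + real (j - 1) powr (1 - \<alpha>)))"

primrec BE_weight :: "real \<Rightarrow> nat \<Rightarrow> real" where
  "BE_weight \<alpha> 0 = 1"
| "BE_weight \<alpha> (Suc j) = - BE_weight \<alpha> j * (\<alpha> - real (Suc j) + 1) / real (Suc j)"

definition discrete_derivative ::
    "(nat \<Rightarrow> real) \<Rightarrow> real \<Rightarrow> real \<Rightarrow> (nat \<Rightarrow> real) \<Rightarrow> nat \<Rightarrow> real" where
  "discrete_derivative \<beta> \<alpha> \<tau> \<phi> n = \<tau> powr (- \<alpha>) * (\<Sum>j=0..n. \<beta> (n - j) * \<phi> j)"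

definition fully_discrete_solution ::
    "(nat \<Rightarrow> real) \<Rightarrow> real \<Rightarrow> real \<Rightarrow> nat \<Rightarrow> 'a::euclidean_space set \<Rightarrow> 'a set set \<Rightarrow>
      (real \<Rightarrow> 'a \<Rightarrow> real) \<Rightarrow> (nat \<Rightarrow> 'a \<Rightarrow> real) \<Rightarrow> bool" where
  "fully_discrete_solution \<beta> \<alpha> \<tau> N \<Omega> \<T> g U \<longleftrightarrow>
     (\<forall>n\<le>N. U n \<in> fe_space \<Omega> \<T>) \<and> U 0 = (\<lambda>_. 0) \<and>
     (\<forall>n\<in>{1..N}. \<forall>x.
        discrete_derivative \<beta> \<alpha> \<tau> (\<lambda>j. U j x) n - discrete_laplacian \<Omega> \<T> (U n) x
          = L2_projection \<Omega> \<T> (g (real n * \<tau>)) x)"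

end

(*
  In an L2-orthonormal eigenbasis of the discrete Laplacian both problems decouple into scalar ones
  with parameters mu >= 0, and all constants have to be uniform in mu.  The semidiscrete mode is the
  convolution of the data with the Mittag-Leffler kernel E_mu, the fully discrete mode is a discrete
  convolution with the resolvent of the weights.  For both schemes the partial sums of the discrete
  resolvent agree with the primitive of E_mu at n up to C n^(alpha-1): for backward Euler
  because they are the averages of the primitive over a Gamma-distributed time of mean and variance n,
  for the L1 scheme because its truncation error is summable and, by Kaluza's theorem, its resolvent
  is nonnegative and O(n^(alpha-1)).  By summation by parts the error at t_n is then bounded by
  tau^alpha times a convolution of (n-j+1)^(alpha-1) with the oscillation h_j of the data on
  [t_(j-1), t_j], plus a term from the jump of size |g(t_1)| at the origin.  The fractional Morrey
  embedding makes the l^p norm of h of order tau^(s-1/p), and Young's inequality concludes.  The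
  maximum bound is the case s = 1/p + alpha together with max <= tau^(-1/p) times the l^p norm.
*)
theory Submission
  imports Defs "HOL-Probability.Distributions" "HOL-Real_Asymp.Real_Asymp"
begin

text \<open>The mesh enters only through the eigenvalues kappa \<ge> 0, and rescaling time by tau
  turns them into mu = kappa tau^alpha. Independence of h is therefore uniformity in mu, and it is
  won without contour integrals from the positivity of \<open>ml_kernel\<close>: two identities with
  nonnegative terms then bound the kernel by its value at mu = 0 and its mass by 1/mu. Up to a power
  of t the kernel depends on mu t^alpha only, so regularity in t is regularity in mu, where the
  resolvent identity is available.

  The exponent 1/p + alpha comes from the origin. The fully discrete problem does not see g(0), so
  its data jump from 0 to g(t_1), and the response tau^alpha n^(alpha-1) to this jump has a discrete
  L^p norm of order tau^(1/p+alpha) if (1-alpha)p > 1. Otherwise the sum over n grows with N, and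
  the gap s < 1 leaves just enough room to end at tau^s.

  Different modes have different kernels. The error vector is therefore tested against itself, so
  that a bound uniform in kappa and one Cauchy-Schwarz inequality over the modes suffice.\<close>

section \<open>The Mittag-Leffler kernel\<close>

text \<open>
  Convolutions are formed with values in $[0,\infty]$, so that associativity and commutativity hold
  without integrability side conditions; signed functions enter through \<open>pos\<close> of their positive and
  negative parts.
\<close>

definition nnconv :: "(real \<Rightarrow> ennreal) \<Rightarrow> (real \<Rightarrow> ennreal) \<Rightarrow> real \<Rightarrow> ennreal" where
  "nnconv u v t = (\<integral>\<^sup>+s. u (t - s) * v s \<partial>lborel)"

text \<open>Time 0 belongs to the zero set, so that a convolution at time t sees only the open
  interval (0,t), where all powers are genuine powers.\<close>

definition causal :: "(real \<Rightarrow> ennreal) \<Rightarrow> bool" where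
  "causal u \<longleftrightarrow> u \<in> borel_measurable borel \<and> (\<forall>t\<le>0. u t = 0)"

lemma causalD: "causal u \<Longrightarrow> u \<in> borel_measurable borel" "causal u \<Longrightarrow> t \<le> 0 \<Longrightarrow> u t = 0"
  by (auto simp: causal_def)

lemma nnconv_commute:
  assumes [measurable]: "u \<in> borel_measurable borel" "v \<in> borel_measurable borel"
  shows "nnconv u v = nnconv v u"
proof
  fix t show "nnconv u v t = nnconv v u t"
    unfolding nnconv_def
    by (subst nn_integral_real_affine[where c = "-1" and t = t]) (auto simp: mult.commute)
qed

lemma nnconv_measurable [measurable]:
  assumes [measurable]: "u \<in> borel_measurable borel" "v \<in> borel_measurable borel"
  shows "nnconv u v \<in> borel_measurable borel"
proof -
  have "(\<lambda>t. \<integral>\<^sup>+s. u (t - s) * v s \<partial>lborel) \<in> borel_measurable borel"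
    by measurable
  then show ?thesis by (simp add: nnconv_def[abs_def])
qed

lemma nnconv_assoc:
  assumes [measurable]: "u \<in> borel_measurable borel" "v \<in> borel_measurable borel"
    "w \<in> borel_measurable borel"
  shows "nnconv (nnconv u v) w = nnconv u (nnconv v w)"
proof
  fix t
  have "nnconv (nnconv u v) w t = (\<integral>\<^sup>+s. (\<integral>\<^sup>+r. u (t - s - r) * v r * w s \<partial>lborel) \<partial>lborel)"
    unfolding nnconv_def by (simp add: nn_integral_multc)
  also have "\<dots> = (\<integral>\<^sup>+s. (\<integral>\<^sup>+r. u (t - r) * v (r - s) * w s \<partial>lborel) \<partial>lborel)"
  proof (rule nn_integral_cong)
    fix s :: real
    show "(\<integral>\<^sup>+r. u (t - s - r) * v r * w s \<partial>lborel) = (\<integral>\<^sup>+r. u (t - r) * v (r - s) * w s \<partial>lborel)"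
      by (subst nn_integral_real_affine[where c = 1 and t = "- s"]) (auto simp: algebra_simps)
  qed
  also have "\<dots> = (\<integral>\<^sup>+r. (\<integral>\<^sup>+s. u (t - r) * v (r - s) * w s \<partial>lborel) \<partial>lborel)"
    by (rule lborel_pair.Fubini') measurable
  also have "\<dots> = nnconv u (nnconv v w) t"
    unfolding nnconv_def by (simp add: nn_integral_cmult mult.assoc)
  finally show "nnconv (nnconv u v) w t = nnconv u (nnconv v w) t" .
qed

lemma nnconv_add_left:
  assumes [measurable]: "u \<in> borel_measurable borel" "v \<in> borel_measurable borel"
    "w \<in> borel_measurable borel"
  shows "nnconv (\<lambda>t. u t + v t) w t = nnconv u w t + nnconv v w t"
  unfolding nnconv_def by (simp add: distrib_right nn_integral_add)

lemma nnconv_add_right: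
  assumes [measurable]: "u \<in> borel_measurable borel" "v \<in> borel_measurable borel"
    "w \<in> borel_measurable borel"
  shows "nnconv w (\<lambda>t. u t + v t) t = nnconv w u t + nnconv w v t"
  unfolding nnconv_def by (simp add: distrib_left nn_integral_add)

lemma nnconv_cmult_left:
  assumes [measurable]: "u \<in> borel_measurable borel" "w \<in> borel_measurable borel"
  shows "nnconv (\<lambda>t. c * u t) w t = c * nnconv u w t"
  unfolding nnconv_def by (simp add: mult.assoc nn_integral_cmult)

lemma nnconv_cmult_right:
  assumes [measurable]: "u \<in> borel_measurable borel" "w \<in> borel_measurable borel"
  shows "nnconv w (\<lambda>t. c * u t) t = c * nnconv w u t"
  unfolding nnconv_def by (simp add: mult.left_commute[of _ c] nn_integral_cmult)

lemma nnconv_eq: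
  assumes "causal u" "causal v"
  shows "nnconv u v t = (\<integral>\<^sup>+s\<in>{0<..<t}. u (t - s) * v s \<partial>lborel)"
  unfolding nnconv_def
  by (rule nn_integral_cong) (use assms in \<open>auto simp: causal_def indicator_def not_less\<close>)

text \<open>Causality makes the value at t depend on (0,t) only. This lets an equation that is known
  just up to the final time be convolved with a kernel.\<close>

lemma nnconv_cong:
  assumes "causal u" "causal v" "causal u'" "causal v'"
    and "\<And>s. 0 < s \<Longrightarrow> s < t \<Longrightarrow> u s = u' s" "\<And>s. 0 < s \<Longrightarrow> s < t \<Longrightarrow> v s = v' s"
  shows "nnconv u v t = nnconv u' v' t"
  unfolding nnconv_eq[OF assms(1,2)] nnconv_eq[OF assms(3,4)]
  by (rule nn_integral_cong) (use assms(5,6) in \<open>auto simp: indicator_def\<close>)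

lemma nnconv_mono:
  assumes "\<And>s. u s \<le> u' s" "\<And>s. v s \<le> v' s"
  shows "nnconv u v t \<le> nnconv u' v' t"
  unfolding nnconv_def by (intro nn_integral_mono mult_mono assms) auto

lemma causal_nnconv:
  assumes "causal u" "causal v" shows "causal (nnconv u v)"
  using assms nnconv_measurable[of u v] nnconv_eq[OF assms]
  by (auto simp: causal_def)

section \<open>Riemann-Liouville kernels\<close>

text \<open>The kernel of fractional integration of order \<open>\<beta>\<close>: order 1 is plain
  integration, and order 1 - alpha gives the integral whose derivative is the Riemann-Liouville
  derivative of order alpha.\<close>

definition rl_kernel :: "real \<Rightarrow> real \<Rightarrow> real" where
  "rl_kernel \<beta> t = t powr (\<beta> - 1) / Gamma \<beta>"

text \<open>\<open>ennreal\<close> truncates at 0, so \<open>pos\<close> also takes the positive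
  part; identities between real functions are recovered from it only where the function is
  nonnegative.\<close>

definition pos :: "(real \<Rightarrow> real) \<Rightarrow> real \<Rightarrow> ennreal" where
  "pos u t = ennreal (u t) * indicator {0<..} t"

lemma causal_pos: "u \<in> borel_measurable borel \<Longrightarrow> causal (pos u)"
  by (auto simp: causal_def pos_def[abs_def])

lemma rl_kernel_measurable [measurable]: "rl_kernel \<beta> \<in> borel_measurable borel"
  by (auto simp: rl_kernel_def[abs_def])

lemma causal_pos_rl: "causal (pos (rl_kernel \<beta>))"
  by (rule causal_pos) measurable

lemma rl_kernel_nonneg: "0 < \<beta> \<Longrightarrow> 0 \<le> rl_kernel \<beta> t"
  by (simp add: rl_kernel_def Gamma_real_pos less_imp_le)

lemma rl_kernel_pos: "0 < \<beta> \<Longrightarrow> 0 < t \<Longrightarrow> 0 < rl_kernel \<beta> t"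
  by (simp add: rl_kernel_def Gamma_real_pos)

lemma nn_integral_Beta:
  assumes "0 < a" "0 < (b::real)"
  shows "(\<integral>\<^sup>+x\<in>{0<..<1}. ennreal (x powr (a - 1) * (1 - x) powr (b - 1)) \<partial>lborel) = ennreal (Beta a b)"
proof -
  have "(\<integral>\<^sup>+x\<in>{0<..<1}. ennreal (x powr (a - 1) * (1 - x) powr (b - 1)) \<partial>lborel)
      = (\<integral>\<^sup>+x. ennreal (indicator {0..1} x * (x powr (a - 1) * (1 - x) powr (b - 1))) \<partial>lborel)"
    by (rule nn_integral_cong_AE, rule AE_mp[OF AE_lborel_singleton[of 0]],
        rule AE_mp[OF AE_lborel_singleton[of 1]])
       (auto simp: indicator_def)
  also have "\<dots> = ennreal (Beta a b)"
    using has_integral_Beta_real[OF assms]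
    by (subst nn_integral_has_integral_lebesgue[OF _ has_integral_Beta_real[OF assms]]) auto
  finally show ?thesis .
qed

text \<open>Substituting s = t x reduces the convolution to a Beta integral, and the Gamma quotient
  of the Beta function supplies the new normalisation: fractional integration is a semigroup in its
  order.\<close>

lemma nnconv_rl:
  assumes "0 < \<beta>" "0 < \<gamma>"
  shows "nnconv (pos (rl_kernel \<beta>)) (pos (rl_kernel \<gamma>)) = pos (rl_kernel (\<beta> + \<gamma>))"
proof
  fix t :: real
  show "nnconv (pos (rl_kernel \<beta>)) (pos (rl_kernel \<gamma>)) t = pos (rl_kernel (\<beta> + \<gamma>)) t"
  proof (cases "0 < t")
    case True
    have "nnconv (pos (rl_kernel \<beta>)) (pos (rl_kernel \<gamma>)) t
       = ennreal \<bar>t\<bar> * (\<integral>\<^sup>+x. pos (rl_kernel \<beta>) (t - (0 + t * x)) * pos (rl_kernel \<gamma>) (0 + t * x) \<partial>lborel)"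
      unfolding nnconv_def using True
      by (intro nn_integral_real_affine) (auto simp: pos_def[abs_def])
    also have "(\<integral>\<^sup>+x. pos (rl_kernel \<beta>) (t - (0 + t * x)) * pos (rl_kernel \<gamma>) (0 + t * x) \<partial>lborel)
      = (\<integral>\<^sup>+x. ennreal (t powr (\<beta> + \<gamma> - 2) / (Gamma \<beta> * Gamma \<gamma>)) *
          (ennreal (x powr (\<gamma> - 1) * (1 - x) powr (\<beta> - 1)) * indicator {0<..<1} x) \<partial>lborel)"
    proof (rule nn_integral_cong)
      fix x :: real
      have *: "t - t * x = t * (1 - x)" by (simp add: algebra_simps)
      show "pos (rl_kernel \<beta>) (t - (0 + t * x)) * pos (rl_kernel \<gamma>) (0 + t * x) =
         ennreal (t powr (\<beta> + \<gamma> - 2) / (Gamma \<beta> * Gamma \<gamma>)) *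
          (ennreal (x powr (\<gamma> - 1) * (1 - x) powr (\<beta> - 1)) * indicator {0<..<1} x)"
      proof (cases "0 < x \<and> x < 1")
        case t: True
        have "rl_kernel \<beta> (t * (1 - x)) * rl_kernel \<gamma> (t * x) = t powr (\<beta> - 1) * t powr (\<gamma> - 1) / (Gamma \<beta> * Gamma \<gamma>) *
            (x powr (\<gamma> - 1) * (1 - x) powr (\<beta> - 1))"
          using t True by (simp add: rl_kernel_def powr_mult)
        also have "t powr (\<beta> - 1) * t powr (\<gamma> - 1) = t powr (\<beta> + \<gamma> - 2)"
          by (simp add: powr_add[symmetric] add_diff_eq diff_add_eq)
        finally show ?thesis
          using t True assms rl_kernel_nonneg[of \<beta> "t * (1-x)"] rl_kernel_nonneg[of \<gamma> "t * x"]
          by (simp add: pos_def * ennreal_mult[symmetric] zero_less_mult_iff Gamma_real_pos less_imp_le del: right_diff_distrib')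
      next
        case False
        then have "\<not> 0 < t * x \<or> \<not> 0 < t * (1 - x)"
          using True by (auto simp: zero_less_mult_iff)
        with False show ?thesis
          by (auto simp: * pos_def indicator_def simp del: right_diff_distrib')
      qed
    qed
    also have "\<dots> = ennreal (t powr (\<beta> + \<gamma> - 2) / (Gamma \<beta> * Gamma \<gamma>)) * ennreal (Beta \<gamma> \<beta>)"
      using assms by (subst nn_integral_cmult) (auto simp: nn_integral_Beta)
    also have "ennreal \<bar>t\<bar> * \<dots> = ennreal (rl_kernel (\<beta> + \<gamma>) t)"
    proof -
      have "t powr (\<beta> + \<gamma> - 1) = t * t powr (\<beta> + \<gamma> - 2)"
        using True powr_add[of t "\<beta> + \<gamma> - 2" 1] by simp
      moreover have "Beta \<gamma> \<beta> = Gamma \<beta> * Gamma \<gamma> / Gamma (\<beta> + \<gamma>)"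
        by (simp add: Beta_altdef add.commute mult.commute rGamma_inverse_Gamma divide_inverse)
      moreover have "Gamma \<beta> > 0" "Gamma \<gamma> > 0" "Gamma (\<beta> + \<gamma>) > 0"
        using assms by (auto intro!: Gamma_real_pos)
      ultimately show ?thesis using True
        by (simp add: rl_kernel_def ennreal_mult[symmetric] less_imp_le)
    qed
    finally show ?thesis using True by (simp add: pos_def[of "rl_kernel (\<beta> + \<gamma>)"])
  next
    case False
    then show ?thesis
      using causal_nnconv[OF causal_pos_rl causal_pos_rl, of \<beta> \<gamma>] by (simp add: causal_def pos_def)
  qed
qed

section \<open>Mittag-Leffler functions\<close>

text \<open>The point y is the convex combination of y - 1 and y + alpha with weights
  alpha/(1+alpha) and 1/(1+alpha). Log-convexity of Gamma together with Gamma y = (y-1) Gamma (y-1)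
  gives the bound, which feeds the ratio test in \<open>summable_ml\<close>.\<close>

lemma Gamma_ratio_ge:
  assumes "0 < \<alpha>" "1 < (y::real)"
  shows "(y - 1) powr \<alpha> * Gamma y \<le> Gamma (y + \<alpha>)"
proof -
  have "ln (Gamma y) \<le> (\<alpha> / (1 + \<alpha>)) * ln (Gamma (y - 1)) + (1 / (1 + \<alpha>)) * ln (Gamma (y + \<alpha>))"
  proof -
    have "(ln \<circ> Gamma) ((\<alpha> / (1 + \<alpha>)) *\<^sub>R (y - 1) + (1 / (1 + \<alpha>)) *\<^sub>R (y + \<alpha>))
      \<le> (\<alpha> / (1 + \<alpha>)) * (ln \<circ> Gamma) (y - 1) + (1 / (1 + \<alpha>)) * (ln \<circ> Gamma) (y + \<alpha>)"
    proof -
      have [simp]: "1 - 1 / (1 + \<alpha>) = \<alpha> / (1 + \<alpha>)" using assms by (simp add: field_simps)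
      show ?thesis
        using assms convex_onD[OF log_convex_Gamma_real, of "1 / (1 + \<alpha>)" "y - 1" "y + \<alpha>"] by simp
    qed
    moreover have "(\<alpha> / (1 + \<alpha>)) *\<^sub>R (y - 1) + (1 / (1 + \<alpha>)) *\<^sub>R (y + \<alpha>) = y"
    proof -
      have "(\<alpha> / (1 + \<alpha>)) *\<^sub>R (y - 1) + (1 / (1 + \<alpha>)) *\<^sub>R (y + \<alpha>) = (y * (1 + \<alpha>)) / (1 + \<alpha>)"
        by (simp add: algebra_simps flip: add_divide_distrib)
      then show ?thesis using assms by simp
    qed
    ultimately show ?thesis by simp
  qed
  then have "(1 + \<alpha>) * ln (Gamma y) \<le> (1 + \<alpha>) * ((\<alpha> / (1 + \<alpha>)) * ln (Gamma (y - 1)) + (1 / (1 + \<alpha>)) * ln (Gamma (y + \<alpha>)))"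
    using assms by (intro mult_left_mono) auto
  also have "\<dots> = \<alpha> * ln (Gamma (y - 1)) + ln (Gamma (y + \<alpha>))"
  proof -
    have "(1 + \<alpha>) * (\<alpha> / (1 + \<alpha>)) = \<alpha>" "(1 + \<alpha>) * (1 / (1 + \<alpha>)) = 1"
      using assms by auto
    then show ?thesis unfolding distrib_left mult.assoc[symmetric] by simp
  qed
  finally have *: "(1 + \<alpha>) * ln (Gamma y) \<le> \<alpha> * ln (Gamma (y - 1)) + ln (Gamma (y + \<alpha>))" .
  have "Gamma y = (y - 1) * Gamma (y - 1)"
    using Gamma_plus1[of "y - 1"] assms by (auto simp: nonpos_Ints_def)
  then have "ln (Gamma y) = ln ((y - 1) * Gamma (y - 1))" by simp
  also have "\<dots> = ln (y - 1) + ln (Gamma (y - 1))"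
    using assms Gamma_real_pos[of "y - 1"] by (intro ln_mult_pos) auto
  finally have "ln (Gamma y) = ln (y - 1) + ln (Gamma (y - 1))" .
  with * have "\<alpha> * ln (y - 1) + ln (Gamma y) \<le> ln (Gamma (y + \<alpha>))"
    by (simp add: algebra_simps)
  moreover have G: "0 < Gamma y" "0 < Gamma (y + \<alpha>)"
    using assms by (auto intro!: Gamma_real_pos)
  ultimately have "ln ((y - 1) powr \<alpha> * Gamma y) \<le> ln (Gamma (y + \<alpha>))"
    using assms by (subst ln_mult_pos) (auto simp: ln_powr)
  then show ?thesis
    using assms G by (subst (asm) ln_le_cancel_iff) auto
qed

lemma summable_ml:
  assumes "0 < \<alpha>" "0 < \<gamma>"
  shows "summable (\<lambda>j. x ^ j / Gamma (\<alpha> * real j + \<gamma>))"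
proof -
  have "filterlim (\<lambda>j. (\<alpha> * real j + \<gamma> - 1) powr \<alpha>) at_top sequentially"
  proof -
    have *: "filterlim (\<lambda>j. (\<gamma> - 1) + \<alpha> * real j) at_top sequentially"
      using assms by (intro filterlim_tendsto_add_at_top[OF tendsto_const]
         filterlim_tendsto_pos_mult_at_top[OF tendsto_const] filterlim_real_sequentially) auto
    have "filterlim (\<lambda>x::real. x powr \<alpha>) at_top at_top"
      using assms by real_asymp
    from filterlim_compose[OF this *] show ?thesis
      by (simp add: algebra_simps)
  qed
  then have "eventually (\<lambda>j. 2 * \<bar>x\<bar> + 1 \<le> (\<alpha> * real j + \<gamma> - 1) powr \<alpha>) sequentially"
    by (simp add: filterlim_at_top)
  moreover have "eventually (\<lambda>j. 1 < \<alpha> * real j + \<gamma>) sequentially"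
  proof -
    have "filterlim (\<lambda>j. \<gamma> + \<alpha> * real j) at_top sequentially"
      using assms by (intro filterlim_tendsto_add_at_top[OF tendsto_const]
         filterlim_tendsto_pos_mult_at_top[OF tendsto_const] filterlim_real_sequentially) auto
    then show ?thesis by (simp add: filterlim_at_top_dense add.commute)
  qed
  ultimately obtain J where J: "\<And>j. j \<ge> J \<Longrightarrow> 2 * \<bar>x\<bar> + 1 \<le> (\<alpha> * real j + \<gamma> - 1) powr \<alpha> \<and> 1 < \<alpha> * real j + \<gamma>"
    unfolding eventually_sequentially by (metis (lifting) nat_le_linear order_trans)
  show ?thesis
  proof (rule summable_ratio_test[of "1/2" J])
    fix j assume j: "J \<le> j"
    let ?y = "\<alpha> * real j + \<gamma>"
    have y: "2 * \<bar>x\<bar> \<le> (?y - 1) powr \<alpha>" "1 < ?y" using J[OF j] by auto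
    have G: "0 < Gamma ?y" "0 < Gamma (?y + \<alpha>)"
      using y assms by (auto intro!: Gamma_real_pos)
    have "2 * \<bar>x\<bar> * Gamma ?y \<le> (?y - 1) powr \<alpha> * Gamma ?y"
      using y G by (intro mult_right_mono) auto
    also have "\<dots> \<le> Gamma (?y + \<alpha>)" by (rule Gamma_ratio_ge) (use assms y in auto)
    finally have "\<bar>x\<bar> / Gamma (?y + \<alpha>) \<le> 1 / 2 * (1 / Gamma ?y)"
      using G by (simp add: field_simps)
    then have "\<bar>x\<bar> ^ j * (\<bar>x\<bar> / Gamma (?y + \<alpha>)) \<le> \<bar>x\<bar> ^ j * (1 / 2 * (1 / Gamma ?y))"
      by (intro mult_left_mono) auto
    moreover have "\<alpha> * real (Suc j) + \<gamma> = ?y + \<alpha>" by (simp add: algebra_simps)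
    ultimately show "norm (x ^ Suc j / Gamma (\<alpha> * real (Suc j) + \<gamma>)) \<le> 1/2 * norm (x ^ j / Gamma ?y)"
      using G by (simp add: power_abs abs_mult field_simps)
  qed auto
qed

definition mittag_leffler :: "real \<Rightarrow> real \<Rightarrow> real \<Rightarrow> real" where
  "mittag_leffler \<alpha> \<gamma> x = (\<Sum>j. x ^ j / Gamma (\<alpha> * real j + \<gamma>))"

text \<open>The kernel $E(t) = t^{\<alpha>-1} E_{\<alpha>,\<alpha>}(-\<mu> t^\<alpha>)$: the scalar equation \<open>\<partial>\<^sup>\<alpha> c + \<mu> c = f\<close>, \<open>c(0) = 0\<close>, has the solution \<open>E * f\<close>.\<close>

definition ml_kernel :: "real \<Rightarrow> real \<Rightarrow> real \<Rightarrow> real" where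
  "ml_kernel \<alpha> \<mu> t = t powr (\<alpha> - 1) * mittag_leffler \<alpha> \<alpha> (- \<mu> * t powr \<alpha>)"

lemma mittag_leffler_sums:
  assumes "0 < \<alpha>" "0 < \<gamma>"
  shows "(\<lambda>j. x ^ j / Gamma (\<alpha> * real j + \<gamma>)) sums mittag_leffler \<alpha> \<gamma> x"
  unfolding mittag_leffler_def using summable_ml[OF assms] by (rule summable_sums)

lemma mittag_leffler_rec:
  assumes "0 < \<alpha>" "0 < \<gamma>"
  shows "mittag_leffler \<alpha> \<gamma> x = 1 / Gamma \<gamma> + x * mittag_leffler \<alpha> (\<alpha> + \<gamma>) x"
proof -
  have "(\<lambda>j. x * (x ^ j / Gamma (\<alpha> * real j + (\<alpha> + \<gamma>)))) sums (x * mittag_leffler \<alpha> (\<alpha> + \<gamma>) x)"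
    by (rule sums_mult, rule mittag_leffler_sums) (use assms in auto)
  then have "(\<lambda>j. x ^ Suc j / Gamma (\<alpha> * real (Suc j) + \<gamma>)) sums (x * mittag_leffler \<alpha> (\<alpha> + \<gamma>) x)"
    by (simp add: algebra_simps)
  then have "(\<lambda>j. x ^ j / Gamma (\<alpha> * real j + \<gamma>)) sums (x * mittag_leffler \<alpha> (\<alpha> + \<gamma>) x + 1 / Gamma \<gamma>)"
    by (subst (asm) sums_Suc_iff) simp
  then show ?thesis using mittag_leffler_sums[OF assms, of x] sums_unique2 by (simp add: add.commute)
qed

lemma mittag_leffler_0: "0 < \<alpha> \<Longrightarrow> 0 < \<gamma> \<Longrightarrow> mittag_leffler \<alpha> \<gamma> 0 = 1 / Gamma \<gamma>"
  using mittag_leffler_rec[of \<alpha> \<gamma> 0] by simp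

lemma mittag_leffler_differentiable:
  assumes "0 < \<alpha>" "0 < \<gamma>"
  shows "\<exists>D. (mittag_leffler \<alpha> \<gamma> has_real_derivative D) (at x)"
proof -
  have "DERIV (\<lambda>x. \<Sum>j. (1 / Gamma (\<alpha> * real j + \<gamma>)) * x ^ j) x :> (\<Sum>j. diffs (\<lambda>j. 1 / Gamma (\<alpha> * real j + \<gamma>)) j * x ^ j)"
    by (rule termdiffs_strong_converges_everywhere) (use summable_ml[OF assms] in simp)
  then show ?thesis by (auto simp: mittag_leffler_def[abs_def])
qed

lemma mittag_leffler_continuous: "0 < \<alpha> \<Longrightarrow> 0 < \<gamma> \<Longrightarrow> isCont (mittag_leffler \<alpha> \<gamma>) x"
  using mittag_leffler_differentiable[of \<alpha> \<gamma> x] DERIV_isCont by blast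

lemma mittag_leffler_measurable:
  assumes "0 < \<alpha>" "0 < \<gamma>" shows "mittag_leffler \<alpha> \<gamma> \<in> borel_measurable borel"
  using mittag_leffler_continuous[OF assms] by (intro borel_measurable_continuous_onI) (simp add: continuous_on_eq_continuous_at)

lemma ml_kernel_measurable:
  assumes "0 < \<alpha>" shows "ml_kernel \<alpha> \<mu> \<in> borel_measurable borel"
proof -
  note [measurable] = mittag_leffler_measurable[OF assms assms]
  show ?thesis unfolding ml_kernel_def[abs_def] by measurable
qed

lemma rl_kernel_series:
  assumes "0 < \<alpha>" "0 < \<gamma>" "0 < t"
  shows "(\<lambda>j. c ^ j * rl_kernel (\<alpha> * real j + \<gamma>) t) sums (t powr (\<gamma> - 1) * mittag_leffler \<alpha> \<gamma> (c * t powr \<alpha>))"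
proof -
  have "c ^ j * rl_kernel (\<alpha> * real j + \<gamma>) t = t powr (\<gamma> - 1) * ((c * t powr \<alpha>) ^ j / Gamma (\<alpha> * real j + \<gamma>))" for j
  proof -
    have "t powr (\<alpha> * real j + \<gamma> - 1) = t powr (\<gamma> - 1) * (t powr \<alpha>) ^ j"
      using assms by (simp add: powr_realpow[symmetric] powr_powr powr_add[symmetric] algebra_simps)
    then show ?thesis by (simp add: rl_kernel_def power_mult_distrib)
  qed
  then show ?thesis using sums_mult[OF mittag_leffler_sums[OF assms(1,2)]] by simp
qed

lemma ml_kernel_sums:
  assumes "0 < \<alpha>" "0 < t"
  shows "(\<lambda>j. (- \<mu>) ^ j * rl_kernel (\<alpha> * real j + \<alpha>) t) sums ml_kernel \<alpha> \<mu> t"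
  unfolding ml_kernel_def by (rule rl_kernel_series) (use assms in auto)

lemma rl_kernel_conv_integral:
  assumes "0 < \<beta>" "0 < \<gamma>" "0 < t"
  shows "has_bochner_integral lborel (\<lambda>s. indicator {0<..<t} s * (rl_kernel \<beta> (t - s) * rl_kernel \<gamma> s)) (rl_kernel (\<beta> + \<gamma>) t)"
proof (rule has_bochner_integral_nn_integral)
  have "(\<integral>\<^sup>+x. ennreal (indicat_real {0<..<t} x * (rl_kernel \<beta> (t - x) * rl_kernel \<gamma> x)) \<partial>lborel)
     = nnconv (pos (rl_kernel \<beta>)) (pos (rl_kernel \<gamma>)) t"
    unfolding nnconv_eq[OF causal_pos_rl causal_pos_rl]
    using assms rl_kernel_nonneg by (intro nn_integral_cong) (auto simp: pos_def indicator_def ennreal_mult)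
  also have "\<dots> = ennreal (rl_kernel (\<beta> + \<gamma>) t)"
    using assms by (simp add: nnconv_rl pos_def)
  finally show "(\<integral>\<^sup>+x. ennreal (indicat_real {0<..<t} x * (rl_kernel \<beta> (t - x) * rl_kernel \<gamma> x)) \<partial>lborel) = ennreal (rl_kernel (\<beta> + \<gamma>) t)" .
qed (use assms rl_kernel_nonneg in \<open>auto intro!: AE_I2 mult_nonneg_nonneg\<close>)

text \<open>The series is integrated term by term; the norms of its terms form the same series with
  |mu| in place of -mu. Real-valued integrals are used here because the sign of the kernel is not
  known yet.\<close>

lemma ml_kernel_conv_integral:
  assumes "0 < \<alpha>" "0 < \<beta>" "0 < t"
  shows "has_bochner_integral lborel (\<lambda>s. indicator {0<..<t} s * (rl_kernel \<beta> (t - s) * ml_kernel \<alpha> \<mu> s))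
     (t powr (\<alpha> + \<beta> - 1) * mittag_leffler \<alpha> (\<alpha> + \<beta>) (- \<mu> * t powr \<alpha>))"
proof -
  define F where "F j s = (- \<mu>) ^ j * (indicator {0<..<t} s * (rl_kernel \<beta> (t - s) * rl_kernel (\<alpha> * real j + \<alpha>) s))" for j s
  have hb: "has_bochner_integral lborel (F j) ((- \<mu>) ^ j * rl_kernel (\<alpha> * real j + (\<alpha> + \<beta>)) t)" for j
    using has_bochner_integral_mult_right[OF rl_kernel_conv_integral[of \<beta> "\<alpha> * real j + \<alpha>" t], of "(- \<mu>) ^ j"] assms
    unfolding F_def by (simp add: algebra_simps add_pos_nonneg)
  have int: "integrable lborel (F j)" for j using hb by (rule integrable.intros)
  have sums: "(\<lambda>j. F j s) sums (indicator {0<..<t} s * (rl_kernel \<beta> (t - s) * ml_kernel \<alpha> \<mu> s))" for s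
  proof (cases "s \<in> {0<..<t}")
    case True
    have "(\<lambda>j. rl_kernel \<beta> (t - s) * ((- \<mu>) ^ j * rl_kernel (\<alpha> * real j + \<alpha>) s)) sums (rl_kernel \<beta> (t - s) * ml_kernel \<alpha> \<mu> s)"
      by (rule sums_mult, rule ml_kernel_sums) (use assms True in auto)
    then show ?thesis using True by (simp add: F_def mult.left_commute)
  qed (simp add: F_def)
  have norm_F: "norm (F j s) = \<bar>\<mu>\<bar> ^ j * (indicator {0<..<t} s * (rl_kernel \<beta> (t - s) * rl_kernel (\<alpha> * real j + \<alpha>) s))" for j s
    using rl_kernel_nonneg[of \<beta> "t - s"] rl_kernel_nonneg[of "\<alpha> * real j + \<alpha>" s] assms
    by (simp add: F_def abs_mult power_abs add_nonneg_pos)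
  have summable1: "summable (\<lambda>j. norm (F j s))" for s
  proof (cases "s \<in> {0<..<t}")
    case True
    have "summable (\<lambda>j. rl_kernel \<beta> (t - s) * (\<bar>\<mu>\<bar> ^ j * rl_kernel (\<alpha> * real j + \<alpha>) s))"
      by (rule summable_mult, rule sums_summable[OF rl_kernel_series]) (use assms True in auto)
    then show ?thesis using True unfolding norm_F by (simp add: mult.left_commute)
  qed (simp add: F_def)
  have hbn: "has_bochner_integral lborel (\<lambda>s. norm (F j s)) (\<bar>\<mu>\<bar> ^ j * rl_kernel (\<alpha> * real j + (\<alpha> + \<beta>)) t)" for j
    using has_bochner_integral_mult_right[OF rl_kernel_conv_integral[of \<beta> "\<alpha> * real j + \<alpha>" t], of "\<bar>\<mu>\<bar> ^ j"] assms
    unfolding norm_F by (simp add: algebra_simps add_pos_nonneg)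
  have summable2: "summable (\<lambda>j. \<integral>s. norm (F j s) \<partial>lborel)"
    unfolding has_bochner_integral_integral_eq[OF hbn]
    by (rule sums_summable[OF rl_kernel_series]) (use assms in auto)
  have eq: "(\<lambda>s. \<Sum>j. F j s) = (\<lambda>s. indicator {0<..<t} s * (rl_kernel \<beta> (t - s) * ml_kernel \<alpha> \<mu> s))"
    using sums by (auto simp: sums_iff fun_eq_iff)
  have "integrable lborel (\<lambda>s. \<Sum>j. F j s)"
    by (rule integrable_suminf[OF int AE_I2[OF summable1] summable2])
  moreover have "(\<lambda>j. integral\<^sup>L lborel (F j)) sums (\<integral>s. (\<Sum>j. F j s) \<partial>lborel)"
    by (rule sums_integral[OF int AE_I2[OF summable1] summable2])
  moreover have "(\<lambda>j. integral\<^sup>L lborel (F j)) sums (t powr (\<alpha> + \<beta> - 1) * mittag_leffler \<alpha> (\<alpha> + \<beta>) (- \<mu> * t powr \<alpha>))"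
    unfolding has_bochner_integral_integral_eq[OF hb] by (rule rl_kernel_series) (use assms in auto)
  ultimately show ?thesis unfolding eq has_bochner_integral_iff using sums_unique2 by blast
qed

context
  fixes \<alpha> \<mu> :: real
  assumes \<alpha>: "0 < \<alpha>" "\<alpha> < 1" and \<mu>: "0 \<le> \<mu>"
begin

text \<open>The two convolutions are Mittag-Leffler functions with second index 1 and alpha + 1,
  which \<open>mittag_leffler_rec\<close> links. For kernels this reads k * E + mu (1 * E) = 1, the
  equation of the fundamental solution integrated once in time.\<close>

lemma ml_kernel_caputo:
  assumes "0 < t"
  shows "(LINT s|lborel. indicator {0<..<t} s * (rl_kernel (1 - \<alpha>) (t - s) * ml_kernel \<alpha> \<mu> s))
    + \<mu> * (LINT s|lborel. indicator {0<..<t} s * ml_kernel \<alpha> \<mu> s) = 1"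
proof -
  have 1: "(LINT s|lborel. indicator {0<..<t} s * (rl_kernel (1 - \<alpha>) (t - s) * ml_kernel \<alpha> \<mu> s)) = mittag_leffler \<alpha> 1 (- \<mu> * t powr \<alpha>)"
    using has_bochner_integral_integral_eq[OF ml_kernel_conv_integral[of \<alpha> "1 - \<alpha>" t \<mu>]] \<alpha> assms by simp
  have "(LINT s|lborel. indicator {0<..<t} s * ml_kernel \<alpha> \<mu> s)
      = (LINT s|lborel. indicator {0<..<t} s * (rl_kernel 1 (t - s) * ml_kernel \<alpha> \<mu> s))"
    by (rule Bochner_Integration.integral_cong) (auto simp: rl_kernel_def indicator_def)
  also have "\<dots> = t powr \<alpha> * mittag_leffler \<alpha> (\<alpha> + 1) (- \<mu> * t powr \<alpha>)"
    using has_bochner_integral_integral_eq[OF ml_kernel_conv_integral[of \<alpha> 1 t \<mu>]] \<alpha> assms by simp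
  finally show ?thesis unfolding 1 using mittag_leffler_rec[of \<alpha> 1 "- \<mu> * t powr \<alpha>"] \<alpha> by simp
qed

lemma ml_kernel_DERIV: "0 < t \<Longrightarrow> \<exists>D. (ml_kernel \<alpha> \<mu> has_real_derivative D) (at t)"
proof -
  assume t: "0 < t"
  obtain D where D: "(mittag_leffler \<alpha> \<alpha> has_real_derivative D) (at (- \<mu> * t powr \<alpha>))"
    using mittag_leffler_differentiable[of \<alpha> \<alpha>] \<alpha> by blast
  have "((\<lambda>t. - \<mu> * t powr \<alpha>) has_real_derivative - \<mu> * (\<alpha> * t powr (\<alpha> - 1))) (at t)"
    using t by (auto intro!: derivative_eq_intros)
  from DERIV_chain2[OF D this]
  have "((\<lambda>t. mittag_leffler \<alpha> \<alpha> (- \<mu> * t powr \<alpha>)) has_real_derivative D * (- \<mu> * (\<alpha> * t powr (\<alpha> - 1)))) (at t)" .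
  moreover have "((\<lambda>t. t powr (\<alpha> - 1)) has_real_derivative (\<alpha> - 1) * t powr (\<alpha> - 1 - 1)) (at t)"
    using t by (auto intro!: derivative_eq_intros)
  ultimately show ?thesis unfolding ml_kernel_def[abs_def] using DERIV_mult by blast
qed

lemma ml_kernel_isCont: "0 < t \<Longrightarrow> isCont (ml_kernel \<alpha> \<mu>) t"
  using ml_kernel_DERIV DERIV_isCont by blast

lemma ml_kernel_integrable: "0 < t \<Longrightarrow> integrable lborel (\<lambda>s. indicator {0<..<t} s * ml_kernel \<alpha> \<mu> s)"
proof -
  assume t: "0 < t"
  have "integrable lborel (\<lambda>s. indicator {0<..<t} s * (rl_kernel 1 (t - s) * ml_kernel \<alpha> \<mu> s))"
    by (rule integrable.intros[OF ml_kernel_conv_integral]) (use t \<alpha> in auto)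
  also have "(\<lambda>s. indicator {0<..<t} s * (rl_kernel 1 (t - s) * ml_kernel \<alpha> \<mu> s)) = (\<lambda>s. indicator {0<..<t} s * ml_kernel \<alpha> \<mu> s)"
    by (auto simp: rl_kernel_def indicator_def)
  finally show ?thesis .
qed

lemma ml_kernel_pos_near_0: "\<exists>\<delta>>0. \<forall>t. 0 < t \<and> t < \<delta> \<longrightarrow> 0 < ml_kernel \<alpha> \<mu> t"
proof -
  have "((\<lambda>t. mittag_leffler \<alpha> \<alpha> (- \<mu> * t powr \<alpha>)) \<longlongrightarrow> mittag_leffler \<alpha> \<alpha> (- \<mu> * 0)) (at_right 0)"
  proof (rule isCont_tendsto_compose[OF mittag_leffler_continuous])
    have "((\<lambda>t. t powr \<alpha>) \<longlongrightarrow> 0) (at_right 0)" using \<alpha> by real_asymp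
    then show "((\<lambda>t. - \<mu> * t powr \<alpha>) \<longlongrightarrow> - \<mu> * 0) (at_right 0)" by (rule tendsto_mult_left)
  qed (use \<alpha> in auto)
  moreover have "mittag_leffler \<alpha> \<alpha> (- \<mu> * 0) > 0" using \<alpha> by (simp add: mittag_leffler_0 Gamma_real_pos)
  ultimately have "eventually (\<lambda>t. 0 < mittag_leffler \<alpha> \<alpha> (- \<mu> * t powr \<alpha>)) (at_right 0)"
    by (rule order_tendstoD)
  then show ?thesis unfolding eventually_at_right_field
    by (auto simp: ml_kernel_def)
qed

end

section \<open>Positivity of the kernel\<close>

context
  fixes \<alpha> \<mu> :: real
  assumes \<alpha>: "0 < \<alpha>" "\<alpha> < 1" and \<mu>: "0 \<le> \<mu>"
begin

text \<open>The constant is the slope of the kernel at \<open>t0\<close>, where it is smallest in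
  modulus on (0,t0], so that it serves all x at once.\<close>

lemma rl_kernel_diff_ge:
  assumes "0 < h" "h < x" "x \<le> t0"
  shows "h * (\<alpha> * t0 powr (- \<alpha> - 1) / Gamma (1 - \<alpha>)) \<le> rl_kernel (1 - \<alpha>) (x - h) - rl_kernel (1 - \<alpha>) x"
proof -
  have "\<exists>z>x - h. z < x \<and> x powr (- \<alpha>) - (x - h) powr (- \<alpha>) = (x - (x - h)) * (- \<alpha> * z powr (- \<alpha> - 1))"
    using assms by (intro MVT2) (auto intro!: derivative_eq_intros)
  then obtain z where z: "x - h < z" "z < x" "x powr (- \<alpha>) - (x - h) powr (- \<alpha>) = h * (- \<alpha> * z powr (- \<alpha> - 1))"
    by auto
  have "t0 powr (- \<alpha> - 1) \<le> z powr (- \<alpha> - 1)"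
    using \<alpha> assms z by (intro powr_mono2') auto
  then have "h * (\<alpha> * t0 powr (- \<alpha> - 1)) \<le> h * (\<alpha> * z powr (- \<alpha> - 1))"
    using \<alpha> assms by (intro mult_left_mono) auto
  also have "\<dots> = (x - h) powr (- \<alpha>) - x powr (- \<alpha>)" using z by simp
  finally have "h * (\<alpha> * t0 powr (- \<alpha> - 1)) / Gamma (1 - \<alpha>) \<le> ((x - h) powr (- \<alpha>) - x powr (- \<alpha>)) / Gamma (1 - \<alpha>)"
    using \<alpha> by (intro divide_right_mono) (auto intro!: less_imp_le Gamma_real_pos)
  then show ?thesis by (simp add: rl_kernel_def diff_divide_distrib)
qed

text \<open>
  At a first zero \<open>t0\<close> the function \<open>E\<close> is \<open>O(h)\<close> on \<open>[t0 - h, t0]\<close>.  In the identity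
  \<open>k * E + \<mu> (1 * E) = 1\<close> this interval therefore contributes only \<open>o(h)\<close>, whereas the decrease of \<open>k\<close>
  makes the remaining part of \<open>k * E\<close> at \<open>t0 - h\<close> larger than at \<open>t0\<close> by a multiple of \<open>h\<close>.
\<close>

lemma ml_kernel_pos:
  assumes "0 < t" shows "0 < ml_kernel \<alpha> \<mu> t"
proof (rule ccontr)
  assume neg: "\<not> 0 < ml_kernel \<alpha> \<mu> t"
  let ?m = "ml_kernel \<alpha> \<mu>" and ?k = "rl_kernel (1 - \<alpha>)"
  note [measurable] = ml_kernel_measurable[OF \<alpha>(1), of \<mu>]
  \<comment> \<open>A first zero t0 exists and is positive, since the kernel is continuous for t > 0
    and positive near 0.\<close>
  define S where "S = {t. 0 < t \<and> ?m t \<le> 0}"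
  define t0 where "t0 = Inf S"
  have "t \<in> S" using neg assms by (simp add: S_def)
  then have S: "S \<noteq> {}" "bdd_below S" by (auto simp: S_def intro!: bdd_belowI[of _ 0])
  obtain \<delta> where \<delta>: "\<delta> > 0" "\<And>t. 0 < t \<Longrightarrow> t < \<delta> \<Longrightarrow> 0 < ?m t"
    using ml_kernel_pos_near_0[OF \<alpha> \<mu>] by auto
  have "\<delta> \<le> s" if "s \<in> S" for s
  proof (rule ccontr)
    assume "\<not> \<delta> \<le> s"
    with that \<delta>(2)[of s] show False by (auto simp: S_def)
  qed
  then have "\<delta> \<le> t0" unfolding t0_def using S by (intro cInf_greatest)
  with \<delta> have t0: "0 < t0" by simp
  have pos: "0 < ?m s" if "0 < s" "s < t0" for s
  proof (rule ccontr)
    assume "\<not> 0 < ?m s"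
    then have "s \<in> S" using that by (simp add: S_def)
    from cInf_lower[OF this S(2)] that show False by (simp add: t0_def)
  qed
  have "?m t0 \<le> 0"
  proof (rule ccontr)
    assume "\<not> ?m t0 \<le> 0"
    with ml_kernel_isCont[OF \<alpha> \<mu> t0] have "eventually (\<lambda>s. 0 < ?m s) (nhds t0)"
      unfolding isCont_def tendsto_at_iff_tendsto_nhds by (auto intro: order_tendstoD)
    then obtain e where e: "e > 0" "\<And>s. dist s t0 < e \<Longrightarrow> 0 < ?m s"
      unfolding eventually_nhds_metric by auto
    have "t0 + e \<le> s" if "s \<in> S" for s
    proof (rule ccontr)
      assume "\<not> t0 + e \<le> s"
      then have "dist s t0 < e" using cInf_lower[OF that S(2)] e(1) by (simp add: t0_def dist_real_def)
      from e(2)[OF this] that show False by (simp add: S_def)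
    qed
    then have "t0 + e \<le> t0" unfolding t0_def using S by (intro cInf_greatest) auto
    with e show False by simp
  qed
  moreover have "0 \<le> ?m t0"
  proof (rule tendsto_lowerbound)
    show "(?m \<longlongrightarrow> ?m t0) (at_left t0)"
      using ml_kernel_isCont[OF \<alpha> \<mu> t0] unfolding isCont_def by (rule filterlim_mono) (auto simp: at_le)
    show "eventually (\<lambda>s. 0 \<le> ?m s) (at_left t0)"
      unfolding eventually_at_left[OF t0] using t0 pos by (intro exI[of _ 0]) (auto intro: less_imp_le)
  qed auto
  ultimately have mt0: "?m t0 = 0" by simp
  \<comment> \<open>At a zero, differentiability gives a linear bound C (t0 - s) to the left of
    t0.\<close>
  obtain D where "(?m has_real_derivative D) (at t0)" using ml_kernel_DERIV[OF \<alpha> \<mu> t0] by blast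
  then have "((\<lambda>s. (?m s - ?m t0) / (s - t0)) \<longlongrightarrow> D) (at t0)" by (simp add: has_field_derivative_iff)
  then have "((\<lambda>s. \<bar>(?m s - ?m t0) / (s - t0)\<bar>) \<longlongrightarrow> \<bar>D\<bar>) (at t0)" by (rule tendsto_rabs)
  then have "eventually (\<lambda>s. \<bar>(?m s - ?m t0) / (s - t0)\<bar> < \<bar>D\<bar> + 1) (at t0)" by (rule order_tendstoD) simp
  then obtain e where e: "e > 0" "\<And>s. s \<noteq> t0 \<Longrightarrow> dist s t0 < e \<Longrightarrow> \<bar>?m s / (s - t0)\<bar> < \<bar>D\<bar> + 1"
    unfolding eventually_at mt0 by auto
  define C where "C = \<bar>D\<bar> + 1"
  have C: "C > 0" by (simp add: C_def)
  have lip: "?m s \<le> C * (t0 - s)" if "t0 - e < s" "s < t0" for s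
  proof -
    have "\<bar>?m s\<bar> / \<bar>s - t0\<bar> < C" using e(2)[of s] that by (auto simp: C_def dist_real_def)
    then have "\<bar>?m s\<bar> < C * \<bar>s - t0\<bar>" using that by (simp add: field_simps)
    then show ?thesis using that by simp
  qed
  define c0 where "c0 = \<alpha> * t0 powr (- \<alpha> - 1) / Gamma (1 - \<alpha>)"
  have G: "0 < Gamma (1 - \<alpha>)" using \<alpha> by (intro Gamma_real_pos) simp
  have c0: "c0 > 0" using \<alpha> t0 G by (simp add: c0_def)
  \<comment> \<open>The half interval keeps J independent of h: for h < t0/2 it lies in (0, t0 -
    h).\<close>
  define J where "J = (LINT s|lborel. indicator {0<..<t0/2} s * ?m s)"
  have J: "J > 0"
  proof -
    have nn: "0 \<le> indicator {0<..<t0/2} s * ?m s" for s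
      using pos[of s] t0 by (auto simp: indicator_def less_imp_le)
    then have "J \<ge> 0" unfolding J_def by (intro integral_nonneg_AE AE_I2)
    moreover have "J \<noteq> 0"
    proof
      assume "J = 0"
      then have "AE s in lborel. indicator {0<..<t0/2} s * ?m s = 0"
        unfolding J_def using nn
        by (subst (asm) integral_nonneg_eq_0_iff_AE[OF ml_kernel_integrable[OF \<alpha> \<mu>]]) (use t0 in auto)
      then have "AE s in lborel. s \<notin> {0<..<t0/2}"
        by eventually_elim (use pos t0 in \<open>force simp: indicator_def\<close>)
      then have "{0<..<t0/2} \<in> null_sets lborel"
        by (subst AE_iff_null_sets) auto
      then show False using t0 by (simp add: null_sets_def)
    qed
    ultimately show ?thesis by simp
  qed
  define K where "K t = (LINT s|lborel. indicator {0<..<t} s * (?k (t - s) * ?m s))" for t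
  define L where "L t = (LINT s|lborel. indicator {0<..<t} s * ?m s)" for t
  have KL: "K t + \<mu> * L t = 1" if "0 < t" for t
    using ml_kernel_caputo[OF \<alpha> \<mu> that] by (simp add: K_def L_def)
  have intK: "integrable lborel (\<lambda>s. indicator {0<..<t} s * (?k (t - s) * ?m s))" if "0 < t" for t
    by (rule integrable.intros[OF ml_kernel_conv_integral]) (use that \<alpha> in auto)
  have sub: "integrable lborel (\<lambda>s. indicator B s * g s :: real)"
    if "integrable lborel (\<lambda>s. indicator A s * g s)" "B \<subseteq> A" "B \<in> sets borel" for A B g
  proof -
    have "integrable lborel (\<lambda>s. indicator B s *\<^sub>R (indicator A s * g s))"
      using that by (intro integrable_mult_indicator) auto
    also have "(\<lambda>s. indicator B s *\<^sub>R (indicator A s * g s)) = (\<lambda>s. indicator B s * g s)"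
      using that(2) by (auto simp: fun_eq_iff indicator_def)
    finally show ?thesis .
  qed
  have main: "c0 * J \<le> C * h powr (1 - \<alpha>) / Gamma (1 - \<alpha>) + \<mu> * C * h"
    if h: "0 < h" "h < t0 / 2" "h < e" for h
  proof -
    define A1 where "A1 = (LINT s|lborel. indicator {0<..<t0-h} s * (?k (t0 - s) * ?m s))"
    have iA1: "integrable lborel (\<lambda>s. indicator {0<..<t0-h} s * (?k (t0 - s) * ?m s))"
      by (rule sub[OF intK[OF t0]]) (use h in auto)
    have iJ: "integrable lborel (\<lambda>s. indicator {0<..<t0/2} s * ?m s)"
      by (rule ml_kernel_integrable[OF \<alpha> \<mu>]) (use t0 in auto)
    have iL: "integrable lborel (\<lambda>s. indicator {0<..<t0} s * ?m s)"
      by (rule ml_kernel_integrable[OF \<alpha> \<mu>]) (use t0 in auto)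
    have iA2: "integrable lborel (\<lambda>s. indicator {t0-h..<t0} s * (?k (t0 - s) * ?m s))"
      by (rule sub[OF intK[OF t0]]) (use h in auto)
    have iL1: "integrable lborel (\<lambda>s. indicator {0<..<t0-h} s * ?m s)"
      by (rule sub[OF iL]) (use h in auto)
    have iL2: "integrable lborel (\<lambda>s. indicator {t0-h..<t0} s * ?m s)"
      by (rule sub[OF iL]) (use h in auto)
    have "A1 + h * c0 * J = (LINT s|lborel. indicator {0<..<t0-h} s * (?k (t0 - s) * ?m s)
         + h * c0 * (indicator {0<..<t0/2} s * ?m s))"
      unfolding A1_def J_def using iA1 iJ by simp
    also have "\<dots> \<le> K (t0 - h)"
      unfolding K_def
    proof (rule integral_mono)
      fix s
      show "indicator {0<..<t0-h} s * (?k (t0 - s) * ?m s) + h * c0 * (indicator {0<..<t0/2} s * ?m s)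
        \<le> indicator {0<..<t0-h} s * (?k (t0 - h - s) * ?m s)"
      proof (cases "0 < s \<and> s < t0 - h")
        case True
        have "h * c0 \<le> ?k (t0 - s - h) - ?k (t0 - s)"
          unfolding c0_def by (rule rl_kernel_diff_ge) (use h True in auto)
        moreover have eq: "t0 - s - h = t0 - h - s" by simp
        ultimately have "?k (t0 - s) + h * c0 \<le> ?k (t0 - h - s)" unfolding eq by linarith
        then have "(?k (t0 - s) + h * c0) * ?m s \<le> ?k (t0 - h - s) * ?m s"
          using pos[of s] True h by (intro mult_right_mono) auto
        then have "?k (t0 - s) * ?m s + h * c0 * ?m s \<le> ?k (t0 - h - s) * ?m s"
          by (simp add: distrib_right)
        moreover have "h * c0 * (indicator {0<..<t0/2} s * ?m s) \<le> h * c0 * ?m s"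
          using pos[of s] True h c0 by (intro mult_left_mono) (auto simp: indicator_def)
        ultimately show ?thesis using True by simp
      next
        case False
        then show ?thesis using h by (auto simp: indicator_def)
      qed
    qed (use iA1 iJ intK[of "t0 - h"] h in auto)
    finally have 1: "A1 + h * c0 * J \<le> K (t0 - h)" .
    have split: "indicator {0<..<t0} s * g = indicator {0<..<t0-h} s * g + indicator {t0-h..<t0} s * g" for s g :: real
      using h by (auto simp: indicator_def)
    have 2: "K t0 = A1 + (LINT s|lborel. indicator {t0-h..<t0} s * (?k (t0 - s) * ?m s))"
      unfolding K_def A1_def split using iA1 iA2 by simp
    have "(LINT s|lborel. indicator {t0-h..<t0} s * (?k (t0 - s) * ?m s))
        \<le> (LINT s|lborel. indicator {t0-h..<t0} s * (C * h powr (1 - \<alpha>) / Gamma (1 - \<alpha>)))"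
    proof (rule integral_mono)
      fix s
      show "indicator {t0-h..<t0} s * (?k (t0 - s) * ?m s) \<le> indicator {t0-h..<t0} s * (C * h powr (1 - \<alpha>) / Gamma (1 - \<alpha>))"
      proof (cases "s \<in> {t0-h..<t0}")
        case True
        have "?k (t0 - s) * ?m s \<le> ?k (t0 - s) * (C * (t0 - s))"
          using True h lip[of s] \<alpha> by (intro mult_left_mono rl_kernel_nonneg) auto
        also have "\<dots> = C * (t0 - s) powr (1 - \<alpha>) / Gamma (1 - \<alpha>)"
          using True powr_add[of "t0 - s" "- \<alpha>" 1] by (simp add: rl_kernel_def)
        also have "\<dots> \<le> C * h powr (1 - \<alpha>) / Gamma (1 - \<alpha>)"
          using True C G \<alpha> by (intro divide_right_mono mult_left_mono powr_mono2) auto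
        finally show ?thesis using True by simp
      qed auto
    qed (use iA2 h in \<open>auto\<close>)
    also have "\<dots> = h * (C * h powr (1 - \<alpha>) / Gamma (1 - \<alpha>))"
      using h by simp
    finally have 3: "(LINT s|lborel. indicator {t0-h..<t0} s * (?k (t0 - s) * ?m s)) \<le> h * (C * h powr (1 - \<alpha>) / Gamma (1 - \<alpha>))" .
    have 4: "L t0 = L (t0 - h) + (LINT s|lborel. indicator {t0-h..<t0} s * ?m s)"
      unfolding L_def split using iL1 iL2 by simp
    have "(LINT s|lborel. indicator {t0-h..<t0} s * ?m s) \<le> (LINT s|lborel. indicator {t0-h..<t0} s * (C * h))"
    proof (rule integral_mono)
      fix s
      show "indicator {t0-h..<t0} s * ?m s \<le> indicator {t0-h..<t0} s * (C * h)"
      proof (cases "s \<in> {t0-h..<t0}")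
        case True
        then have "?m s \<le> C * (t0 - s)" using lip h by auto
        also have "\<dots> \<le> C * h" using C True by auto
        finally show ?thesis using True by simp
      qed auto
    qed (use iL2 h in auto)
    also have "\<dots> = h * (C * h)" using h by simp
    finally have "(LINT s|lborel. indicator {t0-h..<t0} s * ?m s) \<le> h * (C * h)" .
    then have 5: "\<mu> * (LINT s|lborel. indicator {t0-h..<t0} s * ?m s) \<le> \<mu> * (h * (C * h))"
      using \<mu> by (rule mult_left_mono)
    have "A1 + h * c0 * J \<le> K t0 + \<mu> * (L t0 - L (t0 - h))"
      using 1 KL[of t0] KL[of "t0 - h"] t0 h by (simp add: algebra_simps)
    also have "\<dots> \<le> A1 + h * (C * h powr (1 - \<alpha>) / Gamma (1 - \<alpha>)) + \<mu> * (h * (C * h))"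
      using 2 3 4 5 by simp
    finally have "h * (c0 * J) \<le> h * (C * h powr (1 - \<alpha>) / Gamma (1 - \<alpha>) + \<mu> * C * h)"
      by (simp add: algebra_simps)
    then show ?thesis using h by simp
  qed
  \<comment> \<open>The left side of \<open>main\<close> does not depend on h, while its right side
    tends to 0.\<close>
  have "c0 * J \<le> 0"
  proof (rule tendsto_lowerbound)
    show "((\<lambda>h. C * h powr (1 - \<alpha>) / Gamma (1 - \<alpha>) + \<mu> * C * h) \<longlongrightarrow> 0) (at_right 0)"
    proof -
      have 1: "((\<lambda>h. h powr (1 - \<alpha>)) \<longlongrightarrow> 0) (at_right 0)" using \<alpha> by real_asymp
      have 2: "((\<lambda>h::real. h) \<longlongrightarrow> 0) (at_right 0)" by real_asymp
      have "((\<lambda>h. (C / Gamma (1 - \<alpha>)) * h powr (1 - \<alpha>) + \<mu> * C * h) \<longlongrightarrow> (C / Gamma (1 - \<alpha>)) * 0 + \<mu> * C * 0) (at_right 0)"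
        by (intro tendsto_intros 1 2)
      then show ?thesis by simp
    qed
    show "eventually (\<lambda>h. c0 * J \<le> C * h powr (1 - \<alpha>) / Gamma (1 - \<alpha>) + \<mu> * C * h) (at_right 0)"
      unfolding eventually_at_right_field using main t0 e by (intro exI[of _ "min (t0/2) e"]) auto
  qed auto
  moreover have "0 < c0 * J" using c0 J by simp
  ultimately show False by simp
qed

section \<open>Identities and bounds for the positive kernel\<close>

lemma causal_mlk: "causal (pos (ml_kernel \<alpha> \<mu>))"
  by (rule causal_pos[OF ml_kernel_measurable[OF \<alpha>(1)]])

text \<open>Positivity of the kernel is what permits the passage from the Bochner integral of
  \<open>ml_kernel_conv_integral\<close> to values in [0,infinity]. It also yields the sign of the
  Mittag-Leffler functions with larger second index.\<close>

lemma nnconv_rl_mlk: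
  assumes "0 < \<beta>" "0 < t"
  shows "nnconv (pos (rl_kernel \<beta>)) (pos (ml_kernel \<alpha> \<mu>)) t = ennreal (t powr (\<alpha> + \<beta> - 1) * mittag_leffler \<alpha> (\<alpha> + \<beta>) (- \<mu> * t powr \<alpha>))"
    and "0 \<le> t powr (\<alpha> + \<beta> - 1) * mittag_leffler \<alpha> (\<alpha> + \<beta>) (- \<mu> * t powr \<alpha>)"
proof -
  note hb = ml_kernel_conv_integral[OF \<alpha>(1) assms, of \<mu>]
  have nonneg: "0 \<le> indicator {0<..<t} s * (rl_kernel \<beta> (t - s) * ml_kernel \<alpha> \<mu> s)" for s
    using ml_kernel_pos[of s] rl_kernel_nonneg[of \<beta> "t - s"] assms by (auto simp: indicator_def less_imp_le)
  have "nnconv (pos (rl_kernel \<beta>)) (pos (ml_kernel \<alpha> \<mu>)) t = (\<integral>\<^sup>+s. ennreal (indicator {0<..<t} s * (rl_kernel \<beta> (t - s) * ml_kernel \<alpha> \<mu> s)) \<partial>lborel)"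
    unfolding nnconv_eq[OF causal_pos_rl causal_mlk]
    using rl_kernel_nonneg[of \<beta>] assms ml_kernel_pos by (intro nn_integral_cong) (auto simp: pos_def indicator_def ennreal_mult less_imp_le)
  also have "\<dots> = ennreal (LINT s|lborel. indicator {0<..<t} s * (rl_kernel \<beta> (t - s) * ml_kernel \<alpha> \<mu> s))"
    using nonneg by (intro nn_integral_eq_integral AE_I2 integrable.intros[OF hb]) auto
  finally show "nnconv (pos (rl_kernel \<beta>)) (pos (ml_kernel \<alpha> \<mu>)) t = ennreal (t powr (\<alpha> + \<beta> - 1) * mittag_leffler \<alpha> (\<alpha> + \<beta>) (- \<mu> * t powr \<alpha>))"
    using has_bochner_integral_integral_eq[OF hb] by simp
  show "0 \<le> t powr (\<alpha> + \<beta> - 1) * mittag_leffler \<alpha> (\<alpha> + \<beta>) (- \<mu> * t powr \<alpha>)"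
    unfolding has_bochner_integral_integral_eq[OF hb, symmetric]
    by (rule integral_nonneg_AE[OF AE_I2[OF nonneg]])
qed

lemma nnconv_caputo:
  assumes "0 < t"
  shows "nnconv (pos (rl_kernel (1 - \<alpha>))) (pos (ml_kernel \<alpha> \<mu>)) t + ennreal \<mu> * nnconv (pos (rl_kernel 1)) (pos (ml_kernel \<alpha> \<mu>)) t = 1"
proof -
  let ?x = "- \<mu> * t powr \<alpha>"
  have 1: "nnconv (pos (rl_kernel (1 - \<alpha>))) (pos (ml_kernel \<alpha> \<mu>)) t = ennreal (mittag_leffler \<alpha> 1 ?x)" "0 \<le> mittag_leffler \<alpha> 1 ?x"
    using nnconv_rl_mlk[of "1 - \<alpha>" t] \<alpha> assms by simp_all
  have 2: "nnconv (pos (rl_kernel 1)) (pos (ml_kernel \<alpha> \<mu>)) t = ennreal (t powr \<alpha> * mittag_leffler \<alpha> (\<alpha> + 1) ?x)" "0 \<le> t powr \<alpha> * mittag_leffler \<alpha> (\<alpha> + 1) ?x"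
    using nnconv_rl_mlk[of 1 t] \<alpha> assms by simp_all
  have "mittag_leffler \<alpha> 1 ?x + \<mu> * (t powr \<alpha> * mittag_leffler \<alpha> (\<alpha> + 1) ?x) = 1"
    using mittag_leffler_rec[of \<alpha> 1 ?x] \<alpha> by simp
  moreover have "ennreal (mittag_leffler \<alpha> 1 ?x) + ennreal \<mu> * ennreal (t powr \<alpha> * mittag_leffler \<alpha> (\<alpha> + 1) ?x) =
     ennreal (mittag_leffler \<alpha> 1 ?x + \<mu> * (t powr \<alpha> * mittag_leffler \<alpha> (\<alpha> + 1) ?x))"
    using 1(2) 2(2) \<mu> by (simp add: ennreal_mult ennreal_plus)
  ultimately show ?thesis unfolding 1(1) 2(1) by simp
qed

text \<open>This is the Volterra equation of the second kind E + mu (k * E) = k for the kernel k of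
  order alpha. Written without subtraction it bounds E at once by its value for mu = 0.\<close>

lemma nnconv_resolvent:
  "pos (ml_kernel \<alpha> \<mu>) t + ennreal \<mu> * nnconv (pos (rl_kernel \<alpha>)) (pos (ml_kernel \<alpha> \<mu>)) t = pos (rl_kernel \<alpha>) t"
proof (cases "0 < t")
  case t: True
  let ?x = "- \<mu> * t powr \<alpha>"
  have 1: "nnconv (pos (rl_kernel \<alpha>)) (pos (ml_kernel \<alpha> \<mu>)) t = ennreal (t powr (\<alpha> + \<alpha> - 1) * mittag_leffler \<alpha> (\<alpha> + \<alpha>) ?x)"
     "0 \<le> t powr (\<alpha> + \<alpha> - 1) * mittag_leffler \<alpha> (\<alpha> + \<alpha>) ?x"
    using nnconv_rl_mlk[of \<alpha> t] \<alpha> t by simp_all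
  have pw: "t powr (\<alpha> + \<alpha> - 1) = t powr (\<alpha> - 1) * t powr \<alpha>"
    by (simp add: powr_add[symmetric])
  have "ml_kernel \<alpha> \<mu> t + \<mu> * (t powr (\<alpha> + \<alpha> - 1) * mittag_leffler \<alpha> (\<alpha> + \<alpha>) ?x) = rl_kernel \<alpha> t"
  proof -
    have "ml_kernel \<alpha> \<mu> t + \<mu> * (t powr (\<alpha> + \<alpha> - 1) * mittag_leffler \<alpha> (\<alpha> + \<alpha>) ?x)
        = t powr (\<alpha> - 1) * (mittag_leffler \<alpha> \<alpha> ?x - ?x * mittag_leffler \<alpha> (\<alpha> + \<alpha>) ?x)"
      unfolding ml_kernel_def pw by (simp add: algebra_simps)
    also have "mittag_leffler \<alpha> \<alpha> ?x - ?x * mittag_leffler \<alpha> (\<alpha> + \<alpha>) ?x = 1 / Gamma \<alpha>"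
      using mittag_leffler_rec[of \<alpha> \<alpha> ?x] \<alpha> by simp
    finally show ?thesis by (simp add: rl_kernel_def)
  qed
  moreover have "ennreal (ml_kernel \<alpha> \<mu> t) + ennreal \<mu> * ennreal (t powr (\<alpha> + \<alpha> - 1) * mittag_leffler \<alpha> (\<alpha> + \<alpha>) ?x)
     = ennreal (ml_kernel \<alpha> \<mu> t + \<mu> * (t powr (\<alpha> + \<alpha> - 1) * mittag_leffler \<alpha> (\<alpha> + \<alpha>) ?x))"
    using 1(2) \<mu> ml_kernel_pos[OF t] by (simp add: ennreal_mult ennreal_plus less_imp_le)
  ultimately show ?thesis unfolding 1(1) using t by (simp add: pos_def)
next
  case False
  then show ?thesis using causalD(2)[OF causal_nnconv[OF causal_pos_rl causal_mlk], of t \<alpha>]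
    by (simp add: pos_def)
qed

lemma ml_kernel_le_rl:
  assumes "0 < t" shows "ml_kernel \<alpha> \<mu> t \<le> rl_kernel \<alpha> t"
proof -
  have "pos (ml_kernel \<alpha> \<mu>) t \<le> pos (rl_kernel \<alpha>) t"
    by (subst nnconv_resolvent[symmetric]) simp
  then show ?thesis using assms \<alpha> rl_kernel_nonneg[of \<alpha> t] by (simp add: pos_def)
qed

lemma ml_kernel_mass: "ennreal \<mu> * (\<integral>\<^sup>+s. pos (ml_kernel \<alpha> \<mu>) s * indicator {0<..<t} s \<partial>lborel) \<le> 1"
proof (cases "0 < t")
  case True
  have "nnconv (pos (rl_kernel 1)) (pos (ml_kernel \<alpha> \<mu>)) t = (\<integral>\<^sup>+s. pos (ml_kernel \<alpha> \<mu>) s * indicator {0<..<t} s \<partial>lborel)"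
    unfolding nnconv_eq[OF causal_pos_rl causal_mlk]
    by (rule nn_integral_cong) (auto simp: pos_def rl_kernel_def indicator_def)
  moreover have "ennreal \<mu> * nnconv (pos (rl_kernel 1)) (pos (ml_kernel \<alpha> \<mu>)) t \<le> 1"
    unfolding nnconv_caputo[OF True, symmetric] by simp
  ultimately show ?thesis by simp
qed auto

end

lemma pos_mlk_le:
  assumes "0 < \<alpha>" "\<alpha> < 1" "0 \<le> \<mu>"
  shows "pos (ml_kernel \<alpha> \<mu>) t \<le> pos (rl_kernel \<alpha>) t"
  using ml_kernel_le_rl[OF assms, of t] rl_kernel_nonneg[OF assms(1)] by (auto simp: pos_def indicator_def)

section \<open>Dependence on mu and regularity in time\<close>

context
  fixes \<alpha> \<mu> \<nu> :: real
  assumes \<alpha>: "0 < \<alpha>" "\<alpha> < 1" and \<mu>: "0 \<le> \<mu>" and \<nu>: "0 \<le> \<nu>"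
begin

text \<open>The resolvent identity a - b = (nu - mu) (a * b), with the subtractions moved across.
  Expanding k * a and k * b by \<open>nnconv_resolvent\<close> shows that either side, increased by
  mu nu (k * a * b), equals k. The triple convolution may be cancelled because it is dominated by
  the finite k * k * k.\<close>

lemma nnconv_resolvent_identity:
  shows "pos (ml_kernel \<alpha> \<mu>) t + ennreal \<mu> * nnconv (pos (ml_kernel \<alpha> \<mu>)) (pos (ml_kernel \<alpha> \<nu>)) t
       = pos (ml_kernel \<alpha> \<nu>) t + ennreal \<nu> * nnconv (pos (ml_kernel \<alpha> \<mu>)) (pos (ml_kernel \<alpha> \<nu>)) t"
proof -
  let ?g = "pos (rl_kernel \<alpha>)" and ?a = "pos (ml_kernel \<alpha> \<mu>)" and ?b = "pos (ml_kernel \<alpha> \<nu>)"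
  have [measurable]: "?g \<in> borel_measurable borel" "?a \<in> borel_measurable borel" "?b \<in> borel_measurable borel"
    using causal_pos_rl[of \<alpha>] causal_mlk[OF \<alpha> \<mu>] causal_mlk[OF \<alpha> \<nu>] by (auto simp: causal_def)
  define X where "X = nnconv (nnconv ?g ?a) ?b"
  have ga: "?g = (\<lambda>t. ?a t + ennreal \<mu> * nnconv ?g ?a t)"
    using nnconv_resolvent[OF \<alpha> \<mu>] by simp
  have gb: "?g = (\<lambda>t. ?b t + ennreal \<nu> * nnconv ?g ?b t)"
    using nnconv_resolvent[OF \<alpha> \<nu>] by simp
  have 1: "nnconv ?g ?b t = nnconv ?a ?b t + ennreal \<mu> * X t"
    by (subst ga) (simp add: nnconv_add_left nnconv_cmult_left X_def)
  have "nnconv ?g ?a t = nnconv ?b ?a t + ennreal \<nu> * nnconv (nnconv ?g ?b) ?a t"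
    by (subst gb) (simp add: nnconv_add_left nnconv_cmult_left)
  also have "nnconv ?b ?a = nnconv ?a ?b" by (rule nnconv_commute) auto
  also have "nnconv (nnconv ?g ?b) ?a = X"
    unfolding X_def by (simp add: nnconv_assoc nnconv_commute[of ?b ?a])
  finally have 2: "nnconv ?g ?a t = nnconv ?a ?b t + ennreal \<nu> * X t" .
  have "X t \<le> nnconv (nnconv ?g ?g) ?g t"
    unfolding X_def by (intro nnconv_mono pos_mlk_le \<alpha> \<mu> \<nu>) auto
  also have "\<dots> < top" using \<alpha> by (simp add: nnconv_rl pos_def[of "rl_kernel _"] indicator_def)
  finally have fin: "ennreal \<mu> * ennreal \<nu> * X t \<noteq> top"
    by (simp add: ennreal_mult_eq_top_iff)
  have "?a t + ennreal \<mu> * nnconv ?a ?b t + ennreal \<mu> * ennreal \<nu> * X t = ?g t"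
    by (subst ga, subst 2) (simp add: distrib_left mult.assoc add.assoc)
  also have "\<dots> = ?b t + ennreal \<nu> * nnconv ?a ?b t + ennreal \<mu> * ennreal \<nu> * X t"
    by (subst gb, subst 1) (simp add: distrib_left mult.assoc add.assoc mult.left_commute)
  finally have "ennreal \<mu> * ennreal \<nu> * X t + (?a t + ennreal \<mu> * nnconv ?a ?b t)
      = ennreal \<mu> * ennreal \<nu> * X t + (?b t + ennreal \<nu> * nnconv ?a ?b t)"
    by (simp only: add.commute)
  then show ?thesis
    using fin by (simp only: ennreal_add_left_cancel) simp
qed

text \<open>At every s one of s and t - s is at least t/2. The kernel at that time is bounded by the
  Riemann-Liouville kernel at t/2, and the other one is integrated, with mass at most 1/mu or
  1/nu.\<close>

lemma nnconv_mlk_le: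
  assumes "0 < \<mu>" "0 < \<nu>" "0 < t"
  shows "nnconv (pos (ml_kernel \<alpha> \<mu>)) (pos (ml_kernel \<alpha> \<nu>)) t \<le> ennreal (rl_kernel \<alpha> (t/2) * (1 / \<mu> + 1 / \<nu>))"
proof -
  let ?a = "pos (ml_kernel \<alpha> \<mu>)" and ?b = "pos (ml_kernel \<alpha> \<nu>)" and ?R = "ennreal (rl_kernel \<alpha> (t/2))"
  have [measurable]: "?a \<in> borel_measurable borel" "?b \<in> borel_measurable borel"
    using causal_mlk[OF \<alpha> \<mu>] causal_mlk[OF \<alpha> \<nu>] by (auto simp: causal_def)
  have R: "pos (ml_kernel \<alpha> \<kappa>) s \<le> ?R" if "t/2 \<le> s" "0 \<le> \<kappa>" for s \<kappa>
  proof -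
    have "pos (ml_kernel \<alpha> \<kappa>) s \<le> pos (rl_kernel \<alpha>) s" by (rule pos_mlk_le[OF \<alpha> that(2)])
    also have "\<dots> \<le> ?R"
      using that assms \<alpha> by (auto simp: pos_def rl_kernel_def intro!: ennreal_leI divide_right_mono powr_mono2' less_imp_le[OF Gamma_real_pos])
    finally show ?thesis .
  qed
  have mass: "(\<integral>\<^sup>+s. pos (ml_kernel \<alpha> \<kappa>) s * indicator {0<..<t} s \<partial>lborel) \<le> ennreal (1 / \<kappa>)" if "0 < \<kappa>" for \<kappa>
  proof -
    let ?I = "\<integral>\<^sup>+s. pos (ml_kernel \<alpha> \<kappa>) s * indicator {0<..<t} s \<partial>lborel"
    have "?I = ennreal (1 / \<kappa>) * (ennreal \<kappa> * ?I)"
      using that by (simp add: mult.assoc[symmetric] ennreal_mult[symmetric])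
    also have "\<dots> \<le> ennreal (1 / \<kappa>) * 1"
      using that ml_kernel_mass[OF \<alpha>, of \<kappa> t] by (intro mult_left_mono) auto
    finally show ?thesis by simp
  qed
  have "nnconv ?a ?b t = (\<integral>\<^sup>+s\<in>{0<..<t}. ?a (t - s) * ?b s \<partial>lborel)"
    by (rule nnconv_eq[OF causal_mlk[OF \<alpha> \<mu>] causal_mlk[OF \<alpha> \<nu>]])
  also have "\<dots> \<le> (\<integral>\<^sup>+s. ?R * (?b s * indicator {0<..<t} s) + ?R * (?a (t - s) * indicator {0<..<t} (t - s)) \<partial>lborel)"
  proof (rule nn_integral_mono)
    fix s
    show "?a (t - s) * ?b s * indicator {0<..<t} s \<le> ?R * (?b s * indicator {0<..<t} s) + ?R * (?a (t - s) * indicator {0<..<t} (t - s))"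
    proof (cases "s \<in> {0<..<t}")
      case True
      show ?thesis
      proof (cases "s \<le> t / 2")
        case le: True
        have "?a (t - s) * ?b s \<le> ?R * ?b s" using le by (intro mult_right_mono R \<mu>) auto
        then show ?thesis using True by (auto intro: add_increasing2)
      next
        case False
        have "?a (t - s) * ?b s \<le> ?a (t - s) * ?R" using False by (intro mult_left_mono R \<nu>) auto
        then show ?thesis using True by (auto intro: add_increasing simp: mult.commute)
      qed
    qed auto
  qed
  also have "\<dots> = ?R * (\<integral>\<^sup>+s. ?b s * indicator {0<..<t} s \<partial>lborel) + ?R * (\<integral>\<^sup>+s. ?a (t - s) * indicator {0<..<t} (t - s) \<partial>lborel)"
    by (simp add: nn_integral_add nn_integral_cmult)
  also have "(\<integral>\<^sup>+s. ?a (t - s) * indicator {0<..<t} (t - s) \<partial>lborel) = (\<integral>\<^sup>+s. ?a s * indicator {0<..<t} s \<partial>lborel)"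
    by (subst (2) nn_integral_real_affine[where c = "-1" and t = t]) auto
  also have "?R * (\<integral>\<^sup>+s. ?b s * indicator {0<..<t} s \<partial>lborel) + ?R * (\<integral>\<^sup>+s. ?a s * indicator {0<..<t} s \<partial>lborel)
     \<le> ?R * ennreal (1 / \<nu>) + ?R * ennreal (1 / \<mu>)"
  proof -
    have m: "(\<integral>\<^sup>+s. ?b s * indicator {0<..<t} s \<partial>lborel) \<le> ennreal (1 / \<nu>)"
      "(\<integral>\<^sup>+s. ?a s * indicator {0<..<t} s \<partial>lborel) \<le> ennreal (1 / \<mu>)"
      using mass[OF assms(2)] mass[OF assms(1)] by simp_all
    show ?thesis by (rule add_mono[OF mult_left_mono[OF m(1) zero_le] mult_left_mono[OF m(2) zero_le]])
  qed
  also have "\<dots> = ennreal (rl_kernel \<alpha> (t/2) * (1 / \<mu> + 1 / \<nu>))"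
  proof -
    have nn: "0 \<le> rl_kernel \<alpha> (t/2) * (1 / \<nu>)" "0 \<le> rl_kernel \<alpha> (t/2) * (1 / \<mu>)"
      using assms rl_kernel_nonneg[OF \<alpha>(1), of "t/2"] by auto
    have "rl_kernel \<alpha> (t/2) * (1 / \<mu> + 1 / \<nu>) = rl_kernel \<alpha> (t/2) * (1 / \<nu>) + rl_kernel \<alpha> (t/2) * (1 / \<mu>)"
      by (simp add: distrib_left)
    then show ?thesis
      using nn assms rl_kernel_nonneg[OF \<alpha>(1), of "t/2"] by (simp add: ennreal_mult'[symmetric])
  qed
  finally show ?thesis .
qed

end

text \<open>
  The resolvent identity turns the difference of two kernels into a convolution; combined with the
  scaling \<open>ml_kernel \<alpha> \<mu> t\<close> in \<open>\<mu> t\<^sup>\<alpha>\<close>, continuity in \<open>\<mu>\<close> gives a Lipschitz bound in \<open>t\<close> that is uniform in \<open>\<mu>\<close>.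
\<close>

lemma ml_kernel_diff_le_aux:
  assumes \<alpha>: "0 < \<alpha>" "\<alpha> < 1" and "0 < \<mu>" "\<mu> \<le> \<nu>" "0 < t"
  shows "\<bar>ml_kernel \<alpha> \<mu> t - ml_kernel \<alpha> \<nu> t\<bar> \<le> (\<nu> - \<mu>) * (rl_kernel \<alpha> (t/2) * (1 / \<mu> + 1 / \<nu>))"
proof -
  let ?C = "nnconv (pos (ml_kernel \<alpha> \<mu>)) (pos (ml_kernel \<alpha> \<nu>)) t"
  have \<mu>\<nu>: "0 < \<mu>" "0 < \<nu>" "0 \<le> \<mu>" "0 \<le> \<nu>" using assms by auto
  have B: "0 \<le> rl_kernel \<alpha> (t/2) * (1 / \<mu> + 1 / \<nu>)"
    using \<mu>\<nu> rl_kernel_nonneg[OF \<alpha>(1)] by (intro mult_nonneg_nonneg) auto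
  have C: "?C \<le> ennreal (rl_kernel \<alpha> (t/2) * (1 / \<mu> + 1 / \<nu>))"
    by (rule nnconv_mlk_le) (use assms in auto)
  then obtain c where c: "?C = ennreal c" "0 \<le> c"
    by (cases ?C) (auto simp: top_unique)
  have cB: "c \<le> rl_kernel \<alpha> (t/2) * (1 / \<mu> + 1 / \<nu>)" using C c B by simp
  have p: "0 < ml_kernel \<alpha> \<mu> t" "0 < ml_kernel \<alpha> \<nu> t" using ml_kernel_pos \<alpha> \<mu>\<nu> assms by auto
  have sum: "ennreal (ml_kernel \<alpha> \<kappa> t + \<kappa> * c) = pos (ml_kernel \<alpha> \<kappa>) t + ennreal \<kappa> * ennreal c" if "0 < \<kappa>" for \<kappa>
    using ml_kernel_pos[OF \<alpha> less_imp_le[OF that] \<open>0 < t\<close>] that c \<open>0 < t\<close>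
    by (simp add: pos_def[of _ t] ennreal_mult less_imp_le)
  have "ennreal (ml_kernel \<alpha> \<mu> t + \<mu> * c) = ennreal (ml_kernel \<alpha> \<nu> t + \<nu> * c)"
    unfolding sum[OF \<mu>\<nu>(1)] sum[OF \<mu>\<nu>(2)]
    using nnconv_resolvent_identity[OF \<alpha> \<mu>\<nu>(3,4), of t] unfolding c(1) .
  then have "ml_kernel \<alpha> \<mu> t + \<mu> * c = ml_kernel \<alpha> \<nu> t + \<nu> * c"
    using p c \<mu>\<nu> by (subst (asm) ennreal_inj) auto
  then have "ml_kernel \<alpha> \<mu> t - ml_kernel \<alpha> \<nu> t = (\<nu> - \<mu>) * c"
    by (simp add: algebra_simps)
  moreover have "(\<nu> - \<mu>) * c \<le> (\<nu> - \<mu>) * (rl_kernel \<alpha> (t/2) * (1 / \<mu> + 1 / \<nu>))"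
    using assms by (intro mult_left_mono cB) auto
  ultimately show ?thesis using assms c by simp
qed

text \<open>The summand 1 is the cost of rescaling time while mu t^alpha is kept fixed, the other
  one the cost of changing mu at a fixed time; see \<open>ml_kernel_lipschitz\<close>.\<close>

definition ml_kernel_lip :: "real \<Rightarrow> real" where
  "ml_kernel_lip \<alpha> = (1 + 2 * 2 powr (1 - \<alpha>)) / Gamma \<alpha>"

lemma ml_kernel_lip_pos: "0 < \<alpha> \<Longrightarrow> 0 < ml_kernel_lip \<alpha>"
  by (simp add: ml_kernel_lip_def Gamma_real_pos add_pos_nonneg)

text \<open>With u = s/t and nu = mu u^alpha the Mittag-Leffler function has the same argument for
  (mu,s) and for (nu,t), so these two kernel values differ by a power of u only. The remaining
  comparison, of nu and mu at the same time t, is \<open>ml_kernel_diff_le_aux\<close>.\<close>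

lemma ml_kernel_lipschitz:
  assumes \<alpha>: "0 < \<alpha>" "\<alpha> < 1" and \<mu>: "0 \<le> \<mu>" and st: "0 < s" "s \<le> t"
  shows "\<bar>ml_kernel \<alpha> \<mu> s - ml_kernel \<alpha> \<mu> t\<bar> \<le> ml_kernel_lip \<alpha> * s powr (\<alpha> - 2) * (t - s)"
proof -
  define u where "u = s / t"
  define \<nu> where "\<nu> = \<mu> * u powr \<alpha>"
  have t: "0 < t" using st by simp
  have u: "0 < u" "u \<le> 1" using st t by (auto simp: u_def)
  have ut: "u * t = s" using t by (simp add: u_def)
  have u1: "u \<le> u powr b" if "0 < b" "b \<le> 1" for b
    using powr_mono'[of b 1 u] u that by simp
  have ua: "u powr \<alpha> \<le> 1" "0 < u powr \<alpha>" using u \<alpha> by (auto simp: powr_le1)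
  have G: "0 < Gamma \<alpha>" using \<alpha> by (intro Gamma_real_pos)
  have arg: "\<mu> * s powr \<alpha> = \<nu> * t powr \<alpha>"
    unfolding \<nu>_def ut[symmetric] using u t by (simp add: powr_mult)
  have s1: "s powr (\<alpha> - 1) = u powr (\<alpha> - 1) * t powr (\<alpha> - 1)"
    unfolding ut[symmetric] using u t by (simp add: powr_mult)
  have "ml_kernel \<alpha> \<nu> t = u powr (1 - \<alpha>) * ml_kernel \<alpha> \<mu> s"
    using u unfolding ml_kernel_def s1 by (simp add: arg mult.assoc[symmetric] powr_add[symmetric])
  then have "ml_kernel \<alpha> \<mu> s - ml_kernel \<alpha> \<nu> t = (1 - u powr (1 - \<alpha>)) * ml_kernel \<alpha> \<mu> s"
    by (simp add: algebra_simps)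
  moreover have "0 \<le> 1 - u powr (1 - \<alpha>)" using u \<alpha> by (simp add: powr_le1)
  moreover have "(1 - u powr (1 - \<alpha>)) * ml_kernel \<alpha> \<mu> s \<le> (1 - u) * rl_kernel \<alpha> s"
    using u u1[of "1 - \<alpha>"] \<alpha> ml_kernel_le_rl[OF \<alpha> \<mu> st(1)] ml_kernel_pos[OF \<alpha> \<mu> st(1)] rl_kernel_nonneg[OF \<alpha>(1), of s]
    by (intro mult_mono) auto
  moreover have "(1 - u) * rl_kernel \<alpha> s \<le> 1 / Gamma \<alpha> * s powr (\<alpha> - 2) * (t - s)"
  proof -
    have "(1 - u) = (t - s) / t" using t by (simp add: u_def field_simps)
    also have "\<dots> \<le> (t - s) / s" using st by (intro divide_left_mono) auto
    finally have "(1 - u) * rl_kernel \<alpha> s \<le> (t - s) / s * rl_kernel \<alpha> s"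
      by (intro mult_right_mono rl_kernel_nonneg \<alpha>)
    also have "\<dots> = 1 / Gamma \<alpha> * (s powr (\<alpha> - 1) / s) * (t - s)" by (simp add: rl_kernel_def mult_ac)
    also have "s powr (\<alpha> - 1) / s = s powr (\<alpha> - 2)"
      using st powr_diff[of s "\<alpha> - 1" 1] by simp
    finally show ?thesis .
  qed
  ultimately have 1: "\<bar>ml_kernel \<alpha> \<mu> s - ml_kernel \<alpha> \<nu> t\<bar> \<le> 1 / Gamma \<alpha> * s powr (\<alpha> - 2) * (t - s)"
    using ml_kernel_pos[OF \<alpha> \<mu> st(1)] by (simp add: abs_mult)
  have 2: "\<bar>ml_kernel \<alpha> \<nu> t - ml_kernel \<alpha> \<mu> t\<bar> \<le> 2 * 2 powr (1 - \<alpha>) / Gamma \<alpha> * s powr (\<alpha> - 2) * (t - s)"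
  proof (cases "\<mu> = 0")
    case True
    then show ?thesis using st G by (simp add: \<nu>_def)
  next
    case False
    then have \<mu>': "0 < \<mu>" using \<mu> by simp
    have \<nu>: "0 < \<nu>" "\<nu> \<le> \<mu>" using \<mu>' ua by (auto simp: \<nu>_def)
    have "\<bar>ml_kernel \<alpha> \<nu> t - ml_kernel \<alpha> \<mu> t\<bar> \<le> (\<mu> - \<nu>) * (rl_kernel \<alpha> (t/2) * (1 / \<nu> + 1 / \<mu>))"
      by (rule ml_kernel_diff_le_aux[OF \<alpha> \<nu> t])
    \<comment> \<open>Here mu cancels: (mu - nu)(1/nu + 1/mu) depends on u alone, which makes the
      bound uniform in mu.\<close>
    also have "\<dots> = rl_kernel \<alpha> (t/2) * ((1 - u powr \<alpha>) * (1 / u powr \<alpha> + 1))"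
      using \<mu>' ua(2) by (simp add: \<nu>_def field_simps)
    also have "\<dots> \<le> rl_kernel \<alpha> (t/2) * ((1 - u) * (2 / u))"
    proof (intro mult_left_mono mult_mono rl_kernel_nonneg \<alpha>)
      have "1 / u powr \<alpha> \<le> 1 / u" using u1[of \<alpha>] \<alpha> u ua by (intro divide_left_mono) auto
      moreover have "1 \<le> 1 / u" using u by simp
      ultimately show "1 / u powr \<alpha> + 1 \<le> 2 / u" by (simp add: field_simps)
    qed (use u u1[of \<alpha>] \<alpha> in auto)
    also have "(1 - u) * (2 / u) = 2 * (t - s) / s" using t st by (simp add: u_def field_simps)
    also have "rl_kernel \<alpha> (t/2) = 2 powr (1 - \<alpha>) * t powr (\<alpha> - 1) / Gamma \<alpha>"
      using t by (simp add: rl_kernel_def powr_divide powr_diff)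
    also have "2 powr (1 - \<alpha>) * t powr (\<alpha> - 1) / Gamma \<alpha> * (2 * (t - s) / s)
      \<le> 2 powr (1 - \<alpha>) * s powr (\<alpha> - 1) / Gamma \<alpha> * (2 * (t - s) / s)"
      using st G \<alpha> by (intro mult_right_mono divide_right_mono mult_left_mono powr_mono2') auto
    also have "\<dots> = 2 * 2 powr (1 - \<alpha>) / Gamma \<alpha> * (s powr (\<alpha> - 1) / s) * (t - s)" by simp
    also have "s powr (\<alpha> - 1) / s = s powr (\<alpha> - 2)"
      using st powr_diff[of s "\<alpha> - 1" 1] by simp
    finally show ?thesis .
  qed
  have "\<bar>ml_kernel \<alpha> \<mu> s - ml_kernel \<alpha> \<mu> t\<bar> \<le> 1 / Gamma \<alpha> * s powr (\<alpha> - 2) * (t - s) + 2 * 2 powr (1 - \<alpha>) / Gamma \<alpha> * s powr (\<alpha> - 2) * (t - s)"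
    using 1 2 by simp
  also have "\<dots> = ml_kernel_lip \<alpha> * s powr (\<alpha> - 2) * (t - s)"
    by (simp add: ml_kernel_lip_def add_divide_distrib distrib_right)
  finally show ?thesis .
qed

section \<open>The Volterra equation with continuous data\<close>

text \<open>For t \<le> 0 the interval is empty and the value is 0; continuity at the origin,
  contained in \<open>conv0_isCont\<close>, is therefore an initial condition.\<close>

definition conv0 :: "(real \<Rightarrow> real) \<Rightarrow> (real \<Rightarrow> real) \<Rightarrow> real \<Rightarrow> real" where
  "conv0 u g t = (LINT s|lborel. indicator {0<..<t} s * (u (t - s) * g s))"

lemma conv0_integrable:
  assumes [measurable]: "u \<in> borel_measurable borel" "g \<in> borel_measurable borel"
    and u: "integrable lborel (\<lambda>s. indicator {0<..<t::real} s * u s :: real)"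
    and g: "\<And>s. 0 < s \<Longrightarrow> s < t \<Longrightarrow> \<bar>g s\<bar> \<le> B"
  shows "integrable lborel (\<lambda>s. indicator {0<..<t} s * (u (t - s) * g s :: real))"
proof -
  have "integrable lborel (\<lambda>s. indicator {0<..<t} (t + (-1) * s) * u (t + (-1) * s))"
    by (rule lborel_integrable_real_affine[OF u]) simp
  then have "integrable lborel (\<lambda>s. B * (indicator {0<..<t} (t - s) * u (t - s)))"
    by (intro integrable_mult_right) simp
  then show ?thesis
  proof (rule Bochner_Integration.integrable_bound[OF _ _ AE_I2])
    fix s show "norm (indicator {0<..<t} s * (u (t - s) * g s)) \<le> norm (B * (indicator {0<..<t} (t - s) * u (t - s)))"
    proof (cases "0 < s \<and> s < t")
      case True
      have "\<bar>u (t - s)\<bar> * \<bar>g s\<bar> \<le> \<bar>u (t - s)\<bar> * B" using True g by (intro mult_left_mono) auto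
      also have "\<dots> \<le> \<bar>u (t - s)\<bar> * \<bar>B\<bar>" by (intro mult_left_mono) auto
      finally show ?thesis using True by (simp add: abs_mult mult.commute)
    qed auto
  qed measurable
qed

lemma nnconv_rconv:
  assumes [measurable]: "u \<in> borel_measurable borel" "g \<in> borel_measurable borel"
    and u: "integrable lborel (\<lambda>s. indicator {0<..<t::real} s * u s :: real)" "\<And>s. 0 < s \<Longrightarrow> 0 \<le> u s"
    and g: "\<And>s. 0 < s \<Longrightarrow> s < t \<Longrightarrow> 0 \<le> g s" "\<And>s. 0 < s \<Longrightarrow> s < t \<Longrightarrow> g s \<le> B"
  shows "nnconv (pos u) (pos g) t = ennreal (conv0 u g t)" "0 \<le> conv0 u g t"
proof -
  have int: "integrable lborel (\<lambda>s. indicator {0<..<t} s * (u (t - s) * g s))"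
    using g by (intro conv0_integrable[OF _ _ u(1)]) (auto simp: abs_le_iff intro: order_trans)
  have nn: "0 \<le> indicator {0<..<t} s * (u (t - s) * g s)" for s
    using u(2)[of "t - s"] g(1)[of s] by (auto simp: indicator_def)
  have "nnconv (pos u) (pos g) t = (\<integral>\<^sup>+s. ennreal (indicator {0<..<t} s * (u (t - s) * g s)) \<partial>lborel)"
    unfolding nnconv_eq[OF causal_pos causal_pos, OF assms(1,2)]
    using u(2) g(1) by (intro nn_integral_cong) (auto simp: pos_def indicator_def ennreal_mult)
  also have "\<dots> = ennreal (conv0 u g t)" unfolding conv0_def
    using nn by (intro nn_integral_eq_integral int AE_I2) auto
  finally show "nnconv (pos u) (pos g) t = ennreal (conv0 u g t)" .
  show "0 \<le> conv0 u g t" unfolding conv0_def by (intro integral_nonneg_AE AE_I2 nn)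
qed

lemma conv0_commute: "conv0 u g t = (LINT s|lborel. indicator {0<..<t} s * (u s * g (t - s)))"
proof -
  have "conv0 u g t = \<bar>-1\<bar> *\<^sub>R (LINT s|lborel. indicator {0<..<t} (t + -1 * s) * (u (t - (t + -1 * s)) * g (t + -1 * s)))"
    unfolding conv0_def by (rule lborel_integral_real_affine) simp
  also have "\<dots> = (LINT s|lborel. indicator {0<..<t} s * (u s * g (t - s)))"
    by (simp, rule Bochner_Integration.integral_cong) (auto simp: indicator_def)
  finally show ?thesis .
qed

text \<open>After \<open>conv0_commute\<close> the singular factor no longer depends on t. Dominated
  convergence then applies, since g is locally bounded and the indicator converges for every s other
  than t.\<close>

lemma conv0_isCont:
  assumes [measurable]: "u \<in> borel_measurable borel"
    and u: "\<And>t. 0 < t \<Longrightarrow> integrable lborel (\<lambda>s. indicator {0<..<t} s * u s :: real)"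
    and g: "continuous_on UNIV g"
  shows "isCont (conv0 u g) t"
proof -
  have [measurable]: "g \<in> borel_measurable borel" using g by (rule borel_measurable_continuous_onI)
  have "(\<lambda>n. conv0 u g (x n)) \<longlonglongrightarrow> conv0 u g t" if x: "x \<longlonglongrightarrow> t" for x :: "nat \<Rightarrow> real"
  proof -
    define b where "b = \<bar>t\<bar> + 1"
    have "bounded (g ` {0..b})" by (intro compact_imp_bounded compact_continuous_image continuous_on_subset[OF g]) auto
    then obtain B where B: "\<And>s. s \<in> {0..b} \<Longrightarrow> \<bar>g s\<bar> \<le> B" unfolding bounded_iff by fastforce
    have "eventually (\<lambda>n. dist (x n) t < 1) sequentially" using x tendstoD zero_less_one by blast
    then have "eventually (\<lambda>n. x n < b) sequentially" by eventually_elim (auto simp: b_def dist_real_def)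
    then obtain n0 where n0: "\<And>n. n \<ge> n0 \<Longrightarrow> x n < b" by (auto simp: eventually_sequentially)
    have "(\<lambda>n. conv0 u g (x (n + n0))) \<longlonglongrightarrow> conv0 u g t"
      unfolding conv0_commute
    proof (rule integral_dominated_convergence[where w = "\<lambda>s. B * norm (indicator {0<..<b} s * u s)"])
      show "integrable lborel (\<lambda>s. B * norm (indicator {0<..<b} s * u s))"
        by (intro integrable_mult_right integrable_norm u) (auto simp: b_def)
      show "AE s in lborel. (\<lambda>n. indicator {0<..<x (n + n0)} s * (u s * g (x (n + n0) - s))) \<longlonglongrightarrow> indicator {0<..<t} s * (u s * g (t - s))"
        using AE_lborel_singleton[of t]
      proof eventually_elim
        fix s :: real assume st: "s \<noteq> t"
        have x': "(\<lambda>n. x (n + n0)) \<longlonglongrightarrow> t" using x by (rule LIMSEQ_ignore_initial_segment)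
        have gl: "(\<lambda>n. g (x (n + n0) - s)) \<longlonglongrightarrow> g (t - s)"
          by (rule isCont_tendsto_compose[of _ g])
            (use g x' in \<open>auto simp: continuous_on_eq_continuous_at intro!: tendsto_intros\<close>)
        have "(\<lambda>n. indicator {0<..<x (n + n0)} s :: real) \<longlonglongrightarrow> indicator {0<..<t} s"
        proof (rule tendsto_eventually)
          show "\<forall>\<^sub>F n in sequentially. indicat_real {0<..<x (n + n0)} s = indicat_real {0<..<t} s"
          proof (cases "s < t")
            case True
            with x' have "\<forall>\<^sub>F n in sequentially. s < x (n + n0)" by (rule order_tendstoD)
            then show ?thesis by eventually_elim (use True in \<open>auto simp: indicator_def\<close>)
          next
            case False
            with st x' have "\<forall>\<^sub>F n in sequentially. x (n + n0) < s" by (intro order_tendstoD) auto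
            then show ?thesis by eventually_elim (use False in \<open>auto simp: indicator_def\<close>)
          qed
        qed
        then show "(\<lambda>n. indicator {0<..<x (n + n0)} s * (u s * g (x (n + n0) - s))) \<longlonglongrightarrow> indicator {0<..<t} s * (u s * g (t - s))"
          by (intro tendsto_intros gl)
      qed
      show "AE s in lborel. norm (indicator {0<..<x (n + n0)} s * (u s * g (x (n + n0) - s))) \<le> B * norm (indicator {0<..<b} s * u s)" for n
      proof (rule AE_I2)
        fix s
        show "norm (indicator {0<..<x (n + n0)} s * (u s * g (x (n + n0) - s))) \<le> B * norm (indicator {0<..<b} s * u s)"
        proof (cases "0 < s \<and> s < x (n + n0)")
          case True
          then have "\<bar>g (x (n + n0) - s)\<bar> \<le> B" using n0[of "n + n0"] by (intro B) auto
          from mult_left_mono[OF this, of "\<bar>u s\<bar>"] show ?thesis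
            using True n0[of "n + n0"] by (simp add: abs_mult mult.commute)
        next
          case False
          have "B \<ge> 0" using B[of 0] by (auto simp: b_def intro: order_trans[OF abs_ge_zero])
          with False show ?thesis by (auto simp: indicator_def)
        qed
      qed
    qed measurable
    then show ?thesis by (rule LIMSEQ_offset)
  qed
  then show ?thesis by (auto simp: continuous_at_sequentially o_def)
qed

lemma conv0_rl1:
  assumes g: "continuous_on UNIV g" and "0 \<le> t"
  shows "conv0 (rl_kernel 1) g t = integral {0..t} g"
proof -
  have "integrable lborel (\<lambda>s. indicator {0..t} s *\<^sub>R g s)"
    by (intro borel_integrable_compact continuous_on_subset[OF g]) auto
  then have si: "set_integrable lborel {0..t} g" by (simp add: set_integrable_def)
  have "conv0 (rl_kernel 1) g t = (LINT s|lborel. indicator {0..t} s *\<^sub>R g s)"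
    unfolding conv0_def
  proof (rule integral_cong_AE)
    have [measurable]: "g \<in> borel_measurable borel" using g by (rule borel_measurable_continuous_onI)
    show "(\<lambda>s. indicator {0<..<t} s * (rl_kernel 1 (t - s) * g s)) \<in> borel_measurable lborel"
      "(\<lambda>s. indicator {0..t} s *\<^sub>R g s) \<in> borel_measurable lborel" by measurable
    show "AE s in lborel. indicator {0<..<t} s * (rl_kernel 1 (t - s) * g s) = indicator {0..t} s *\<^sub>R g s"
      using AE_lborel_singleton[of 0] AE_lborel_singleton[of t]
      by eventually_elim (auto simp: indicator_def rl_kernel_def)
  qed
  also have "\<dots> = integral {0..t} g"
    using set_borel_integral_eq_integral(2)[OF si] by (simp add: set_lebesgue_integral_def)
  finally show ?thesis .
qed

lemma rl_kernel_integrable: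
  assumes "0 < \<beta>" "0 < t" shows "integrable lborel (\<lambda>s. indicator {0<..<t} s * rl_kernel \<beta> s)"
proof -
  have "integrable lborel (\<lambda>s. indicator {0<..<t} s * (rl_kernel 1 (t - s) * rl_kernel \<beta> s))"
    by (rule integrable.intros[OF rl_kernel_conv_integral]) (use assms in auto)
  also have "(\<lambda>s. indicator {0<..<t} s * (rl_kernel 1 (t - s) * rl_kernel \<beta> s)) = (\<lambda>s. indicator {0<..<t} s * rl_kernel \<beta> s)"
    by (auto simp: fun_eq_iff indicator_def rl_kernel_def)
  finally show ?thesis .
qed

text \<open>Convolving the equation with E and using \<open>nnconv_caputo\<close> turns it into 1 *
  c = 1 * (E * f), and differentiation gives c = E * f. The hypothesis is the fractional equation
  integrated once in time, a form that makes sense for merely continuous c.\<close>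

lemma volterra_mlk:
  assumes \<alpha>: "0 < \<alpha>" "\<alpha> < 1" and \<mu>: "0 \<le> \<mu>"
    and c: "continuous_on UNIV c" and f: "continuous_on UNIV f"
    and eq: "\<And>t. 0 < t \<Longrightarrow> t \<le> T \<Longrightarrow> conv0 (rl_kernel (1 - \<alpha>)) c t = conv0 (rl_kernel 1) (\<lambda>s. f s - \<mu> * c s) t"
    and t: "0 < t" "t \<le> T"
  shows "c t = conv0 (ml_kernel \<alpha> \<mu>) f t"
proof -
  let ?k = "rl_kernel (1 - \<alpha>)" and ?o = "rl_kernel 1" and ?e = "ml_kernel \<alpha> \<mu>"
  define pc where "pc s = max 0 (c s)" for s
  define qc where "qc s = max 0 (- c s)" for s
  define pf where "pf s = max 0 (f s)" for s
  define qf where "qf s = max 0 (- f s)" for s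
  have cont: "continuous_on UNIV pc" "continuous_on UNIV qc" "continuous_on UNIV pf" "continuous_on UNIV qf"
    unfolding pc_def[abs_def] qc_def[abs_def] pf_def[abs_def] qf_def[abs_def] by (intro continuous_intros c f)+
  define H where "H = {pc, qc, pf, qf}"
  have Hc: "continuous_on UNIV h" if "h \<in> H" for h using that cont by (auto simp: H_def)
  have Hm: "h \<in> borel_measurable borel" if "h \<in> H" for h using Hc[OF that] by (rule borel_measurable_continuous_onI)
  have Hn: "0 \<le> h s" if "h \<in> H" for h s using that by (auto simp: H_def pc_def qc_def pf_def qf_def)
  have bnd: "\<exists>B. \<forall>s. 0 < s \<and> s < x \<longrightarrow> \<bar>h s\<bar> \<le> B" if "continuous_on UNIV h" for h :: "real \<Rightarrow> real" and x
  proof -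
    have "bounded (h ` {0..x})" by (intro compact_imp_bounded compact_continuous_image continuous_on_subset[OF that]) auto
    then show ?thesis by (auto simp: bounded_iff) (meson atLeastAtMost_iff less_imp_le)
  qed
  define U where "U = {?k, ?o, ?e}"
  have Um: "u \<in> borel_measurable borel" if "u \<in> U" for u
    using that ml_kernel_measurable[OF \<alpha>(1)] by (auto simp: U_def)
  have Ui: "integrable lborel (\<lambda>s. indicator {0<..<x} s * u s)" if "u \<in> U" "0 < x" for u x
    using that rl_kernel_integrable[of "1 - \<alpha>" x] rl_kernel_integrable[of 1 x] ml_kernel_integrable[OF \<alpha> \<mu>, of x] \<alpha> by (auto simp: U_def)
  have Un: "0 \<le> u s" if "u \<in> U" "0 < s" for u s
    using that rl_kernel_nonneg[of "1 - \<alpha>" s] rl_kernel_nonneg[of 1 s] ml_kernel_pos[OF \<alpha> \<mu>, of s] \<alpha> by (auto simp: U_def)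
  have int: "integrable lborel (\<lambda>s. indicator {0<..<x} s * (u (x - s) * h s))"
    if "u \<in> U" "continuous_on UNIV h" "0 < x" for u h x
    using bnd[OF that(2), of x] conv0_integrable[OF Um[OF that(1)] borel_measurable_continuous_onI[OF that(2)] Ui[OF that(1,3)]]
    by blast
  have nnr: "nnconv (pos u) (pos h) x = ennreal (conv0 u h x)" "0 \<le> conv0 u h x"
    if hyp: "u \<in> U" "continuous_on UNIV h" "\<And>s. 0 \<le> h s" "0 < x" for u h x
  proof -
    obtain B where B: "\<And>s. 0 < s \<Longrightarrow> s < x \<Longrightarrow> \<bar>h s\<bar> \<le> B" using bnd[OF hyp(2), of x] by blast
    show "nnconv (pos u) (pos h) x = ennreal (conv0 u h x)" "0 \<le> conv0 u h x"
      using nnconv_rconv[OF Um[OF hyp(1)] borel_measurable_continuous_onI[OF hyp(2)] Ui[OF hyp(1,4)] Un[OF hyp(1)] hyp(3), of B]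
        B abs_le_D1 by blast+
  qed
  have nnH: "nnconv (pos u) (pos h) x = ennreal (conv0 u h x)" "0 \<le> conv0 u h x"
    if "u \<in> U" "h \<in> H" "0 < x" for u h x
    using nnr[OF that(1) Hc[OF that(2)] Hn[OF that(2)] that(3)] by auto
  have lin: "conv0 u (\<lambda>s. a * g s + b * h s) x = a * conv0 u g x + b * conv0 u h x"
    if "u \<in> U" "continuous_on UNIV g" "continuous_on UNIV h" "0 < x" for u g h x a b
  proof -
    have "a * conv0 u g x + b * conv0 u h x = (LINT s|lborel. a * (indicator {0<..<x} s * (u (x - s) * g s)) + b * (indicator {0<..<x} s * (u (x - s) * h s)))"
      unfolding conv0_def using int[OF that(1,2,4)] int[OF that(1,3,4)] by simp
    also have "\<dots> = conv0 u (\<lambda>s. a * g s + b * h s) x"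
      unfolding conv0_def by (rule Bochner_Integration.integral_cong) (auto simp: algebra_simps)
    finally show ?thesis by simp
  qed
  have split: "c = (\<lambda>s. 1 * pc s + (-1) * qc s)" "f = (\<lambda>s. 1 * pf s + (-1) * qf s)"
    by (auto simp: fun_eq_iff pc_def qc_def pf_def qf_def)
  have Uin: "?k \<in> U" "?o \<in> U" "?e \<in> U" and Hin: "pc \<in> H" "qc \<in> H" "pf \<in> H" "qf \<in> H" by (auto simp: U_def H_def)
  have cdiff: "conv0 u c x = conv0 u pc x - conv0 u qc x" "conv0 u f x = conv0 u pf x - conv0 u qf x"
    if "u \<in> U" "0 < x" for u x
    using lin[OF that(1) cont(1,2) that(2), of 1 "-1"] lin[OF that(1) cont(3,4) that(2), of 1 "-1"] split by simp_all
  let ?K = "pos ?k" and ?O = "pos ?o" and ?E = "pos ?e"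
  \<comment> \<open>A and A' are the two sides of the equation after every term with a negative sign
    has been moved across, so that only nonnegative functions are convolved from here on.\<close>
  define A where "A x = nnconv ?K (pos pc) x + (nnconv ?O (pos qf) x + ennreal \<mu> * nnconv ?O (pos pc) x)" for x
  define A' where "A' x = nnconv ?K (pos qc) x + (nnconv ?O (pos pf) x + ennreal \<mu> * nnconv ?O (pos qc) x)" for x
  have causU: "causal (pos u)" if "u \<in> U" for u using Um[OF that] by (rule causal_pos)
  have causH: "causal (pos h)" if "h \<in> H" for h using Hm[OF that] by (rule causal_pos)
  have measU: "pos u \<in> borel_measurable borel" if "u \<in> U" for u using causU[OF that] by (simp add: causal_def)
  have measH: "pos u \<in> borel_measurable borel" if "u \<in> H" for u using causH[OF that] by (simp add: causal_def)
  note [measurable] = measU[OF Uin(1)] measU[OF Uin(2)] measU[OF Uin(3)]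
    measH[OF Hin(1)] measH[OF Hin(2)] measH[OF Hin(3)] measH[OF Hin(4)]
  have AA': "A x = A' x" if x: "0 < x" "x \<le> T" for x
  proof -
    have "conv0 ?o (\<lambda>s. f s - \<mu> * c s) x = conv0 ?o f x - \<mu> * conv0 ?o c x"
      using lin[OF Uin(2) f c x(1), of 1 "- \<mu>"] by simp
    with eq[OF x] have "conv0 ?k pc x + (conv0 ?o qf x + \<mu> * conv0 ?o pc x) = conv0 ?k qc x + (conv0 ?o pf x + \<mu> * conv0 ?o qc x)"
      unfolding cdiff[OF Uin(1) x(1)] cdiff[OF Uin(2) x(1)] by (simp add: algebra_simps)
    moreover have "A x = ennreal (conv0 ?k pc x + (conv0 ?o qf x + \<mu> * conv0 ?o pc x))"
      unfolding A_def using nnH[OF _ _ x(1)] Uin Hin \<mu> by (simp add: ennreal_mult)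
    moreover have "A' x = ennreal (conv0 ?k qc x + (conv0 ?o pf x + \<mu> * conv0 ?o qc x))"
      unfolding A'_def using nnH[OF _ _ x(1)] Uin Hin \<mu> by (simp add: ennreal_mult)
    ultimately show ?thesis by simp
  qed
  have causA: "causal A" "causal A'"
    using causal_nnconv[OF causU causH] Uin Hin unfolding A_def[abs_def] A'_def[abs_def] causal_def by auto
  \<comment> \<open>This identity removes the fractional kernel once the equation has been convolved
    with E.\<close>
  have O: "(\<lambda>x. nnconv ?E ?K x + ennreal \<mu> * nnconv ?E ?O x) = ?O"
  proof
    fix x :: real
    show "nnconv ?E ?K x + ennreal \<mu> * nnconv ?E ?O x = ?O x"
    proof (cases "0 < x")
      case True
      then show ?thesis using nnconv_caputo[OF \<alpha> \<mu> True]
        by (simp add: nnconv_commute[of ?E] pos_def[of "rl_kernel 1" x] rl_kernel_def)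
    next
      case False
      then show ?thesis
        using causalD(2)[OF causal_nnconv[OF causU[OF Uin(3)] causU[OF Uin(1)]], of x]
          causalD(2)[OF causal_nnconv[OF causU[OF Uin(3)] causU[OF Uin(2)]], of x]
        by (simp add: pos_def[of "rl_kernel 1" x])
    qed
  qed
  have EA: "nnconv ?E (\<lambda>x. nnconv ?K P x + (nnconv ?O Q x + ennreal \<mu> * nnconv ?O P x)) x
      = nnconv ?O P x + nnconv ?O (nnconv ?E Q) x"
    if [measurable]: "P \<in> borel_measurable borel" "Q \<in> borel_measurable borel" for P Q x
  proof -
    have "nnconv ?E (\<lambda>x. nnconv ?K P x + (nnconv ?O Q x + ennreal \<mu> * nnconv ?O P x)) x
      = nnconv (nnconv ?E ?K) P x + (nnconv ?E (nnconv ?O Q) x + ennreal \<mu> * nnconv (nnconv ?E ?O) P x)"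
      by (simp add: nnconv_add_right nnconv_cmult_right nnconv_assoc)
    also have "\<dots> = nnconv (\<lambda>x. nnconv ?E ?K x + ennreal \<mu> * nnconv ?E ?O x) P x + nnconv ?E (nnconv ?O Q) x"
      by (simp add: nnconv_add_left nnconv_cmult_left ac_simps)
    also have "nnconv ?E (nnconv ?O Q) = nnconv ?O (nnconv ?E Q)"
      by (simp add: nnconv_assoc[symmetric] nnconv_commute[of ?E ?O])
    finally show ?thesis unfolding O .
  qed
  define wp where "wp = conv0 ?e pf"
  define wq where "wq = conv0 ?e qf"
  have wcont: "continuous_on UNIV wp" "continuous_on UNIV wq"
    unfolding wp_def wq_def continuous_on_eq_continuous_at[OF open_UNIV]
    using conv0_isCont[OF Um[OF Uin(3)] Ui[OF Uin(3)] cont(3)] conv0_isCont[OF Um[OF Uin(3)] Ui[OF Uin(3)] cont(4)] by auto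
  have wnn: "0 \<le> wp s" "0 \<le> wq s" for s
    using nnr(2)[OF Uin(3) Hc[OF Hin(3)] Hn[OF Hin(3)], of s] nnr(2)[OF Uin(3) Hc[OF Hin(4)] Hn[OF Hin(4)], of s]
    by (cases "0 < s"; simp add: wp_def wq_def conv0_def)+
  have wpos: "nnconv ?E (pos pf) = pos wp" "nnconv ?E (pos qf) = pos wq"
  proof -
    have "nnconv ?E (pos h) x = pos (conv0 ?e h) x" if "h \<in> H" for h x
      using nnr(1)[OF Uin(3) Hc[OF that] Hn[OF that], of x] causalD(2)[OF causal_nnconv[OF causU[OF Uin(3)] causH[OF that]], of x]
      by (cases "0 < x") (auto simp: pos_def[of "conv0 _ _"])
    then show "nnconv ?E (pos pf) = pos wp" "nnconv ?E (pos qf) = pos wq"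
      using Hin by (auto simp: wp_def wq_def)
  qed
  define D where "D s = (pc s - qc s) - (wp s - wq s)" for s
  have Dc: "continuous_on UNIV D" unfolding D_def[abs_def] by (intro continuous_intros cont wcont)
  have D0: "integral {0..x} D = 0" if x: "0 \<le> x" "x \<le> T" for x
  proof (cases "x = 0")
    case False
    then have x0: "0 < x" using x by simp
    have "nnconv ?E A x = nnconv ?E A' x"
      by (rule nnconv_cong) (use causU[OF Uin(3)] causA AA' x in auto)
    then have "nnconv ?O (pos pc) x + nnconv ?O (pos wq) x = nnconv ?O (pos qc) x + nnconv ?O (pos wp) x"
      unfolding A_def[abs_def] A'_def[abs_def] by (simp add: EA wpos)
    then have "conv0 ?o pc x + conv0 ?o wq x = conv0 ?o qc x + conv0 ?o wp x"
      using nnr[OF Uin(2) cont(1) Hn[OF Hin(1)] x0] nnr[OF Uin(2) cont(2) Hn[OF Hin(2)] x0]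
        nnr[OF Uin(2) wcont(1) wnn(1) x0] nnr[OF Uin(2) wcont(2) wnn(2) x0]
      by (simp flip: ennreal_plus)
    moreover have "conv0 ?o D x = (conv0 ?o pc x - conv0 ?o qc x) - (conv0 ?o wp x - conv0 ?o wq x)"
    proof -
      have "conv0 ?o D x = conv0 ?o (\<lambda>s. 1 * (1 * pc s + (-1) * qc s) + (-1) * (1 * wp s + (-1) * wq s)) x"
        by (simp add: D_def[abs_def] algebra_simps)
      also have "\<dots> = (conv0 ?o pc x - conv0 ?o qc x) - (conv0 ?o wp x - conv0 ?o wq x)"
        by (subst lin[OF Uin(2) _ _ x0], (intro continuous_intros cont wcont)+,
          subst lin[OF Uin(2) cont(1,2) x0], subst lin[OF Uin(2) wcont x0]) simp
      finally show ?thesis .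
    qed
    ultimately show ?thesis using conv0_rl1[OF Dc x(1)] by simp
  qed simp
  have T: "0 < T" using t by simp
  \<comment> \<open>The primitive of the continuous function D vanishes on [0,T], hence so does D.
    Differentiation within [0,T] includes the case t = T.\<close>
  have "((\<lambda>x. integral {0..x} D) has_vector_derivative D t) (at t within {0..T})"
    by (rule integral_has_vector_derivative[OF continuous_on_subset[OF Dc]]) (use t in auto)
  then have "((\<lambda>x. 0) has_vector_derivative D t) (at t within {0..T})"
    by (rule has_vector_derivative_transform[rotated 2]) (use t D0 in auto)
  moreover have "((\<lambda>x. 0) has_vector_derivative (0::real)) (at t within {0..T})" by simp
  ultimately have "D t = 0"
    using vector_derivative_unique_within_closed_interval[of 0 T t "\<lambda>x. 0" "D t" 0] t T by simp
  then show ?thesis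
    using cdiff(2)[OF Uin(3) t(1)] split(1) by (simp add: D_def wp_def wq_def fun_eq_iff)
qed

section \<open>Convolution sums and discrete resolvents\<close>

text \<open>The term \<open>i = 0\<close> vanishes, because \<open>0 powr a = 0\<close>.\<close>

definition zeta_sum :: "real \<Rightarrow> real" where
  "zeta_sum q = (\<Sum>i. real i powr (- q))"

lemma zeta_sum_bound:
  assumes "1 < q" "finite A"
  shows "(\<Sum>i\<in>A. real i powr (- q)) \<le> zeta_sum q"
  unfolding zeta_sum_def using assms by (intro sum_le_suminf) (auto simp: summable_real_powr_iff)

lemma zeta_sum_nonneg: "1 < q \<Longrightarrow> 0 \<le> zeta_sum q"
  using zeta_sum_bound[of q "{}"] by simp

text \<open>One of i and m + 1 - i is at least half of m + 1. If it is i, then i^(-q) is split into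
  i^(-q') and i^(-(q-q')), and in the second factor i is replaced by the smaller m + 1 - i. In both
  cases a summable power with exponent q > 1 remains, so the slower decay q' survives.\<close>

lemma sum_powr_conv:
  assumes q: "1 < q" "0 \<le> q'" "q' \<le> q"
  shows "(\<Sum>i=1..m. real i powr (- q) * real (m + 1 - i) powr (- q')) \<le> 2 * 2 powr q' * zeta_sum q * real (m + 1) powr (- q')"
proof -
  define M where "M = real (m + 1)"
  have M: "M > 0" by (simp add: M_def)
  have half: "x powr (- q') \<le> 2 powr q' * M powr (- q')" if "M / 2 \<le> x" for x
  proof -
    have "x powr (- q') \<le> (M / 2) powr (- q')" using that M q by (intro powr_mono2') auto
    also have "\<dots> = 2 powr q' * M powr (- q')" using M by (simp add: powr_divide powr_minus field_simps)
    finally show ?thesis .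
  qed
  have tm: "real i powr (- q) * real (m + 1 - i) powr (- q') \<le> 2 powr q' * M powr (- q') * (real i powr (- q) + real (m + 1 - i) powr (- q))"
    if i: "i \<in> {1..m}" for i
  proof (cases "M / 2 \<le> real (m + 1 - i)")
    case True
    have "real i powr (- q) * real (m + 1 - i) powr (- q') \<le> real i powr (- q) * (2 powr q' * M powr (- q'))"
      by (intro mult_left_mono half True) auto
    also have "\<dots> \<le> 2 powr q' * M powr (- q') * (real i powr (- q) + real (m + 1 - i) powr (- q))"
      by (simp add: distrib_left mult.commute)
    finally show ?thesis .
  next
    case False
    let ?y = "real (m + 1 - i)"
    have y: "1 \<le> ?y" "real i + ?y = M" using i by (auto simp: M_def)
    then have le: "M / 2 \<le> real i" "?y \<le> real i" using False by auto
    have "real i powr (- q) = real i powr (- q') * real i powr (- (q - q'))"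
      using i by (simp add: powr_add[symmetric])
    also have "\<dots> \<le> (2 powr q' * M powr (- q')) * ?y powr (- (q - q'))"
      using q y le by (intro mult_mono half powr_mono2') auto
    finally have "real i powr (- q) * ?y powr (- q') \<le> (2 powr q' * M powr (- q')) * ?y powr (- (q - q')) * ?y powr (- q')"
      by (intro mult_right_mono) auto
    also have "\<dots> = 2 powr q' * M powr (- q') * ?y powr (- q)"
      using y by (simp add: mult.assoc powr_add[symmetric])
    also have "\<dots> \<le> 2 powr q' * M powr (- q') * (real i powr (- q) + ?y powr (- q))"
      by (intro mult_left_mono) auto
    finally show ?thesis .
  qed
  have "(\<Sum>i=1..m. real i powr (- q) * real (m + 1 - i) powr (- q')) \<le> (\<Sum>i=1..m. 2 powr q' * M powr (- q') * (real i powr (- q) + real (m + 1 - i) powr (- q)))"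
    by (rule sum_mono) (rule tm)
  also have "\<dots> = 2 powr q' * M powr (- q') * ((\<Sum>i=1..m. real i powr (- q)) + (\<Sum>i=1..m. real (m + 1 - i) powr (- q)))"
    by (simp only: sum_distrib_left[symmetric] sum.distrib)
  also have "(\<Sum>i=1..m. real (m + 1 - i) powr (- q)) = (\<Sum>i=1..m. real i powr (- q))"
    by (rule sum.reindex_bij_witness[of _ "\<lambda>i. m + 1 - i" "\<lambda>i. m + 1 - i"]) auto
  also have "2 powr q' * M powr (- q') * ((\<Sum>i=1..m. real i powr (- q)) + (\<Sum>i=1..m. real i powr (- q)))
      \<le> 2 powr q' * M powr (- q') * (zeta_sum q + zeta_sum q)"
    by (intro mult_left_mono add_mono zeta_sum_bound q) auto
  finally show ?thesis by (simp add: M_def mult_ac)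
qed

text \<open>Up to sign the left side is the covariance of g and h under the uniform distribution on
  the cell, which does not change when kappa and kappa' are subtracted. One factor may thus be
  merely integrable as long as the other oscillates little.\<close>

lemma covariance_bound:
  fixes g h :: "real \<Rightarrow> real" and a \<kappa> \<kappa>' G :: real
  defines "I \<equiv> \<lambda>f. LINT s|lborel. indicator {a<..<a+1} s * f s"
  assumes g: "integrable lborel (\<lambda>s. indicator {a<..<a+1} s * g s)"
    and h: "integrable lborel (\<lambda>s. indicator {a<..<a+1} s * h s)"
    and gh: "integrable lborel (\<lambda>s. indicator {a<..<a+1} s * (g s * h s))"
    and G: "\<And>s. a < s \<Longrightarrow> s < a + 1 \<Longrightarrow> \<bar>g s - \<kappa>\<bar> \<le> G"
  shows "\<bar>I g * I h - I (\<lambda>s. g s * h s)\<bar> \<le> 2 * G * I (\<lambda>s. \<bar>h s - \<kappa>'\<bar>)"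
proof -
  let ?i = "indicator {a<..<a+1} :: real \<Rightarrow> real"
  have c: "integrable lborel (\<lambda>s. ?i s * \<kappa>)" "integrable lborel (\<lambda>s. ?i s * c)" for c :: real by auto
  have I1: "I (\<lambda>s. c) = c" for c by (simp add: I_def)
  have ig: "integrable lborel (\<lambda>s. ?i s * (g s - \<kappa>))"
    using Bochner_Integration.integrable_diff[OF g c(1)] by (simp add: algebra_simps)
  have ih: "integrable lborel (\<lambda>s. ?i s * (h s - \<kappa>'))"
    using Bochner_Integration.integrable_diff[OF h c(2)[of \<kappa>']] by (simp add: algebra_simps)
  have ih': "integrable lborel (\<lambda>s. ?i s * \<bar>h s - \<kappa>'\<bar>)"
    using integrable_norm[OF ih] by (simp add: abs_mult)
  have igh: "integrable lborel (\<lambda>s. ?i s * ((g s - \<kappa>) * (h s - \<kappa>')))"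
  proof -
    have "integrable lborel (\<lambda>s. ?i s * (g s * h s) - \<kappa>' * (?i s * g s) - \<kappa> * (?i s * h s) + \<kappa> * \<kappa>' * (?i s * 1))"
      by (intro Bochner_Integration.integrable_add Bochner_Integration.integrable_diff integrable_mult_right g h gh c(2))
    then show ?thesis by (simp add: algebra_simps)
  qed
  have Ig: "I (\<lambda>s. g s - \<kappa>) = I g - \<kappa>" and Ih: "I (\<lambda>s. h s - \<kappa>') = I h - \<kappa>'"
    using I1[of \<kappa>] I1[of \<kappa>'] g h c unfolding I_def by (simp_all add: right_diff_distrib)
  have "I (\<lambda>s. (g s - \<kappa>) * (h s - \<kappa>')) = (LINT s|lborel. ?i s * (g s * h s) - \<kappa>' * (?i s * g s) - \<kappa> * (?i s * h s) + \<kappa> * \<kappa>' * (?i s * 1))"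
    unfolding I_def by (rule Bochner_Integration.integral_cong) (auto simp: algebra_simps)
  also have "\<dots> = I (\<lambda>s. g s * h s) - \<kappa>' * I g - \<kappa> * I h + \<kappa> * \<kappa>' * I (\<lambda>s. 1)"
    unfolding I_def using g h gh c by (simp add: integrable_mult_right)
  finally have eq: "I g * I h - I (\<lambda>s. g s * h s) = I (\<lambda>s. g s - \<kappa>) * I (\<lambda>s. h s - \<kappa>') - I (\<lambda>s. (g s - \<kappa>) * (h s - \<kappa>'))"
    unfolding Ig Ih I1 by (simp add: algebra_simps)
  have G0: "0 \<le> G" using G[of "a + 1/2"] by simp
  have b1: "\<bar>I (\<lambda>s. g s - \<kappa>)\<bar> \<le> G"
  proof -
    have "\<bar>I (\<lambda>s. g s - \<kappa>)\<bar> \<le> (LINT s|lborel. norm (?i s * (g s - \<kappa>)))"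
      unfolding I_def using integral_norm_bound[of lborel "\<lambda>s. ?i s * (g s - \<kappa>)"] by simp
    also have "\<dots> \<le> I (\<lambda>s. G)"
      unfolding I_def by (rule integral_mono[OF integrable_norm[OF ig] c(2)]) (auto simp: indicator_def G)
    finally show ?thesis by (simp add: I1)
  qed
  have b2: "\<bar>I (\<lambda>s. h s - \<kappa>')\<bar> \<le> I (\<lambda>s. \<bar>h s - \<kappa>'\<bar>)"
    unfolding I_def using integral_norm_bound[of lborel "\<lambda>s. ?i s * (h s - \<kappa>')"] by (simp add: abs_mult)
  have b3: "\<bar>I (\<lambda>s. (g s - \<kappa>) * (h s - \<kappa>'))\<bar> \<le> G * I (\<lambda>s. \<bar>h s - \<kappa>'\<bar>)"
  proof -
    have "\<bar>I (\<lambda>s. (g s - \<kappa>) * (h s - \<kappa>'))\<bar> \<le> (LINT s|lborel. norm (?i s * ((g s - \<kappa>) * (h s - \<kappa>'))))"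
      unfolding I_def using integral_norm_bound[of lborel "\<lambda>s. ?i s * ((g s - \<kappa>) * (h s - \<kappa>'))"] by simp
    also have "\<dots> \<le> (LINT s|lborel. G * (?i s * \<bar>h s - \<kappa>'\<bar>))"
      by (rule integral_mono[OF integrable_norm[OF igh] integrable_mult_right[OF ih']])
         (auto simp: indicator_def abs_mult intro!: mult_right_mono G)
    finally show ?thesis by (simp add: I_def)
  qed
  have "\<bar>I (\<lambda>s. g s - \<kappa>) * I (\<lambda>s. h s - \<kappa>')\<bar> \<le> G * I (\<lambda>s. \<bar>h s - \<kappa>'\<bar>)"
    unfolding abs_mult using b1 b2 G0 by (intro mult_mono) auto
  then show ?thesis unfolding eq using b3 by linarith
qed

section \<open>Reciprocal power series and discrete resolvents\<close>

text \<open>Kaluza's theorem on reciprocals of log-convex power series, in terms of coefficients.\<close>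

lemma kaluza:
  fixes a c :: "nat \<Rightarrow> real"
  assumes a: "\<And>n. 0 < a n" and lc: "\<And>n. a (Suc n) * a (Suc n) \<le> a n * a (Suc (Suc n))"
    and c: "\<And>n. (\<Sum>j\<le>n. c j * a (n - j)) = (if n = 0 then 1 else 0)"
  shows "0 < n \<Longrightarrow> c n \<le> 0"
proof (induction n rule: less_induct)
  case (less n)
  obtain m where n: "n = Suc m" using less.prems by (cases n) auto
  have mono: "a (Suc i) / a i \<le> a (Suc j) / a j" if "i \<le> j" for i j
    using that
  proof (induction rule: dec_induct)
    case (step j)
    have "a (Suc j) / a j \<le> a (Suc (Suc j)) / a (Suc j)" using lc[of j] a[of j] a[of "Suc j"] by (simp add: field_simps)
    with step show ?case by simp
  qed simp
  show ?case
  proof (cases "m = 0")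
    case True
    have "c 0 * a 0 = 1" using c[of 0] by simp
    then have "0 < c 0" using a[of 0] by (metis zero_less_mult_pos2 zero_less_one)
    moreover have "c 0 * a 1 + c 1 * a 0 = 0" using c[of 1] by simp
    moreover have "0 < c 0 * a 1" using \<open>0 < c 0\<close> a by simp
    ultimately have "c 1 * a 0 < 0" by linarith
    then show ?thesis using n True a[of 0] by (simp add: mult_less_0_iff not_less less_imp_le)
  next
    case False
    have 1: "(\<Sum>j\<le>m. c j * a (m - j)) = 0" using c[of m] False by simp
    have 2: "(\<Sum>j\<le>m. c j * a (Suc m - j)) + c (Suc m) * a 0 = 0" using c[of "Suc m"] by simp
    \<comment> \<open>Subtracting the identity of order m with factor a (m+1) / a m cancels the term
      j = 0, the only one whose coefficient is positive; the others have a sign by induction and by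
      the monotone quotients.\<close>
    have "c (Suc m) * a 0 = (a (Suc m) / a m) * (\<Sum>j\<le>m. c j * a (m - j)) - (\<Sum>j\<le>m. c j * a (Suc m - j))"
      using 1 2 by simp
    also have "\<dots> = (\<Sum>j\<le>m. c j * (a (m - j) * (a (Suc m) / a m) - a (Suc m - j)))"
      by (simp add: sum_distrib_left sum_subtractf[symmetric] algebra_simps)
    also have "\<dots> \<le> 0"
    proof (rule sum_nonpos)
      fix j assume j: "j \<in> {..m}"
      show "c j * (a (m - j) * (a (Suc m) / a m) - a (Suc m - j)) \<le> 0"
      proof (cases "j = 0")
        case True
        then show ?thesis using a[of m] by (simp add: field_simps)
      next
        case False
        have "a (Suc m - j) = a (m - j) * (a (Suc (m - j)) / a (m - j))"
          using a[of "m - j"] j by (simp add: Suc_diff_le)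
        also have "\<dots> \<le> a (m - j) * (a (Suc m) / a m)"
          using a[of "m - j"] by (intro mult_left_mono mono) auto
        finally show ?thesis using less.IH[of j] False j n by (intro mult_nonpos_nonneg) auto
      qed
    qed
    finally show ?thesis using n a[of 0] by (simp add: mult_le_0_iff not_less less_imp_le)
  qed
qed

text \<open>The discrete resolvent has the generating function \<open>1 / (\<beta>(\<zeta>) + \<mu>)\<close>, so \<open>resolvent_sum\<close> is the discrete counterpart of \<open>ml_primitive\<close>.\<close>

definition discrete_resolvent :: "(nat \<Rightarrow> real) \<Rightarrow> real \<Rightarrow> nat \<Rightarrow> real" where
  "discrete_resolvent \<beta> \<mu> n = fps_nth (inverse (Abs_fps \<beta> + fps_const \<mu>)) n"

text \<open>The coefficients of \<beta>(\<zeta>) / (1 - \<zeta>). As the weights are differences of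
  these numbers, they play the role of the kernel of order 1 - alpha in front of the time
  derivative.\<close>

definition weight_sum :: "(nat \<Rightarrow> real) \<Rightarrow> nat \<Rightarrow> real" where
  "weight_sum \<beta> n = (\<Sum>j\<le>n. \<beta> j)"

definition resolvent_sum :: "(nat \<Rightarrow> real) \<Rightarrow> real \<Rightarrow> nat \<Rightarrow> real" where
  "resolvent_sum \<beta> \<mu> n = (\<Sum>j<n. discrete_resolvent \<beta> \<mu> j)"

context
  fixes \<beta> :: "nat \<Rightarrow> real" and \<mu> :: real
  assumes \<beta>0: "0 < \<beta> 0" and \<mu>: "0 \<le> \<mu>"
begin

lemma fps_dker: "(Abs_fps \<beta> + fps_const \<mu>) * Abs_fps (discrete_resolvent \<beta> \<mu>) = 1"
proof -
  have "Abs_fps (discrete_resolvent \<beta> \<mu>) = inverse (Abs_fps \<beta> + fps_const \<mu>)"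
    by (simp add: fps_eq_iff discrete_resolvent_def)
  moreover have "fps_nth (Abs_fps \<beta> + fps_const \<mu>) 0 \<noteq> 0" using \<beta>0 \<mu> by simp
  ultimately show ?thesis by (simp add: inverse_mult_eq_1')
qed

lemma fps_bsum: "(1 - fps_X) * Abs_fps (\<lambda>n. weight_sum \<beta> n + \<mu>) = Abs_fps \<beta> + fps_const \<mu>"
proof (rule fps_ext)
  fix n
  show "fps_nth ((1 - fps_X) * Abs_fps (\<lambda>n. weight_sum \<beta> n + \<mu>)) n = fps_nth (Abs_fps \<beta> + fps_const \<mu>) n"
    by (cases n) (simp_all add: left_diff_distrib weight_sum_def)
qed

text \<open>The discrete counterpart of \<open>ml_kernel_caputo\<close>: the defining equation of
  the resolvent, divided by 1 - \<zeta>.\<close>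

lemma discrete_resolvent_bsum: "(\<Sum>j\<le>n. discrete_resolvent \<beta> \<mu> j * (weight_sum \<beta> (n - j) + \<mu>)) = 1"
proof -
  have "(1 - fps_X) * (Abs_fps (discrete_resolvent \<beta> \<mu>) * Abs_fps (\<lambda>n. weight_sum \<beta> n + \<mu>)) = 1"
    using fps_dker unfolding fps_bsum[symmetric] by (simp add: ac_simps)
  moreover have "(1 - fps_X) * Abs_fps (\<lambda>n. 1::real) = 1"
    by (rule fps_ext) (case_tac n; simp add: left_diff_distrib)
  ultimately have "(1 - fps_X) * (Abs_fps (discrete_resolvent \<beta> \<mu>) * Abs_fps (\<lambda>n. weight_sum \<beta> n + \<mu>)) = (1 - fps_X) * Abs_fps (\<lambda>n. 1::real)"
    by simp
  moreover have "(1 - fps_X :: real fps) \<noteq> 0"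
  proof
    assume "(1 - fps_X :: real fps) = 0"
    then have "fps_nth (1 - fps_X :: real fps) 0 = 0" by simp
    then show False by simp
  qed
  ultimately have "Abs_fps (discrete_resolvent \<beta> \<mu>) * Abs_fps (\<lambda>n. weight_sum \<beta> n + \<mu>) = Abs_fps (\<lambda>n. 1::real)"
    by simp
  then have "fps_nth (Abs_fps (discrete_resolvent \<beta> \<mu>) * Abs_fps (\<lambda>n. weight_sum \<beta> n + \<mu>)) n = 1" by simp
  then show ?thesis by (simp add: fps_mult_nth atMost_atLeast0)
qed

lemma discrete_resolvent_conv_unique:
  assumes "\<And>n. n \<le> N \<Longrightarrow> (\<Sum>j\<le>n. \<beta> (n - j) * U j) + \<mu> * U n = f n" "n \<le> N"
  shows "U n = (\<Sum>j\<le>n. discrete_resolvent \<beta> \<mu> (n - j) * f j)"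
proof -
  \<comment> \<open>The equation is given only up to N, whereas power series need all indices. The
    actual left-hand side is used for all of them, and f is inserted at the end, where only indices
    up to n \<le> N occur.\<close>
  define f' where "f' n = (\<Sum>j\<le>n. \<beta> (n - j) * U j) + \<mu> * U n" for n
  have AU: "(Abs_fps \<beta> + fps_const \<mu>) * Abs_fps U = Abs_fps f'"
  proof (rule fps_ext)
    fix n
    have "(\<Sum>j\<le>n. \<beta> (n - j) * U j) = (\<Sum>i\<le>n. \<beta> i * U (n - i))"
      by (rule sum.reindex_bij_witness[of _ "\<lambda>i. n - i" "\<lambda>i. n - i"]) auto
    moreover have "fps_nth (Abs_fps \<beta> * Abs_fps U) n = (\<Sum>i\<le>n. \<beta> i * U (n - i))"
      by (simp add: fps_mult_nth atMost_atLeast0)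
    ultimately show "fps_nth ((Abs_fps \<beta> + fps_const \<mu>) * Abs_fps U) n = fps_nth (Abs_fps f') n"
      by (simp add: distrib_right f'_def)
  qed
  have "Abs_fps U = ((Abs_fps \<beta> + fps_const \<mu>) * Abs_fps (discrete_resolvent \<beta> \<mu>)) * Abs_fps U"
    by (simp add: fps_dker)
  also have "\<dots> = ((Abs_fps \<beta> + fps_const \<mu>) * Abs_fps U) * Abs_fps (discrete_resolvent \<beta> \<mu>)"
    by (simp only: ac_simps)
  finally have "Abs_fps U = Abs_fps f' * Abs_fps (discrete_resolvent \<beta> \<mu>)" unfolding AU .
  then have "fps_nth (Abs_fps U) n = fps_nth (Abs_fps f' * Abs_fps (discrete_resolvent \<beta> \<mu>)) n" by simp
  then have "U n = (\<Sum>j\<le>n. discrete_resolvent \<beta> \<mu> (n - j) * f' j)"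
    by (simp add: fps_mult_nth atMost_atLeast0 mult.commute)
  also have "\<dots> = (\<Sum>j\<le>n. discrete_resolvent \<beta> \<mu> (n - j) * f j)"
    using assms by (intro sum.cong) (auto simp: f'_def)
  finally show ?thesis .
qed

text \<open>Adding the constant mu preserves log-convexity, because a positive log-convex sequence
  is convex. Kaluza's theorem then makes the resolvent decreasing, differences of
  \<open>discrete_resolvent_bsum\<close> make it nonnegative, and replacing both factors in that sum
  by their smallest values gives the product bound.\<close>

lemma discrete_resolvent_bounds:
  assumes \<beta>n: "\<And>n. 0 < n \<Longrightarrow> \<beta> n \<le> 0" and bpos: "\<And>n. 0 < weight_sum \<beta> n"
    and lc: "\<And>n. weight_sum \<beta> (Suc n) * weight_sum \<beta> (Suc n) \<le> weight_sum \<beta> n * weight_sum \<beta> (Suc (Suc n))"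
  shows "0 \<le> discrete_resolvent \<beta> \<mu> n" "real (n + 1) * discrete_resolvent \<beta> \<mu> n * weight_sum \<beta> n \<le> 1"
proof -
  let ?d = "discrete_resolvent \<beta> \<mu>"
  define a where "a n = weight_sum \<beta> n + \<mu>" for n
  have a: "0 < a n" for n using bpos[of n] \<mu> by (simp add: a_def)
  have lca: "a (Suc n) * a (Suc n) \<le> a n * a (Suc (Suc n))" for n
  proof -
    let ?x = "weight_sum \<beta> n" and ?y = "weight_sum \<beta> (Suc n)" and ?z = "weight_sum \<beta> (Suc (Suc n))"
    have "(2 * ?y)\<^sup>2 \<le> 4 * (?x * ?z)" using lc[of n] by (simp add: power2_eq_square)
    also have "\<dots> \<le> (?x + ?z)\<^sup>2" using zero_le_power2[of "?x - ?z"] by (simp add: power2_eq_square algebra_simps)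
    finally have sq: "(2 * ?y)\<^sup>2 \<le> (?x + ?z)\<^sup>2" .
    have "0 \<le> ?x + ?z" using bpos[of n] bpos[of "Suc (Suc n)"] by linarith
    with sq have "2 * ?y \<le> ?x + ?z" by (rule power2_le_imp_le)
    then have "\<mu> * (2 * ?y) \<le> \<mu> * (?x + ?z)" using \<mu> by (rule mult_left_mono)
    then show ?thesis using lc[of n] by (simp add: a_def algebra_simps)
  qed
  have bdec: "weight_sum \<beta> (Suc n) \<le> weight_sum \<beta> n" for n using \<beta>n[of "Suc n"] by (simp add: weight_sum_def)
  have bmono: "weight_sum \<beta> n \<le> weight_sum \<beta> m" if "m \<le> n" for m n
    using that by (induction rule: dec_induct) (auto intro: order_trans[OF bdec])
  \<comment> \<open>The coefficients of the reciprocal of the series of a, which is 1 - \<zeta>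
    times the resolvent.\<close>
  define c where "c n = ?d n - (if n = 0 then 0 else ?d (n - 1))" for n
  have cc: "(\<Sum>j\<le>n. c j * a (n - j)) = (if n = 0 then 1 else 0)" for n
  proof (cases n)
    case 0
    then show ?thesis using discrete_resolvent_bsum[of 0] by (simp add: c_def a_def)
  next
    case (Suc m)
    have "(\<Sum>j\<le>Suc m. c j * a (Suc m - j)) = (\<Sum>j\<le>Suc m. ?d j * a (Suc m - j)) - (\<Sum>j\<le>Suc m. (if j = 0 then 0 else ?d (j - 1)) * a (Suc m - j))"
      by (simp add: c_def left_diff_distrib sum_subtractf)
    also have "(\<Sum>j\<le>Suc m. (if j = 0 then 0 else ?d (j - 1)) * a (Suc m - j)) = (\<Sum>j\<le>m. ?d j * a (m - j))"
      by (subst sum.atMost_Suc_shift) simp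
    finally show ?thesis using discrete_resolvent_bsum[of "Suc m"] discrete_resolvent_bsum[of m] Suc by (simp add: a_def)
  qed
  have "c n \<le> 0" if "0 < n" for n using kaluza[OF a lca cc that] .
  then have dec: "?d (Suc n) \<le> ?d n" for n using \<open>\<And>n. 0 < n \<Longrightarrow> c n \<le> 0\<close>[of "Suc n"] by (simp add: c_def)
  have dmono: "?d n \<le> ?d m" if "m \<le> n" for m n
    using that by (induction rule: dec_induct) (auto intro: order_trans[OF dec])
  have dnn: "0 \<le> ?d n" for n
  proof (induction n rule: less_induct)
    case (less n)
    show ?case
    proof (cases n)
      case 0
      have "?d 0 * a 0 = 1" using discrete_resolvent_bsum[of 0] by (simp add: a_def)
      then have "0 < ?d 0" using a[of 0] by (metis zero_less_mult_pos2 zero_less_one)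
      then show ?thesis using 0 by simp
    next
      case (Suc m)
      have "(\<Sum>j\<le>m. ?d j * a (m - j)) = (\<Sum>j\<le>m. ?d j * a (Suc m - j)) + ?d (Suc m) * a 0"
        using discrete_resolvent_bsum[of m] discrete_resolvent_bsum[of "Suc m"] by (simp add: a_def)
      moreover have "(\<Sum>j\<le>m. ?d j * a (Suc m - j)) \<le> (\<Sum>j\<le>m. ?d j * a (m - j))"
        using less.IH Suc bmono by (intro sum_mono mult_left_mono) (auto simp: a_def)
      ultimately have "0 \<le> ?d (Suc m) * a 0" by linarith
      then show ?thesis using a[of 0] Suc by (simp add: zero_le_mult_iff)
    qed
  qed
  then show "0 \<le> ?d n" .
  have "real (n + 1) * ?d n * weight_sum \<beta> n = (\<Sum>j\<le>n. ?d n * weight_sum \<beta> n)" by simp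
  also have "\<dots> \<le> (\<Sum>j\<le>n. ?d j * (weight_sum \<beta> (n - j) + \<mu>))"
  proof (rule sum_mono)
    fix j assume "j \<in> {..n}"
    then have "weight_sum \<beta> n \<le> weight_sum \<beta> (n - j) + \<mu>" "?d n \<le> ?d j" using bmono[of "n - j" n] dmono[of j n] \<mu> by auto
    then show "?d n * weight_sum \<beta> n \<le> ?d j * (weight_sum \<beta> (n - j) + \<mu>)"
      using dnn bpos[of n] by (intro mult_mono) auto
  qed
  also have "\<dots> = 1" by (rule discrete_resolvent_bsum)
  finally show "real (n + 1) * ?d n * weight_sum \<beta> n \<le> 1" .
qed

end

section \<open>The L1 scheme\<close>

definition ml_primitive :: "real \<Rightarrow> real \<Rightarrow> real \<Rightarrow> real" where
  "ml_primitive \<alpha> \<mu> t = (LINT s|lborel. indicator {0<..<t} s * ml_kernel \<alpha> \<mu> s)"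

lemma integrable_indicator_subset:
  fixes g :: "real \<Rightarrow> real"
  assumes "integrable lborel (\<lambda>s. indicator A s * g s)" "B \<subseteq> A" "B \<in> sets borel"
  shows "integrable lborel (\<lambda>s. indicator B s * g s)"
proof -
  have "integrable lborel (\<lambda>s. indicator B s *\<^sub>R (indicator A s * g s))"
    using assms by (intro integrable_mult_indicator) auto
  also have "(\<lambda>s. indicator B s *\<^sub>R (indicator A s * g s)) = (\<lambda>s. indicator B s * g s)"
    using assms(2) by (auto simp: indicator_def fun_eq_iff)
  finally show ?thesis .
qed

lemma LINT_unit_const: "(LINT s|lborel. indicator {a<..<a + 1} s * c) = (c::real)" for a :: real
  by simp

lemma LINT_split_at:
  fixes g :: "real \<Rightarrow> real"
  assumes g: "integrable lborel (\<lambda>s. indicator {a<..<c} s * g s)" and "a \<le> b" "b \<le> c"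
  shows "(LINT s|lborel. indicator {a<..<c} s * g s) = (LINT s|lborel. indicator {a<..<b} s * g s) + (LINT s|lborel. indicator {b<..<c} s * g s)"
proof -
  have i: "integrable lborel (\<lambda>s. indicator {a<..<b} s * g s)" "integrable lborel (\<lambda>s. indicator {b<..<c} s * g s)"
    by (rule integrable_indicator_subset[OF g]; use assms in auto)+
  have "(LINT s|lborel. indicator {a<..<c} s * g s) = (LINT s|lborel. indicator {a<..<b} s * g s + indicator {b<..<c} s * g s)"
  proof (rule integral_cong_AE)
    show "AE s in lborel. indicator {a<..<c} s * g s = indicator {a<..<b} s * g s + indicator {b<..<c} s * g s"
      using AE_lborel_singleton[of b] by eventually_elim (use assms in \<open>auto simp: indicator_def\<close>)
  qed (use g i in auto)
  then show ?thesis using i by simp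
qed

lemma LINT_split_sum:
  fixes g :: "real \<Rightarrow> real"
  assumes "integrable lborel (\<lambda>s. indicator {0<..<real n} s * g s)"
  shows "(LINT s|lborel. indicator {0<..<real n} s * g s) = (\<Sum>j=1..n. LINT s|lborel. indicator {real j - 1<..<real j} s * g s)"
  using assms
proof (induction n)
  case (Suc n)
  have "integrable lborel (\<lambda>s. indicator {0<..<real n} s * g s)"
    by (rule integrable_indicator_subset[OF Suc.prems]) auto
  with Suc.IH LINT_split_at[OF Suc.prems, of "real n"] show ?case by simp
qed simp

lemma rl_kernel_mass:
  assumes "0 < \<gamma>" "0 \<le> t"
  shows "(LINT s|lborel. indicator {0<..<t} s * rl_kernel \<gamma> s) = rl_kernel (\<gamma> + 1) t"
proof (cases "t = 0")
  case False
  then have t: "0 < t" using assms by simp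
  have "(LINT s|lborel. indicator {0<..<t} s * rl_kernel \<gamma> s) = (LINT s|lborel. indicator {0<..<t} s * (rl_kernel 1 (t - s) * rl_kernel \<gamma> s))"
    by (rule Bochner_Integration.integral_cong) (auto simp: indicator_def rl_kernel_def)
  also have "\<dots> = rl_kernel (1 + \<gamma>) t" by (rule has_bochner_integral_integral_eq[OF rl_kernel_conv_integral]) (use assms t in auto)
  finally show ?thesis by (simp add: add.commute)
qed (simp add: rl_kernel_def)

lemma rl_kernel_antimono: "0 < \<gamma> \<Longrightarrow> \<gamma> \<le> 1 \<Longrightarrow> 0 < x \<Longrightarrow> x \<le> y \<Longrightarrow> rl_kernel \<gamma> y \<le> rl_kernel \<gamma> x"
  unfolding rl_kernel_def by (intro divide_right_mono powr_mono2') (auto intro: less_imp_le Gamma_real_pos)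

lemma powr_shift_le:
  assumes "2 \<le> n" "0 \<le> q"
  shows "real (n - 1) powr (- q) \<le> 2 powr q * real n powr (- q)"
proof -
  have "real (n - 1) powr (- q) \<le> (real n / 2) powr (- q)"
    using assms by (intro powr_mono2') (auto simp: of_nat_diff)
  also have "\<dots> = 2 powr q * real n powr (- q)" using assms by (simp add: powr_divide powr_minus field_simps)
  finally show ?thesis .
qed

context
  fixes \<alpha> :: real
  assumes \<alpha>: "0 < \<alpha>" "\<alpha> < 1"
begin

lemma ml_primitive_0 [simp]: "ml_primitive \<alpha> \<mu> 0 = 0"
  by (simp add: ml_primitive_def)

lemma ml_primitive_nonneg: "0 \<le> \<mu> \<Longrightarrow> 0 \<le> ml_primitive \<alpha> \<mu> t"
  unfolding ml_primitive_def using ml_kernel_pos[OF \<alpha>, of \<mu>]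
  by (intro integral_nonneg_AE AE_I2) (auto simp: indicator_def less_imp_le)

lemma ml_primitive_le:
  assumes "0 \<le> \<mu>" "0 \<le> t" shows "ml_primitive \<alpha> \<mu> t \<le> rl_kernel (\<alpha> + 1) t"
proof (cases "t = 0")
  case False
  with assms have t: "0 < t" by simp
  have "ml_primitive \<alpha> \<mu> t \<le> (LINT s|lborel. indicator {0<..<t} s * rl_kernel \<alpha> s)"
    unfolding ml_primitive_def using ml_kernel_le_rl[OF \<alpha> assms(1)]
    by (intro integral_mono ml_kernel_integrable rl_kernel_integrable \<alpha> assms t) (auto simp: indicator_def)
  then show ?thesis using rl_kernel_mass[of \<alpha> t] \<alpha> assms by simp
qed (simp add: rl_kernel_def)

lemma ml_primitive_diff:
  assumes "0 \<le> \<mu>" "0 \<le> a" "a \<le> b"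
  shows "ml_primitive \<alpha> \<mu> b - ml_primitive \<alpha> \<mu> a = (LINT s|lborel. indicator {a<..<b} s * ml_kernel \<alpha> \<mu> s)"
proof (cases "b = 0")
  case False
  then show ?thesis
    using LINT_split_at[OF ml_kernel_integrable[OF \<alpha> assms(1), of b] assms(2,3)] assms by (simp add: ml_primitive_def)
qed (use assms in simp)

text \<open>These turn out to be the partial sums of the L1 weights, since the L1 scheme integrates
  the kernel exactly against the piecewise constant derivative of the interpolant.\<close>

definition rl_cell :: "nat \<Rightarrow> real" where
  "rl_cell m = (LINT s|lborel. indicator {0<..<1} s * rl_kernel (1 - \<alpha>) (real m + s))"

lemma rl_cell_integrable: "integrable lborel (\<lambda>s. indicator {0<..<1} s * rl_kernel (1 - \<alpha>) (real m + s))"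
proof -
  have "integrable lborel (\<lambda>s. indicator {real m<..<real m + 1} s * rl_kernel (1 - \<alpha>) s)"
    by (rule integrable_indicator_subset[OF rl_kernel_integrable[of "1 - \<alpha>" "real m + 1"]]) (use \<alpha> in auto)
  from lborel_integrable_real_affine[OF this, of 1 "real m"]
  have "integrable lborel (\<lambda>s. indicator {real m<..<real m + 1} (real m + s) * rl_kernel (1 - \<alpha>) (real m + s))" by simp
  also have "(\<lambda>s. indicator {real m<..<real m + 1} (real m + s) * rl_kernel (1 - \<alpha>) (real m + s)) = (\<lambda>s. indicator {0<..<1} s * rl_kernel (1 - \<alpha>) (real m + s))"
    by (auto simp: indicator_def fun_eq_iff)
  finally show ?thesis .
qed

lemma rl_cell_eq: "rl_cell m = rl_kernel (2 - \<alpha>) (real m + 1) - rl_kernel (2 - \<alpha>) (real m)"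
proof -
  have "(LINT s|lborel. indicator {real m<..<real m + 1} s * rl_kernel (1 - \<alpha>) s) =
    \<bar>1\<bar> *\<^sub>R (LINT s|lborel. indicator {real m<..<real m + 1} (real m + 1 * s) * rl_kernel (1 - \<alpha>) (real m + 1 * s))"
    by (rule lborel_integral_real_affine) simp
  also have "\<dots> = rl_cell m" unfolding rl_cell_def
    by (simp, rule Bochner_Integration.integral_cong) (auto simp: indicator_def)
  finally have "rl_cell m = (LINT s|lborel. indicator {real m<..<real m + 1} s * rl_kernel (1 - \<alpha>) s)" by simp
  moreover have "rl_kernel (1 - \<alpha> + 1) (real m + 1) = rl_kernel (1 - \<alpha> + 1) (real m) + (LINT s|lborel. indicator {real m<..<real m + 1} s * rl_kernel (1 - \<alpha>) s)"
    using LINT_split_at[OF rl_kernel_integrable[of "1 - \<alpha>" "real m + 1"], of "real m"] rl_kernel_mass[of "1 - \<alpha>" "real m"] rl_kernel_mass[of "1 - \<alpha>" "real m + 1"] \<alpha>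
    by simp
  ultimately show ?thesis by simp
qed

lemma rl_cell_reflect:
  assumes "1 \<le> j" "j \<le> n"
  shows "(LINT s|lborel. indicator {real j - 1<..<real j} s * rl_kernel (1 - \<alpha>) (real n - s)) = rl_cell (n - j)"
    "integrable lborel (\<lambda>s. indicator {real j - 1<..<real j} s * rl_kernel (1 - \<alpha>) (real n - s))"
proof -
  have eq: "(\<lambda>s. indicator {real j - 1<..<real j} (real j + -1 * s) * rl_kernel (1 - \<alpha>) (real n - (real j + -1 * s)))
     = (\<lambda>s. indicator {0<..<1} s * rl_kernel (1 - \<alpha>) (real (n - j) + s))"
    using assms by (auto simp: indicator_def fun_eq_iff of_nat_diff algebra_simps)
  show "(LINT s|lborel. indicator {real j - 1<..<real j} s * rl_kernel (1 - \<alpha>) (real n - s)) = rl_cell (n - j)"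
    using lborel_integral_real_affine[of "-1" "\<lambda>s. indicator {real j - 1<..<real j} s * rl_kernel (1 - \<alpha>) (real n - s)" "real j"]
    unfolding eq rl_cell_def by simp
  show "integrable lborel (\<lambda>s. indicator {real j - 1<..<real j} s * rl_kernel (1 - \<alpha>) (real n - s))"
    using rl_cell_integrable[of "n - j"] unfolding eq[symmetric] by (subst (asm) lborel_integrable_real_affine_iff) auto
qed

lemma rl_cell_ge: "rl_kernel (1 - \<alpha>) (real m + 1) \<le> rl_cell m"
proof -
  have "rl_kernel (1 - \<alpha>) (real m + 1) = (LINT s|lborel. indicator {0<..<1::real} s * rl_kernel (1 - \<alpha>) (real m + 1))"
    using LINT_unit_const[of 0 "rl_kernel (1 - \<alpha>) (real m + 1)"] unfolding add_0 by (rule sym)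
  also have "\<dots> \<le> rl_cell m" unfolding rl_cell_def
  proof (rule integral_mono[OF _ rl_cell_integrable])
    show "integrable lborel (\<lambda>s. indicator {0<..<1::real} s * rl_kernel (1 - \<alpha>) (real m + 1))"
      by (intro integrable_mult_left integrable_real_indicator) auto
    fix s :: real
    show "indicator {0<..<1} s * rl_kernel (1 - \<alpha>) (real m + 1) \<le> indicator {0<..<1} s * rl_kernel (1 - \<alpha>) (real m + s)"
      using rl_kernel_antimono[of "1 - \<alpha>" "real m + s" "real m + 1"] \<alpha> by (auto simp: indicator_def)
  qed
  finally show ?thesis .
qed

lemma rl_cell_pos: "0 < rl_cell m"
  using rl_cell_ge[of m] rl_kernel_pos[of "1 - \<alpha>" "real m + 1"] \<alpha> by linarith

lemma rl_cell_dec: "rl_cell (Suc m) \<le> rl_cell m"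
  unfolding rl_cell_def
  by (rule integral_mono[OF rl_cell_integrable rl_cell_integrable]) (use \<alpha> in \<open>auto simp: indicator_def intro!: rl_kernel_antimono\<close>)

text \<open>The kernel itself satisfies the inequality because x (x+2) \<le> (x+1)^2. The product
  form does not pass to integrals directly, but the equivalent family of linear inequalities 2y
  \<le> theta x + z/theta does; afterwards theta = y/x recovers the product form.\<close>

lemma rl_cell_log_convex: "rl_cell (Suc m) * rl_cell (Suc m) \<le> rl_cell m * rl_cell (Suc (Suc m))"
proof -
  let ?k = "rl_kernel (1 - \<alpha>)"
  have am: "2 * rl_cell (Suc m) \<le> \<theta> * rl_cell m + (1 / \<theta>) * rl_cell (Suc (Suc m))" if th: "0 < \<theta>" for \<theta>
  proof -
    have "2 * rl_cell (Suc m) = (LINT s|lborel. 2 * (indicator {0<..<1} s * ?k (real (Suc m) + s)))"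
      unfolding rl_cell_def by simp
    also have "\<dots> \<le> (LINT s|lborel. \<theta> * (indicator {0<..<1} s * ?k (real m + s)) + (1 / \<theta>) * (indicator {0<..<1} s * ?k (real (Suc (Suc m)) + s)))"
    proof (rule integral_mono)
      fix s :: real
      show "2 * (indicator {0<..<1} s * ?k (real (Suc m) + s)) \<le> \<theta> * (indicator {0<..<1} s * ?k (real m + s)) + (1 / \<theta>) * (indicator {0<..<1} s * ?k (real (Suc (Suc m)) + s))"
      proof (cases "s \<in> {0<..<1}")
        case True
        define x where "x = real m + s"
        have x: "0 < x" using True by (simp add: x_def)
        have k: "0 < ?k x" "0 < ?k (x + 1)" "0 < ?k (x + 2)" using x \<alpha> by (auto intro!: rl_kernel_pos)
        have "(?k (x + 1))\<^sup>2 \<le> ?k x * ?k (x + 2)"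
        proof -
          have "((x + 1) * (x + 1)) powr (- \<alpha>) \<le> (x * (x + 2)) powr (- \<alpha>)"
            using x \<alpha> by (intro powr_mono2') (auto simp: algebra_simps intro!: add_pos_pos)
          then have "(x + 1) powr (- \<alpha>) * (x + 1) powr (- \<alpha>) \<le> x powr (- \<alpha>) * (x + 2) powr (- \<alpha>)"
            using x by (simp add: powr_mult)
          then have "((x + 1) powr (- \<alpha>) * (x + 1) powr (- \<alpha>)) / (Gamma (1 - \<alpha>) * Gamma (1 - \<alpha>)) \<le> (x powr (- \<alpha>) * (x + 2) powr (- \<alpha>)) / (Gamma (1 - \<alpha>) * Gamma (1 - \<alpha>))"
            by (rule divide_right_mono) simp
          then show ?thesis by (simp add: rl_kernel_def power2_eq_square)
        qed
        then have "(2 * ?k (x + 1))\<^sup>2 \<le> 4 * ((\<theta> * ?k x) * ((1 / \<theta>) * ?k (x + 2)))"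
          using th by (simp add: power2_eq_square)
        also have "\<dots> \<le> (\<theta> * ?k x + (1 / \<theta>) * ?k (x + 2))\<^sup>2"
        proof -
          have "4 * (p * q) \<le> (p + q)\<^sup>2" for p q :: real
            using zero_le_power2[of "p - q"] by (simp add: power2_eq_square algebra_simps)
          then show ?thesis .
        qed
        finally have sq: "(2 * ?k (x + 1))\<^sup>2 \<le> (\<theta> * ?k x + (1 / \<theta>) * ?k (x + 2))\<^sup>2" .
        have "0 \<le> \<theta> * ?k x + (1 / \<theta>) * ?k (x + 2)" using k th by (intro add_nonneg_nonneg mult_nonneg_nonneg) auto
        with sq have "2 * ?k (x + 1) \<le> \<theta> * ?k x + (1 / \<theta>) * ?k (x + 2)" by (rule power2_le_imp_le)
        then show ?thesis using True by (simp add: x_def add_ac)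
      qed auto
    qed (intro Bochner_Integration.integrable_add integrable_mult_right rl_cell_integrable)+
    also have "\<dots> = \<theta> * rl_cell m + (1 / \<theta>) * rl_cell (Suc (Suc m))"
      unfolding rl_cell_def using rl_cell_integrable[of m] rl_cell_integrable[of "Suc (Suc m)"]
      by (subst Bochner_Integration.integral_add) (auto intro: integrable_mult_right)
    finally show ?thesis .
  qed
  let ?x = "rl_cell m" and ?y = "rl_cell (Suc m)" and ?z = "rl_cell (Suc (Suc m))"
  have p: "0 < ?x" "0 < ?y" "0 < ?z" by (rule rl_cell_pos)+
  have "2 * ?y \<le> (?y / ?x) * ?x + (1 / (?y / ?x)) * ?z" by (rule am) (use p in auto)
  then have "?y \<le> ?x * ?z / ?y" using p by simp
  then show ?thesis using p by (simp add: field_simps)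
qed

section \<open>L1 weights and their resolvent\<close>

lemma L1_bsum: "weight_sum (L1_weight \<alpha>) n = rl_cell n"
proof (induction n)
  case 0
  then show ?case using \<alpha> by (simp add: weight_sum_def L1_weight_def rl_cell_eq rl_kernel_def)
next
  case (Suc n)
  have "weight_sum (L1_weight \<alpha>) (Suc n) = rl_cell n + L1_weight \<alpha> (Suc n)" using Suc by (simp add: weight_sum_def)
  also have "\<dots> = rl_cell (Suc n)"
    by (simp add: rl_cell_eq L1_weight_def rl_kernel_def add_divide_distrib diff_divide_distrib add_ac)
  finally show ?case .
qed

lemma L1_weight_0_pos: "0 < L1_weight \<alpha> 0"
  using \<alpha> by (simp add: L1_weight_def Gamma_real_pos)

lemma L1_weight_nonpos: "0 < n \<Longrightarrow> L1_weight \<alpha> n \<le> 0"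
proof -
  assume "0 < n"
  then obtain m where n: "n = Suc m" by (cases n) auto
  have "L1_weight \<alpha> n = weight_sum (L1_weight \<alpha>) (Suc m) - weight_sum (L1_weight \<alpha>) m" by (simp add: weight_sum_def n)
  then show ?thesis using rl_cell_dec[of m] by (simp add: L1_bsum)
qed

text \<open>The lower bound of \<open>rl_cell\<close> by the kernel at n + 1 is inserted into the
  product bound of \<open>discrete_resolvent_bounds\<close>.\<close>

lemma L1_dker:
  assumes "0 \<le> \<mu>"
  shows "0 \<le> discrete_resolvent (L1_weight \<alpha>) \<mu> n" "discrete_resolvent (L1_weight \<alpha>) \<mu> n \<le> Gamma (1 - \<alpha>) * real (n + 1) powr (\<alpha> - 1)"
proof -
  let ?d = "discrete_resolvent (L1_weight \<alpha>) \<mu> n"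
  note b = discrete_resolvent_bounds[where \<beta> = "L1_weight \<alpha>" and n = n, OF L1_weight_0_pos assms, unfolded L1_bsum, OF L1_weight_nonpos rl_cell_pos rl_cell_log_convex]
  show nn: "0 \<le> ?d" by (rule b(1))
  have G: "0 < Gamma (1 - \<alpha>)" using \<alpha> by (intro Gamma_real_pos) simp
  have "real (n + 1) * ?d * rl_kernel (1 - \<alpha>) (real n + 1) \<le> real (n + 1) * ?d * rl_cell n"
    using nn by (intro mult_left_mono rl_cell_ge) auto
  also have "\<dots> \<le> 1" by (rule b(2))
  finally have "real (n + 1) * ?d * real (n + 1) powr (- \<alpha>) \<le> Gamma (1 - \<alpha>)"
    using G by (simp add: rl_kernel_def field_simps)
  moreover have "real (n + 1) * real (n + 1) powr (- \<alpha>) = real (n + 1) powr (1 - \<alpha>)"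
    using powr_add[of "real (n + 1)" 1 "- \<alpha>"] by simp
  then have "?d * real (n + 1) powr (1 - \<alpha>) = real (n + 1) * ?d * real (n + 1) powr (- \<alpha>)"
    by (metis mult.assoc mult.commute)
  ultimately have "?d * real (n + 1) powr (1 - \<alpha>) \<le> Gamma (1 - \<alpha>)" by (simp only:)
  then have "?d * real (n + 1) powr (1 - \<alpha>) * real (n + 1) powr (\<alpha> - 1) \<le> Gamma (1 - \<alpha>) * real (n + 1) powr (\<alpha> - 1)"
    by (rule mult_right_mono) simp
  then show "?d \<le> Gamma (1 - \<alpha>) * real (n + 1) powr (\<alpha> - 1)"
    by (simp add: mult.assoc powr_add[symmetric])
qed

lemma rl_kernel_diff_le:
  assumes "0 < x" "x \<le> y"
  shows "0 \<le> rl_kernel (1 - \<alpha>) x - rl_kernel (1 - \<alpha>) y" "rl_kernel (1 - \<alpha>) x - rl_kernel (1 - \<alpha>) y \<le> \<alpha> / Gamma (1 - \<alpha>) * x powr (- \<alpha> - 1) * (y - x)"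
proof -
  show "0 \<le> rl_kernel (1 - \<alpha>) x - rl_kernel (1 - \<alpha>) y" using rl_kernel_antimono[of "1 - \<alpha>" x y] assms \<alpha> by simp
  show "rl_kernel (1 - \<alpha>) x - rl_kernel (1 - \<alpha>) y \<le> \<alpha> / Gamma (1 - \<alpha>) * x powr (- \<alpha> - 1) * (y - x)"
  proof (cases "x = y")
    case False
    then have "\<exists>z>x. z < y \<and> y powr (- \<alpha>) - x powr (- \<alpha>) = (y - x) * (- \<alpha> * z powr (- \<alpha> - 1))"
      using assms by (intro MVT2) (auto intro!: derivative_eq_intros)
    then obtain z where z: "x < z" "z < y" "y powr (- \<alpha>) - x powr (- \<alpha>) = (y - x) * (- \<alpha> * z powr (- \<alpha> - 1))" by auto
    have "x powr (- \<alpha>) - y powr (- \<alpha>) = (y - x) * (\<alpha> * z powr (- \<alpha> - 1))" using z by simp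
    also have "\<dots> \<le> (y - x) * (\<alpha> * x powr (- \<alpha> - 1))"
      using z assms \<alpha> by (intro mult_left_mono powr_mono2') auto
    finally have "(x powr (- \<alpha>) - y powr (- \<alpha>)) / Gamma (1 - \<alpha>) \<le> (y - x) * (\<alpha> * x powr (- \<alpha> - 1)) / Gamma (1 - \<alpha>)"
      using \<alpha> by (intro divide_right_mono) (auto intro!: less_imp_le Gamma_real_pos)
    then show ?thesis by (simp add: rl_kernel_def diff_divide_distrib mult_ac)
  qed simp
qed

end

section \<open>Truncation error of the L1 scheme\<close>

text \<open>In terms of increments the factors become partial sums of the weights, which for the L1
  scheme are integrals of the kernel over cells.\<close>

lemma sum_by_parts_bsum:
  fixes F :: "nat \<Rightarrow> real"
  assumes "F 0 = 0"
  shows "(\<Sum>j\<le>n. \<beta> (n - j) * F j) = (\<Sum>j=1..n. weight_sum \<beta> (n - j) * (F j - F (j - 1)))"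
proof (cases n)
  case (Suc m)
  have b: "\<beta> (n - j) = weight_sum \<beta> (n - j) - (if j = n then 0 else weight_sum \<beta> (m - j))" if "j \<le> n" for j
  proof (cases "j = n")
    case False
    then have "n - j = Suc (m - j)" using that Suc by auto
    then show ?thesis using False by (simp add: weight_sum_def)
  qed (simp add: weight_sum_def)
  have "(\<Sum>j\<le>n. \<beta> (n - j) * F j) = (\<Sum>j\<le>n. weight_sum \<beta> (n - j) * F j - (if j = n then 0 else weight_sum \<beta> (m - j)) * F j)"
    by (rule sum.cong) (auto simp: b left_diff_distrib)
  also have "\<dots> = (\<Sum>j\<le>n. weight_sum \<beta> (n - j) * F j) - (\<Sum>j\<le>n. (if j = n then 0 else weight_sum \<beta> (m - j)) * F j)"
    by (simp add: sum_subtractf)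
  also have "(\<Sum>j\<le>n. (if j = n then 0 else weight_sum \<beta> (m - j)) * F j) = (\<Sum>j\<le>m. weight_sum \<beta> (m - j) * F j)"
    unfolding Suc by simp
  also have "\<dots> = (\<Sum>j=1..n. weight_sum \<beta> (n - j) * F (j - 1))"
    unfolding Suc by (rule sum.reindex_bij_witness[of _ "\<lambda>i. i - 1" Suc]) auto
  also have "(\<Sum>j\<le>n. weight_sum \<beta> (n - j) * F j) = (\<Sum>j=1..n. weight_sum \<beta> (n - j) * F j)"
    by (rule sum.mono_neutral_right) (auto simp: assms Suc_le_eq)
  finally show ?thesis by (simp add: right_diff_distrib sum_subtractf)
qed (simp add: assms)

lemma resolvent_sum_alt: "resolvent_sum \<beta> \<mu> n = (\<Sum>j=1..n. discrete_resolvent \<beta> \<mu> (n - j))"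
  unfolding resolvent_sum_def by (rule sum.reindex_bij_witness[of _ "\<lambda>i. n - i" "\<lambda>i. n - i"]) auto

context
  fixes \<alpha> :: real
  assumes \<alpha>: "0 < \<alpha>" "\<alpha> < 1"
begin

text \<open>An increment of the primitive is the integral of E over a cell, and the partial sums of
  the weights are integrals of k over cells. Comparison with \<open>ml_kernel_caputo\<close>, split
  into cells, leaves in each cell a product of averages minus the average of the product.\<close>

lemma L1_truncation_terms:
  assumes \<mu>: "0 \<le> \<mu>" and n: "1 \<le> n"
  defines "I \<equiv> \<lambda>j f. LINT s|lborel. indicator {real j - 1<..<real j} s * f s"
  shows "(\<Sum>j=1..n. weight_sum (L1_weight \<alpha>) (n - j) * (ml_primitive \<alpha> \<mu> (real j) - ml_primitive \<alpha> \<mu> (real (j - 1)))) + \<mu> * ml_primitive \<alpha> \<mu> (real n) - 1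
    = (\<Sum>j=1..n. I j (\<lambda>s. rl_kernel (1 - \<alpha>) (real n - s)) * I j (ml_kernel \<alpha> \<mu>) - I j (\<lambda>s. rl_kernel (1 - \<alpha>) (real n - s) * ml_kernel \<alpha> \<mu> s))"
proof -
  have 1: "weight_sum (L1_weight \<alpha>) (n - j) * (ml_primitive \<alpha> \<mu> (real j) - ml_primitive \<alpha> \<mu> (real (j - 1))) = I j (\<lambda>s. rl_kernel (1 - \<alpha>) (real n - s)) * I j (ml_kernel \<alpha> \<mu>)"
    if "j \<in> {1..n}" for j
    using that ml_primitive_diff[OF \<alpha> \<mu>, of "real (j - 1)" "real j"] rl_cell_reflect(1)[OF \<alpha>, of j n]
    by (simp add: L1_bsum[OF \<alpha>] I_def of_nat_diff)
  have "integrable lborel (\<lambda>s. indicator {0<..<real n} s * (rl_kernel (1 - \<alpha>) (real n - s) * ml_kernel \<alpha> \<mu> s))"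
    by (rule integrable.intros[OF ml_kernel_conv_integral]) (use \<alpha> n in auto)
  from LINT_split_sum[OF this] have "(LINT s|lborel. indicator {0<..<real n} s * (rl_kernel (1 - \<alpha>) (real n - s) * ml_kernel \<alpha> \<mu> s)) = (\<Sum>j=1..n. I j (\<lambda>s. rl_kernel (1 - \<alpha>) (real n - s) * ml_kernel \<alpha> \<mu> s))"
    by (simp add: I_def)
  with ml_kernel_caputo[OF \<alpha> \<mu>, of "real n"] n
  have 2: "1 = (\<Sum>j=1..n. I j (\<lambda>s. rl_kernel (1 - \<alpha>) (real n - s) * ml_kernel \<alpha> \<mu> s)) + \<mu> * ml_primitive \<alpha> \<mu> (real n)"
    by (simp add: ml_primitive_def)
  have "(\<Sum>j=1..n. weight_sum (L1_weight \<alpha>) (n - j) * (ml_primitive \<alpha> \<mu> (real j) - ml_primitive \<alpha> \<mu> (real (j - 1)))) = (\<Sum>j=1..n. I j (\<lambda>s. rl_kernel (1 - \<alpha>) (real n - s)) * I j (ml_kernel \<alpha> \<mu>))"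
    by (rule sum.cong[OF refl 1])
  then show ?thesis by (subst 2) (simp add: sum_subtractf)
qed

text \<open>In cell j the kernel k is regular unless j = n, and E is regular unless j = 1; each fact
  yields a bound through \<open>covariance_bound\<close>. The number \<open>\<kappa>\<close> is left
  free: 0 is used in the first cell and the value of E at j in the inner cells.\<close>

lemma L1_term_bound:
  assumes \<mu>: "0 \<le> \<mu>" and j: "1 \<le> j" "j \<le> n"
  defines "I \<equiv> \<lambda>j f. LINT s|lborel. indicator {real j - 1<..<real j} s * f s"
  defines "\<rho> \<equiv> I j (\<lambda>s. rl_kernel (1 - \<alpha>) (real n - s)) * I j (ml_kernel \<alpha> \<mu>) - I j (\<lambda>s. rl_kernel (1 - \<alpha>) (real n - s) * ml_kernel \<alpha> \<mu> s)"
  shows "j < n \<Longrightarrow> \<bar>\<rho>\<bar> \<le> 2 * (\<alpha> / Gamma (1 - \<alpha>) * real (n - j) powr (- \<alpha> - 1)) * I j (\<lambda>s. \<bar>ml_kernel \<alpha> \<mu> s - \<kappa>\<bar>)"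
    and "2 \<le> j \<Longrightarrow> I j (\<lambda>s. \<bar>ml_kernel \<alpha> \<mu> s - ml_kernel \<alpha> \<mu> (real j)\<bar>) \<le> ml_kernel_lip \<alpha> * real (j - 1) powr (\<alpha> - 2)"
    and "2 \<le> j \<Longrightarrow> \<bar>\<rho>\<bar> \<le> 2 * (ml_kernel_lip \<alpha> * real (j - 1) powr (\<alpha> - 2)) * I j (\<lambda>s. rl_kernel (1 - \<alpha>) (real n - s))"
    and "I j (ml_kernel \<alpha> \<mu>) \<le> 1 / Gamma (\<alpha> + 1)"
    and "I j (\<lambda>s. rl_kernel (1 - \<alpha>) (real n - s) * ml_kernel \<alpha> \<mu> s) \<le> 1"
    and "0 \<le> I j (ml_kernel \<alpha> \<mu>)" "0 \<le> I j (\<lambda>s. rl_kernel (1 - \<alpha>) (real n - s) * ml_kernel \<alpha> \<mu> s)"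
proof -
  let ?k = "\<lambda>s. rl_kernel (1 - \<alpha>) (real n - s)" and ?E = "ml_kernel \<alpha> \<mu>"
  have k: "integrable lborel (\<lambda>s. indicator {real j - 1<..<real j} s * ?k s)" by (rule rl_cell_reflect(2)[OF \<alpha> j])
  have E: "integrable lborel (\<lambda>s. indicator {real j - 1<..<real j} s * ?E s)"
    by (rule integrable_indicator_subset[OF ml_kernel_integrable[OF \<alpha> \<mu>, of "real j"]]) (use j in auto)
  have fullkE: "integrable lborel (\<lambda>s. indicator {0<..<real n} s * (?k s * ?E s))"
    by (rule integrable.intros[OF ml_kernel_conv_integral]) (use \<alpha> j in auto)
  have kE: "integrable lborel (\<lambda>s. indicator {real j - 1<..<real j} s * (?k s * ?E s))"
    by (rule integrable_indicator_subset[OF fullkE]) (use j in auto)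
  have Ek: "integrable lborel (\<lambda>s. indicator {real j - 1<..<real j} s * (?E s * ?k s))"
    using kE by (simp add: mult.commute)
  have a: "real j - 1 + 1 = real j" by simp
  have lip: "\<bar>?E s - ?E (real j)\<bar> \<le> ml_kernel_lip \<alpha> * real (j - 1) powr (\<alpha> - 2)"
    if "2 \<le> j" "real j - 1 < s" "s < real j" for s
  proof -
    have "\<bar>?E s - ?E (real j)\<bar> \<le> ml_kernel_lip \<alpha> * s powr (\<alpha> - 2) * (real j - s)"
      by (rule ml_kernel_lipschitz[OF \<alpha> \<mu>]) (use that j in auto)
    also have "\<dots> \<le> ml_kernel_lip \<alpha> * s powr (\<alpha> - 2) * 1"
      using that ml_kernel_lip_pos[OF \<alpha>(1)] by (intro mult_left_mono) auto
    also have "\<dots> \<le> ml_kernel_lip \<alpha> * real (j - 1) powr (\<alpha> - 2)"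
      using that ml_kernel_lip_pos[OF \<alpha>(1)] \<alpha> by (simp, intro mult_left_mono powr_mono2') (auto simp: of_nat_diff)
    finally show ?thesis .
  qed
  have nnE: "0 \<le> indicator {real j - 1<..<real j} s * ?E s" for s
    using ml_kernel_pos[OF \<alpha> \<mu>, of s] j by (auto simp: indicator_def less_imp_le)
  have nnkE: "0 \<le> indicator {0<..<real n} s * (?k s * ?E s)" for s
    using ml_kernel_pos[OF \<alpha> \<mu>, of s] rl_kernel_nonneg[of "1 - \<alpha>" "real n - s"] j \<alpha> by (auto simp: indicator_def less_imp_le)
  show "\<bar>\<rho>\<bar> \<le> 2 * (\<alpha> / Gamma (1 - \<alpha>) * real (n - j) powr (- \<alpha> - 1)) * I j (\<lambda>s. \<bar>?E s - \<kappa>\<bar>)" if "j < n"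
    unfolding \<rho>_def I_def
  proof (rule covariance_bound[of "real j - 1" _ _ "rl_kernel (1 - \<alpha>) (real n - (real j - 1))", unfolded a, OF k E kE])
    fix s assume s: "real j - 1 < s" "s < real j"
    have nj: "real (n - j) \<le> real n - s" "1 \<le> real (n - j)" using s that by (auto simp: of_nat_diff)
    have "\<bar>?k s - rl_kernel (1 - \<alpha>) (real n - (real j - 1))\<bar> \<le> \<alpha> / Gamma (1 - \<alpha>) * (real n - s) powr (- \<alpha> - 1) * (real n - (real j - 1) - (real n - s))"
      using rl_kernel_diff_le[OF \<alpha>, of "real n - s" "real n - (real j - 1)"] s nj by simp
    also have "\<dots> \<le> \<alpha> / Gamma (1 - \<alpha>) * (real n - s) powr (- \<alpha> - 1) * 1"
      using s \<alpha> by (intro mult_left_mono) (auto intro!: divide_nonneg_nonneg less_imp_le[OF Gamma_real_pos])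
    also have "\<dots> \<le> \<alpha> / Gamma (1 - \<alpha>) * real (n - j) powr (- \<alpha> - 1)"
      using nj \<alpha> by (simp only: mult_1_right, intro mult_left_mono powr_mono2') (auto intro!: divide_nonneg_nonneg less_imp_le[OF Gamma_real_pos])
    finally show "\<bar>?k s - rl_kernel (1 - \<alpha>) (real n - (real j - 1))\<bar> \<le> \<alpha> / Gamma (1 - \<alpha>) * real (n - j) powr (- \<alpha> - 1)" .
  qed
  show "I j (\<lambda>s. \<bar>?E s - ?E (real j)\<bar>) \<le> ml_kernel_lip \<alpha> * real (j - 1) powr (\<alpha> - 2)" if "2 \<le> j"
  proof -
    have iE: "integrable lborel (\<lambda>s. indicator {real j - 1<..<real j} s * \<bar>?E s - ?E (real j)\<bar>)"
    proof -
      have "integrable lborel (\<lambda>s. indicator {real j - 1<..<real j} s * ?E s - indicator {real j - 1<..<real j} s * ?E (real j))"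
        by (intro Bochner_Integration.integrable_diff E) auto
      from integrable_norm[OF this] show ?thesis by (simp add: right_diff_distrib[symmetric] abs_mult)
    qed
    have "I j (\<lambda>s. \<bar>?E s - ?E (real j)\<bar>) \<le> (LINT s|lborel. indicator {real j - 1<..<real j - 1 + 1} s * (ml_kernel_lip \<alpha> * real (j - 1) powr (\<alpha> - 2)))"
      unfolding I_def
    proof (rule integral_mono[OF iE])
      show "integrable lborel (\<lambda>s. indicator {real j - 1<..<real j - 1 + 1} s * (ml_kernel_lip \<alpha> * real (j - 1) powr (\<alpha> - 2)))"
        by (intro integrable_mult_left integrable_real_indicator) auto
      fix s
      show "indicator {real j - 1<..<real j} s * \<bar>?E s - ?E (real j)\<bar> \<le> indicator {real j - 1<..<real j - 1 + 1} s * (ml_kernel_lip \<alpha> * real (j - 1) powr (\<alpha> - 2))"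
        using lip[OF that, of s] by (cases "real j - 1 < s \<and> s < real j") auto
    qed
    then show ?thesis unfolding LINT_unit_const .
  qed
  have Iabs: "I j (\<lambda>s. \<bar>?k s - 0\<bar>) = I j ?k"
    unfolding I_def using rl_kernel_nonneg[of "1 - \<alpha>"] \<alpha> by simp
  show "\<bar>\<rho>\<bar> \<le> 2 * (ml_kernel_lip \<alpha> * real (j - 1) powr (\<alpha> - 2)) * I j ?k" if "2 \<le> j"
  proof -
    have "\<bar>I j ?E * I j ?k - I j (\<lambda>s. ?E s * ?k s)\<bar> \<le> 2 * (ml_kernel_lip \<alpha> * real (j - 1) powr (\<alpha> - 2)) * I j (\<lambda>s. \<bar>?k s - 0\<bar>)"
      unfolding I_def
      by (rule covariance_bound[of "real j - 1" _ _ "?E (real j)", unfolded a, OF E k Ek lip[OF that]])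
    then show ?thesis unfolding Iabs \<rho>_def by (simp add: mult.commute)
  qed
  show "I j ?E \<le> 1 / Gamma (\<alpha> + 1)"
  proof -
    have "I j ?E = (LINT s|lborel. indicator {0<..<1} s * ?E (real (j - 1) + s))"
    proof -
      have "I j ?E = \<bar>1\<bar> *\<^sub>R (LINT s|lborel. indicator {real j - 1<..<real j} (real (j - 1) + 1 * s) * ?E (real (j - 1) + 1 * s))"
        unfolding I_def by (rule lborel_integral_real_affine) simp
      also have "\<dots> = (LINT s|lborel. indicator {0<..<1} s * ?E (real (j - 1) + s))"
        using j by (simp, intro Bochner_Integration.integral_cong) (auto simp: indicator_def of_nat_diff)
      finally show ?thesis .
    qed
    also have "\<dots> \<le> (LINT s|lborel. indicator {0<..<1} s * rl_kernel \<alpha> s)"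
    proof (rule integral_mono)
      have "integrable lborel (\<lambda>s. indicator {real j - 1<..<real j} (real (j - 1) + 1 * s) * ?E (real (j - 1) + 1 * s))"
        by (rule lborel_integrable_real_affine[OF E]) simp
      also have "(\<lambda>s. indicator {real j - 1<..<real j} (real (j - 1) + 1 * s) * ?E (real (j - 1) + 1 * s)) = (\<lambda>s. indicator {0<..<1} s * ?E (real (j - 1) + s))"
        using j by (auto simp: fun_eq_iff indicator_def of_nat_diff)
      finally show "integrable lborel (\<lambda>s. indicator {0<..<1} s * ?E (real (j - 1) + s))" .
      show "integrable lborel (\<lambda>s. indicator {0<..<1} s * rl_kernel \<alpha> s)" by (rule rl_kernel_integrable) (use \<alpha> in auto)
      show "indicator {0<..<1} s * ?E (real (j - 1) + s) \<le> indicator {0<..<1} s * rl_kernel \<alpha> s" for s :: real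
        using ml_kernel_le_rl[OF \<alpha> \<mu>, of "real (j - 1) + s"] rl_kernel_antimono[of \<alpha> s "real (j - 1) + s"] \<alpha>
        by (auto simp: indicator_def)
    qed
    also have "\<dots> = 1 / Gamma (\<alpha> + 1)" using rl_kernel_mass[of \<alpha> 1] \<alpha> by (simp add: rl_kernel_def)
    finally show ?thesis .
  qed
  show "0 \<le> I j ?E" unfolding I_def using nnE by (intro integral_nonneg_AE AE_I2) auto
  show "0 \<le> I j (\<lambda>s. ?k s * ?E s)"
  proof -
    have "0 \<le> indicator {real j - 1<..<real j} s * (?k s * ?E s)" for s
      using nnkE[of s] j by (auto simp: indicator_def split: if_splits)
    then show ?thesis unfolding I_def by (intro integral_nonneg_AE AE_I2) auto
  qed
  show "I j (\<lambda>s. ?k s * ?E s) \<le> 1"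
  proof -
    have "I j (\<lambda>s. ?k s * ?E s) \<le> (LINT s|lborel. indicator {0<..<real n} s * (?k s * ?E s))"
      unfolding I_def
    proof (rule integral_mono[OF kE fullkE])
      fix s show "indicator {real j - 1<..<real j} s * (?k s * ?E s) \<le> indicator {0<..<real n} s * (?k s * ?E s)"
        using nnkE[of s] j by (auto simp: indicator_def split: if_splits)
    qed
    also have "\<dots> \<le> 1"
      using ml_kernel_caputo[OF \<alpha> \<mu>, of "real n"] ml_primitive_nonneg[OF \<alpha> \<mu>, of "real n"] \<mu> j
      unfolding ml_primitive_def[symmetric] by (smt (verit) mult_nonneg_nonneg of_nat_0_less_iff less_le_trans zero_less_one)
    finally show ?thesis .
  qed
qed

text \<open>Differences of the two kernels decay like n^(-1-alpha) and n^(alpha-2), and q is the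
  smaller exponent. The first and the last cell have one regular factor each. The inner cells have
  two, and there \<open>sum_powr_conv\<close> keeps the decay because q > 1.\<close>

lemma L1_truncation:
  defines "q \<equiv> 1 + min \<alpha> (1 - \<alpha>)"
  shows "\<exists>C\<ge>0. \<forall>\<mu>\<ge>0. \<forall>n\<ge>1. \<bar>(\<Sum>j=1..n. weight_sum (L1_weight \<alpha>) (n - j) * (ml_primitive \<alpha> \<mu> (real j) - ml_primitive \<alpha> \<mu> (real (j - 1))))
    + \<mu> * ml_primitive \<alpha> \<mu> (real n) - 1\<bar> \<le> C * real n powr (- q)"
proof -
  define c where "c = \<alpha> / Gamma (1 - \<alpha>)"
  define M where "M = 1 / Gamma (\<alpha> + 1)"
  define L where "L = ml_kernel_lip \<alpha>"
  define b where "b = rl_cell \<alpha> 0"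
  have q: "1 < q" using \<alpha> by (simp add: q_def)
  have pos: "0 \<le> c" "0 \<le> M" "0 \<le> L" "0 \<le> b"
    using \<alpha> rl_cell_pos[OF \<alpha>, of 0] ml_kernel_lip_pos[OF \<alpha>(1)] Gamma_real_pos[of "1 - \<alpha>"] Gamma_real_pos[of "\<alpha> + 1"]
    by (auto simp: c_def M_def L_def b_def less_imp_le)
  define Z where "Z = 2 * 2 powr q * zeta_sum q"
  have Z: "0 \<le> Z" using zeta_sum_nonneg[OF q] by (simp add: Z_def)
  define C' where "C' = 2 * c * M + 2 * c * L * Z + 2 * L * b"
  have C': "0 \<le> C'" using pos Z by (simp add: C'_def)
  have pw: "real m powr (- \<alpha> - 1) \<le> real m powr (- q)" "real m powr (\<alpha> - 2) \<le> real m powr (- q)" for m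
    by (cases "m = 0"; auto simp: q_def intro!: powr_mono)+
  have "\<bar>(\<Sum>j=1..n. weight_sum (L1_weight \<alpha>) (n - j) * (ml_primitive \<alpha> \<mu> (real j) - ml_primitive \<alpha> \<mu> (real (j - 1))))
    + \<mu> * ml_primitive \<alpha> \<mu> (real n) - 1\<bar> \<le> (2 powr q * C' + (b * M + 1)) * real n powr (- q)"
    if \<mu>: "0 \<le> \<mu>" and n: "1 \<le> n" for \<mu> n
  proof -
    define I where "I j f = (LINT s|lborel. indicator {real j - 1<..<real j} s * f s)" for j :: nat and f :: "real \<Rightarrow> real"
    let ?k = "\<lambda>s. rl_kernel (1 - \<alpha>) (real n - s)" and ?E = "ml_kernel \<alpha> \<mu>"
    define \<rho> where "\<rho> j = I j ?k * I j ?E - I j (\<lambda>s. ?k s * ?E s)" for j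
    have Ik: "I j ?k = rl_cell \<alpha> (n - j)" if "1 \<le> j" "j \<le> n" for j
      unfolding I_def by (rule rl_cell_reflect(1)[OF \<alpha> that])
    note tb = L1_term_bound[OF \<mu>, folded I_def]
    have eq: "(\<Sum>j=1..n. weight_sum (L1_weight \<alpha>) (n - j) * (ml_primitive \<alpha> \<mu> (real j) - ml_primitive \<alpha> \<mu> (real (j - 1)))) + \<mu> * ml_primitive \<alpha> \<mu> (real n) - 1 = (\<Sum>j=1..n. \<rho> j)"
      unfolding \<rho>_def I_def by (rule L1_truncation_terms[OF \<mu> n])
    show ?thesis
    \<comment> \<open>For n = 1 the only cell contains both singularities, so its two contributions
      are bounded separately.\<close>
    proof (cases "n = 1")
      case True
      have "0 \<le> I 1 ?k * I 1 ?E" using Ik[of 1] True tb(6)[of 1 1] rl_cell_pos[OF \<alpha>, of 0] by simp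
      moreover have "I 1 ?k * I 1 ?E \<le> b * M"
        unfolding b_def M_def using Ik[of 1] True tb(4)[of 1 1] tb(6)[of 1 1] rl_cell_pos[OF \<alpha>, of 0] by (intro mult_mono) auto
      moreover have "0 \<le> I 1 (\<lambda>s. ?k s * ?E s)" "I 1 (\<lambda>s. ?k s * ?E s) \<le> 1" using tb(5)[of 1 n] tb(7)[of 1 n] True by simp_all
      ultimately have "\<bar>\<rho> 1\<bar> \<le> b * M + 1" unfolding \<rho>_def abs_le_iff by linarith
      also have "\<dots> \<le> 2 powr q * C' + (b * M + 1)" using C' by simp
      finally show ?thesis unfolding eq using True by simp
    next
      case False
      then have n2: "2 \<le> n" using n by simp
      have "{1..n} = insert 1 (insert n {2..n - 1})" using n2 by auto
      then have split: "(\<Sum>j=1..n. \<bar>\<rho> j\<bar>) = \<bar>\<rho> 1\<bar> + \<bar>\<rho> n\<bar> + (\<Sum>j=2..n - 1. \<bar>\<rho> j\<bar>)" using n2 by simp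
      let ?p = "real (n - 1) powr (- q)"
      have r1: "\<bar>\<rho> 1\<bar> \<le> 2 * c * M * ?p"
      proof -
        have "\<bar>\<rho> 1\<bar> \<le> 2 * (c * real (n - 1) powr (- \<alpha> - 1)) * I 1 (\<lambda>s. \<bar>?E s - 0\<bar>)"
          unfolding \<rho>_def c_def by (rule tb(1)) (use n2 in auto)
        also have "I 1 (\<lambda>s. \<bar>?E s - 0\<bar>) = I 1 ?E"
          unfolding I_def using ml_kernel_pos[OF \<alpha> \<mu>] by (intro Bochner_Integration.integral_cong) (auto simp: indicator_def abs_of_pos)
        also have "2 * (c * real (n - 1) powr (- \<alpha> - 1)) * I 1 ?E \<le> 2 * (c * ?p) * M"
          unfolding M_def using pos tb(4)[of 1 n] tb(6)[of 1 n] n2 by (intro mult_mono pw mult_left_mono) auto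
        finally show ?thesis by (simp add: mult_ac)
      qed
      have rn: "\<bar>\<rho> n\<bar> \<le> 2 * L * b * ?p"
      proof -
        have "\<bar>\<rho> n\<bar> \<le> 2 * (L * real (n - 1) powr (\<alpha> - 2)) * I n ?k"
          unfolding \<rho>_def L_def by (rule tb(3)) (use n2 in auto)
        also have "I n ?k = b" using Ik[of n] n2 by (simp add: b_def)
        also have "2 * (L * real (n - 1) powr (\<alpha> - 2)) * b \<le> 2 * (L * ?p) * b"
          using pos by (intro mult_right_mono mult_left_mono pw) auto
        finally show ?thesis by (simp add: mult_ac)
      qed
      have rj: "\<bar>\<rho> j\<bar> \<le> 2 * c * L * (real (j - 1) powr (- q) * real (n - j) powr (- q))" if j: "j \<in> {2..n - 1}" for j
      proof -
        have "\<bar>\<rho> j\<bar> \<le> 2 * (c * real (n - j) powr (- \<alpha> - 1)) * I j (\<lambda>s. \<bar>?E s - ?E (real j)\<bar>)"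
          unfolding \<rho>_def c_def by (rule tb(1)) (use j in auto)
        also have "\<dots> \<le> 2 * (c * real (n - j) powr (- \<alpha> - 1)) * (L * real (j - 1) powr (\<alpha> - 2))"
          unfolding L_def using pos j by (intro mult_left_mono tb(2)) auto
        also have "\<dots> \<le> 2 * (c * real (n - j) powr (- q)) * (L * real (j - 1) powr (- q))"
          using pos by (intro mult_mono mult_left_mono pw) auto
        finally show ?thesis by (simp add: mult_ac)
      qed
      have "(\<Sum>j=2..n - 1. \<bar>\<rho> j\<bar>) \<le> (\<Sum>j=2..n - 1. 2 * c * L * (real (j - 1) powr (- q) * real (n - j) powr (- q)))"
        by (rule sum_mono) (rule rj)
      also have "\<dots> = 2 * c * L * (\<Sum>j=2..n - 1. real (j - 1) powr (- q) * real (n - j) powr (- q))"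
        by (simp only: sum_distrib_left)
      also have "(\<Sum>j=2..n - 1. real (j - 1) powr (- q) * real (n - j) powr (- q)) = (\<Sum>i=1..n - 2. real i powr (- q) * real (n - 2 + 1 - i) powr (- q))"
        by (rule sum.reindex_bij_witness[of _ "\<lambda>i. i + 1" "\<lambda>j. j - 1"]) (use n2 in auto)
      also have "2 * c * L * \<dots> \<le> 2 * c * L * (Z * real (n - 2 + 1) powr (- q))"
        unfolding Z_def using pos q by (intro mult_left_mono sum_powr_conv) auto
      also have "n - 2 + 1 = n - 1" using n2 by simp
      finally have rs: "(\<Sum>j=2..n - 1. \<bar>\<rho> j\<bar>) \<le> 2 * c * L * (Z * ?p)" .
      have "\<bar>\<Sum>j=1..n. \<rho> j\<bar> \<le> (\<Sum>j=1..n. \<bar>\<rho> j\<bar>)" by (rule sum_abs)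
      also have "\<dots> \<le> C' * ?p" unfolding split C'_def using r1 rn rs by (simp add: algebra_simps)
      also have "\<dots> \<le> C' * (2 powr q * real n powr (- q))"
        using C' n2 q by (intro mult_left_mono powr_shift_le) auto
      also have "\<dots> \<le> (2 powr q * C' + (b * M + 1)) * real n powr (- q)"
        using pos by (simp add: algebra_simps)
      finally show ?thesis unfolding eq .
    qed
  qed
  then show ?thesis using C' pos by (intro exI[of _ "2 powr q * C' + (b * M + 1)"]) (auto intro!: add_nonneg_nonneg mult_nonneg_nonneg)
qed

text \<open>The primitive solves the scheme with right-hand side 1 plus the truncation error.
  Applied to 1 the resolvent gives \<open>resolvent_sum\<close>; applied to the error it gives a
  convolution of n^(alpha-1) with n^(-q), in which the slower decay survives.\<close>

lemma L1_error:
  "\<exists>C\<ge>0. \<forall>\<mu>\<ge>0. \<forall>n\<ge>1. \<bar>ml_primitive \<alpha> \<mu> (real n) - resolvent_sum (L1_weight \<alpha>) \<mu> n\<bar> \<le> C * real n powr (\<alpha> - 1)"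
proof -
  define q where "q = 1 + min \<alpha> (1 - \<alpha>)"
  have q: "1 < q" "0 \<le> 1 - \<alpha>" "1 - \<alpha> \<le> q" using \<alpha> by (auto simp: q_def)
  let ?tr = "\<lambda>\<mu> n. (\<Sum>j=1..n. weight_sum (L1_weight \<alpha>) (n - j) * (ml_primitive \<alpha> \<mu> (real j) - ml_primitive \<alpha> \<mu> (real (j - 1)))) + \<mu> * ml_primitive \<alpha> \<mu> (real n) - 1"
  obtain C where C: "C \<ge> 0" "\<And>\<mu> n. 0 \<le> \<mu> \<Longrightarrow> 1 \<le> n \<Longrightarrow> \<bar>?tr \<mu> n\<bar> \<le> C * real n powr (- q)"
    using L1_truncation unfolding q_def by blast
  define D where "D = Gamma (1 - \<alpha>) * C * (2 * 2 powr (1 - \<alpha>) * zeta_sum q)"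
  have G: "0 \<le> Gamma (1 - \<alpha>)" using \<alpha> by (intro less_imp_le Gamma_real_pos) simp
  have D: "0 \<le> D" using G C zeta_sum_nonneg[OF q(1)] by (simp add: D_def)
  have "\<bar>ml_primitive \<alpha> \<mu> (real n) - resolvent_sum (L1_weight \<alpha>) \<mu> n\<bar> \<le> D * real n powr (\<alpha> - 1)" if \<mu>: "0 \<le> \<mu>" and n: "1 \<le> n" for \<mu> n
  proof -
    let ?d = "discrete_resolvent (L1_weight \<alpha>) \<mu>" and ?F = "\<lambda>n. ml_primitive \<alpha> \<mu> (real n)"
    have "?F n = (\<Sum>j\<le>n. ?d (n - j) * ((\<Sum>i\<le>j. L1_weight \<alpha> (j - i) * ?F i) + \<mu> * ?F j))"
      by (rule discrete_resolvent_conv_unique[where \<beta> = "L1_weight \<alpha>" and N = n and U = ?F, OF L1_weight_0_pos[OF \<alpha>] \<mu>]) auto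
    also have "\<dots> = (\<Sum>j=1..n. ?d (n - j) * (1 + ?tr \<mu> j))"
    proof (rule sum.mono_neutral_cong_right)
      show "\<forall>j\<in>{..n} - {1..n}. ?d (n - j) * ((\<Sum>i\<le>j. L1_weight \<alpha> (j - i) * ?F i) + \<mu> * ?F j) = 0"
        using \<alpha> by (auto simp: Suc_le_eq)
      fix j
      show "?d (n - j) * ((\<Sum>i\<le>j. L1_weight \<alpha> (j - i) * ?F i) + \<mu> * ?F j) = ?d (n - j) * (1 + ?tr \<mu> j)"
        using \<alpha> by (subst sum_by_parts_bsum) auto
    qed auto
    also have "\<dots> = resolvent_sum (L1_weight \<alpha>) \<mu> n + (\<Sum>j=1..n. ?d (n - j) * ?tr \<mu> j)"
      unfolding resolvent_sum_alt by (simp only: distrib_left sum.distrib mult_1_right)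
    finally have "\<bar>?F n - resolvent_sum (L1_weight \<alpha>) \<mu> n\<bar> = \<bar>\<Sum>j=1..n. ?d (n - j) * ?tr \<mu> j\<bar>" by simp
    also have "\<dots> \<le> (\<Sum>j=1..n. \<bar>?d (n - j) * ?tr \<mu> j\<bar>)" by (rule sum_abs)
    also have "\<dots> \<le> (\<Sum>j=1..n. (Gamma (1 - \<alpha>) * C) * (real j powr (- q) * real (n + 1 - j) powr (- (1 - \<alpha>))))"
    proof (rule sum_mono)
      fix j assume j: "j \<in> {1..n}"
      have "\<bar>?d (n - j) * ?tr \<mu> j\<bar> \<le> (Gamma (1 - \<alpha>) * real (n - j + 1) powr (\<alpha> - 1)) * (C * real j powr (- q))"
        unfolding abs_mult using L1_dker[OF \<alpha> \<mu>, of "n - j"] j \<mu> C G by (intro mult_mono C(2)) auto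
      also have "n - j + 1 = n + 1 - j" using j by auto
      finally show "\<bar>?d (n - j) * ?tr \<mu> j\<bar> \<le> (Gamma (1 - \<alpha>) * C) * (real j powr (- q) * real (n + 1 - j) powr (- (1 - \<alpha>)))"
        by (simp add: mult_ac)
    qed
    also have "\<dots> = (Gamma (1 - \<alpha>) * C) * (\<Sum>j=1..n. real j powr (- q) * real (n + 1 - j) powr (- (1 - \<alpha>)))"
      by (simp only: sum_distrib_left)
    also have "\<dots> \<le> (Gamma (1 - \<alpha>) * C) * (2 * 2 powr (1 - \<alpha>) * zeta_sum q * real (n + 1) powr (- (1 - \<alpha>)))"
      using C G by (intro mult_left_mono sum_powr_conv q) auto
    also have "\<dots> = D * real (n + 1) powr (\<alpha> - 1)" by (simp add: D_def)
    also have "\<dots> \<le> D * real n powr (\<alpha> - 1)"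
      using D n \<alpha> by (intro mult_left_mono powr_mono2') auto
    finally show ?thesis .
  qed
  with D show ?thesis by blast
qed

end

section \<open>Backward Euler convolution quadrature\<close>

text \<open>For fixed s these are the Poisson probabilities with mean s; for fixed n they form the
  density in s of the Gamma distribution with shape n + 1.\<close>

definition poisson :: "nat \<Rightarrow> real \<Rightarrow> real" where
  "poisson n s = s ^ n * exp (- s) / fact n"

lemma poisson_measurable [measurable]: "poisson n \<in> borel_measurable borel"
  unfolding poisson_def[abs_def] by measurable

lemma poisson_nonneg: "0 \<le> s \<Longrightarrow> 0 \<le> poisson n s"
  by (simp add: poisson_def)

lemma poisson_add: "poisson n (x + y) = (\<Sum>i\<le>n. poisson i x * poisson (n - i) y)"
proof -
  have "poisson n (x + y) = (\<Sum>i\<le>n. real (n choose i) * x ^ i * y ^ (n - i)) * (exp (- x) * exp (- y)) / fact n"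
    by (simp add: poisson_def binomial_ring exp_add[symmetric])
  also have "\<dots> = (\<Sum>i\<le>n. poisson i x * poisson (n - i) y)"
    unfolding sum_distrib_right sum_divide_distrib
    by (rule sum.cong) (auto simp: poisson_def binomial_fact)
  finally show ?thesis .
qed

text \<open>Reduces the moments of the Gamma density to total masses.\<close>

lemma poisson_times: "s * poisson n s = real (Suc n) * poisson (Suc n) s"
  by (simp add: poisson_def field_simps del: of_nat_Suc)

lemma nn_integral_poisson: "(\<integral>\<^sup>+s. pos (poisson n) s \<partial>lborel) = 1"
proof -
  have "(\<integral>\<^sup>+s. pos (poisson n) s \<partial>lborel) = (\<integral>\<^sup>+s. ennreal (1 / fact n) * (ennreal (s ^ n * exp (- s)) * indicator {0..} s) \<partial>lborel)"
  proof (rule nn_integral_cong_AE, use AE_lborel_singleton[of "0::real"] in eventually_elim)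
    fix s :: real assume "s \<noteq> 0"
    then show "pos (poisson n) s = ennreal (1 / fact n) * (ennreal (s ^ n * exp (- s)) * indicator {0..} s)"
      by (auto simp: pos_def poisson_def indicator_def ennreal_mult'[symmetric])
  qed
  also have "\<dots> = ennreal (1 / fact n) * ennreal (fact n)"
    by (subst nn_integral_cmult) (auto simp: nn_intergal_power_times_exp_Ici)
  also have "\<dots> = 1" by (simp add: ennreal_mult'[symmetric])
  finally show ?thesis .
qed

lemma poisson_has_integral: "has_bochner_integral lborel (\<lambda>s. indicator {0<..} s * poisson n s) 1"
proof (rule has_bochner_integral_nn_integral)
  have "(\<integral>\<^sup>+s. ennreal (indicator {0<..} s * poisson n s) \<partial>lborel) = (\<integral>\<^sup>+s. pos (poisson n) s \<partial>lborel)"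
    by (rule nn_integral_cong) (auto simp: pos_def indicator_def)
  then show "(\<integral>\<^sup>+s. ennreal (indicator {0<..} s * poisson n s) \<partial>lborel) = ennreal 1" by (simp add: nn_integral_poisson)
qed (auto intro!: AE_I2 poisson_nonneg simp: indicator_def)

text \<open>Sampling at a Gamma-distributed time turns continuous convolution into the Cauchy product.\<close>

definition poisson_sample :: "(real \<Rightarrow> ennreal) \<Rightarrow> nat \<Rightarrow> ennreal" where
  "poisson_sample u n = (\<integral>\<^sup>+s. u s * ennreal (poisson n s) \<partial>lborel)"

text \<open>By \<open>poisson_add\<close> the probabilities at q + r are the Cauchy product of those
  at q and at r; the rest is Tonelli's theorem and a shift of the variable.\<close>

lemma poisson_sample_nnconv:
  assumes "causal u" "causal v"
  shows "poisson_sample (nnconv u v) n = (\<Sum>i\<le>n. poisson_sample u i * poisson_sample v (n - i))"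
proof -
  have [measurable]: "u \<in> borel_measurable borel" "v \<in> borel_measurable borel"
    using assms by (auto simp: causal_def)
  have "poisson_sample (nnconv u v) n = (\<integral>\<^sup>+s. (\<integral>\<^sup>+r. u (s - r) * v r * ennreal (poisson n s) \<partial>lborel) \<partial>lborel)"
    unfolding poisson_sample_def nnconv_def by (simp add: nn_integral_multc)
  also have "\<dots> = (\<integral>\<^sup>+r. (\<integral>\<^sup>+s. u (s - r) * v r * ennreal (poisson n s) \<partial>lborel) \<partial>lborel)"
    by (rule lborel_pair.Fubini') measurable
  also have "\<dots> = (\<integral>\<^sup>+r. (\<integral>\<^sup>+q. u q * v r * ennreal (poisson n (q + r)) \<partial>lborel) \<partial>lborel)"
  proof (rule nn_integral_cong)
    fix r :: real
    show "(\<integral>\<^sup>+s. u (s - r) * v r * ennreal (poisson n s) \<partial>lborel) = (\<integral>\<^sup>+q. u q * v r * ennreal (poisson n (q + r)) \<partial>lborel)"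
      by (subst nn_integral_real_affine[where c = 1 and t = r]) (auto simp: add.commute)
  qed
  also have "\<dots> = (\<integral>\<^sup>+r. (\<integral>\<^sup>+q. (\<Sum>i\<le>n. (u q * ennreal (poisson i q)) * (v r * ennreal (poisson (n - i) r))) \<partial>lborel) \<partial>lborel)"
  proof (intro nn_integral_cong)
    fix q r :: real
    show "u q * v r * ennreal (poisson n (q + r)) = (\<Sum>i\<le>n. (u q * ennreal (poisson i q)) * (v r * ennreal (poisson (n - i) r)))"
    proof (cases "0 < q \<and> 0 < r")
      case True
      then have "ennreal (poisson n (q + r)) = (\<Sum>i\<le>n. ennreal (poisson i q) * ennreal (poisson (n - i) r))"
        unfolding poisson_add by (subst sum_ennreal[symmetric]) (auto simp: poisson_nonneg ennreal_mult)
      then show ?thesis by (simp add: sum_distrib_left mult_ac)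
    next
      case False
      then have "u q = 0 \<or> v r = 0" using assms by (auto simp: causal_def not_less)
      then show ?thesis by auto
    qed
  qed
  also have "\<dots> = (\<integral>\<^sup>+r. (\<Sum>i\<le>n. poisson_sample u i * (v r * ennreal (poisson (n - i) r))) \<partial>lborel)"
    unfolding poisson_sample_def by (simp add: nn_integral_sum nn_integral_multc)
  also have "\<dots> = (\<Sum>i\<le>n. poisson_sample u i * poisson_sample v (n - i))"
    unfolding poisson_sample_def by (simp add: nn_integral_sum nn_integral_cmult)
  finally show ?thesis .
qed

text \<open>The values are the coefficients of (1 - \<zeta>)^(-\<gamma>). This is the reason why
  backward Euler convolution quadrature is the same thing as sampling at a Gamma-distributed
  time.\<close>

lemma poisson_sample_rl:
  assumes "0 < \<gamma>"
  shows "poisson_sample (pos (rl_kernel \<gamma>)) n = ennreal (Gamma (real n + \<gamma>) / (Gamma \<gamma> * fact n))"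
proof -
  have "poisson_sample (pos (rl_kernel \<gamma>)) n = (\<integral>\<^sup>+s. ennreal (1 / (Gamma \<gamma> * fact n)) * ennreal (indicator {0..} s * s powr (real n + \<gamma> - 1) / exp s) \<partial>lborel)"
    unfolding poisson_sample_def
  proof (rule nn_integral_cong_AE, use AE_lborel_singleton[of "0::real"] in eventually_elim)
    fix s :: real assume s: "s \<noteq> 0"
    show "pos (rl_kernel \<gamma>) s * ennreal (poisson n s) = ennreal (1 / (Gamma \<gamma> * fact n)) * ennreal (indicator {0..} s * s powr (real n + \<gamma> - 1) / exp s)"
    proof (cases "0 < s")
      case True
      have "rl_kernel \<gamma> s * poisson n s = 1 / (Gamma \<gamma> * fact n) * (s powr (real n + \<gamma> - 1) / exp s)"
        using True by (simp add: rl_kernel_def poisson_def powr_realpow[symmetric] powr_add[symmetric] exp_minus field_simps add_ac)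
      then show ?thesis
        using True rl_kernel_nonneg[OF assms, of s] Gamma_real_pos[OF assms] by (simp add: pos_def[of _ s] ennreal_mult'[symmetric])
    next
      case False
      then show ?thesis using s by (simp add: pos_def[of _ s])
    qed
  qed
  also have "\<dots> = ennreal (1 / (Gamma \<gamma> * fact n)) * ennreal (Gamma (real n + \<gamma>))"
    using assms by (subst nn_integral_cmult) (auto simp: Gamma_conv_nn_integral_real)
  also have "\<dots> = ennreal (Gamma (real n + \<gamma>) / (Gamma \<gamma> * fact n))"
    using assms Gamma_real_pos[OF assms] by (simp add: ennreal_mult'[symmetric])
  finally show ?thesis .
qed

context
  fixes \<alpha> :: real
  assumes \<alpha>: "0 < \<alpha>" "\<alpha> < 1"
begin

text \<open>The weights are the coefficients of (1 - \<zeta>)^\<alpha>, so their partial sums are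
  those of (1 - \<zeta>)^(\<alpha>-1). The recursion determines a weight from its predecessor, and
  the sum needs the closed form of the weight; hence the joint induction.\<close>

lemma BE_bsum: "weight_sum (BE_weight \<alpha>) n = Gamma (real n + (1 - \<alpha>)) / (Gamma (1 - \<alpha>) * fact n)"
  and BE_weight_Suc: "BE_weight \<alpha> (Suc n) = - \<alpha> * (Gamma (real n + (1 - \<alpha>)) / (Gamma (1 - \<alpha>) * fact n)) / real (Suc n)"
proof (induction n)
  case 0
  have "0 < Gamma (1 - \<alpha>)" using \<alpha> by (intro Gamma_real_pos) simp
  then show "weight_sum (BE_weight \<alpha>) 0 = Gamma (real 0 + (1 - \<alpha>)) / (Gamma (1 - \<alpha>) * fact 0)"
    "BE_weight \<alpha> (Suc 0) = - \<alpha> * (Gamma (real 0 + (1 - \<alpha>)) / (Gamma (1 - \<alpha>) * fact 0)) / real (Suc 0)"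
    by (simp_all add: weight_sum_def)
next
  case (Suc n)
  define g where "g = Gamma (real n + (1 - \<alpha>)) / (Gamma (1 - \<alpha>) * fact n)"
  have Gs: "Gamma (real n + (1 - \<alpha>) + 1) = (real n + (1 - \<alpha>)) * Gamma (real n + (1 - \<alpha>))"
    using \<alpha> by (intro Gamma_plus1) (auto simp: nonpos_Ints_def)
  then have g1: "Gamma (real (Suc n) + (1 - \<alpha>)) / (Gamma (1 - \<alpha>) * fact (Suc n)) = g * (real (Suc n) - \<alpha>) / real (Suc n)"
  proof -
    have e: "real (Suc n) + (1 - \<alpha>) = real n + (1 - \<alpha>) + 1" "real (Suc n) - \<alpha> = real n + (1 - \<alpha>)" by simp_all
    show ?thesis unfolding e Gs g_def fact_Suc of_nat_mult by (simp add: mult_ac)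
  qed
  have "weight_sum (BE_weight \<alpha>) (Suc n) = g + - \<alpha> * g / real (Suc n)"
    using Suc by (simp only: weight_sum_def sum.atMost_Suc g_def)
  also have "\<dots> = g * (real (Suc n) - \<alpha>) / real (Suc n)" by (simp add: field_simps)
  finally show "weight_sum (BE_weight \<alpha>) (Suc n) = Gamma (real (Suc n) + (1 - \<alpha>)) / (Gamma (1 - \<alpha>) * fact (Suc n))"
    unfolding g1 .
  have "BE_weight \<alpha> (Suc (Suc n)) = - BE_weight \<alpha> (Suc n) * (\<alpha> - real (Suc (Suc n)) + 1) / real (Suc (Suc n))"
    by (rule BE_weight.simps)
  also have "BE_weight \<alpha> (Suc n) = - \<alpha> * g / real (Suc n)" using Suc by (simp only: g_def)
  also have "- (- \<alpha> * g / real (Suc n)) * (\<alpha> - real (Suc (Suc n)) + 1) / real (Suc (Suc n)) = - \<alpha> * (g * (real (Suc n) - \<alpha>) / real (Suc n)) / real (Suc (Suc n))"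
    by (simp add: field_simps)
  finally show "BE_weight \<alpha> (Suc (Suc n)) = - \<alpha> * (Gamma (real (Suc n) + (1 - \<alpha>)) / (Gamma (1 - \<alpha>) * fact (Suc n))) / real (Suc (Suc n))"
    unfolding g1 .
qed

lemma BE_bsum_pos: "0 < weight_sum (BE_weight \<alpha>) n"
  unfolding BE_bsum using \<alpha> by (auto intro!: divide_pos_pos mult_pos_pos Gamma_real_pos)

text \<open>Sampling \<open>nnconv_caputo\<close> produces the equation
  \<open>discrete_resolvent_bsum\<close>, whose solution is unique since its leading coefficient is
  positive. The resolvent inherits its sign from E.\<close>

lemma BE_smp:
  assumes \<mu>: "0 \<le> \<mu>"
  shows "poisson_sample (pos (ml_kernel \<alpha> \<mu>)) n = ennreal (discrete_resolvent (BE_weight \<alpha>) \<mu> n)" "0 \<le> discrete_resolvent (BE_weight \<alpha>) \<mu> n"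
proof -
  let ?E = "pos (ml_kernel \<alpha> \<mu>)" and ?b = "weight_sum (BE_weight \<alpha>)" and ?d = "discrete_resolvent (BE_weight \<alpha>) \<mu>"
  have caus: "causal ?E" "causal (pos (rl_kernel (1 - \<alpha>)))" "causal (pos (rl_kernel 1))"
    using causal_mlk[OF \<alpha> \<mu>] causal_pos_rl by auto
  then have [measurable]: "?E \<in> borel_measurable borel" "pos (rl_kernel (1 - \<alpha>)) \<in> borel_measurable borel" "pos (rl_kernel 1) \<in> borel_measurable borel"
    by (auto simp: causal_def)
  have bs: "poisson_sample (pos (rl_kernel (1 - \<alpha>))) i = ennreal (?b i)" for i
    using poisson_sample_rl[of "1 - \<alpha>" i] \<alpha> by (simp add: BE_bsum)
  have os: "poisson_sample (pos (rl_kernel 1)) i = 1" for i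
    using poisson_sample_rl[of 1 i] Gamma_fact[of i, where 'a = real] by (simp add: add.commute)
  have main: "(\<Sum>i\<le>n. ennreal (?b i + \<mu>) * poisson_sample ?E (n - i)) = 1" for n
  proof -
    have "1 = (\<integral>\<^sup>+s. (nnconv (pos (rl_kernel (1 - \<alpha>))) ?E s + ennreal \<mu> * nnconv (pos (rl_kernel 1)) ?E s) * ennreal (poisson n s) \<partial>lborel)"
      unfolding nn_integral_poisson[of n, symmetric]
    proof (rule nn_integral_cong)
      fix s :: real
      show "pos (poisson n) s = (nnconv (pos (rl_kernel (1 - \<alpha>))) ?E s + ennreal \<mu> * nnconv (pos (rl_kernel 1)) ?E s) * ennreal (poisson n s)"
      proof (cases "0 < s")
        case True
        then show ?thesis using nnconv_caputo[OF \<alpha> \<mu> True] by (simp add: pos_def[of _ s])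
      next
        case False
        then show ?thesis using causalD(2)[OF causal_nnconv[OF caus(2,1)], of s] causalD(2)[OF causal_nnconv[OF caus(3,1)], of s]
          by (simp add: pos_def[of _ s])
      qed
    qed
    also have "\<dots> = poisson_sample (nnconv (pos (rl_kernel (1 - \<alpha>))) ?E) n + ennreal \<mu> * poisson_sample (nnconv (pos (rl_kernel 1)) ?E) n"
      unfolding poisson_sample_def by (simp add: distrib_right nn_integral_add nn_integral_cmult mult.assoc)
    also have "\<dots> = (\<Sum>i\<le>n. ennreal (?b i) * poisson_sample ?E (n - i)) + ennreal \<mu> * (\<Sum>i\<le>n. poisson_sample ?E (n - i))"
      by (simp add: poisson_sample_nnconv caus bs os)
    also have "\<dots> = (\<Sum>i\<le>n. ennreal (?b i + \<mu>) * poisson_sample ?E (n - i))"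
      using \<mu> BE_bsum_pos by (simp add: sum_distrib_left sum.distrib[symmetric] distrib_right less_imp_le)
    finally show ?thesis by simp
  qed
  \<comment> \<open>Finiteness is read off from \<open>main\<close>, whose first summand is the
    sample times a positive number.\<close>
  have fin: "poisson_sample ?E n \<noteq> top" for n
  proof
    assume "poisson_sample ?E n = top"
    moreover have "ennreal (?b 0 + \<mu>) * poisson_sample ?E (n - 0) \<le> (\<Sum>i\<le>n. ennreal (?b i + \<mu>) * poisson_sample ?E (n - i))"
      by (rule member_le_sum) auto
    moreover have "ennreal (?b 0 + \<mu>) \<noteq> 0" using BE_bsum_pos[of 0] \<mu> by (simp add: ennreal_eq_0_iff)
    ultimately show False unfolding main by (simp add: ennreal_mult_top top_unique)
  qed
  define e where "e n = enn2real (poisson_sample ?E n)" for n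
  have e: "poisson_sample ?E n = ennreal (e n)" "0 \<le> e n" for n using fin[of n] by (auto simp: e_def less_top)
  have me: "(\<Sum>j\<le>n. e j * (?b (n - j) + \<mu>)) = 1" for n
  proof -
    have "ennreal (\<Sum>i\<le>n. (?b i + \<mu>) * e (n - i)) = 1"
      unfolding main[of n, symmetric] using e(2) BE_bsum_pos \<mu>
      by (subst sum_ennreal[symmetric]) (auto simp: e(1) ennreal_mult add_nonneg_nonneg less_imp_le intro!: mult_nonneg_nonneg)
    then have "(\<Sum>i\<le>n. (?b i + \<mu>) * e (n - i)) = 1" by simp
    moreover have "(\<Sum>i\<le>n. (?b i + \<mu>) * e (n - i)) = (\<Sum>j\<le>n. e j * (?b (n - j) + \<mu>))"
      by (rule sum.reindex_bij_witness[of _ "\<lambda>i. n - i" "\<lambda>i. n - i"]) auto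
    ultimately show ?thesis by simp
  qed
  have "e n = ?d n" for n
  proof (induction n rule: less_induct)
    case (less n)
    have "(\<Sum>j\<le>n. e j * (?b (n - j) + \<mu>)) = (\<Sum>j\<le>n. ?d j * (?b (n - j) + \<mu>))"
      unfolding me using discrete_resolvent_bsum[OF _ \<mu>, of "BE_weight \<alpha>" n] by simp
    moreover have "(\<Sum>j\<in>{..n} - {n}. e j * (?b (n - j) + \<mu>)) = (\<Sum>j\<in>{..n} - {n}. ?d j * (?b (n - j) + \<mu>))"
      using less by (intro sum.cong) auto
    ultimately have "e n * (?b 0 + \<mu>) = ?d n * (?b 0 + \<mu>)"
      by (simp add: sum.remove[of "{..n}" n])
    then show ?case using BE_bsum_pos[of 0] \<mu> by simp
  qed
  then show "poisson_sample ?E n = ennreal (?d n)" "0 \<le> ?d n" using e[of n] by auto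
qed

text \<open>Also the source of measurability: the primitive is read back from a convolution, which
  is known to be measurable.\<close>

lemma ml_primitive_nnconv:
  assumes \<mu>: "0 \<le> \<mu>"
  shows "nnconv (pos (rl_kernel 1)) (pos (ml_kernel \<alpha> \<mu>)) = pos (ml_primitive \<alpha> \<mu>)" "ml_primitive \<alpha> \<mu> \<in> borel_measurable borel"
proof -
  have "nnconv (pos (rl_kernel 1)) (pos (ml_kernel \<alpha> \<mu>)) t = pos (ml_primitive \<alpha> \<mu>) t" for t
  proof (cases "0 < t")
    case True
    have eq: "(LINT s|lborel. indicator {0<..<t} s * (rl_kernel 1 (t - s) * ml_kernel \<alpha> \<mu> s)) = ml_primitive \<alpha> \<mu> t"
      unfolding ml_primitive_def by (rule Bochner_Integration.integral_cong) (auto simp: rl_kernel_def indicator_def)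
    have "nnconv (pos (rl_kernel 1)) (pos (ml_kernel \<alpha> \<mu>)) t = ennreal (ml_primitive \<alpha> \<mu> t)"
      using nnconv_rl_mlk(1)[OF \<alpha> \<mu>, of 1 t] has_bochner_integral_integral_eq[OF ml_kernel_conv_integral[OF \<alpha>(1), of 1 t \<mu>]] True
      unfolding eq by simp
    then show ?thesis using True by (simp add: pos_def[of _ t])
  next
    case False
    then show ?thesis using causalD(2)[OF causal_nnconv[OF causal_pos_rl causal_mlk[OF \<alpha> \<mu>]], of t 1] by (simp add: pos_def[of _ t])
  qed
  then show eq: "nnconv (pos (rl_kernel 1)) (pos (ml_kernel \<alpha> \<mu>)) = pos (ml_primitive \<alpha> \<mu>)" by auto
  have "ml_primitive \<alpha> \<mu> = (\<lambda>t. enn2real (pos (ml_primitive \<alpha> \<mu>) t))"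
  proof
    fix t
    show "ml_primitive \<alpha> \<mu> t = enn2real (pos (ml_primitive \<alpha> \<mu>) t)"
    proof (cases "0 < t")
      case True
      then show ?thesis using ml_primitive_nonneg[OF \<alpha> \<mu>, of t] by (simp add: pos_def[of _ t])
    next
      case False
      then have "{0<..<t} = {}" by auto
      then have "ml_primitive \<alpha> \<mu> t = 0" by (simp add: ml_primitive_def)
      then show ?thesis by (simp add: pos_def[of _ t])
    qed
  qed
  moreover have "(\<lambda>t. enn2real (pos (ml_primitive \<alpha> \<mu>) t)) \<in> borel_measurable borel"
    unfolding eq[symmetric] using causal_nnconv[OF causal_pos_rl[of 1] causal_mlk[OF \<alpha> \<mu>]]
    by (intro measurable_compose[OF _ borel_measurable_enn2real]) (auto simp: causal_def)
  ultimately show "ml_primitive \<alpha> \<mu> \<in> borel_measurable borel" by simp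
qed

text \<open>The shift of the index matters: the density \<open>poisson n\<close> has mean n + 1,
  which is the time at which the sum is compared with the primitive.\<close>

lemma BE_wker:
  assumes \<mu>: "0 \<le> \<mu>"
  shows "poisson_sample (pos (ml_primitive \<alpha> \<mu>)) n = ennreal (resolvent_sum (BE_weight \<alpha>) \<mu> (Suc n))"
proof -
  have os: "poisson_sample (pos (rl_kernel 1)) i = 1" for i
    using poisson_sample_rl[of 1 i] Gamma_fact[of i, where 'a = real] by (simp add: add.commute)
  have "poisson_sample (pos (ml_primitive \<alpha> \<mu>)) n = (\<Sum>i\<le>n. poisson_sample (pos (rl_kernel 1)) i * poisson_sample (pos (ml_kernel \<alpha> \<mu>)) (n - i))"
    unfolding ml_primitive_nnconv(1)[OF \<mu>, symmetric] by (rule poisson_sample_nnconv[OF causal_pos_rl causal_mlk[OF \<alpha> \<mu>]])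
  also have "\<dots> = (\<Sum>i\<le>n. ennreal (discrete_resolvent (BE_weight \<alpha>) \<mu> (n - i)))" by (simp add: os BE_smp[OF \<mu>])
  also have "\<dots> = ennreal (\<Sum>i\<le>n. discrete_resolvent (BE_weight \<alpha>) \<mu> (n - i))" using BE_smp(2)[OF \<mu>] by simp
  also have "(\<Sum>i\<le>n. discrete_resolvent (BE_weight \<alpha>) \<mu> (n - i)) = resolvent_sum (BE_weight \<alpha>) \<mu> (Suc n)"
    unfolding resolvent_sum_def lessThan_Suc_atMost by (rule sum.reindex_bij_witness[of _ "\<lambda>i. n - i" "\<lambda>i. n - i"]) auto
  finally show ?thesis .
qed

section \<open>Second-order expansion and the backward Euler error\<close>

text \<open>For s \<ge> x/2 the Lipschitz bound of E is integrated between s and x. For s < x/2 no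
  cancellation is used: the increment of the primitive and the linear term are both O(x^alpha),
  which (s - x)^2 dominates because |s - x| exceeds x/2.\<close>

lemma ml_primitive_taylor:
  "\<exists>C\<ge>0. \<forall>\<mu>\<ge>0. \<forall>x>0. \<forall>s>0. \<bar>ml_primitive \<alpha> \<mu> s - ml_primitive \<alpha> \<mu> x - ml_kernel \<alpha> \<mu> x * (s - x)\<bar> \<le> C * x powr (\<alpha> - 2) * (s - x)\<^sup>2"
proof -
  define L where "L = ml_kernel_lip \<alpha>"
  have L: "0 < L" using ml_kernel_lip_pos[OF \<alpha>(1)] by (simp add: L_def)
  \<comment> \<open>The factor 2^(2-alpha) arises from evaluating the Lipschitz bound at x/2, the
    factor 4 from x^2 \<le> 4 (s - x)^2.\<close>
  define C where "C = L * 2 powr (2 - \<alpha>) + 4 * (1 / Gamma (\<alpha> + 1) + 1 / Gamma \<alpha>)"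
  have G: "0 < Gamma \<alpha>" "0 < Gamma (\<alpha> + 1)" using \<alpha> by (auto intro!: Gamma_real_pos)
  have "\<bar>ml_primitive \<alpha> \<mu> s - ml_primitive \<alpha> \<mu> x - ml_kernel \<alpha> \<mu> x * (s - x)\<bar> \<le> C * x powr (\<alpha> - 2) * (s - x)\<^sup>2"
    if \<mu>: "0 \<le> \<mu>" and x: "0 < x" and s: "0 < s" for \<mu> x s
  proof (cases "x / 2 \<le> s")
    case True
    define a where "a = min x s"
    define b where "b = max x s"
    define B where "B = L * (x / 2) powr (\<alpha> - 2) * \<bar>s - x\<bar>"
    have ab: "0 < a" "a \<le> b" "x / 2 \<le> a" using x s True by (auto simp: a_def b_def)
    have E: "\<bar>ml_kernel \<alpha> \<mu> r - ml_kernel \<alpha> \<mu> x\<bar> \<le> B" if "a < r" "r < b" for r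
    proof -
      have r: "x / 2 \<le> min r x" "0 < min r x" using that ab x by auto
      have "\<bar>ml_kernel \<alpha> \<mu> r - ml_kernel \<alpha> \<mu> x\<bar> \<le> L * min r x powr (\<alpha> - 2) * \<bar>r - x\<bar>"
        using ml_kernel_lipschitz[OF \<alpha> \<mu>, of r x] ml_kernel_lipschitz[OF \<alpha> \<mu>, of x r] r x that s unfolding L_def
        by (cases "r \<le> x") (auto simp: abs_minus_commute min_def)
      also have "\<dots> \<le> L * (x / 2) powr (\<alpha> - 2) * \<bar>s - x\<bar>"
        using L r x \<alpha> that by (intro mult_mono powr_mono2' mult_left_mono) (auto simp: a_def b_def min_def max_def split: if_splits)
      finally show ?thesis unfolding B_def .
    qed
    have i: "integrable lborel (\<lambda>r. indicator {a<..<b} r * ml_kernel \<alpha> \<mu> r)"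
      by (rule integrable_indicator_subset[OF ml_kernel_integrable[OF \<alpha> \<mu>, of b]]) (use ab in auto)
    have ic: "integrable lborel (\<lambda>r. indicator {a<..<b} r * c)" for c :: real
      by (intro integrable_mult_left integrable_real_indicator) (use ab in auto)
    have Ic: "(LINT r|lborel. indicator {a<..<b} r * c) = (b - a) * c" for c :: real
      using ab by simp
    have e1: "(ml_primitive \<alpha> \<mu> b - ml_primitive \<alpha> \<mu> a) - (b - a) * ml_kernel \<alpha> \<mu> x = (LINT r|lborel. indicator {a<..<b} r * ml_kernel \<alpha> \<mu> r - indicator {a<..<b} r * ml_kernel \<alpha> \<mu> x)"
      using ml_primitive_diff[OF \<alpha> \<mu>, of a b] ab i ic Ic by (subst Bochner_Integration.integral_diff) auto
    have "\<bar>(ml_primitive \<alpha> \<mu> b - ml_primitive \<alpha> \<mu> a) - (b - a) * ml_kernel \<alpha> \<mu> x\<bar> \<le> (LINT r|lborel. norm (indicator {a<..<b} r * ml_kernel \<alpha> \<mu> r - indicator {a<..<b} r * ml_kernel \<alpha> \<mu> x))"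
      unfolding e1 real_norm_def by (rule integral_abs_bound)
    also have "\<dots> \<le> (LINT r|lborel. indicator {a<..<b} r * B)"
    proof (rule integral_mono)
      show "integrable lborel (\<lambda>r. norm (indicator {a<..<b} r * ml_kernel \<alpha> \<mu> r - indicator {a<..<b} r * ml_kernel \<alpha> \<mu> x))"
        by (intro integrable_norm Bochner_Integration.integrable_diff i ic)
      show "norm (indicator {a<..<b} r * ml_kernel \<alpha> \<mu> r - indicator {a<..<b} r * ml_kernel \<alpha> \<mu> x) \<le> indicator {a<..<b} r * B" for r
      proof (cases "r \<in> {a<..<b}")
        case True
        then show ?thesis using E[of r] by simp
      qed simp
    qed (rule ic)
    also have "\<dots> = (b - a) * B" by (rule Ic)
    also have "(b - a) * B = L * (x / 2) powr (\<alpha> - 2) * (s - x)\<^sup>2"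
    proof -
      have "(b - a) = \<bar>s - x\<bar>" by (auto simp: a_def b_def)
      then show ?thesis by (simp add: B_def power2_eq_square abs_mult_self_eq mult.assoc mult.left_commute)
    qed
    finally have "\<bar>(ml_primitive \<alpha> \<mu> b - ml_primitive \<alpha> \<mu> a) - (b - a) * ml_kernel \<alpha> \<mu> x\<bar> \<le> L * (x / 2) powr (\<alpha> - 2) * (s - x)\<^sup>2" .
    moreover have "\<bar>(ml_primitive \<alpha> \<mu> b - ml_primitive \<alpha> \<mu> a) - (b - a) * ml_kernel \<alpha> \<mu> x\<bar> = \<bar>ml_primitive \<alpha> \<mu> s - ml_primitive \<alpha> \<mu> x - ml_kernel \<alpha> \<mu> x * (s - x)\<bar>"
      by (cases "x \<le> s") (simp_all add: a_def b_def min_def max_def left_diff_distrib right_diff_distrib mult.commute abs_minus_commute)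
    moreover have "(x / 2) powr (\<alpha> - 2) = 2 powr (2 - \<alpha>) * x powr (\<alpha> - 2)"
      using x by (simp add: powr_divide powr_diff field_simps)
    moreover have "L * 2 powr (2 - \<alpha>) \<le> C" using G by (simp add: C_def)
    then have "L * 2 powr (2 - \<alpha>) * (x powr (\<alpha> - 2) * (s - x)\<^sup>2) \<le> C * (x powr (\<alpha> - 2) * (s - x)\<^sup>2)"
      by (rule mult_right_mono) simp
    ultimately show ?thesis by (simp add: mult.assoc)
  next
    case False
    have pw: "x powr \<alpha> = x powr (\<alpha> - 2) * x\<^sup>2" using x by (simp add: powr_diff)
    have "\<bar>ml_primitive \<alpha> \<mu> s - ml_primitive \<alpha> \<mu> x\<bar> \<le> x powr \<alpha> / Gamma (\<alpha> + 1)"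
    proof -
      have "0 \<le> ml_primitive \<alpha> \<mu> x - ml_primitive \<alpha> \<mu> s"
        using ml_primitive_diff[OF \<alpha> \<mu>, of s x] False s x ml_kernel_pos[OF \<alpha> \<mu>]
        by (auto intro!: integral_nonneg_AE AE_I2 simp: indicator_def less_imp_le)
      moreover have "ml_primitive \<alpha> \<mu> x \<le> x powr \<alpha> / Gamma (\<alpha> + 1)" using ml_primitive_le[OF \<alpha> \<mu>, of x] x by (simp add: rl_kernel_def)
      ultimately show ?thesis using ml_primitive_nonneg[OF \<alpha> \<mu>, of s] by simp
    qed
    moreover have "\<bar>ml_kernel \<alpha> \<mu> x * (s - x)\<bar> \<le> x powr \<alpha> / Gamma \<alpha>"
    proof -
      have "\<bar>ml_kernel \<alpha> \<mu> x * (s - x)\<bar> \<le> rl_kernel \<alpha> x * x"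
        unfolding abs_mult using ml_kernel_pos[OF \<alpha> \<mu> x] ml_kernel_le_rl[OF \<alpha> \<mu> x] False s x by (intro mult_mono) auto
      also have "\<dots> = x powr \<alpha> / Gamma \<alpha>" using x powr_diff[of x \<alpha> 1] by (simp add: rl_kernel_def)
      finally show ?thesis .
    qed
    ultimately have "\<bar>ml_primitive \<alpha> \<mu> s - ml_primitive \<alpha> \<mu> x - ml_kernel \<alpha> \<mu> x * (s - x)\<bar> \<le> (1 / Gamma (\<alpha> + 1) + 1 / Gamma \<alpha>) * x powr \<alpha>"
      by (simp add: algebra_simps)
    also have "\<dots> \<le> (1 / Gamma (\<alpha> + 1) + 1 / Gamma \<alpha>) * (x powr (\<alpha> - 2) * (4 * (s - x)\<^sup>2))"
    proof -
      have "(x / 2)\<^sup>2 \<le> (x - s)\<^sup>2" using False x s by (intro power_mono) auto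
      then have "x\<^sup>2 \<le> 4 * (s - x)\<^sup>2" by (simp add: power2_commute power_divide)
      then show ?thesis unfolding pw using G by (intro mult_left_mono) auto
    qed
    also have "\<dots> = (4 * (1 / Gamma (\<alpha> + 1) + 1 / Gamma \<alpha>)) * (x powr (\<alpha> - 2) * (s - x)\<^sup>2)" by simp
    also have "\<dots> \<le> C * (x powr (\<alpha> - 2) * (s - x)\<^sup>2)" using L by (intro mult_right_mono) (auto simp: C_def)
    finally show ?thesis by (simp add: mult.assoc)
  qed
  moreover have "0 \<le> C" using L G by (simp add: C_def)
  ultimately show ?thesis by blast
qed

lemma BE_error:
  "\<exists>C\<ge>0. \<forall>\<mu>\<ge>0. \<forall>n\<ge>1. \<bar>ml_primitive \<alpha> \<mu> (real n) - resolvent_sum (BE_weight \<alpha>) \<mu> n\<bar> \<le> C * real n powr (\<alpha> - 1)"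
proof -
  obtain C where C: "C \<ge> 0" "\<And>\<mu> x s. 0 \<le> \<mu> \<Longrightarrow> 0 < x \<Longrightarrow> 0 < s \<Longrightarrow> \<bar>ml_primitive \<alpha> \<mu> s - ml_primitive \<alpha> \<mu> x - ml_kernel \<alpha> \<mu> x * (s - x)\<bar> \<le> C * x powr (\<alpha> - 2) * (s - x)\<^sup>2"
    using ml_primitive_taylor by blast
  have "\<bar>ml_primitive \<alpha> \<mu> (real n) - resolvent_sum (BE_weight \<alpha>) \<mu> n\<bar> \<le> C * real n powr (\<alpha> - 1)" if \<mu>: "0 \<le> \<mu>" and n: "1 \<le> n" for \<mu> n
  proof -
    obtain m where m: "n = Suc m" using n by (cases n) auto
    let ?F = "ml_primitive \<alpha> \<mu>" and ?E = "ml_kernel \<alpha> \<mu>" and ?w = "resolvent_sum (BE_weight \<alpha>) \<mu> n" and ?p = "\<lambda>s. indicator {0<..} s * poisson m s"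
    note [measurable] = ml_primitive_nnconv(2)[OF \<mu>]
    have w: "0 \<le> ?w" unfolding resolvent_sum_def using BE_smp(2)[OF \<mu>] by (intro sum_nonneg) auto
    have "has_bochner_integral lborel (\<lambda>s. ?p s * ?F s) ?w"
    proof (rule has_bochner_integral_nn_integral)
      have "(\<integral>\<^sup>+s. ennreal (?p s * ?F s) \<partial>lborel) = poisson_sample (pos ?F) m"
        unfolding poisson_sample_def using ml_primitive_nonneg[OF \<alpha> \<mu>]
        by (intro nn_integral_cong) (auto simp: pos_def[of ?F] indicator_def ennreal_mult poisson_nonneg mult.commute)
      then show "(\<integral>\<^sup>+s. ennreal (?p s * ?F s) \<partial>lborel) = ennreal ?w" using BE_wker[OF \<mu>, of m] m by simp
    qed (use w ml_primitive_nonneg[OF \<alpha> \<mu>] in \<open>auto intro!: AE_I2 mult_nonneg_nonneg simp: indicator_def poisson_nonneg\<close>)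
    note h0 = this
    note p0 = poisson_has_integral[of m]
    have p1: "has_bochner_integral lborel (\<lambda>s. ?p s * s) (real n)"
    proof -
      have "?p s * s = real n * (indicator {0<..} s * poisson (Suc m) s)" for s
      proof -
        have "?p s * s = indicator {0<..} s * (s * poisson m s)" by (simp only: mult_ac)
        also have "\<dots> = real n * (indicator {0<..} s * poisson (Suc m) s)" unfolding poisson_times m by (simp only: mult_ac)
        finally show ?thesis .
      qed
      then have "(\<lambda>s. ?p s * s) = (\<lambda>s. real n * (indicator {0<..} s * poisson (Suc m) s))" by (rule ext)
      then show ?thesis using has_bochner_integral_mult_right[OF poisson_has_integral[of "Suc m"], of "real n"] by (simp only: mult_1_right)
    qed
    have p2: "has_bochner_integral lborel (\<lambda>s. ?p s * s\<^sup>2) (real n * (real n + 1))"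
    proof -
      have "?p s * s\<^sup>2 = (real n * (real n + 1)) * (indicator {0<..} s * poisson (Suc (Suc m)) s)" for s
      proof -
        have "s\<^sup>2 * poisson m s = s * (s * poisson m s)" by (simp add: power2_eq_square)
        also have "\<dots> = real (Suc m) * (s * poisson (Suc m) s)" unfolding poisson_times[of s m] by (rule mult.left_commute)
        also have "\<dots> = real (Suc m) * (real (Suc (Suc m)) * poisson (Suc (Suc m)) s)" unfolding poisson_times[of s "Suc m"] by (rule refl)
        finally show ?thesis by (simp add: m mult_ac)
      qed
      then have "(\<lambda>s. ?p s * s\<^sup>2) = (\<lambda>s. (real n * (real n + 1)) * (indicator {0<..} s * poisson (Suc (Suc m)) s))" by (rule ext)
      then show ?thesis using has_bochner_integral_mult_right[OF poisson_has_integral[of "Suc (Suc m)"], of "real n * (real n + 1)"] by (simp only: mult_1_right)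
    qed
    have var: "has_bochner_integral lborel (\<lambda>s. C * real n powr (\<alpha> - 2) * (?p s * (s - real n)\<^sup>2)) (C * real n powr (\<alpha> - 2) * real n)"
    proof -
      have "has_bochner_integral lborel (\<lambda>s. ?p s * s\<^sup>2 - (2 * real n) * (?p s * s) + (real n)\<^sup>2 * ?p s) (real n * (real n + 1) - (2 * real n) * real n + (real n)\<^sup>2 * 1)"
        by (intro has_bochner_integral_add has_bochner_integral_diff has_bochner_integral_mult_right p0 p1 p2)
      moreover have "(\<lambda>s. ?p s * s\<^sup>2 - (2 * real n) * (?p s * s) + (real n)\<^sup>2 * ?p s) = (\<lambda>s. ?p s * (s - real n)\<^sup>2)"
        by (simp add: fun_eq_iff power2_diff algebra_simps)
      moreover have "real n * (real n + 1) - (2 * real n) * real n + (real n)\<^sup>2 * 1 = real n"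
        by (simp add: power2_eq_square algebra_simps)
      ultimately have "has_bochner_integral lborel (\<lambda>s. ?p s * (s - real n)\<^sup>2) (real n)" by simp
      then show ?thesis by (rule has_bochner_integral_mult_right)
    qed
    \<comment> \<open>The density times the Taylor remainder at n. Its first-order term integrates
      to 0 because the mean is n, and the variance n turns n^(alpha-2) into n^(alpha-1).\<close>
    let ?g = "\<lambda>s. ?p s * ?F s - ?F (real n) * ?p s - ?E (real n) * (?p s * s) + ?E (real n) * real n * ?p s"
    have d: "has_bochner_integral lborel ?g (?w - ?F (real n) * 1 - ?E (real n) * real n + ?E (real n) * real n * 1)"
      by (intro has_bochner_integral_add has_bochner_integral_diff has_bochner_integral_mult_right h0 p0 p1)
    have "\<bar>?w - ?F (real n)\<bar> = \<bar>LINT s|lborel. ?g s\<bar>"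
      using has_bochner_integral_integral_eq[OF d] by simp
    also have "\<dots> \<le> (LINT s|lborel. norm (?g s))" unfolding real_norm_def by (rule integral_abs_bound)
    also have "\<dots> \<le> (LINT s|lborel. C * real n powr (\<alpha> - 2) * (?p s * (s - real n)\<^sup>2))"
    proof (rule integral_mono)
      show "norm (?g s) \<le> C * real n powr (\<alpha> - 2) * (?p s * (s - real n)\<^sup>2)" for s
      proof (cases "0 < s")
        case True
        have "?g s = poisson m s * (?F s - ?F (real n) - ?E (real n) * (s - real n))" using True by (simp add: algebra_simps)
        then have "norm (?g s) = poisson m s * \<bar>?F s - ?F (real n) - ?E (real n) * (s - real n)\<bar>"
          using poisson_nonneg[of s m] True by (simp add: abs_mult)
        also have "\<dots> \<le> poisson m s * (C * real n powr (\<alpha> - 2) * (s - real n)\<^sup>2)"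
          using poisson_nonneg[of s m] True n by (intro mult_left_mono C(2)[OF \<mu>]) auto
        finally show ?thesis using True by (simp add: mult_ac)
      qed simp
    qed (use integrable.intros[OF d] integrable.intros[OF var] in \<open>auto intro: integrable_norm\<close>)
    also have "\<dots> = C * real n powr (\<alpha> - 2) * real n" by (rule has_bochner_integral_integral_eq[OF var])
    also have "\<dots> = C * real n powr (\<alpha> - 1)" using n powr_add[of "real n" "\<alpha> - 2" 1] by simp
    finally show ?thesis by (simp add: abs_minus_commute)
  qed
  with C(1) show ?thesis by blast
qed

end

section \<open>Error representation and summation\<close>

lemma Cauchy_Schwarz_sum_le:
  fixes x y :: "'i \<Rightarrow> real"
  assumes "(\<Sum>i\<in>I. (y i)\<^sup>2) \<le> b\<^sup>2" "0 \<le> b"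
  shows "(\<Sum>i\<in>I. \<bar>x i\<bar> * \<bar>y i\<bar>) \<le> sqrt (\<Sum>i\<in>I. (x i)\<^sup>2) * b"
proof -
  have "(\<Sum>i\<in>I. \<bar>x i\<bar> * \<bar>y i\<bar>)\<^sup>2 \<le> (\<Sum>i\<in>I. \<bar>x i\<bar>\<^sup>2) * (\<Sum>i\<in>I. \<bar>y i\<bar>\<^sup>2)"
    by (rule Cauchy_Schwarz_ineq_sum)
  also have "\<dots> \<le> (\<Sum>i\<in>I. (x i)\<^sup>2) * b\<^sup>2"
    using assms by (simp add: mult_left_mono sum_nonneg)
  also have "\<dots> = (sqrt (\<Sum>i\<in>I. (x i)\<^sup>2) * b)\<^sup>2"
    by (simp add: power_mult_distrib sum_nonneg)
  finally show ?thesis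
    by (rule power2_le_imp_le) (use assms in \<open>auto intro!: mult_nonneg_nonneg sum_nonneg\<close>)
qed

context
  fixes \<alpha> :: real
  assumes \<alpha>: "0 < \<alpha>" "\<alpha> < 1"
begin

lemma ml_kernel_scale:
  assumes "0 < \<tau>" "0 < s"
  shows "\<tau> * ml_kernel \<alpha> \<kappa> (\<tau> * s) = \<tau> powr \<alpha> * ml_kernel \<alpha> (\<kappa> * \<tau> powr \<alpha>) s"
proof -
  have "\<tau> * \<tau> powr (\<alpha> - 1) = \<tau> powr \<alpha>" using assms powr_add[of \<tau> 1 "\<alpha> - 1"] by simp
  then show ?thesis using assms by (simp add: ml_kernel_def powr_mult mult_ac)
qed

lemma ml_primitive_scale:
  assumes "0 < \<tau>"
  shows "ml_primitive \<alpha> \<kappa> (x * \<tau>) = \<tau> powr \<alpha> * ml_primitive \<alpha> (\<kappa> * \<tau> powr \<alpha>) x"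
proof -
  have "ml_primitive \<alpha> \<kappa> (x * \<tau>) = \<bar>\<tau>\<bar> *\<^sub>R (LINT s|lborel. indicator {0<..<x * \<tau>} (0 + \<tau> * s) * ml_kernel \<alpha> \<kappa> (0 + \<tau> * s))"
    unfolding ml_primitive_def by (rule lborel_integral_real_affine) (use assms in auto)
  also have "\<dots> = (LINT s|lborel. \<tau> * (indicator {0<..<x * \<tau>} (0 + \<tau> * s) * ml_kernel \<alpha> \<kappa> (0 + \<tau> * s)))"
    using assms by simp
  also have "\<dots> = (LINT s|lborel. \<tau> powr \<alpha> * (indicator {0<..<x} s * ml_kernel \<alpha> (\<kappa> * \<tau> powr \<alpha>) s))"
  proof (rule Bochner_Integration.integral_cong)
    fix s
    show "\<tau> * (indicator {0<..<x * \<tau>} (0 + \<tau> * s) * ml_kernel \<alpha> \<kappa> (0 + \<tau> * s)) = \<tau> powr \<alpha> * (indicator {0<..<x} s * ml_kernel \<alpha> (\<kappa> * \<tau> powr \<alpha>) s)"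
      using assms ml_kernel_scale[of \<tau> s \<kappa>] by (auto simp: indicator_def zero_less_mult_iff mult.commute)
  qed simp
  also have "\<dots> = \<tau> powr \<alpha> * ml_primitive \<alpha> (\<kappa> * \<tau> powr \<alpha>) x" by (simp add: ml_primitive_def)
  finally show ?thesis .
qed

text \<open>With u = m/(m+1) this is the inequality u \<le> u^alpha on [0,1].\<close>

lemma powr_increment_le: "real (m + 1) powr \<alpha> - real m powr \<alpha> \<le> real (m + 1) powr (\<alpha> - 1)"
proof -
  define u where "u = real m / real (m + 1)"
  have u: "0 \<le> u" "u \<le> 1" by (auto simp: u_def)
  have "u \<le> u powr \<alpha>" using powr_mono'[of \<alpha> 1 u] u \<alpha> by simp
  then have "real (m + 1) powr \<alpha> * u \<le> real (m + 1) powr \<alpha> * u powr \<alpha>" by (intro mult_left_mono) auto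
  also have "\<dots> = real m powr \<alpha>" unfolding powr_mult[symmetric] by (simp add: u_def)
  finally have "real (m + 1) powr \<alpha> - real m powr \<alpha> \<le> real (m + 1) powr \<alpha> * (1 - u)" by (simp add: right_diff_distrib)
  also have "1 - u = 1 / real (m + 1)" by (simp add: u_def field_simps)
  also have "real (m + 1) powr \<alpha> * (1 / real (m + 1)) = real (m + 1) powr (\<alpha> - 1)"
    using powr_diff[of "real (m + 1)" \<alpha> 1] by simp
  finally show ?thesis .
qed

lemma rl_kernel_interval:
  assumes "0 < \<tau>" "1 \<le> j" "j \<le> n"
  shows "integrable lborel (\<lambda>s. indicator {real (j - 1) * \<tau><..<real j * \<tau>} s * rl_kernel \<alpha> (real n * \<tau> - s))"
    and "(LINT s|lborel. indicator {real (j - 1) * \<tau><..<real j * \<tau>} s * rl_kernel \<alpha> (real n * \<tau> - s)) \<le> 1 / Gamma (\<alpha> + 1) * \<tau> powr \<alpha> * real (n - j + 1) powr (\<alpha> - 1)"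
proof -
  define m where "m = n - j"
  have nm: "real n = real m + real j" "real (j - 1) = real j - 1" using assms by (auto simp: m_def)
  let ?i = "\<lambda>s. indicator {real (j - 1) * \<tau><..<real j * \<tau>} s * rl_kernel \<alpha> (real n * \<tau> - s)"
  have eq: "?i (real n * \<tau> + -1 * s) = indicator {real m * \<tau><..<real (m + 1) * \<tau>} s * rl_kernel \<alpha> s" for s
    unfolding nm by (auto simp: indicator_def algebra_simps)
  have i0: "integrable lborel (\<lambda>s. indicator {0<..<real (m + 1) * \<tau>} s * rl_kernel \<alpha> s)"
    by (rule rl_kernel_integrable) (use assms \<alpha> in \<open>auto intro!: mult_pos_pos simp del: of_nat_add\<close>)
  have i1: "integrable lborel (\<lambda>s. indicator {real m * \<tau><..<real (m + 1) * \<tau>} s * rl_kernel \<alpha> s)"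
  proof (rule integrable_indicator_subset[OF i0])
    have "0 \<le> real m * \<tau>" using assms by simp
    then show "{real m * \<tau><..<real (m + 1) * \<tau>} \<subseteq> {0<..<real (m + 1) * \<tau>}" by auto
  qed simp
  then have "integrable lborel (\<lambda>s. ?i (real n * \<tau> + -1 * s))" unfolding eq .
  then show "integrable lborel ?i" by (subst (asm) lborel_integrable_real_affine_iff) auto
  have "(LINT s|lborel. ?i s) = \<bar>-1\<bar> *\<^sub>R (LINT s|lborel. ?i (real n * \<tau> + -1 * s))"
    by (rule lborel_integral_real_affine) simp
  also have "\<dots> = (LINT s|lborel. indicator {real m * \<tau><..<real (m + 1) * \<tau>} s * rl_kernel \<alpha> s)" unfolding eq by simp
  also have "\<dots> = rl_kernel (\<alpha> + 1) (real (m + 1) * \<tau>) - rl_kernel (\<alpha> + 1) (real m * \<tau>)"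
    using LINT_split_at[OF i0, of "real m * \<tau>"] rl_kernel_mass[of \<alpha> "real (m + 1) * \<tau>"] rl_kernel_mass[of \<alpha> "real m * \<tau>"] \<alpha> assms
    by (simp del: of_nat_add of_nat_Suc add: mult_right_mono)
  also have "\<dots> = 1 / Gamma (\<alpha> + 1) * \<tau> powr \<alpha> * (real (m + 1) powr \<alpha> - real m powr \<alpha>)"
  proof -
    have "(real k * \<tau>) powr \<alpha> = \<tau> powr \<alpha> * real k powr \<alpha>" for k :: nat
      using assms by (simp add: powr_mult)
    then show ?thesis by (simp only: rl_kernel_def add_diff_cancel_right') (simp add: right_diff_distrib diff_divide_distrib)
  qed
  also have "\<dots> \<le> 1 / Gamma (\<alpha> + 1) * \<tau> powr \<alpha> * real (m + 1) powr (\<alpha> - 1)"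
    using \<alpha> by (intro mult_left_mono powr_increment_le) (auto intro!: less_imp_le[OF Gamma_real_pos])
  finally show "(LINT s|lborel. ?i s) \<le> 1 / Gamma (\<alpha> + 1) * \<tau> powr \<alpha> * real (n - j + 1) powr (\<alpha> - 1)"
    by (simp add: m_def)
qed

lemma LINT_split_sum_scaled:
  fixes g :: "real \<Rightarrow> real"
  assumes "integrable lborel (\<lambda>s. indicator {0<..<real n * \<tau>} s * g s)" "0 < \<tau>"
  shows "(LINT s|lborel. indicator {0<..<real n * \<tau>} s * g s) = (\<Sum>j=1..n. LINT s|lborel. indicator {real (j - 1) * \<tau><..<real j * \<tau>} s * g s)"
  using assms(1)
proof (induction n)
  case (Suc n)
  have le: "real n * \<tau> \<le> real (Suc n) * \<tau>" using assms(2) by (intro mult_right_mono) auto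
  have "integrable lborel (\<lambda>s. indicator {0<..<real n * \<tau>} s * g s)"
    by (rule integrable_indicator_subset[OF Suc.prems]) (use le in \<open>auto simp del: of_nat_Suc\<close>)
  then have IH: "(LINT s|lborel. indicator {0<..<real n * \<tau>} s * g s) = (\<Sum>j=1..n. LINT s|lborel. indicator {real (j - 1) * \<tau><..<real j * \<tau>} s * g s)"
    by (rule Suc.IH)
  have split: "(LINT s|lborel. indicator {0<..<real (Suc n) * \<tau>} s * g s) = (LINT s|lborel. indicator {0<..<real n * \<tau>} s * g s) + (LINT s|lborel. indicator {real n * \<tau><..<real (Suc n) * \<tau>} s * g s)"
    by (rule LINT_split_at[OF Suc.prems _ le]) (use assms(2) in simp)
  have gen: "(\<Sum>j=1..Suc n. A j) = (\<Sum>j=1..n. A j) + A (Suc n)" for A :: "nat \<Rightarrow> real" by simp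
  show ?case unfolding split IH gen by (simp only: diff_Suc_1)
qed simp

text \<open>By \<open>ml_primitive_scale\<close> this is tau^alpha times the quantity bounded in
  \<open>L1_error\<close> and \<open>BE_error\<close>, taken at mu = kappa tau^alpha.\<close>

definition kernel_error :: "(nat \<Rightarrow> real) \<Rightarrow> real \<Rightarrow> real \<Rightarrow> nat \<Rightarrow> real" where
  "kernel_error \<beta> \<kappa> \<tau> n = ml_primitive \<alpha> \<kappa> (real n * \<tau>) - \<tau> powr \<alpha> * resolvent_sum \<beta> (\<kappa> * \<tau> powr \<alpha>) n"

text \<open>On every cell the data are replaced by their value at the right end point; the first sum
  is the price. For piecewise constant data both solutions are sums of kernel increments, and
  summation by parts moves the increments to the data. As there is no discrete datum at time 0, g
  starts from 0.\<close>

lemma scalar_error: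
  assumes \<beta>0: "0 < \<beta> 0" and \<kappa>: "0 \<le> \<kappa>" and \<tau>: "0 < \<tau>" and f: "continuous_on UNIV f"
    and U: "U 0 = 0" "\<And>n. 1 \<le> n \<Longrightarrow> n \<le> N \<Longrightarrow> \<tau> powr (- \<alpha>) * (\<Sum>j\<le>n. \<beta> (n - j) * U j) + \<kappa> * U n = f (real n * \<tau>)"
    and n: "1 \<le> n" "n \<le> N"
  defines "g \<equiv> \<lambda>j. if j = 0 then 0 else f (real j * \<tau>)"
  shows "conv0 (ml_kernel \<alpha> \<kappa>) f (real n * \<tau>) - U n =
      (\<Sum>j=1..n. LINT s|lborel. indicator {real (j - 1) * \<tau><..<real j * \<tau>} s * (ml_kernel \<alpha> \<kappa> (real n * \<tau> - s) * (f s - f (real j * \<tau>))))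
      + (\<Sum>j=1..n. kernel_error \<beta> \<kappa> \<tau> (n - j + 1) * (g j - g (j - 1)))"
    and "\<And>j. 1 \<le> j \<Longrightarrow> j \<le> n \<Longrightarrow> integrable lborel (\<lambda>s. indicator {real (j - 1) * \<tau><..<real j * \<tau>} s * (ml_kernel \<alpha> \<kappa> (real n * \<tau> - s) * (f s - f (real j * \<tau>))))"
proof -
  let ?E = "ml_kernel \<alpha> \<kappa>" and ?t = "real n * \<tau>" and ?\<mu> = "\<kappa> * \<tau> powr \<alpha>"
  let ?J = "\<lambda>j. {real (j - 1) * \<tau><..<real j * \<tau>}"
  have t: "0 < ?t" using n \<tau> by simp
  have \<mu>: "0 \<le> ?\<mu>" using \<kappa> by simp
  note [measurable] = ml_kernel_measurable[OF \<alpha>(1), of \<kappa>] borel_measurable_continuous_onI[OF f]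
  have "bounded (f ` {0..?t})" by (intro compact_imp_bounded compact_continuous_image continuous_on_subset[OF f]) auto
  then obtain B where B: "\<forall>s\<in>{0..?t}. \<bar>f s\<bar> \<le> B" by (auto simp: bounded_iff)
  have full: "integrable lborel (\<lambda>s. indicator {0<..<?t} s * (?E (?t - s) * f s))"
    by (rule conv0_integrable[OF _ _ ml_kernel_integrable[OF \<alpha> \<kappa> t]]) (use B in auto)
  have fullE: "integrable lborel (\<lambda>s. indicator {0<..<?t} s * (?E (?t - s) * 1))"
    by (rule conv0_integrable[OF _ _ ml_kernel_integrable[OF \<alpha> \<kappa> t], where B = 1]) auto
  have sub: "?J j \<subseteq> {0<..<?t}" if "1 \<le> j" "j \<le> n" for j
  proof -
    have "0 \<le> real (j - 1) * \<tau>" "real j * \<tau> \<le> ?t" using that \<tau> by (auto intro!: mult_right_mono)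
    then show ?thesis by auto
  qed
  have ij: "integrable lborel (\<lambda>s. indicator (?J j) s * (?E (?t - s) * f s))"
    "integrable lborel (\<lambda>s. indicator (?J j) s * (?E (?t - s) * 1))" if "1 \<le> j" "j \<le> n" for j
    by (rule integrable_indicator_subset[OF full sub[OF that]], simp, rule integrable_indicator_subset[OF fullE sub[OF that]], simp)
  have eqd: "indicator (?J j) s * (?E (?t - s) * (f s - f (real j * \<tau>))) = indicator (?J j) s * (?E (?t - s) * f s) - f (real j * \<tau>) * (indicator (?J j) s * (?E (?t - s) * 1))" for j s
    by (simp add: algebra_simps)
  show "integrable lborel (\<lambda>s. indicator (?J j) s * (?E (?t - s) * (f s - f (real j * \<tau>))))" if "1 \<le> j" "j \<le> n" for j
    unfolding eqd by (intro Bochner_Integration.integrable_diff integrable_mult_right ij that)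
  have IE: "(LINT s|lborel. indicator (?J j) s * (?E (?t - s) * 1)) = ml_primitive \<alpha> \<kappa> (real (n - j + 1) * \<tau>) - ml_primitive \<alpha> \<kappa> (real (n - j) * \<tau>)"
    if j: "1 \<le> j" "j \<le> n" for j
  proof -
    have "(LINT s|lborel. indicator (?J j) s * (?E (?t - s) * 1)) = \<bar>-1\<bar> *\<^sub>R (LINT s|lborel. indicator (?J j) (?t + -1 * s) * (?E (?t - (?t + -1 * s)) * 1))"
      by (rule lborel_integral_real_affine) simp
    also have "\<dots> = (LINT s|lborel. indicator {real (n - j) * \<tau><..<real (n - j + 1) * \<tau>} s * ?E s)"
      using j by (simp, intro Bochner_Integration.integral_cong) (auto simp: indicator_def of_nat_diff algebra_simps)
    also have "\<dots> = ml_primitive \<alpha> \<kappa> (real (n - j + 1) * \<tau>) - ml_primitive \<alpha> \<kappa> (real (n - j) * \<tau>)"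
      by (rule ml_primitive_diff[OF \<alpha> \<kappa>, symmetric]) (use \<tau> in \<open>auto intro!: mult_right_mono simp del: of_nat_add\<close>)
    finally show ?thesis .
  qed
  have A: "conv0 ?E f ?t = (\<Sum>j=1..n. LINT s|lborel. indicator (?J j) s * (?E (?t - s) * (f s - f (real j * \<tau>))))
      + (\<Sum>j=1..n. (ml_primitive \<alpha> \<kappa> (real (n - j + 1) * \<tau>) - ml_primitive \<alpha> \<kappa> (real (n - j) * \<tau>)) * g j)"
  proof -
    have "conv0 ?E f ?t = (\<Sum>j=1..n. LINT s|lborel. indicator (?J j) s * (?E (?t - s) * f s))"
      unfolding conv0_def by (rule LINT_split_sum_scaled[OF full \<tau>])
    also have "\<dots> = (\<Sum>j=1..n. (LINT s|lborel. indicator (?J j) s * (?E (?t - s) * (f s - f (real j * \<tau>)))) + (ml_primitive \<alpha> \<kappa> (real (n - j + 1) * \<tau>) - ml_primitive \<alpha> \<kappa> (real (n - j) * \<tau>)) * g j)"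
    proof (rule sum.cong[OF refl])
      fix j assume "j \<in> {1..n}"
      then have j: "1 \<le> j" "j \<le> n" by auto
      show "(LINT s|lborel. indicator (?J j) s * (?E (?t - s) * f s)) = (LINT s|lborel. indicator (?J j) s * (?E (?t - s) * (f s - f (real j * \<tau>)))) + (ml_primitive \<alpha> \<kappa> (real (n - j + 1) * \<tau>) - ml_primitive \<alpha> \<kappa> (real (n - j) * \<tau>)) * g j"
        unfolding eqd IE[OF j, symmetric] using ij[OF j] j
        by (subst Bochner_Integration.integral_diff) (auto simp: g_def)
    qed
    finally show ?thesis by (simp add: sum.distrib)
  qed
  \<comment> \<open>Index 0 is included with datum \<open>g 0 = 0\<close>, in accordance with
    \<open>U 0 = 0\<close>.\<close>
  have "\<And>k. k \<le> N \<Longrightarrow> (\<Sum>j\<le>k. \<beta> (k - j) * U j) + ?\<mu> * U k = \<tau> powr \<alpha> * g k"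
  proof -
    fix k assume k: "k \<le> N"
    show "(\<Sum>j\<le>k. \<beta> (k - j) * U j) + ?\<mu> * U k = \<tau> powr \<alpha> * g k"
    proof (cases "k = 0")
      case False
      have "\<tau> powr \<alpha> * (\<tau> powr (- \<alpha>) * (\<Sum>j\<le>k. \<beta> (k - j) * U j) + \<kappa> * U k) = \<tau> powr \<alpha> * f (real k * \<tau>)"
        using U(2)[of k] False k by simp
      moreover have "\<tau> powr \<alpha> * \<tau> powr (- \<alpha>) = 1" using \<tau> by (simp add: powr_add[symmetric])
      moreover have "\<tau> powr \<alpha> * (\<tau> powr (- \<alpha>) * X + \<kappa> * U k) = (\<tau> powr \<alpha> * \<tau> powr (- \<alpha>)) * X + ?\<mu> * U k" for X
        by (simp only: distrib_left ac_simps)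
      ultimately show ?thesis using False by (simp add: g_def)
    qed (simp add: U g_def)
  qed
  then have "U n = (\<Sum>j\<le>n. discrete_resolvent \<beta> ?\<mu> (n - j) * (\<tau> powr \<alpha> * g j))"
    by (rule discrete_resolvent_conv_unique[where \<beta> = \<beta> and U = U and N = N and f = "\<lambda>j. \<tau> powr \<alpha> * g j", OF \<beta>0 \<mu>]) (use n in auto)
  also have "\<dots> = (\<Sum>j=1..n. discrete_resolvent \<beta> ?\<mu> (n - j) * (\<tau> powr \<alpha> * g j))"
    by (rule sum.mono_neutral_right) (auto simp: g_def Suc_le_eq)
  also have "\<dots> = (\<Sum>j=1..n. \<tau> powr \<alpha> * (resolvent_sum \<beta> ?\<mu> (n - j + 1) - resolvent_sum \<beta> ?\<mu> (n - j)) * g j)"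
    by (rule sum.cong) (auto simp: resolvent_sum_def)
  finally have Ueq: "U n = (\<Sum>j=1..n. \<tau> powr \<alpha> * (resolvent_sum \<beta> ?\<mu> (n - j + 1) - resolvent_sum \<beta> ?\<mu> (n - j)) * g j)" .
  let ?S = "kernel_error \<beta> \<kappa> \<tau>"
  \<comment> \<open>This removes the boundary term at j = n; the one at j = 0 vanishes because
    \<open>g 0 = 0\<close>.\<close>
  have S0: "?S 0 = 0" using \<alpha> by (simp add: kernel_error_def resolvent_sum_def)
  have "(\<Sum>j=1..n. (ml_primitive \<alpha> \<kappa> (real (n - j + 1) * \<tau>) - ml_primitive \<alpha> \<kappa> (real (n - j) * \<tau>)) * g j) - U n = (\<Sum>j=1..n. (?S (n - j + 1) - ?S (n - j)) * g j)"
    unfolding Ueq sum_subtractf[symmetric] by (rule sum.cong) (auto simp: kernel_error_def algebra_simps)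
  also have "\<dots> = (\<Sum>j=1..n. ?S (n - j + 1) * (g j - g (j - 1)))"
  proof -
    have "(\<Sum>j=1..n. ?S (n - j) * g j) = (\<Sum>j=1..n - 1. ?S (n - j) * g j)"
      using n S0 by (intro sum.mono_neutral_right) (auto simp: not_le less_Suc_eq_le intro: le_antisym)
    also have "\<dots> = (\<Sum>j=2..n. ?S (n - j + 1) * g (j - 1))"
      by (rule sum.reindex_bij_witness[of _ "\<lambda>i. i - 1" Suc]) (use n in \<open>auto simp: Suc_diff_Suc\<close>)
    also have "\<dots> = (\<Sum>j=1..n. ?S (n - j + 1) * g (j - 1))"
      using n by (intro sum.mono_neutral_left) (auto simp: g_def not_le less_Suc_eq)
    finally show ?thesis by (simp add: left_diff_distrib right_diff_distrib sum_subtractf)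
  qed
  finally show "conv0 ?E f ?t - U n = (\<Sum>j=1..n. LINT s|lborel. indicator (?J j) s * (?E (?t - s) * (f s - f (real j * \<tau>))))
      + (\<Sum>j=1..n. ?S (n - j + 1) * (g j - g (j - 1)))" unfolding A by simp
qed

text \<open>The square of the norm of e is expanded by inserting \<open>scalar_error\<close> in one
  of its two factors. In every summand the kernel is bounded uniformly over the modes,
  Cauchy-Schwarz over the modes splits off the norm of e, and this norm is divided out at the
  end.\<close>

lemma vector_error:
  assumes \<beta>0: "0 < \<beta> 0"
    and C: "0 \<le> C" "\<And>\<mu> n. 0 \<le> \<mu> \<Longrightarrow> 1 \<le> n \<Longrightarrow> \<bar>ml_primitive \<alpha> \<mu> (real n) - resolvent_sum \<beta> \<mu> n\<bar> \<le> C * real n powr (\<alpha> - 1)"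
    and I: "finite I" and \<kappa>: "\<And>i. i \<in> I \<Longrightarrow> 0 \<le> \<kappa> i" and \<tau>: "0 < \<tau>"
    and f: "\<And>i. i \<in> I \<Longrightarrow> continuous_on UNIV (f i)"
    and U: "\<And>i. i \<in> I \<Longrightarrow> U i 0 = 0" "\<And>i n. i \<in> I \<Longrightarrow> 1 \<le> n \<Longrightarrow> n \<le> N \<Longrightarrow> \<tau> powr (- \<alpha>) * (\<Sum>j\<le>n. \<beta> (n - j) * U i j) + \<kappa> i * U i n = f i (real n * \<tau>)"
    and n: "1 \<le> n" "n \<le> N"
    and h: "\<And>j. 0 \<le> h j" "\<And>j s. 1 \<le> j \<Longrightarrow> j \<le> N \<Longrightarrow> real (j - 1) * \<tau> \<le> s \<Longrightarrow> s \<le> real j * \<tau> \<Longrightarrow> (\<Sum>i\<in>I. (f i s - f i (real j * \<tau>))\<^sup>2) \<le> (h j)\<^sup>2"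
    and g1: "0 \<le> g1" "(\<Sum>i\<in>I. (f i \<tau>)\<^sup>2) \<le> g1\<^sup>2"
  shows "sqrt (\<Sum>i\<in>I. (conv0 (ml_kernel \<alpha> (\<kappa> i)) (f i) (real n * \<tau>) - U i n)\<^sup>2)
    \<le> (C + 1 / Gamma (\<alpha> + 1)) * ((\<Sum>j=1..n. \<tau> powr \<alpha> * real (n - j + 1) powr (\<alpha> - 1) * h j) + \<tau> powr \<alpha> * real n powr (\<alpha> - 1) * g1)"
proof -
  define e where "e i = conv0 (ml_kernel \<alpha> (\<kappa> i)) (f i) (real n * \<tau>) - U i n" for i
  define nrm where "nrm = sqrt (\<Sum>i\<in>I. (e i)\<^sup>2)"
  have nrm0: "0 \<le> nrm" by (simp add: nrm_def sum_nonneg)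
  let ?J = "\<lambda>j. {real (j - 1) * \<tau><..<real j * \<tau>}" and ?t = "real n * \<tau>"
  define q where "q i j s = indicator (?J j) s * (ml_kernel \<alpha> (\<kappa> i) (?t - s) * (f i s - f i (real j * \<tau>)))" for i j s
  define g where "g i j = (if j = 0 then 0 else f i (real j * \<tau>))" for i and j :: nat
  let ?S = "\<lambda>i. kernel_error \<beta> (\<kappa> i) \<tau>"
  have eqe: "e i = (\<Sum>j=1..n. LINT s|lborel. q i j s) + (\<Sum>j=1..n. ?S i (n - j + 1) * (g i j - g i (j - 1)))" if "i \<in> I" for i
    unfolding e_def q_def g_def
    by (rule scalar_error(1)[where N = N, OF \<beta>0 \<kappa>[OF that] \<tau> f[OF that] U(1)[OF that] U(2)[OF that] n])
  have qi: "integrable lborel (q i j)" if "i \<in> I" "1 \<le> j" "j \<le> n" for i j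
    unfolding q_def[abs_def]
    by (rule scalar_error(2)[where N = N, OF \<beta>0 \<kappa>[OF that(1)] \<tau> f[OF that(1)] U(1)[OF that(1)] U(2)[OF that(1)] n that(2,3)])
  have S: "\<bar>?S i m\<bar> \<le> C * (\<tau> powr \<alpha> * real m powr (\<alpha> - 1))" if "i \<in> I" "1 \<le> m" for i m
  proof -
    have "?S i m = \<tau> powr \<alpha> * (ml_primitive \<alpha> (\<kappa> i * \<tau> powr \<alpha>) (real m) - resolvent_sum \<beta> (\<kappa> i * \<tau> powr \<alpha>) m)"
      unfolding kernel_error_def ml_primitive_scale[OF \<tau>] by (simp add: right_diff_distrib)
    then have "\<bar>?S i m\<bar> = \<tau> powr \<alpha> * \<bar>ml_primitive \<alpha> (\<kappa> i * \<tau> powr \<alpha>) (real m) - resolvent_sum \<beta> (\<kappa> i * \<tau> powr \<alpha>) m\<bar>"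
      by (simp add: abs_mult)
    then show ?thesis using mult_left_mono[OF C(2)[of "\<kappa> i * \<tau> powr \<alpha>" m], of "\<tau> powr \<alpha>"] \<kappa>[OF that(1)] that(2)
      by (simp add: mult_ac)
  qed
  define H where "H j = (if j = 1 then h 1 + g1 else h j)" for j
  have gdiff: "(\<Sum>i\<in>I. \<bar>e i\<bar> * \<bar>g i j - g i (j - 1)\<bar>) \<le> nrm * (if j = 1 then g1 else h j)" if j: "1 \<le> j" "j \<le> n" for j
    unfolding nrm_def
  proof (rule Cauchy_Schwarz_sum_le)
    show "(\<Sum>i\<in>I. (g i j - g i (j - 1))\<^sup>2) \<le> (if j = 1 then g1 else h j)\<^sup>2"
    proof (cases "j = 1")
      case True
      then show ?thesis using g1 by (simp add: g_def)
    next
      case False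
      have "(\<Sum>i\<in>I. (g i j - g i (j - 1))\<^sup>2) = (\<Sum>i\<in>I. (f i (real (j - 1) * \<tau>) - f i (real j * \<tau>))\<^sup>2)"
        using False j by (intro sum.cong) (auto simp: g_def power2_commute)
      also have "\<dots> \<le> (h j)\<^sup>2" by (rule h(2)) (use j n \<tau> in auto)
      finally show ?thesis using False by simp
    qed
  qed (use g1 h in auto)
  have part1: "(\<Sum>i\<in>I. e i * (LINT s|lborel. q i j s)) \<le> nrm * h j * (1 / Gamma (\<alpha> + 1) * \<tau> powr \<alpha> * real (n - j + 1) powr (\<alpha> - 1))"
    if j: "1 \<le> j" "j \<le> n" for j
  proof -
    have "(\<Sum>i\<in>I. e i * (LINT s|lborel. q i j s)) = (LINT s|lborel. (\<Sum>i\<in>I. e i * q i j s))"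
      using qi[OF _ j] by (subst Bochner_Integration.integral_sum) auto
    also have "\<dots> \<le> (LINT s|lborel. (nrm * h j) * (indicator (?J j) s * rl_kernel \<alpha> (?t - s)))"
    proof (rule integral_mono)
      show "integrable lborel (\<lambda>s. \<Sum>i\<in>I. e i * q i j s)" using qi[OF _ j] by auto
      show "integrable lborel (\<lambda>s. (nrm * h j) * (indicator (?J j) s * rl_kernel \<alpha> (?t - s)))"
        by (intro integrable_mult_right rl_kernel_interval \<tau> j)
      fix s
      show "(\<Sum>i\<in>I. e i * q i j s) \<le> (nrm * h j) * (indicator (?J j) s * rl_kernel \<alpha> (?t - s))"
      proof (cases "s \<in> ?J j")
        case True
        have "real j * \<tau> \<le> ?t" using j \<tau> by (intro mult_right_mono) auto
        then have ts: "0 < ?t - s" using True by auto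
        have "(\<Sum>i\<in>I. e i * q i j s) \<le> (\<Sum>i\<in>I. rl_kernel \<alpha> (?t - s) * (\<bar>e i\<bar> * \<bar>f i s - f i (real j * \<tau>)\<bar>))"
        proof (rule sum_mono)
          fix i assume i: "i \<in> I"
          have E: "0 < ml_kernel \<alpha> (\<kappa> i) (?t - s)" "ml_kernel \<alpha> (\<kappa> i) (?t - s) \<le> rl_kernel \<alpha> (?t - s)"
            using ml_kernel_pos[OF \<alpha> \<kappa>[OF i] ts] ml_kernel_le_rl[OF \<alpha> \<kappa>[OF i] ts] by auto
          have "e i * q i j s = ml_kernel \<alpha> (\<kappa> i) (?t - s) * (e i * (f i s - f i (real j * \<tau>)))" using True by (simp add: q_def mult_ac)
          also have "\<dots> \<le> ml_kernel \<alpha> (\<kappa> i) (?t - s) * (\<bar>e i\<bar> * \<bar>f i s - f i (real j * \<tau>)\<bar>)"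
            using E by (intro mult_left_mono) (auto simp: abs_mult[symmetric])
          also have "\<dots> \<le> rl_kernel \<alpha> (?t - s) * (\<bar>e i\<bar> * \<bar>f i s - f i (real j * \<tau>)\<bar>)"
            using E by (intro mult_right_mono) auto
          finally show "e i * q i j s \<le> rl_kernel \<alpha> (?t - s) * (\<bar>e i\<bar> * \<bar>f i s - f i (real j * \<tau>)\<bar>)" .
        qed
        also have "\<dots> = rl_kernel \<alpha> (?t - s) * (\<Sum>i\<in>I. \<bar>e i\<bar> * \<bar>f i s - f i (real j * \<tau>)\<bar>)" by (simp only: sum_distrib_left)
        also have "\<dots> \<le> rl_kernel \<alpha> (?t - s) * (nrm * h j)"
          unfolding nrm_def using True j n h rl_kernel_nonneg[OF \<alpha>(1)] by (intro mult_left_mono Cauchy_Schwarz_sum_le) auto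
        finally show ?thesis using True by (simp add: mult.commute)
      qed (simp add: q_def)
    qed
    also have "\<dots> = (nrm * h j) * (LINT s|lborel. indicator (?J j) s * rl_kernel \<alpha> (?t - s))" by simp
    also have "\<dots> \<le> (nrm * h j) * (1 / Gamma (\<alpha> + 1) * \<tau> powr \<alpha> * real (n - j + 1) powr (\<alpha> - 1))"
      using nrm0 h(1) by (intro mult_left_mono rl_kernel_interval(2)[OF \<tau> j]) auto
    finally show ?thesis .
  qed
  have part2: "(\<Sum>i\<in>I. e i * (?S i (n - j + 1) * (g i j - g i (j - 1)))) \<le> C * (\<tau> powr \<alpha> * real (n - j + 1) powr (\<alpha> - 1)) * (nrm * (if j = 1 then g1 else h j))"
    if j: "1 \<le> j" "j \<le> n" for j
  proof -
    let ?W = "C * (\<tau> powr \<alpha> * real (n - j + 1) powr (\<alpha> - 1))"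
    have "(\<Sum>i\<in>I. e i * (?S i (n - j + 1) * (g i j - g i (j - 1)))) \<le> (\<Sum>i\<in>I. ?W * (\<bar>e i\<bar> * \<bar>g i j - g i (j - 1)\<bar>))"
    proof (rule sum_mono)
      fix i assume i: "i \<in> I"
      have "e i * (?S i (n - j + 1) * (g i j - g i (j - 1))) \<le> \<bar>e i * (?S i (n - j + 1) * (g i j - g i (j - 1)))\<bar>" by simp
      also have "\<dots> = \<bar>?S i (n - j + 1)\<bar> * (\<bar>e i\<bar> * \<bar>g i j - g i (j - 1)\<bar>)" by (simp add: abs_mult)
      also have "\<dots> \<le> ?W * (\<bar>e i\<bar> * \<bar>g i j - g i (j - 1)\<bar>)" by (intro mult_right_mono S i) auto
      finally show "e i * (?S i (n - j + 1) * (g i j - g i (j - 1))) \<le> ?W * (\<bar>e i\<bar> * \<bar>g i j - g i (j - 1)\<bar>)" .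
    qed
    also have "\<dots> = ?W * (\<Sum>i\<in>I. \<bar>e i\<bar> * \<bar>g i j - g i (j - 1)\<bar>)" by (simp only: sum_distrib_left)
    also have "\<dots> \<le> ?W * (nrm * (if j = 1 then g1 else h j))"
      using C(1) by (intro mult_left_mono gdiff j) auto
    finally show ?thesis .
  qed
  let ?k = "\<lambda>j. \<tau> powr \<alpha> * real (n - j + 1) powr (\<alpha> - 1)"
  let ?G = "1 / Gamma (\<alpha> + 1)"
  have G: "0 < ?G" using \<alpha> by (simp add: Gamma_real_pos)
  have "nrm * nrm = (\<Sum>i\<in>I. e i * e i)"
    unfolding nrm_def by (simp add: sum_nonneg power2_eq_square[symmetric])
  also have "\<dots> = (\<Sum>i\<in>I. \<Sum>j=1..n. e i * (LINT s|lborel. q i j s) + e i * (?S i (n - j + 1) * (g i j - g i (j - 1))))"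
  proof (rule sum.cong[OF refl])
    fix i assume "i \<in> I"
    then have "e i * e i = e i * ((\<Sum>j=1..n. LINT s|lborel. q i j s) + (\<Sum>j=1..n. ?S i (n - j + 1) * (g i j - g i (j - 1))))"
      using eqe by simp
    then show "e i * e i = (\<Sum>j=1..n. e i * (LINT s|lborel. q i j s) + e i * (?S i (n - j + 1) * (g i j - g i (j - 1))))"
      by (simp only: sum_distrib_left distrib_left sum.distrib)
  qed
  also have "\<dots> = (\<Sum>j=1..n. (\<Sum>i\<in>I. e i * (LINT s|lborel. q i j s)) + (\<Sum>i\<in>I. e i * (?S i (n - j + 1) * (g i j - g i (j - 1)))))"
    by (subst sum.swap) (simp only: sum.distrib)
  also have "\<dots> \<le> (\<Sum>j=1..n. nrm * ((C + ?G) * (?k j * h j + (if j = 1 then ?k j * g1 else 0))))"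
  proof (rule sum_mono)
    fix j assume "j \<in> {1..n}"
    then have j: "1 \<le> j" "j \<le> n" by auto
    have "(\<Sum>i\<in>I. e i * (LINT s|lborel. q i j s)) + (\<Sum>i\<in>I. e i * (?S i (n - j + 1) * (g i j - g i (j - 1))))
      \<le> nrm * h j * (?G * \<tau> powr \<alpha> * real (n - j + 1) powr (\<alpha> - 1)) + C * ?k j * (nrm * (if j = 1 then g1 else h j))"
      by (intro add_mono part1 part2 j)
    also have "\<dots> = nrm * (?G * (?k j * h j) + C * (?k j * (if j = 1 then g1 else h j)))" by (simp add: algebra_simps)
    also have "\<dots> \<le> nrm * ((C + ?G) * (?k j * h j + (if j = 1 then ?k j * g1 else 0)))"
    proof (rule mult_left_mono[OF _ nrm0])
      have nn: "0 \<le> ?k j * h j" "0 \<le> ?k j * g1" using h(1) g1 by auto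
      have "?G * (?k j * h j) + C * (?k j * (if j = 1 then g1 else h j)) \<le> ?G * (?k j * h j + (if j = 1 then ?k j * g1 else 0)) + C * (?k j * h j + (if j = 1 then ?k j * g1 else 0))"
        using nn G C(1) by (intro add_mono mult_left_mono) auto
      then show "?G * (?k j * h j) + C * (?k j * (if j = 1 then g1 else h j)) \<le> (C + ?G) * (?k j * h j + (if j = 1 then ?k j * g1 else 0))"
        by (simp only: distrib_right add.commute)
    qed
    finally show "(\<Sum>i\<in>I. e i * (LINT s|lborel. q i j s)) + (\<Sum>i\<in>I. e i * (?S i (n - j + 1) * (g i j - g i (j - 1))))
       \<le> nrm * ((C + ?G) * (?k j * h j + (if j = 1 then ?k j * g1 else 0)))" .
  qed
  also have "\<dots> = nrm * ((C + ?G) * ((\<Sum>j=1..n. ?k j * h j) + (\<Sum>j=1..n. if j = 1 then ?k j * g1 else 0)))"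
    by (simp only: sum_distrib_left[symmetric] sum.distrib)
  \<comment> \<open>Only j = 1 sees the jump at the origin, and there n - j + 1 = n.\<close>
  also have "(\<Sum>j=1..n. if j = 1 then ?k j * g1 else 0) = \<tau> powr \<alpha> * real n powr (\<alpha> - 1) * g1"
    using n by (subst sum.delta) auto
  finally have "nrm * nrm \<le> nrm * ((C + ?G) * ((\<Sum>j=1..n. ?k j * h j) + \<tau> powr \<alpha> * real n powr (\<alpha> - 1) * g1))" .
  moreover have "0 \<le> (C + ?G) * ((\<Sum>j=1..n. ?k j * h j) + \<tau> powr \<alpha> * real n powr (\<alpha> - 1) * g1)"
    using C(1) G h(1) g1 by (intro mult_nonneg_nonneg add_nonneg_nonneg sum_nonneg) auto
  ultimately have "nrm \<le> (C + ?G) * ((\<Sum>j=1..n. ?k j * h j) + \<tau> powr \<alpha> * real n powr (\<alpha> - 1) * g1)"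
    using nrm0 by (cases "nrm = 0") auto
  then show ?thesis by (simp add: nrm_def e_def)
qed

end

section \<open>Young's inequality and summation of the error\<close>

text \<open>Convexity is invoked on the open half-line, so y = 0 is checked by hand.\<close>

lemma powr_above_tangent:
  fixes a p y :: real
  assumes p: "1 \<le> p" and "0 \<le> y" "0 < a"
  shows "a powr p + p * a powr (p - 1) * (y - a) \<le> y powr p"
proof (cases "y = 0")
  case True
  have "a powr p = a powr (p - 1) * a" using assms powr_add[of a "p - 1" 1] by simp
  then have "a powr p + p * a powr (p - 1) * (y - a) = (1 - p) * a powr p" using True by (simp add: algebra_simps)
  also have "\<dots> \<le> 0" using p by (intro mult_nonpos_nonneg) auto
  finally show ?thesis using True by simp
next
  case False
  have "(y powr p) - (a powr p) \<ge> (p * a powr (p - 1)) * (y - a)"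
  proof (rule convex_on_imp_above_tangent[OF powr_convex[OF p]])
    show "((\<lambda>x. x powr p) has_field_derivative p * a powr (p - 1)) (at a within {0<..})"
      using assms by (auto intro!: derivative_eq_intros)
    show "a \<in> interior {0<..}" using assms by (simp add: interior_open)
  qed (use assms False in auto)
  then show ?thesis by simp
qed

text \<open>Jensen's inequality for non-normalised weights: in the tangent inequality at the
  weighted mean y = S/k the linear terms cancel in the sum.\<close>

lemma powr_sum_le:
  fixes a h :: "'i \<Rightarrow> real"
  assumes p: "1 \<le> p" and "finite J" and a: "\<And>j. j \<in> J \<Longrightarrow> 0 \<le> a j" and h: "\<And>j. j \<in> J \<Longrightarrow> 0 \<le> h j"
    and K: "(\<Sum>j\<in>J. a j) \<le> K"
  shows "(\<Sum>j\<in>J. a j * h j) powr p \<le> K powr (p - 1) * (\<Sum>j\<in>J. a j * h j powr p)"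
proof -
  define S where "S = (\<Sum>j\<in>J. a j * h j)"
  define k where "k = (\<Sum>j\<in>J. a j)"
  have S: "0 \<le> S" unfolding S_def using a h by (intro sum_nonneg mult_nonneg_nonneg) auto
  have k0: "0 \<le> k" unfolding k_def using a by (intro sum_nonneg) auto
  have R: "0 \<le> (\<Sum>j\<in>J. a j * h j powr p)" using a by (intro sum_nonneg mult_nonneg_nonneg) auto
  show ?thesis
  proof (cases "S = 0")
    case True
    then show ?thesis using R by (simp add: S_def[symmetric])
  next
    case False
    then have S0: "0 < S" using S by simp
    have "k \<noteq> 0"
    proof
      assume "k = 0"
      then have "\<forall>j\<in>J. a j = 0" using a assms(2) unfolding k_def by (subst (asm) sum_nonneg_eq_0_iff) auto
      then show False using False by (simp add: S_def)
    qed
    then have k: "0 < k" using k0 by simp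
    define y where "y = S / k"
    have y: "0 < y" using S0 k by (simp add: y_def)
    have "(\<Sum>j\<in>J. a j * (y powr p + p * y powr (p - 1) * (h j - y))) \<le> (\<Sum>j\<in>J. a j * h j powr p)"
      using a h y p by (intro sum_mono mult_left_mono powr_above_tangent) auto
    moreover have "(\<Sum>j\<in>J. a j * (y powr p + p * y powr (p - 1) * (h j - y))) = k * y powr p + p * y powr (p - 1) * (S - k * y)"
      by (simp add: k_def S_def algebra_simps sum.distrib sum_subtractf sum_distrib_left sum_distrib_right)
    moreover have "S - k * y = 0" using k by (simp add: y_def)
    ultimately have "k * y powr p \<le> (\<Sum>j\<in>J. a j * h j powr p)" by simp
    then have "k powr (p - 1) * (k * y powr p) \<le> k powr (p - 1) * (\<Sum>j\<in>J. a j * h j powr p)"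
      by (intro mult_left_mono) auto
    also have "\<dots> \<le> K powr (p - 1) * (\<Sum>j\<in>J. a j * h j powr p)"
      using K k p R by (intro mult_right_mono powr_mono2) (auto simp: k_def)
    also have "k powr (p - 1) * (k * y powr p) = (k powr (p - 1) * k) * y powr p" by simp
    also have "k powr (p - 1) * k = k powr p" using k powr_add[of k "p - 1" 1] by simp
    also have "k powr p * y powr p = S powr p" using k S0 by (simp add: y_def powr_divide)
    finally show ?thesis by (simp add: S_def)
  qed
qed

text \<open>Jensen's inequality in the inner sum and an exchange of the summations; each of the two
  steps costs the total weight K, once with exponent p - 1 and once with exponent 1.\<close>

lemma young_discrete:
  fixes a h :: "nat \<Rightarrow> real"
  assumes p: "1 \<le> p" and a: "\<And>m. 0 \<le> a m" and h: "\<And>j. 0 \<le> h j"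
  shows "(\<Sum>n=1..N. (\<Sum>j=1..n. a (n - j) * h j) powr p) \<le> (\<Sum>m<N. a m) powr p * (\<Sum>j=1..N. h j powr p)"
proof -
  define K where "K = (\<Sum>m<N. a m)"
  have K0: "0 \<le> K" unfolding K_def using a by (intro sum_nonneg) auto
  have "(\<Sum>n=1..N. (\<Sum>j=1..n. a (n - j) * h j) powr p) \<le> (\<Sum>n=1..N. K powr (p - 1) * (\<Sum>j=1..n. a (n - j) * h j powr p))"
  proof (rule sum_mono, rule powr_sum_le[OF p])
    fix n assume n: "n \<in> {1..N}"
    have "(\<Sum>j=1..n. a (n - j)) = (\<Sum>m<n. a m)"
      by (rule sum.reindex_bij_witness[of _ "\<lambda>i. n - i" "\<lambda>i. n - i"]) auto
    also have "\<dots> \<le> K" unfolding K_def using a n by (intro sum_mono2) auto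
    finally show "(\<Sum>j=1..n. a (n - j)) \<le> K" .
  qed (use a h in auto)
  also have "\<dots> = K powr (p - 1) * (\<Sum>n=1..N. \<Sum>j=1..n. a (n - j) * h j powr p)" by (simp only: sum_distrib_left)
  also have "(\<Sum>n=1..N. \<Sum>j=1..n. a (n - j) * h j powr p) = (\<Sum>j=1..N. \<Sum>n=j..N. a (n - j) * h j powr p)"
    by (subst sum.Sigma, simp, simp, subst sum.Sigma, simp, simp)
       (rule sum.reindex_bij_witness[of _ "\<lambda>(j, n). (n, j)" "\<lambda>(n, j). (j, n)"]; auto)
  also have "K powr (p - 1) * \<dots> \<le> K powr (p - 1) * (\<Sum>j=1..N. K * h j powr p)"
  proof (intro mult_left_mono sum_mono)
    fix j assume j: "j \<in> {1..N}"
    have "(\<Sum>n=j..N. a (n - j)) = (\<Sum>m\<in>{..N - j}. a m)"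
      using j by (intro sum.reindex_bij_witness[of _ "\<lambda>m. m + j" "\<lambda>n. n - j"]) auto
    also have "\<dots> \<le> K" unfolding K_def using a j by (intro sum_mono2) auto
    finally show "(\<Sum>n=j..N. a (n - j) * h j powr p) \<le> K * h j powr p"
      unfolding sum_distrib_right[symmetric] by (intro mult_right_mono) auto
  qed auto
  also have "\<dots> = (K powr (p - 1) * K) * (\<Sum>j=1..N. h j powr p)" by (simp add: sum_distrib_left mult.assoc)
  also have "K powr (p - 1) * K = K powr p"
    using K0 powr_add[of K "p - 1" 1] by (cases "K = 0") auto
  finally show ?thesis by (simp add: K_def)
qed

lemma powr_add_le:
  assumes "0 \<le> a" "0 \<le> b" "0 \<le> (p::real)"
  shows "(a + b) powr p \<le> 2 powr p * (a powr p + b powr p)"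
proof -
  have "(a + b) powr p \<le> (2 * max a b) powr p" using assms by (intro powr_mono2) auto
  also have "\<dots> = 2 powr p * max a b powr p" using assms by (simp add: powr_mult)
  also have "\<dots> \<le> 2 powr p * (a powr p + b powr p)" by (intro mult_left_mono) (auto simp: max_def)
  finally show ?thesis .
qed

lemma sum_powr_le:
  assumes \<alpha>: "0 < \<alpha>" "\<alpha> < 1"
  shows "(\<Sum>m<N. real (m + 1) powr (\<alpha> - 1)) \<le> real N powr \<alpha> / \<alpha>"
proof (induction N)
  case (Suc N)
  have "real (N + 1) powr (\<alpha> - 1) \<le> (real (Suc N) powr \<alpha> - real N powr \<alpha>) / \<alpha>"
  proof (cases "N = 0")
    case True
    then show ?thesis using \<alpha> by simp
  next
    case False
    then have "\<exists>z>real N. z < real (Suc N) \<and> real (Suc N) powr \<alpha> - real N powr \<alpha> = (real (Suc N) - real N) * (\<alpha> * z powr (\<alpha> - 1))"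
      by (intro MVT2) (auto intro!: derivative_eq_intros)
    then obtain z where z: "real N < z" "z < real (Suc N)" "real (Suc N) powr \<alpha> - real N powr \<alpha> = \<alpha> * z powr (\<alpha> - 1)" by auto
    have "real (N + 1) powr (\<alpha> - 1) \<le> z powr (\<alpha> - 1)" using z \<alpha> False by (intro powr_mono2') auto
    then show ?thesis using z \<alpha> by simp
  qed
  then show ?case using Suc by (simp add: diff_divide_distrib)
qed simp

text \<open>Young's inequality handles the oscillations, since the weights tau^alpha (m+1)^(alpha-1)
  with m < N sum to at most T^alpha/alpha. The jump contributes the l^p norm of n^(alpha-1), which
  is bounded in N when r = (1-alpha)p > 1 and needs an extra argument otherwise.\<close>

lemma lp_bound:
  assumes \<alpha>: "0 < \<alpha>" "\<alpha> < 1" and p: "1 < p" and s: "s < 1" and T: "0 < T" and A: "0 \<le> A" and B: "0 \<le> B"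
  shows "\<exists>C>0. \<forall>N \<tau> h g1 G \<epsilon>. 1 \<le> N \<and> \<tau> = T / real N \<and> \<tau> \<le> 1 \<and> 0 \<le> G \<and> 0 \<le> g1 \<and> g1 \<le> B * G \<and> (\<forall>j. 0 \<le> h j)
     \<and> (\<Sum>j=1..N. h j powr p) \<le> B * \<tau> powr (s * p - 1) * G powr p
     \<and> (\<forall>n\<in>{1..N}. 0 \<le> \<epsilon> n \<and> \<epsilon> n \<le> A * ((\<Sum>j=1..n. \<tau> powr \<alpha> * real (n - j + 1) powr (\<alpha> - 1) * h j) + \<tau> powr \<alpha> * real n powr (\<alpha> - 1) * g1))
     \<longrightarrow> (\<tau> * (\<Sum>n=1..N. \<epsilon> n powr p)) powr (1 / p) \<le> C * \<tau> powr (min (1 / p + \<alpha>) s) * G"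
proof -
  define m where "m = min (1 / p + \<alpha>) s"
  define r where "r = (1 - \<alpha>) * p"
  define \<eta> where "\<eta> = (1 - s) * p"
  have \<eta>: "0 < \<eta>" using s p by (simp add: \<eta>_def)
  \<comment> \<open>For r \<le> 1 the power n^(-r) is n^(-(1+eta)) n^(1-r+eta), and the second
    factor is bounded by its value at N = T/tau. With eta = (1-s)p the resulting exponent of tau is
    exactly s p.\<close>
  define Z where "Z = (if 1 < r then zeta_sum r else zeta_sum (1 + \<eta>) * T powr (1 - r + \<eta>))"
  have Z0: "0 \<le> Z" using zeta_sum_nonneg[of r] zeta_sum_nonneg[of "1 + \<eta>"] \<eta> by (auto simp: Z_def)
  define D where "D = (2 * A) powr p * ((T powr \<alpha> / \<alpha>) powr p * B + B powr p * Z)"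
  have D0: "0 \<le> D" using B Z0 by (simp add: D_def)
  have main: "(\<tau> * (\<Sum>n=1..N. \<epsilon> n powr p)) powr (1 / p) \<le> (D + 1) powr (1 / p) * \<tau> powr m * G"
    if N: "1 \<le> N" and \<tau>: "\<tau> = T / real N" "\<tau> \<le> 1" and G: "0 \<le> G" and g1: "0 \<le> g1" "g1 \<le> B * G" and h: "\<And>j. 0 \<le> h j"
      and hs: "(\<Sum>j=1..N. h j powr p) \<le> B * \<tau> powr (s * p - 1) * G powr p"
      and \<epsilon>: "\<And>n. n \<in> {1..N} \<Longrightarrow> 0 \<le> \<epsilon> n" "\<And>n. n \<in> {1..N} \<Longrightarrow> \<epsilon> n \<le> A * ((\<Sum>j=1..n. \<tau> powr \<alpha> * real (n - j + 1) powr (\<alpha> - 1) * h j) + \<tau> powr \<alpha> * real n powr (\<alpha> - 1) * g1)"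
    for N \<tau> h g1 G \<epsilon>
  proof -
    have \<tau>0: "0 < \<tau>" using N T by (simp add: \<tau>)
    have N\<tau>: "real N = T / \<tau>" using N T by (simp add: \<tau>)
    define X where "X n = (\<Sum>j=1..n. (\<tau> powr \<alpha> * real (n - j + 1) powr (\<alpha> - 1)) * h j)" for n
    define Y where "Y n = \<tau> powr \<alpha> * real n powr (\<alpha> - 1) * g1" for n
    have XY: "0 \<le> X n" "0 \<le> Y n" for n using h g1 by (auto simp: X_def Y_def intro!: sum_nonneg)
    have mono\<tau>: "\<tau> powr a \<le> \<tau> powr b" if "b \<le> a" for a b using powr_mono'[OF that] \<tau>0 \<tau>(2) by simp
    have "(\<Sum>n=1..N. X n powr p) \<le> (\<Sum>m<N. \<tau> powr \<alpha> * real (m + 1) powr (\<alpha> - 1)) powr p * (\<Sum>j=1..N. h j powr p)"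
      unfolding X_def by (rule young_discrete[of p "\<lambda>m. \<tau> powr \<alpha> * real (m + 1) powr (\<alpha> - 1)"]) (use p h in auto)
    also have "\<dots> \<le> (T powr \<alpha> / \<alpha>) powr p * (B * \<tau> powr (s * p - 1) * G powr p)"
    proof (rule mult_mono[OF _ hs])
      have "(\<Sum>m<N. \<tau> powr \<alpha> * real (m + 1) powr (\<alpha> - 1)) = \<tau> powr \<alpha> * (\<Sum>m<N. real (m + 1) powr (\<alpha> - 1))"
        by (simp only: sum_distrib_left)
      also have "\<dots> \<le> \<tau> powr \<alpha> * (real N powr \<alpha> / \<alpha>)" by (intro mult_left_mono sum_powr_le \<alpha>) auto
      also have "\<dots> = T powr \<alpha> / \<alpha>" using \<tau>0 T by (simp add: N\<tau> powr_divide)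
      finally show "(\<Sum>m<N. \<tau> powr \<alpha> * real (m + 1) powr (\<alpha> - 1)) powr p \<le> (T powr \<alpha> / \<alpha>) powr p"
        using p by (intro powr_mono2) (auto intro!: sum_nonneg)
    qed (auto intro!: sum_nonneg)
    finally have "\<tau> * (\<Sum>n=1..N. X n powr p) \<le> \<tau> * ((T powr \<alpha> / \<alpha>) powr p * (B * \<tau> powr (s * p - 1) * G powr p))"
      using \<tau>0 by (intro mult_left_mono) auto
    also have "\<dots> = (T powr \<alpha> / \<alpha>) powr p * B * (\<tau> * \<tau> powr (s * p - 1)) * G powr p" by simp
    also have "\<tau> * \<tau> powr (s * p - 1) = \<tau> powr (s * p)" using \<tau>0 powr_add[of \<tau> 1 "s * p - 1"] by simp
    also have "(T powr \<alpha> / \<alpha>) powr p * B * \<tau> powr (s * p) * G powr p \<le> (T powr \<alpha> / \<alpha>) powr p * B * \<tau> powr (m * p) * G powr p"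
      using B p by (intro mult_right_mono mult_left_mono mono\<tau>) (auto simp: m_def)
    finally have 1: "\<tau> * (\<Sum>n=1..N. X n powr p) \<le> (T powr \<alpha> / \<alpha>) powr p * B * (\<tau> powr (m * p) * G powr p)" by (simp only: mult.assoc)
    have Ysum: "\<tau> * (\<Sum>n=1..N. Y n powr p) = \<tau> powr (1 + \<alpha> * p) * g1 powr p * (\<Sum>n=1..N. real n powr (- r))"
    proof -
      have "Y n powr p = \<tau> powr (\<alpha> * p) * g1 powr p * real n powr (- r)" for n
        using g1 by (simp add: Y_def powr_mult powr_powr r_def left_diff_distrib)
      then have "(\<Sum>n=1..N. Y n powr p) = \<tau> powr (\<alpha> * p) * g1 powr p * (\<Sum>n=1..N. real n powr (- r))"
        by (simp only: sum_distrib_left)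
      moreover have "\<tau> powr (1 + \<alpha> * p) = \<tau> * \<tau> powr (\<alpha> * p)" using \<tau>0 by (simp add: powr_add)
      ultimately show ?thesis by simp
    qed
    have key: "\<tau> powr (1 + \<alpha> * p) * (\<Sum>n=1..N. real n powr (- r)) \<le> Z * \<tau> powr (m * p)"
    proof (cases "1 < r")
      case True
      have "m * p \<le> (1 / p + \<alpha>) * p" using p by (intro mult_right_mono) (auto simp: m_def)
      also have "\<dots> = 1 + \<alpha> * p" using p by (simp add: distrib_right)
      finally have "\<tau> powr (1 + \<alpha> * p) \<le> \<tau> powr (m * p)" by (rule mono\<tau>)
      moreover have "(\<Sum>n=1..N. real n powr (- r)) \<le> Z" using zeta_sum_bound[OF True, of "{1..N}"] True by (simp add: Z_def)
      ultimately have "\<tau> powr (1 + \<alpha> * p) * (\<Sum>n=1..N. real n powr (- r)) \<le> \<tau> powr (m * p) * Z"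
        by (intro mult_mono) (auto intro: sum_nonneg)
      then show ?thesis by (simp add: mult.commute)
    next
      case False
      have "(\<Sum>n=1..N. real n powr (- r)) \<le> (\<Sum>n=1..N. real n powr (- (1 + \<eta>)) * real N powr (1 - r + \<eta>))"
      proof (rule sum_mono)
        fix n assume n: "n \<in> {1..N}"
        have "real n powr (- r) = real n powr (- (1 + \<eta>)) * real n powr (1 - r + \<eta>)" using n by (simp add: powr_add[symmetric])
        also have "\<dots> \<le> real n powr (- (1 + \<eta>)) * real N powr (1 - r + \<eta>)"
          using n False \<eta> by (intro mult_left_mono powr_mono2) auto
        finally show "real n powr (- r) \<le> real n powr (- (1 + \<eta>)) * real N powr (1 - r + \<eta>)" .
      qed
      also have "\<dots> = (\<Sum>n=1..N. real n powr (- (1 + \<eta>))) * real N powr (1 - r + \<eta>)" by (simp only: sum_distrib_right)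
      also have "\<dots> \<le> zeta_sum (1 + \<eta>) * real N powr (1 - r + \<eta>)"
        using \<eta> by (intro mult_right_mono zeta_sum_bound) auto
      also have "\<dots> = Z * \<tau> powr (- (1 - r + \<eta>))"
      proof -
        have "(T / \<tau>) powr e = T powr e * \<tau> powr (- e)" for e
          using \<tau>0 T by (simp add: powr_divide powr_minus_divide)
        then show ?thesis using False by (simp add: Z_def N\<tau>)
      qed
      finally have "\<tau> powr (1 + \<alpha> * p) * (\<Sum>n=1..N. real n powr (- r)) \<le> \<tau> powr (1 + \<alpha> * p) * (Z * \<tau> powr (- (1 - r + \<eta>)))"
        by (intro mult_left_mono) auto
      also have "\<dots> = Z * \<tau> powr (s * p)"
      proof -
        have "1 + \<alpha> * p + - (1 - r + \<eta>) = s * p" by (simp add: r_def \<eta>_def algebra_simps)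
        then have "\<tau> powr (1 + \<alpha> * p) * \<tau> powr (- (1 - r + \<eta>)) = \<tau> powr (s * p)" by (simp only: powr_add[symmetric])
        then show ?thesis by simp
      qed
      also have "\<dots> \<le> Z * \<tau> powr (m * p)" using Z0 p by (intro mult_left_mono mono\<tau>) (auto simp: m_def)
      finally show ?thesis .
    qed
    have "\<tau> * (\<Sum>n=1..N. Y n powr p) = g1 powr p * (\<tau> powr (1 + \<alpha> * p) * (\<Sum>n=1..N. real n powr (- r)))" unfolding Ysum by (simp only: mult_ac)
    also have "\<dots> \<le> (B * G) powr p * (Z * \<tau> powr (m * p))"
      by (rule mult_mono[OF powr_mono2 key]) (use g1 p in \<open>auto intro!: sum_nonneg mult_nonneg_nonneg\<close>)
    also have "\<dots> = B powr p * Z * (\<tau> powr (m * p) * G powr p)" using B G by (simp add: powr_mult)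
    finally have 2: "\<tau> * (\<Sum>n=1..N. Y n powr p) \<le> B powr p * Z * (\<tau> powr (m * p) * G powr p)" .
    have "(\<Sum>n=1..N. \<epsilon> n powr p) \<le> (\<Sum>n=1..N. (2 * A) powr p * (X n powr p + Y n powr p))"
    proof (rule sum_mono)
      fix n assume n: "n \<in> {1..N}"
      have "\<epsilon> n \<le> A * (X n + Y n)" using \<epsilon>(2)[OF n] by (simp add: X_def Y_def)
      then have "\<epsilon> n powr p \<le> (A * (X n + Y n)) powr p" using \<epsilon>(1)[OF n] p by (intro powr_mono2) auto
      also have "\<dots> = A powr p * (X n + Y n) powr p" using A XY by (simp add: powr_mult)
      also have "\<dots> \<le> A powr p * (2 powr p * (X n powr p + Y n powr p))"
        using XY p by (intro mult_left_mono powr_add_le) auto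
      also have "\<dots> = (2 * A) powr p * (X n powr p + Y n powr p)" using A by (simp add: powr_mult)
      finally show "\<epsilon> n powr p \<le> (2 * A) powr p * (X n powr p + Y n powr p)" .
    qed
    also have "\<dots> = (2 * A) powr p * ((\<Sum>n=1..N. X n powr p) + (\<Sum>n=1..N. Y n powr p))"
      by (simp only: sum_distrib_left[symmetric] sum.distrib)
    finally have "\<tau> * (\<Sum>n=1..N. \<epsilon> n powr p) \<le> \<tau> * ((2 * A) powr p * ((\<Sum>n=1..N. X n powr p) + (\<Sum>n=1..N. Y n powr p)))"
      using \<tau>0 by (intro mult_left_mono) auto
    also have "\<dots> = (2 * A) powr p * (\<tau> * (\<Sum>n=1..N. X n powr p) + \<tau> * (\<Sum>n=1..N. Y n powr p))"
      by (simp add: algebra_simps)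
    also have "\<dots> \<le> (2 * A) powr p * ((T powr \<alpha> / \<alpha>) powr p * B * (\<tau> powr (m * p) * G powr p) + B powr p * Z * (\<tau> powr (m * p) * G powr p))"
      by (intro mult_left_mono add_mono 1 2) auto
    also have "\<dots> = D * (\<tau> powr (m * p) * G powr p)" by (simp add: D_def algebra_simps)
    also have "\<dots> \<le> (D + 1) * (\<tau> powr (m * p) * G powr p)" by (intro mult_right_mono) auto
    finally have "(\<tau> * (\<Sum>n=1..N. \<epsilon> n powr p)) powr (1 / p) \<le> ((D + 1) * (\<tau> powr (m * p) * G powr p)) powr (1 / p)"
      using \<tau>0 p by (intro powr_mono2) (auto intro!: mult_nonneg_nonneg sum_nonneg)
    also have "\<dots> = (D + 1) powr (1 / p) * \<tau> powr m * G"
      using D0 G p by (simp add: powr_mult powr_powr)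
    finally show ?thesis .
  qed
  have "0 < (D + 1) powr (1 / p)" using D0 by simp
  then show ?thesis using main unfolding m_def by (intro exI[of _ "(D + 1) powr (1 / p)"]) blast
qed

section \<open>The Sobolev embedding in time\<close>

lemma L2_mult_integrable:
  assumes "f \<in> L2 \<Omega>" "g \<in> L2 \<Omega>"
  shows "integrable (lebesgue_on \<Omega>) (\<lambda>x. f x * g x)"
proof (rule Bochner_Integration.integrable_bound)
  show "integrable (lebesgue_on \<Omega>) (\<lambda>x. (f x)\<^sup>2 + (g x)\<^sup>2)" using assms by (auto simp: L2_def)
  show "(\<lambda>x. f x * g x) \<in> borel_measurable (lebesgue_on \<Omega>)" using assms by (auto simp: L2_def)
  have "\<bar>a * b\<bar> \<le> a\<^sup>2 + b\<^sup>2" for a b :: real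
  proof -
    have "0 \<le> (\<bar>a\<bar> - \<bar>b\<bar>)\<^sup>2" by simp
    then have "2 * \<bar>a * b\<bar> \<le> a\<^sup>2 + b\<^sup>2" by (simp add: power2_diff abs_mult)
    then show ?thesis by linarith
  qed
  then show "AE x in lebesgue_on \<Omega>. norm (f x * g x) \<le> norm ((f x)\<^sup>2 + (g x)\<^sup>2)" by (auto intro!: AE_I2)
qed

lemma L2_combination:
  assumes "f \<in> L2 \<Omega>" "g \<in> L2 \<Omega>"
  shows "(\<lambda>x. a * f x + b * g x) \<in> L2 \<Omega>"
proof -
  have "integrable (lebesgue_on \<Omega>) (\<lambda>x. a\<^sup>2 * (f x)\<^sup>2 + 2 * a * b * (f x * g x) + b\<^sup>2 * (g x)\<^sup>2)"
    using assms L2_mult_integrable[OF assms]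
    by (intro Bochner_Integration.integrable_add integrable_mult_right) (auto simp: L2_def)
  also have "(\<lambda>x. a\<^sup>2 * (f x)\<^sup>2 + 2 * a * b * (f x * g x) + b\<^sup>2 * (g x)\<^sup>2) = (\<lambda>x. (a * f x + b * g x)\<^sup>2)"
    by (simp add: fun_eq_iff power2_eq_square algebra_simps)
  finally show ?thesis using assms by (auto simp: L2_def)
qed

lemma L2_diff: "f \<in> L2 \<Omega> \<Longrightarrow> g \<in> L2 \<Omega> \<Longrightarrow> (\<lambda>x. f x - g x) \<in> L2 \<Omega>"
  using L2_combination[of f \<Omega> g 1 "-1"] by simp

lemma L2_inner_commute: "L2_inner \<Omega> f g = L2_inner \<Omega> g f"
  by (simp add: L2_inner_def mult.commute)

lemma L2_inner_combination:
  assumes "f \<in> L2 \<Omega>" "g \<in> L2 \<Omega>" "h \<in> L2 \<Omega>"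
  shows "L2_inner \<Omega> (\<lambda>x. a * f x + b * g x) h = a * L2_inner \<Omega> f h + b * L2_inner \<Omega> g h"
proof -
  have "L2_inner \<Omega> (\<lambda>x. a * f x + b * g x) h = (LINT x|lebesgue_on \<Omega>. a * (f x * h x) + b * (g x * h x))"
    unfolding L2_inner_def by (rule Bochner_Integration.integral_cong) (auto simp: algebra_simps)
  then show ?thesis using L2_mult_integrable[OF assms(1,3)] L2_mult_integrable[OF assms(2,3)]
    by (simp add: L2_inner_def)
qed

lemma L2_inner_diff:
  assumes "f \<in> L2 \<Omega>" "g \<in> L2 \<Omega>" "h \<in> L2 \<Omega>"
  shows "L2_inner \<Omega> (\<lambda>x. f x - g x) h = L2_inner \<Omega> f h - L2_inner \<Omega> g h"
  using L2_inner_combination[OF assms, of 1 "-1"] by simp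

lemma L2_inner_nonneg: "0 \<le> L2_inner \<Omega> f f"
  by (simp add: L2_inner_def)

lemma L2_norm_nonneg: "0 \<le> L2_norm \<Omega> f"
  by (simp add: L2_norm_def L2_inner_nonneg)

lemma L2_norm_square: "(L2_norm \<Omega> f)\<^sup>2 = L2_inner \<Omega> f f"
  by (simp add: L2_norm_def L2_inner_nonneg)

lemma L2_norm_expand:
  assumes "f \<in> L2 \<Omega>" "g \<in> L2 \<Omega>"
  shows "(L2_norm \<Omega> (\<lambda>x. a * f x + b * g x))\<^sup>2 = a\<^sup>2 * (L2_norm \<Omega> f)\<^sup>2 + 2 * a * b * L2_inner \<Omega> f g + b\<^sup>2 * (L2_norm \<Omega> g)\<^sup>2"
proof -
  let ?h = "\<lambda>x. a * f x + b * g x"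
  have h: "?h \<in> L2 \<Omega>" by (rule L2_combination[OF assms])
  have "L2_inner \<Omega> ?h ?h = a * L2_inner \<Omega> f ?h + b * L2_inner \<Omega> g ?h"
    by (rule L2_inner_combination[OF assms h])
  also have "L2_inner \<Omega> f ?h = a * L2_inner \<Omega> f f + b * L2_inner \<Omega> g f"
    unfolding L2_inner_commute[of _ f ?h] by (rule L2_inner_combination[OF assms assms(1)])
  also have "L2_inner \<Omega> g ?h = a * L2_inner \<Omega> f g + b * L2_inner \<Omega> g g"
    unfolding L2_inner_commute[of _ g ?h] by (rule L2_inner_combination[OF assms assms(2)])
  also have "L2_inner \<Omega> g f = L2_inner \<Omega> f g" by (rule L2_inner_commute)
  finally show ?thesis unfolding L2_norm_square by (simp add: power2_eq_square algebra_simps)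
qed

text \<open>Nonnegativity of the quadratic form in a and b. A vanishing norm of g has its own case,
  because g need not be the zero function; there the form is affine in k and bounded below, so its
  slope is 0.\<close>

lemma L2_Cauchy_Schwarz:
  assumes "f \<in> L2 \<Omega>" "g \<in> L2 \<Omega>"
  shows "\<bar>L2_inner \<Omega> f g\<bar> \<le> L2_norm \<Omega> f * L2_norm \<Omega> g"
proof -
  let ?I = "L2_inner \<Omega> f g" and ?F = "L2_norm \<Omega> f" and ?G = "L2_norm \<Omega> g"
  have q: "0 \<le> a\<^sup>2 * ?F\<^sup>2 + 2 * a * b * ?I + b\<^sup>2 * ?G\<^sup>2" for a b
    unfolding L2_norm_expand[OF assms, symmetric] by simp
  have "?I\<^sup>2 \<le> (?F * ?G)\<^sup>2"
  proof (cases "?G = 0")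
    case True
    have "0 \<le> ?F\<^sup>2 - 2 * k * ?I\<^sup>2" for k using q[of 1 "- k * ?I"] True by (simp add: power2_eq_square algebra_simps)
    from this[of "(?F\<^sup>2 + 1) / (2 * ?I\<^sup>2)"] have "?I = 0" by (cases "?I = 0") auto
    then show ?thesis by simp
  next
    case False
    have "0 \<le> (?G\<^sup>2)\<^sup>2 * ?F\<^sup>2 + 2 * ?G\<^sup>2 * (- ?I) * ?I + (- ?I)\<^sup>2 * ?G\<^sup>2" by (rule q)
    also have "\<dots> = ?G\<^sup>2 * ((?F * ?G)\<^sup>2 - ?I\<^sup>2)" by (simp add: power2_eq_square algebra_simps)
    finally show ?thesis using False by (simp add: zero_le_mult_iff)
  qed
  then show ?thesis by (metis L2_norm_nonneg abs_le_square_iff abs_of_nonneg mult_nonneg_nonneg)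
qed

lemma L2_norm_triangle:
  assumes "f \<in> L2 \<Omega>" "g \<in> L2 \<Omega>"
  shows "L2_norm \<Omega> (\<lambda>x. f x + g x) \<le> L2_norm \<Omega> f + L2_norm \<Omega> g"
proof -
  have "(L2_norm \<Omega> (\<lambda>x. f x + g x))\<^sup>2 \<le> (L2_norm \<Omega> f + L2_norm \<Omega> g)\<^sup>2"
    using L2_norm_expand[OF assms, of 1 1] L2_Cauchy_Schwarz[OF assms] by (simp add: power2_sum)
  then show ?thesis by (rule power2_le_imp_le) (simp add: L2_norm_nonneg)
qed

lemma L2_norm_minus_commute: "L2_norm \<Omega> (\<lambda>x. f x - g x) = L2_norm \<Omega> (\<lambda>x. g x - f x)"
  by (simp add: L2_norm_def L2_inner_def power2_eq_square[symmetric] power2_commute)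

lemma L2_norm_diff_triangle:
  assumes "f \<in> L2 \<Omega>" "g \<in> L2 \<Omega>" "h \<in> L2 \<Omega>"
  shows "L2_norm \<Omega> (\<lambda>x. f x - h x) \<le> L2_norm \<Omega> (\<lambda>x. f x - g x) + L2_norm \<Omega> (\<lambda>x. g x - h x)"
  using L2_norm_triangle[OF L2_diff[OF assms(1,2)] L2_diff[OF assms(2,3)]] by simp

lemma L2_norm_cong_AE:
  assumes "f \<in> L2 \<Omega>" "f' \<in> L2 \<Omega>" "AE x in lebesgue_on \<Omega>. f x = f' x"
  shows "L2_norm \<Omega> f' = L2_norm \<Omega> f"
proof -
  have [measurable]: "f \<in> borel_measurable (lebesgue_on \<Omega>)" "f' \<in> borel_measurable (lebesgue_on \<Omega>)"
    using assms by (auto simp: L2_def)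
  show ?thesis
    unfolding L2_norm_def L2_inner_def
    by (rule arg_cong[where f = sqrt], rule integral_cong_AE) (use assms(3) in \<open>auto elim!: eventually_mono\<close>)
qed

section \<open>A fractional Morrey estimate\<close>

text \<open>The embedding uses a function \<open>g\<close> with values in \<open>L\<^sup>2\<close> only through \<open>H t \<xi> = \<parallel>g t - g \<xi>\<parallel>\<close>.\<close>

locale cont_pseudometric =
  fixes H :: "real \<Rightarrow> real \<Rightarrow> real"
  assumes H_self: "H x x = 0" and H_sym: "H x y = H y x" and H_tri: "H x z \<le> H x y + H y z"
    and H_cont: "((\<lambda>y. H y x) \<longlongrightarrow> 0) (at x)"
begin

lemma H_nonneg: "0 \<le> H x y"
  using H_tri[of x x y] H_self[of x] H_sym[of x y] by simp

text \<open>The triangle inequality bounds the change of H by the distances in the two arguments.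
  Joint continuity supplies the measurability that the double integrals require.\<close>

lemma H_continuous: "continuous_on UNIV (\<lambda>z. H (fst z) (snd z))"
proof (rule continuous_at_imp_continuous_on, rule ballI)
  fix z :: "real \<times> real"
  obtain a b where z: "z = (a, b)" by fastforce
  have iso: "isCont (\<lambda>y. H y x) x" for x using H_cont[of x] by (simp add: isCont_def H_self)
  have "((\<lambda>w. H (fst w) a + H (snd w) b) \<longlongrightarrow> H (fst (a, b)) a + H (snd (a, b)) b) (at (a, b))"
    by (intro tendsto_intros isCont_tendsto_compose[where g = "\<lambda>y. H y a", OF _ tendsto_fst]
        isCont_tendsto_compose[where g = "\<lambda>y. H y b", OF _ tendsto_snd]) (auto simp: iso)
  then have lim: "((\<lambda>w. H (fst w) a + H (snd w) b) \<longlongrightarrow> 0) (at (a, b))" by (simp add: H_self)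
  have "((\<lambda>w. H (fst w) (snd w) - H a b) \<longlongrightarrow> 0) (at (a, b))"
  proof (rule Lim_null_comparison[OF _ lim], rule always_eventually, rule allI)
    fix w :: "real \<times> real"
    have "H (fst w) (snd w) \<le> H (fst w) a + H a b + H b (snd w)" using H_tri[of "fst w" "snd w" a] H_tri[of a "snd w" b] by linarith
    moreover have "H a b \<le> H a (fst w) + H (fst w) (snd w) + H (snd w) b" using H_tri[of a b "fst w"] H_tri[of "fst w" b "snd w"] by linarith
    ultimately show "norm (H (fst w) (snd w) - H a b) \<le> H (fst w) a + H (snd w) b"
      using H_sym[of b "snd w"] H_sym[of a "fst w"] by (simp add: abs_le_iff)
  qed
  then show "isCont (\<lambda>z. H (fst z) (snd z)) z" unfolding z isCont_def by (subst (asm) LIM_zero_iff) auto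
qed

lemma H_measurable [measurable]: "(\<lambda>z. H (fst z) (snd z)) \<in> borel_measurable (borel \<Otimes>\<^sub>M borel)"
  using borel_measurable_continuous_onI[OF H_continuous] by (simp add: borel_prod)

lemma H_section_measurable [measurable]:
  assumes [measurable]: "f \<in> borel_measurable M" "g \<in> borel_measurable M"
  shows "(\<lambda>z. H (f z) (g z)) \<in> borel_measurable M"
  using measurable_compose[OF measurable_Pair[OF assms] H_measurable] by simp

definition slobodeckij_energy :: "real \<Rightarrow> real \<Rightarrow> real set \<Rightarrow> ennreal" where
  "slobodeckij_energy s p I = (\<integral>\<^sup>+\<xi>. (\<integral>\<^sup>+t. ennreal (H t \<xi> powr p / \<bar>t - \<xi>\<bar> powr (1 + p * s)) * indicator I t \<partial>lborel) * indicator I \<xi> \<partial>lborel)"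

text \<open>Compares the averages of H x over J and over J'. Either H t xi \<le> y, or H t xi \<le>
  y^(1-p) (H t xi)^p, and the latter is at most y^(1-p) L^(1+ps) times the integrand of the energy.
  The free threshold y takes the place of Hoelder's inequality.\<close>

lemma average_step:
  assumes p: "1 < p" and s: "0 < s" and J: "J \<in> sets borel" "J' \<in> sets borel" "J' \<subseteq> J" "J \<subseteq> I" "I \<in> sets borel"
    and L: "0 \<le> L" "emeasure lborel J = ennreal L" "0 \<le> L'" "emeasure lborel J' = ennreal L'" and diam: "\<And>u v. u \<in> J \<Longrightarrow> v \<in> J \<Longrightarrow> \<bar>u - v\<bar> \<le> L"
    and y: "0 < y"
  shows "ennreal L' * (\<integral>\<^sup>+t. ennreal (H x t) * indicator J t \<partial>lborel)
    \<le> ennreal L * (\<integral>\<^sup>+t. ennreal (H x t) * indicator J' t \<partial>lborel) + ennreal (L * L' * y) + ennreal (y powr (1 - p) * L powr (1 + p * s)) * slobodeckij_energy s p I"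
proof -
  note [measurable] = J(1,2,5)
  define \<Phi> where "\<Phi> t \<xi> = H t \<xi> powr p / \<bar>t - \<xi>\<bar> powr (1 + p * s)" for t \<xi>
  define c where "c = y powr (1 - p) * L powr (1 + p * s)"
  have c0: "0 \<le> c" and \<Phi>0: "0 \<le> \<Phi> t \<xi>" for t \<xi> by (simp_all add: c_def \<Phi>_def)
  have [measurable]: "(\<lambda>z. \<Phi> (f z) (g z)) \<in> borel_measurable M" if [measurable]: "f \<in> borel_measurable M" "g \<in> borel_measurable M" for f g and M :: "'z measure"
    unfolding \<Phi>_def by measurable
  have pt: "H x t \<le> H x \<xi> + y + c * \<Phi> t \<xi>" if t: "t \<in> J" and \<xi>: "\<xi> \<in> J'" for t \<xi>
  proof -
    have "H \<xi> t \<le> y + c * \<Phi> t \<xi>"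
    proof (cases "H t \<xi> \<le> y")
      case True
      have "0 \<le> c * \<Phi> t \<xi>" using c0 \<Phi>0 by simp
      then show ?thesis using True H_sym[of \<xi> t] by linarith
    next
      case False
      then have ht: "y < H t \<xi>" by simp
      then have ne: "t \<noteq> \<xi>" using H_self y by auto
      have "H t \<xi> = H t \<xi> powr (1 - p) * H t \<xi> powr p" using ht y by (simp add: powr_add[symmetric])
      also have "\<dots> \<le> y powr (1 - p) * H t \<xi> powr p"
        using ht y p by (intro mult_right_mono powr_mono2') auto
      also have "H t \<xi> powr p = \<bar>t - \<xi>\<bar> powr (1 + p * s) * \<Phi> t \<xi>" using ne by (simp add: \<Phi>_def)
      also have "y powr (1 - p) * (\<bar>t - \<xi>\<bar> powr (1 + p * s) * \<Phi> t \<xi>) \<le> y powr (1 - p) * (L powr (1 + p * s) * \<Phi> t \<xi>)"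
      proof (intro mult_left_mono mult_right_mono powr_mono2)
        show "\<bar>t - \<xi>\<bar> \<le> L" using diam[of t \<xi>] t \<xi> J by auto
      qed (use p s \<Phi>0 in auto)
      finally show ?thesis using H_sym[of \<xi> t] y by (simp add: mult.assoc c_def)
    qed
    then show ?thesis using H_tri[of x t \<xi>] by linarith
  qed
  have "ennreal L' * (\<integral>\<^sup>+t. ennreal (H x t) * indicator J t \<partial>lborel) = (\<integral>\<^sup>+\<xi>. (\<integral>\<^sup>+t. ennreal (H x t) * indicator J t \<partial>lborel) * indicator J' \<xi> \<partial>lborel)"
    by (subst nn_integral_cmult_indicator) (auto simp: L mult.commute)
  also have "\<dots> = (\<integral>\<^sup>+\<xi>. (\<integral>\<^sup>+t. ennreal (H x t) * indicator J t * indicator J' \<xi> \<partial>lborel) \<partial>lborel)"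
    by (simp add: nn_integral_multc)
  also have "\<dots> \<le> (\<integral>\<^sup>+\<xi>. (\<integral>\<^sup>+t. (ennreal (H x \<xi>) * indicator J' \<xi>) * indicator J t + ennreal y * indicator J' \<xi> * indicator J t
     + ennreal c * (ennreal (\<Phi> t \<xi>) * indicator I t * indicator I \<xi>) \<partial>lborel) \<partial>lborel)"
  proof (intro nn_integral_mono)
    fix \<xi> t
    show "ennreal (H x t) * indicator J t * indicator J' \<xi> \<le> (ennreal (H x \<xi>) * indicator J' \<xi>) * indicator J t + ennreal y * indicator J' \<xi> * indicator J t
     + ennreal c * (ennreal (\<Phi> t \<xi>) * indicator I t * indicator I \<xi>)"
    proof (cases "t \<in> J \<and> \<xi> \<in> J'")
      case True
      then have "t \<in> I" "\<xi> \<in> I" using J by auto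
      have "ennreal (H x t) \<le> ennreal (H x \<xi> + y + c * \<Phi> t \<xi>)" using pt True by (intro ennreal_leI) auto
      also have "\<dots> = ennreal (H x \<xi>) + ennreal y + ennreal c * ennreal (\<Phi> t \<xi>)"
        using H_nonneg[of x \<xi>] y c0 \<Phi>0[of t \<xi>] by (simp add: ennreal_mult)
      finally show ?thesis using True \<open>t \<in> I\<close> \<open>\<xi> \<in> I\<close> by simp
    qed auto
  qed
  also have "\<dots> = (\<integral>\<^sup>+\<xi>. ((ennreal (H x \<xi>) * indicator J' \<xi>) * ennreal L + ennreal y * indicator J' \<xi> * ennreal L
     + ennreal c * ((\<integral>\<^sup>+t. ennreal (\<Phi> t \<xi>) * indicator I t * indicator I \<xi> \<partial>lborel))) \<partial>lborel)"
    by (intro nn_integral_cong) (simp add: nn_integral_add nn_integral_cmult nn_integral_cmult_indicator L)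
  also have "\<dots> = ennreal L * (\<integral>\<^sup>+t. ennreal (H x t) * indicator J' t \<partial>lborel) + ennreal (L * L' * y) + ennreal c * slobodeckij_energy s p I"
    unfolding slobodeckij_energy_def \<Phi>_def[symmetric] using y L
    by (simp add: nn_integral_add nn_integral_cmult nn_integral_multc nn_integral_cmult_indicator ennreal_mult mult_ac)
  finally show ?thesis unfolding c_def .
qed

end

text \<open>The dyadic steps form a geometric series with ratio (1/2)^(s-1/p) and factor 3; it is
  doubled because two points are compared through their averages.\<close>

definition morrey_const :: "real \<Rightarrow> real \<Rightarrow> real" where
  "morrey_const s p = 6 / (1 - (1/2) powr (s - 1 / p))"

lemma half_powr_less_one: "0 < \<theta> \<Longrightarrow> (1/2::real) powr \<theta> < 1"
  using powr01_less_one[of "1/2" \<theta>] by simp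

context cont_pseudometric
begin

text \<open>
  The averages of \<open>H x\<close> over intervals shrinking dyadically to \<open>x\<close> tend to \<open>0\<close> by continuity, and
  \<open>average_step\<close> bounds consecutive differences by a geometric sequence.
\<close>

lemma morrey_average:
  assumes p: "1 < p" and s: "1 / p < s" and ab: "a < b" and G: "0 \<le> G" "slobodeckij_energy s p {a<..<b} \<le> ennreal (G powr p)"
    and x: "x \<in> {a..b}"
  shows "(\<integral>\<^sup>+t. ennreal (H x t) * indicator {a<..<b} t \<partial>lborel) \<le> ennreal ((b - a) * (morrey_const s p / 2 * (b - a) powr (s - 1 / p) * G))"
proof -
  define \<theta> where "\<theta> = s - 1 / p"
  define \<rho> where "\<rho> = (1/2::real) powr \<theta>"
  define l where "l = b - a"
  have \<theta>: "0 < \<theta>" "\<theta> * p = s * p - 1" using s p by (auto simp: \<theta>_def field_simps)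
  have \<rho>: "0 < \<rho>" "\<rho> < 1" using half_powr_less_one[OF \<theta>(1)] by (auto simp: \<rho>_def)
  have l: "0 < l" using ab by (simp add: l_def)
  have s0: "0 < s" using s p by (simp add: less_trans[rotated])
  \<comment> \<open>Both end points contract towards x by the factor 1/2, so the intervals have
    length (b-a)/2^k and stay in (a,b) even if x is an end point.\<close>
  define J where "J k = {x - (x - a) / 2 ^ k<..<x + (b - x) / 2 ^ k}" for k :: nat
  define L where "L k = l / 2 ^ k" for k :: nat
  have L: "0 < L k" for k using l by (simp add: L_def)
  have LS: "L (Suc k) = L k / 2" for k by (simp add: L_def)
  have Jle: "x - (x - a) / 2 ^ k \<le> x + (b - x) / 2 ^ k" for k
  proof -
    have "0 \<le> (x - a) / 2 ^ k" "0 \<le> (b - x) / 2 ^ k" using x by auto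
    then show ?thesis by linarith
  qed
  have emJ: "emeasure lborel (J k) = ennreal (L k)" for k
  proof -
    have "x + (b - x) / 2 ^ k - (x - (x - a) / 2 ^ k) = L k" by (simp add: L_def l_def diff_divide_distrib add_divide_distrib)
    then show ?thesis using Jle[of k] by (simp add: J_def)
  qed
  have Jsub: "J (Suc k) \<subseteq> J k" for k
  proof -
    have "(x - a) / 2 ^ Suc k \<le> (x - a) / 2 ^ k" "(b - x) / 2 ^ Suc k \<le> (b - x) / 2 ^ k"
      using x by (auto intro!: divide_left_mono)
    then show ?thesis unfolding J_def by auto
  qed
  have J0: "J 0 = {a<..<b}" by (auto simp: J_def)
  have JI: "J k \<subseteq> {a<..<b}" for k
    by (induction k) (use Jsub J0 in auto)
  have Jm [measurable]: "J k \<in> sets borel" for k by (simp add: J_def)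
  have diam: "\<bar>u - v\<bar> \<le> L k" if "u \<in> J k" "v \<in> J k" for u v k
  proof -
    have "x + (b - x) / 2 ^ k - (x - (x - a) / 2 ^ k) = L k" by (simp add: L_def l_def diff_divide_distrib add_divide_distrib)
    then show ?thesis using that by (auto simp: J_def)
  qed
  define Nn where "Nn k = (\<integral>\<^sup>+t. ennreal (H x t) * indicator (J k) t \<partial>lborel)" for k
  have Hx: "continuous_on UNIV (\<lambda>t. H x t)"
    using continuous_on_compose2[OF H_continuous, of UNIV "\<lambda>t. (x, t)"] by (simp add: continuous_on_Pair)
  have Nle: "Nn k \<le> ennreal (\<delta> * L k)" if "0 \<le> \<delta>" "\<And>t. t \<in> J k \<Longrightarrow> H x t \<le> \<delta>" for \<delta> k
  proof -
    have "Nn k \<le> (\<integral>\<^sup>+t. ennreal \<delta> * indicator (J k) t \<partial>lborel)"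
      unfolding Nn_def by (rule nn_integral_mono) (auto simp: indicator_def that intro!: ennreal_leI)
    also have "\<dots> = ennreal (\<delta> * L k)" using L[of k] that by (simp add: nn_integral_cmult_indicator emJ ennreal_mult)
    finally show ?thesis .
  qed
  have "bounded (H x ` {a..b})" by (intro compact_imp_bounded compact_continuous_image continuous_on_subset[OF Hx]) auto
  then obtain Bd where Bd: "\<forall>t\<in>{a..b}. \<bar>H x t\<bar> \<le> Bd" by (auto simp: bounded_iff)
  have "\<bar>H x a\<bar> \<le> Bd" using Bd ab by auto
  then have Bd0: "0 \<le> Bd" by linarith
  have "Nn k \<le> ennreal (Bd * L k)" for k
  proof (rule Nle[OF Bd0])
    fix t assume "t \<in> J k"
    with JI[of k] have "t \<in> {a..b}" by auto
    with Bd have "\<bar>H x t\<bar> \<le> Bd" by blast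
    then show "H x t \<le> Bd" by linarith
  qed
  then have fin: "Nn k < top" for k by (metis ennreal_less_top order_le_less_trans)
  define n where "n k = enn2real (Nn k)" for k
  have n: "Nn k = ennreal (n k)" "0 \<le> n k" for k using fin[of k] by (auto simp: n_def)
  \<comment> \<open>The threshold has to be positive, while G may be 0. The estimate is therefore
    shown for every positive u \<ge> G, and u tends to G afterwards.\<close>
  have main: "n 0 / L 0 \<le> 3 / (1 - \<rho>) * l powr \<theta> * u" if u: "0 < u" "G \<le> u" for u
  proof -
    \<comment> \<open>This choice balances the two error terms of \<open>average_step\<close>: after
      division by \<open>L k * L (Suc k)\<close> they are \<open>y k\<close> and
      \<open>2 * y k\<close>, whence the factor 3.\<close>
    define y where "y k = L k powr \<theta> * u" for k
    have y: "0 < y k" for k using u L[of k] by (simp add: y_def)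
    have yk: "y k = l powr \<theta> * u * \<rho> ^ k" for k
    proof -
      have "(1 / 2 ^ k) powr \<theta> = \<rho> ^ k"
        unfolding \<rho>_def by (simp add: powr_realpow[symmetric] powr_powr powr_divide powr_power mult.commute flip: power_one_over)
      moreover have "L k = l * (1 / 2 ^ k)" by (simp add: L_def)
      ultimately show ?thesis using l by (simp only: y_def powr_mult) (simp add: powr_mult)
    qed
    have step: "n k / L k \<le> n (Suc k) / L (Suc k) + 3 * y k" for k
    proof -
      let ?R = "y k powr (1 - p) * L k powr (1 + p * s)"
      have "ennreal (L (Suc k)) * Nn k \<le> ennreal (L k) * Nn (Suc k) + ennreal (L k * L (Suc k) * y k) + ennreal ?R * slobodeckij_energy s p {a<..<b}"
        unfolding Nn_def
        by (rule average_step[OF p s0]) (use L[of k] L[of "Suc k"] emJ Jsub JI diam y in auto)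
      also have "\<dots> \<le> ennreal (L k) * Nn (Suc k) + ennreal (L k * L (Suc k) * y k) + ennreal ?R * ennreal (u powr p)"
      proof (intro add_mono mult_left_mono order_refl)
        have "ennreal (G powr p) \<le> ennreal (u powr p)" using u G p by (intro ennreal_leI powr_mono2) auto
        with G(2) show "slobodeckij_energy s p {a<..<b} \<le> ennreal (u powr p)" by (rule order_trans)
      qed auto
      also have "\<dots> = ennreal (L k * n (Suc k) + L k * L (Suc k) * y k + ?R * u powr p)"
        using L[of k] L[of "Suc k"] y[of k] n by (simp add: ennreal_mult less_imp_le)
      finally have "ennreal (L (Suc k) * n k) \<le> ennreal (L k * n (Suc k) + L k * L (Suc k) * y k + ?R * u powr p)"
        using n L[of "Suc k"] by (simp add: ennreal_mult less_imp_le)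
      then have le: "L (Suc k) * n k \<le> L k * n (Suc k) + L k * L (Suc k) * y k + ?R * u powr p"
        using L[of k] L[of "Suc k"] y[of k] n(2) by (subst (asm) ennreal_le_iff) (auto intro!: add_nonneg_nonneg mult_nonneg_nonneg less_imp_le)
      have "?R * u powr p = (L k)\<^sup>2 * y k"
      proof -
        have "y k powr (1 - p) = L k powr (\<theta> * (1 - p)) * u powr (1 - p)" using u L[of k] by (simp add: y_def powr_mult powr_powr)
        then have "?R * u powr p = (L k powr (\<theta> * (1 - p)) * L k powr (1 + p * s)) * (u powr (1 - p) * u powr p)" by (simp only: mult_ac)
        also have "L k powr (\<theta> * (1 - p)) * L k powr (1 + p * s) = L k powr (2 + \<theta>)"
        proof -
          have "\<theta> * (1 - p) + (1 + p * s) = 2 + \<theta>" using \<theta>(2) by (simp add: algebra_simps)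
          then show ?thesis by (simp only: powr_add[symmetric])
        qed
        also have "u powr (1 - p) * u powr p = u" using u by (simp add: powr_add[symmetric])
        also have "L k powr (2 + \<theta>) = (L k)\<^sup>2 * L k powr \<theta>" using L[of k] by (simp add: powr_add)
        finally show ?thesis by (simp add: y_def)
      qed
      with le have "L k * n k \<le> L k * (2 * n (Suc k)) + L k * (3 * (L k * y k))"
        unfolding LS by (simp add: power2_eq_square algebra_simps)
      then have "L k * n k \<le> L k * (2 * n (Suc k) + 3 * (L k * y k))" by (simp only: distrib_left)
      then have "n k \<le> 2 * n (Suc k) + 3 * (L k * y k)" using L[of k] by simp
      then show ?thesis unfolding LS using L[of k] by (simp add: field_simps)
    qed
    have iter: "n 0 / L 0 \<le> n K / L K + 3 * (\<Sum>k<K. y k)" for K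
      by (induction K) (use step in \<open>auto simp: algebra_simps intro: order_trans\<close>)
    have ysum: "(\<Sum>k<K. y k) \<le> l powr \<theta> * u / (1 - \<rho>)" for K
    proof -
      have "(\<Sum>k<K. y k) = l powr \<theta> * u * (\<Sum>k<K. \<rho> ^ k)" unfolding yk by (simp only: sum_distrib_left)
      also have "(\<Sum>k<K. \<rho> ^ k) = (1 - \<rho> ^ K) / (1 - \<rho>)" using \<rho> by (simp add: sum_gp_strict)
      also have "l powr \<theta> * u * ((1 - \<rho> ^ K) / (1 - \<rho>)) \<le> l powr \<theta> * u * (1 / (1 - \<rho>))"
        using \<rho> u by (intro mult_left_mono divide_right_mono) auto
      finally show ?thesis by simp
    qed
    show ?thesis
    proof (rule field_le_epsilon)
      fix e :: real assume e: "0 < e"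
      have "isCont (\<lambda>t. H x t) x" using Hx by (simp add: continuous_on_eq_continuous_at)
      then obtain d where d: "0 < d" "\<And>t. \<bar>t - x\<bar> < d \<Longrightarrow> H x t \<le> e"
        using e unfolding continuous_at_eps_delta H_self by (metis abs_le_D1 diff_zero dist_real_def less_imp_le real_norm_def)
      obtain K where "l / d < 2 ^ K" using real_arch_pow[of 2 "l / d"] by auto
      then have LK: "L K < d" using d by (simp add: L_def field_simps)
      have "Nn K \<le> ennreal (e * L K)"
      proof (rule Nle)
        fix t assume t: "t \<in> J K"
        have "(x - a) / 2 ^ K \<le> L K" "(b - x) / 2 ^ K \<le> L K" using x by (auto simp: L_def l_def intro!: divide_right_mono)
        with t LK show "H x t \<le> e" by (intro d(2)) (auto simp: J_def abs_less_iff)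
      qed (use e in simp)
      then have "n K \<le> e * L K" using n L[of K] e by (simp add: less_imp_le)
      then have "n K / L K \<le> e" using L[of K] by (simp add: field_simps)
      then have "n 0 / L 0 \<le> e + 3 * (l powr \<theta> * u / (1 - \<rho>))" using iter[of K] ysum[of K] by linarith
      then show "n 0 / L 0 \<le> 3 / (1 - \<rho>) * l powr \<theta> * u + e" by (simp add: ac_simps)
    qed
  qed
  have "n 0 / L 0 \<le> 3 / (1 - \<rho>) * l powr \<theta> * G"
  proof (rule field_le_epsilon)
    fix e :: real assume e: "0 < e"
    define c where "c = 3 / (1 - \<rho>) * l powr \<theta>"
    have c: "0 < c" using \<rho> l by (simp add: c_def)
    have "n 0 / L 0 \<le> c * (G + e / c)" unfolding c_def[symmetric] by (rule main[folded c_def]) (use c e G in \<open>auto intro: add_nonneg_pos\<close>)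
    also have "\<dots> = c * G + e" using c by (simp add: distrib_left)
    finally show "n 0 / L 0 \<le> 3 / (1 - \<rho>) * l powr \<theta> * G + e" by (simp add: c_def)
  qed
  then have "n 0 \<le> l * (3 / (1 - \<rho>) * l powr \<theta> * G)" using l by (simp add: L_def field_simps)
  moreover have "morrey_const s p / 2 = 3 / (1 - \<rho>)"
  proof -
    have "6 / d / 2 = 3 / d" for d :: real by simp
    then show ?thesis unfolding morrey_const_def \<rho>_def \<theta>_def .
  qed
  ultimately have "n 0 \<le> (b - a) * (morrey_const s p / 2 * (b - a) powr (s - 1 / p) * G)" by (simp only: l_def \<theta>_def)
  then have "ennreal (n 0) \<le> ennreal ((b - a) * (morrey_const s p / 2 * (b - a) powr (s - 1 / p) * G))" by (rule ennreal_leI)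
  then show ?thesis unfolding n(1)[symmetric] Nn_def J0 .
qed

text \<open>The triangle inequality through t, averaged over t in (a,b), reduces the claim to
  \<open>morrey_average\<close> at x and at y.\<close>

lemma morrey:
  assumes p: "1 < p" and s: "1 / p < s" and ab: "a < b" and G: "0 \<le> G" "slobodeckij_energy s p {a<..<b} \<le> ennreal (G powr p)"
    and x: "x \<in> {a..b}" and y: "y \<in> {a..b}"
  shows "H x y \<le> morrey_const s p * (b - a) powr (s - 1 / p) * G"
proof -
  let ?Z = "morrey_const s p / 2 * (b - a) powr (s - 1 / p) * G"
  have "(1/2::real) powr (s - 1 / p) < 1" using s by (intro half_powr_less_one) auto
  then have mc: "0 \<le> morrey_const s p" by (simp add: morrey_const_def)
  then have Z: "0 \<le> ?Z" using G by simp
  have "ennreal ((b - a) * H x y) = (\<integral>\<^sup>+t. ennreal (H x y) * indicator {a<..<b} t \<partial>lborel)"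
    using ab H_nonneg by (simp add: nn_integral_cmult_indicator ennreal_mult mult.commute)
  also have "\<dots> \<le> (\<integral>\<^sup>+t. ennreal (H x t) * indicator {a<..<b} t + ennreal (H y t) * indicator {a<..<b} t \<partial>lborel)"
  proof (rule nn_integral_mono)
    fix t
    have "ennreal (H x y) \<le> ennreal (H x t) + ennreal (H y t)"
      using H_tri[of x y t] H_sym[of t y] H_nonneg by (simp flip: ennreal_plus)
    then show "ennreal (H x y) * indicator {a<..<b} t \<le> ennreal (H x t) * indicator {a<..<b} t + ennreal (H y t) * indicator {a<..<b} t"
      by (auto simp: indicator_def)
  qed
  also have "\<dots> = (\<integral>\<^sup>+t. ennreal (H x t) * indicator {a<..<b} t \<partial>lborel) + (\<integral>\<^sup>+t. ennreal (H y t) * indicator {a<..<b} t \<partial>lborel)"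
    by (rule nn_integral_add) measurable
  also have "\<dots> \<le> ennreal ((b - a) * ?Z) + ennreal ((b - a) * ?Z)"
    by (intro add_mono morrey_average p s ab G x y)
  also have "\<dots> = ennreal ((b - a) * (2 * ?Z))"
  proof -
    define v where "v = (b - a) * ?Z"
    have "0 \<le> v" unfolding v_def by (rule mult_nonneg_nonneg[OF _ Z]) (use ab in simp)
    then have "ennreal v + ennreal v = ennreal (2 * v)" by (simp flip: ennreal_plus)
    moreover have "2 * v = (b - a) * (2 * ?Z)" unfolding v_def by (simp only: mult.left_commute)
    ultimately show ?thesis unfolding v_def by (simp only:)
  qed
  finally have le: "ennreal ((b - a) * H x y) \<le> ennreal ((b - a) * (2 * ?Z))" .
  have "0 \<le> 2 * ?Z" using Z by linarith
  then have nn: "0 \<le> (b - a) * (2 * ?Z)" by (rule mult_nonneg_nonneg[rotated]) (use ab in simp)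
  have "(b - a) * H x y \<le> (b - a) * (2 * ?Z)" using le by (simp only: ennreal_le_iff[OF nn])
  then show ?thesis using ab by simp
qed

text \<open>The squares of disjoint sets are disjoint parts of the square of D. This superadditivity
  lets the local oscillations be summed in l^p without a factor N.\<close>

lemma slobodeckij_energy_sum_le:
  assumes I: "finite A" "\<And>j. j \<in> A \<Longrightarrow> I j \<in> sets borel" "disjoint_family_on I A" "\<And>j. j \<in> A \<Longrightarrow> I j \<subseteq> D" and D[measurable]: "D \<in> sets borel"
  shows "(\<Sum>j\<in>A. slobodeckij_energy s p (I j)) \<le> slobodeckij_energy s p D"
proof -
  let ?\<Phi> = "\<lambda>t \<xi>. ennreal (H t \<xi> powr p / \<bar>t - \<xi>\<bar> powr (1 + p * s))"
  have m: "(\<lambda>t. ?\<Phi> t \<xi>) \<in> borel_measurable lborel" for \<xi> by measurable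
  have sen2: "slobodeckij_energy s p J = (\<integral>\<^sup>+\<xi>. (\<integral>\<^sup>+t. ?\<Phi> t \<xi> * indicator J t * indicator J \<xi> \<partial>lborel) \<partial>lborel)" if [measurable]: "J \<in> sets borel" for J
    unfolding slobodeckij_energy_def by (simp add: nn_integral_multc)
  have "(\<Sum>j\<in>A. slobodeckij_energy s p (I j)) = (\<integral>\<^sup>+\<xi>. (\<integral>\<^sup>+t. (\<Sum>j\<in>A. ?\<Phi> t \<xi> * indicator (I j) t * indicator (I j) \<xi>) \<partial>lborel) \<partial>lborel)"
  proof -
    have "(\<Sum>j\<in>A. slobodeckij_energy s p (I j)) = (\<Sum>j\<in>A. (\<integral>\<^sup>+\<xi>. (\<integral>\<^sup>+t. ?\<Phi> t \<xi> * indicator (I j) t * indicator (I j) \<xi> \<partial>lborel) \<partial>lborel))"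
      by (rule sum.cong) (auto simp: sen2 I)
    also have "\<dots> = (\<integral>\<^sup>+\<xi>. (\<Sum>j\<in>A. (\<integral>\<^sup>+t. ?\<Phi> t \<xi> * indicator (I j) t * indicator (I j) \<xi> \<partial>lborel)) \<partial>lborel)"
    proof (rule nn_integral_sum[symmetric])
      fix j assume "j \<in> A"
      then have [measurable]: "I j \<in> sets borel" by (rule I)
      show "(\<lambda>\<xi>. \<integral>\<^sup>+t. ?\<Phi> t \<xi> * indicator (I j) t * indicator (I j) \<xi> \<partial>lborel) \<in> borel_measurable lborel" by measurable
    qed
    also have "\<dots> = (\<integral>\<^sup>+\<xi>. (\<integral>\<^sup>+t. (\<Sum>j\<in>A. ?\<Phi> t \<xi> * indicator (I j) t * indicator (I j) \<xi>) \<partial>lborel) \<partial>lborel)"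
    proof (rule nn_integral_cong, rule nn_integral_sum[symmetric])
      fix \<xi> :: real and j assume "j \<in> A"
      then have [measurable]: "I j \<in> sets borel" by (rule I)
      show "(\<lambda>t. ?\<Phi> t \<xi> * indicator (I j) t * indicator (I j) \<xi>) \<in> borel_measurable lborel" by measurable
    qed
    finally show ?thesis .
  qed
  also have "\<dots> \<le> (\<integral>\<^sup>+\<xi>. (\<integral>\<^sup>+t. ?\<Phi> t \<xi> * indicator D t * indicator D \<xi> \<partial>lborel) \<partial>lborel)"
  proof (intro nn_integral_mono)
    fix \<xi> t :: real
    show "(\<Sum>j\<in>A. ?\<Phi> t \<xi> * indicator (I j) t * indicator (I j) \<xi>) \<le> ?\<Phi> t \<xi> * indicator D t * indicator D \<xi>"
    proof (cases "\<exists>k\<in>A. t \<in> I k")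
      case True
      then obtain k where k: "k \<in> A" "t \<in> I k" by blast
      have uniq: "j = k" if "j \<in> A" "t \<in> I j" for j using I(3) k that by (auto simp: disjoint_family_on_def)
      have "(\<Sum>j\<in>A. ?\<Phi> t \<xi> * indicator (I j) t * indicator (I j) \<xi>) = (\<Sum>j\<in>{k}. ?\<Phi> t \<xi> * indicator (I j) t * indicator (I j) \<xi>)"
      proof (rule sum.mono_neutral_right)
        show "\<forall>j\<in>A - {k}. ?\<Phi> t \<xi> * indicator (I j) t * indicator (I j) \<xi> = 0"
        proof
          fix j assume j: "j \<in> A - {k}"
          then have "t \<notin> I j" using uniq[of j] by blast
          then show "?\<Phi> t \<xi> * indicator (I j) t * indicator (I j) \<xi> = 0" by simp
        qed
      qed (use k I(1) in auto)
      also have "\<dots> \<le> ?\<Phi> t \<xi> * indicator D t * indicator D \<xi>"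
        using k I(4)[OF k(1)] by (simp only: sum.insert sum.empty finite.emptyI empty_iff not_False_eq_True add_0_right)
          (intro mult_mono, auto split: split_indicator)
      finally show ?thesis .
    next
      case False
      then have "(\<Sum>j\<in>A. ?\<Phi> t \<xi> * indicator (I j) t * indicator (I j) \<xi>) = 0" by (intro sum.neutral ballI) simp
      then show ?thesis by simp
    qed
  qed
  also have "\<dots> = slobodeckij_energy s p D" by (rule sen2[OF D, symmetric])
  finally show ?thesis .
qed

end

section \<open>Sobolev data on the time grid\<close>

text \<open>Composition with it extends a function on [0,T] to the real line by its end values,
  which preserves continuity and allows statements without restriction of the domain.\<close>

definition clamp_to :: "real \<Rightarrow> real \<Rightarrow> real" where
  "clamp_to T t = max 0 (min T t)"

lemma clamp_to_in: "0 < T \<Longrightarrow> clamp_to T t \<in> {0..T}"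
  by (auto simp: clamp_to_def)

lemma clamp_to_id: "t \<in> {0..T} \<Longrightarrow> clamp_to T t = t"
  by (auto simp: clamp_to_def)

lemma cont_pseudometric_L2:
  assumes T: "0 < T" and gc: "L2_continuous T \<Omega> gc"
  shows "cont_pseudometric (\<lambda>t \<xi>. L2_norm \<Omega> (\<lambda>x. gc (clamp_to T t) x - gc (clamp_to T \<xi>) x))"
proof
  have L: "gc (clamp_to T t) \<in> L2 \<Omega>" for t using gc clamp_to_in[OF T, of t] by (auto simp: L2_continuous_def)
  fix x y z :: real
  show "L2_norm \<Omega> (\<lambda>u. gc (clamp_to T x) u - gc (clamp_to T x) u) = 0" by (simp add: L2_norm_def L2_inner_def)
  show "L2_norm \<Omega> (\<lambda>u. gc (clamp_to T x) u - gc (clamp_to T y) u) = L2_norm \<Omega> (\<lambda>u. gc (clamp_to T y) u - gc (clamp_to T x) u)"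
    by (rule L2_norm_minus_commute)
  show "L2_norm \<Omega> (\<lambda>u. gc (clamp_to T x) u - gc (clamp_to T z) u)
     \<le> L2_norm \<Omega> (\<lambda>u. gc (clamp_to T x) u - gc (clamp_to T y) u) + L2_norm \<Omega> (\<lambda>u. gc (clamp_to T y) u - gc (clamp_to T z) u)"
    by (rule L2_norm_diff_triangle[OF L L L])
  let ?x = "clamp_to T x"
  have lim: "((\<lambda>r. L2_norm \<Omega> (\<lambda>u. gc r u - gc ?x u)) \<longlongrightarrow> 0) (at ?x within {0..T})"
    using gc clamp_to_in[OF T, of x] by (auto simp: L2_continuous_def)
  show "((\<lambda>y. L2_norm \<Omega> (\<lambda>u. gc (clamp_to T y) u - gc ?x u)) \<longlongrightarrow> 0) (at x)"
  proof (rule tendstoI)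
    fix e :: real assume e: "0 < e"
    from tendstoD[OF lim e] obtain d where d: "0 < d" "\<And>r. r \<in> {0..T} \<Longrightarrow> r \<noteq> ?x \<Longrightarrow> dist r ?x < d \<Longrightarrow> dist (L2_norm \<Omega> (\<lambda>u. gc r u - gc ?x u)) 0 < e"
      unfolding eventually_at by auto
    show "\<forall>\<^sub>F y in at x. dist (L2_norm \<Omega> (\<lambda>u. gc (clamp_to T y) u - gc ?x u)) 0 < e"
      unfolding eventually_at
    proof (intro exI conjI ballI impI)
      fix y assume y: "y \<noteq> x \<and> dist y x < d"
      show "dist (L2_norm \<Omega> (\<lambda>u. gc (clamp_to T y) u - gc ?x u)) 0 < e"
      proof (cases "clamp_to T y = ?x")
        case True
        then show ?thesis using e by (simp add: L2_norm_def L2_inner_def)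
      next
        case False
        have "dist (clamp_to T y) ?x \<le> dist y x" by (auto simp: clamp_to_def dist_real_def min_def max_def)
        then show ?thesis using d(2)[OF clamp_to_in[OF T] False] y by simp
      qed
    qed (rule d(1))
  qed
qed

lemma nn_integral_lebesgue_on_Ioo:
  "(\<integral>\<^sup>+t. f t \<partial>lebesgue_on {a<..<b::real}) = (\<integral>\<^sup>+t. f t * indicator {a<..<b} t \<partial>lborel)"
  by (simp add: nn_integral_restrict_space nn_integral_completion)

text \<open>The energy is formed from an arbitrary representative and Lebesgue measure on (0,T).
  Here it is moved to the continuous representative and Borel measure, the setting of
  \<open>morrey\<close>.\<close>

lemma W_energy_continuous_representative:
  assumes T: "0 < T" and g: "bochner_measurable T \<Omega> g" and gc: "continuous_representative T \<Omega> g gc"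
  shows "W_energy s p T \<Omega> g = (\<integral>\<^sup>+t. ennreal (L2_norm \<Omega> (gc t) powr p) * indicator {0<..<T} t \<partial>lborel)
     + cont_pseudometric.slobodeckij_energy (\<lambda>t \<xi>. L2_norm \<Omega> (\<lambda>x. gc (clamp_to T t) x - gc (clamp_to T \<xi>) x)) s p {0<..<T}"
proof -
  interpret cont_pseudometric "\<lambda>t \<xi>. L2_norm \<Omega> (\<lambda>x. gc (clamp_to T t) x - gc (clamp_to T \<xi>) x)"
    by (rule cont_pseudometric_L2[OF T]) (use gc in \<open>simp add: continuous_representative_def\<close>)
  let ?M = "lebesgue_on {0<..<T}"
  have sp: "AE t in ?M. t \<in> {0<..<T}" by (rule AE_I2) simp
  have L: "gc t \<in> L2 \<Omega>" if "t \<in> {0<..<T}" for t using gc that by (auto simp: continuous_representative_def L2_continuous_def)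
  have ae: "AE t in ?M. t \<in> {0<..<T} \<and> g t \<in> L2 \<Omega> \<and> (AE x in lebesgue_on \<Omega>. gc t x = g t x)"
    using g gc sp by (auto simp: bochner_measurable_def continuous_representative_def elim!: eventually_elim2)
  have 1: "(\<integral>\<^sup>+t. ennreal (L2_norm \<Omega> (g t) powr p) \<partial>?M) = (\<integral>\<^sup>+t. ennreal (L2_norm \<Omega> (gc t) powr p) \<partial>?M)"
  proof (rule nn_integral_cong_AE, use ae in eventually_elim)
    fix t assume t: "t \<in> {0<..<T} \<and> g t \<in> L2 \<Omega> \<and> (AE x in lebesgue_on \<Omega>. gc t x = g t x)"
    then have "L2_norm \<Omega> (g t) = L2_norm \<Omega> (gc t)" using L by (intro L2_norm_cong_AE) auto
    then show "ennreal (L2_norm \<Omega> (g t) powr p) = ennreal (L2_norm \<Omega> (gc t) powr p)" by simp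
  qed
  have 2: "(\<integral>\<^sup>+\<xi>. (\<integral>\<^sup>+t. ennreal (L2_norm \<Omega> (\<lambda>x. g t x - g \<xi> x) powr p / \<bar>t - \<xi>\<bar> powr (1 + p * s)) \<partial>?M) \<partial>?M)
     = (\<integral>\<^sup>+\<xi>. (\<integral>\<^sup>+t. ennreal (L2_norm \<Omega> (\<lambda>x. gc (clamp_to T t) x - gc (clamp_to T \<xi>) x) powr p / \<bar>t - \<xi>\<bar> powr (1 + p * s)) \<partial>?M) \<partial>?M)"
  proof (rule nn_integral_cong_AE, use ae in eventually_elim, rule nn_integral_cong_AE, use ae in eventually_elim)
    fix \<xi> t assume xi: "\<xi> \<in> {0<..<T} \<and> g \<xi> \<in> L2 \<Omega> \<and> (AE x in lebesgue_on \<Omega>. gc \<xi> x = g \<xi> x)"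
      and t: "t \<in> {0<..<T} \<and> g t \<in> L2 \<Omega> \<and> (AE x in lebesgue_on \<Omega>. gc t x = g t x)"
    have "AE x in lebesgue_on \<Omega>. gc t x - gc \<xi> x = g t x - g \<xi> x"
      using xi t by (auto elim!: eventually_elim2)
    then have "L2_norm \<Omega> (\<lambda>x. g t x - g \<xi> x) = L2_norm \<Omega> (\<lambda>x. gc t x - gc \<xi> x)"
      using L xi t by (intro L2_norm_cong_AE L2_diff) auto
    moreover have "clamp_to T t = t" "clamp_to T \<xi> = \<xi>" using xi t by (auto intro!: clamp_to_id)
    ultimately show "ennreal (L2_norm \<Omega> (\<lambda>x. g t x - g \<xi> x) powr p / \<bar>t - \<xi>\<bar> powr (1 + p * s))
       = ennreal (L2_norm \<Omega> (\<lambda>x. gc (clamp_to T t) x - gc (clamp_to T \<xi>) x) powr p / \<bar>t - \<xi>\<bar> powr (1 + p * s))" by simp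
  qed
  show ?thesis unfolding W_energy_def 1 2 unfolding slobodeckij_energy_def nn_integral_lebesgue_on_Ioo ..
qed

text \<open>The number h j is the Morrey bound on the j-th cell, tau^(s-1/p) times the p-th root of
  the energy there, and the energies add up to at most that of (0,T). For the sup bound, the norm is
  close to its L^p mean at some time, and Morrey on (0,T) transports this to all times.\<close>

lemma W_space_estimates:
  assumes p: "1 < p" and s: "1 / p < s" and T: "0 < T"
  shows "\<exists>B>0. \<forall>(\<Omega> :: 'a::euclidean_space set) g gc N \<tau>. 1 \<le> N \<and> \<tau> = T / real N \<and> g \<in> W_space s p T \<Omega> \<and> continuous_representative T \<Omega> g gc \<longrightarrow>
    (\<exists>h. (\<forall>j. 0 \<le> h j) \<and>
      (\<forall>j\<in>{1..N}. \<forall>r\<in>{real (j - 1) * \<tau>..real j * \<tau>}. L2_norm \<Omega> (\<lambda>x. gc r x - gc (real j * \<tau>) x) \<le> h j) \<and>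
      (\<Sum>j=1..N. h j powr p) \<le> B * \<tau> powr (s * p - 1) * W_norm s p T \<Omega> g powr p \<and>
      (\<forall>t\<in>{0..T}. L2_norm \<Omega> (gc t) \<le> B * W_norm s p T \<Omega> g))"
proof -
  define C where "C = morrey_const s p"
  have "(1/2::real) powr (s - 1 / p) < 1" using s by (intro half_powr_less_one) auto
  then have C: "0 \<le> C" by (simp add: C_def morrey_const_def)
  define B where "B = C powr p + (C * T powr (s - 1 / p) + T powr (- 1 / p)) + 1"
  have B: "0 < B" using C by (simp add: B_def add_nonneg_pos)
  have main: "\<exists>h. (\<forall>j. 0 \<le> h j) \<and>
      (\<forall>j\<in>{1..N}. \<forall>r\<in>{real (j - 1) * \<tau>..real j * \<tau>}. L2_norm \<Omega> (\<lambda>x. gc r x - gc (real j * \<tau>) x) \<le> h j) \<and>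
      (\<Sum>j=1..N. h j powr p) \<le> B * \<tau> powr (s * p - 1) * W_norm s p T \<Omega> g powr p \<and>
      (\<forall>t\<in>{0..T}. L2_norm \<Omega> (gc t) \<le> B * W_norm s p T \<Omega> g)"
    if N: "1 \<le> N" and \<tau>: "\<tau> = T / real N" and g: "g \<in> W_space s p T \<Omega>" and gc: "continuous_representative T \<Omega> g gc"
    for \<Omega> :: "'a set" and g gc N \<tau>
  proof -
    let ?H = "\<lambda>t \<xi>. L2_norm \<Omega> (\<lambda>x. gc (clamp_to T t) x - gc (clamp_to T \<xi>) x)"
    interpret cont_pseudometric ?H
      by (rule cont_pseudometric_L2[OF T]) (use gc in \<open>simp add: continuous_representative_def\<close>)
    have \<tau>0: "0 < \<tau>" using T N by (simp add: \<tau>)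
    have N\<tau>: "real N * \<tau> = T" using N by (simp add: \<tau>)
    define W where "W = W_norm s p T \<Omega> g"
    have W0: "0 \<le> W" by (simp add: W_def W_norm_def)
    have fin: "W_energy s p T \<Omega> g < \<infinity>" and bm: "bochner_measurable T \<Omega> g" using g by (auto simp: W_space_def)
    have EW: "W_energy s p T \<Omega> g = ennreal (W powr p)"
      using fin p by (simp add: W_def W_norm_def powr_powr less_top)
    note en = W_energy_continuous_representative[OF T bm gc, of s p, unfolded EW]
    have senW: "slobodeckij_energy s p {0<..<T} \<le> ennreal (W powr p)" unfolding en by (rule add_increasing) auto
    have intW: "(\<integral>\<^sup>+t. ennreal (L2_norm \<Omega> (gc t) powr p) * indicator {0<..<T} t \<partial>lborel) \<le> ennreal (W powr p)"
      unfolding en by (rule add_increasing2) auto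
    have L: "gc t \<in> L2 \<Omega>" if "t \<in> {0..T}" for t using gc that by (auto simp: continuous_representative_def L2_continuous_def)
    define I where "I j = {real (j - 1) * \<tau><..<real j * \<tau>}" for j :: nat
    have Isub: "I j \<subseteq> {0<..<T}" if "j \<in> {1..N}" for j
    proof -
      have "0 \<le> real (j - 1) * \<tau>" "real j * \<tau> \<le> real N * \<tau>" using that \<tau>0 by (auto intro!: mult_right_mono)
      then show ?thesis unfolding I_def N\<tau> by auto
    qed
    have Im: "I j \<in> sets borel" for j by (simp add: I_def)
    have disj: "disjoint_family_on I {1..N}"
    proof -
      have "I i \<inter> I j = {}" if "1 \<le> i" "i < j" for i j
      proof -
        have "real i * \<tau> \<le> real (j - 1) * \<tau>" using that \<tau>0 by (intro mult_right_mono) auto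
        then show ?thesis by (auto simp: I_def)
      qed
      then show ?thesis unfolding disjoint_family_on_def
        by (metis Int_commute atLeastAtMost_iff linorder_neqE_nat)
    qed
    have sum_le: "(\<Sum>j=1..N. slobodeckij_energy s p (I j)) \<le> ennreal (W powr p)"
      by (rule order_trans[OF slobodeckij_energy_sum_le senW]) (use Isub disj Im in auto)
    have senfin: "slobodeckij_energy s p (I j) < top" if "j \<in> {1..N}" for j
    proof -
      have "slobodeckij_energy s p (I j) \<le> (\<Sum>j=1..N. slobodeckij_energy s p (I j))" using that by (intro member_le_sum) auto
      with sum_le have "slobodeckij_energy s p (I j) \<le> ennreal (W powr p)" by (rule order_trans[rotated])
      then show ?thesis by (rule le_less_trans) simp
    qed
    define G where "G j = enn2real (slobodeckij_energy s p (I j)) powr (1 / p)" for j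
    define h where "h j = C * \<tau> powr (s - 1 / p) * G j" for j
    have G: "0 \<le> G j" "G j powr p = enn2real (slobodeckij_energy s p (I j))" for j using p by (auto simp: G_def powr_powr)
    have h0: "0 \<le> h j" for j using C G by (simp add: h_def)
    have hj: "L2_norm \<Omega> (\<lambda>x. gc r x - gc (real j * \<tau>) x) \<le> h j" if j: "j \<in> {1..N}" and r: "r \<in> {real (j - 1) * \<tau>..real j * \<tau>}" for j r
    proof -
      have len: "real j * \<tau> - real (j - 1) * \<tau> = \<tau>" using j by (simp add: of_nat_diff algebra_simps)
      have "slobodeckij_energy s p {real (j - 1) * \<tau><..<real j * \<tau>} \<le> ennreal (G j powr p)"
        using senfin[OF j] unfolding I_def[symmetric] G(2) by (simp add: less_top)
      note morrey[OF p s _ G(1) this r, of "real j * \<tau>", unfolded len]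
      then have "?H r (real j * \<tau>) \<le> h j" using \<tau>0 r j unfolding h_def C_def by auto
      moreover have "0 \<le> real (j - 1) * \<tau>" "real j * \<tau> \<le> real N * \<tau>" using j \<tau>0 by (auto intro!: mult_right_mono)
      then have "0 \<le> r" "r \<le> T" "0 \<le> real j * \<tau>" "real j * \<tau> \<le> T" using r \<tau>0 unfolding N\<tau> atLeastAtMost_iff by linarith+
      then have "clamp_to T r = r" "clamp_to T (real j * \<tau>) = real j * \<tau>" by (simp_all add: clamp_to_id)
      ultimately show ?thesis by simp
    qed
    have hsum: "(\<Sum>j=1..N. h j powr p) \<le> B * \<tau> powr (s * p - 1) * W powr p"
    proof -
      have "h j powr p = C powr p * \<tau> powr (s * p - 1) * enn2real (slobodeckij_energy s p (I j))" for j
      proof -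
        have "(s - 1 / p) * p = s * p - 1" using p by (simp add: left_diff_distrib)
        then show ?thesis using C G \<tau>0 by (simp add: h_def powr_mult powr_powr)
      qed
      then have "(\<Sum>j=1..N. h j powr p) = C powr p * \<tau> powr (s * p - 1) * (\<Sum>j=1..N. enn2real (slobodeckij_energy s p (I j)))"
        by (simp only: sum_distrib_left)
      also have "(\<Sum>j=1..N. enn2real (slobodeckij_energy s p (I j))) \<le> W powr p"
      proof -
        have "ennreal (\<Sum>j=1..N. enn2real (slobodeckij_energy s p (I j))) = (\<Sum>j=1..N. ennreal (enn2real (slobodeckij_energy s p (I j))))"
          by (rule sum_ennreal[symmetric]) simp
        also have "\<dots> = (\<Sum>j=1..N. slobodeckij_energy s p (I j))" using senfin by (intro sum.cong) (auto simp: less_top)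
        finally have "ennreal (\<Sum>j=1..N. enn2real (slobodeckij_energy s p (I j))) \<le> ennreal (W powr p)" using sum_le by (simp only:)
        then show ?thesis by (subst (asm) ennreal_le_iff) auto
      qed
      also have "C powr p * \<tau> powr (s * p - 1) * W powr p \<le> B * \<tau> powr (s * p - 1) * W powr p"
        using C by (intro mult_right_mono) (auto simp: B_def)
      finally show ?thesis by (simp add: mult_left_mono)
    qed
    have sup: "L2_norm \<Omega> (gc x) \<le> B * W" if x: "x \<in> {0..T}" for x
    proof -
      have "L2_norm \<Omega> (gc x) \<le> (C * T powr (s - 1 / p) + T powr (- 1 / p)) * W"
      proof (rule field_le_epsilon)
        fix \<delta> :: real assume \<delta>: "0 < \<delta>"
        define v where "v = T powr (- 1 / p) * W + \<delta>"
        have v: "0 < v" using W0 \<delta> by (simp add: v_def add_nonneg_pos)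
        \<comment> \<open>If the norm were at least v throughout, the integral of its p-th power
          would exceed W^p; the term delta makes this strict.\<close>
        have "\<exists>t\<in>{0<..<T}. L2_norm \<Omega> (gc t) < v"
        proof (rule ccontr)
          assume "\<not> (\<exists>t\<in>{0<..<T}. L2_norm \<Omega> (gc t) < v)"
          then have ge: "v \<le> L2_norm \<Omega> (gc t)" if "t \<in> {0<..<T}" for t
            using \<open>\<not> (\<exists>t\<in>{0<..<T}. L2_norm \<Omega> (gc t) < v)\<close> that by (meson not_le)
          have "ennreal (v powr p * T) = (\<integral>\<^sup>+t. ennreal (v powr p) * indicator {0<..<T} t \<partial>lborel)"
            using T by (simp add: nn_integral_cmult_indicator ennreal_mult)
          also have "\<dots> \<le> (\<integral>\<^sup>+t. ennreal (L2_norm \<Omega> (gc t) powr p) * indicator {0<..<T} t \<partial>lborel)"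
            using ge v p by (intro nn_integral_mono) (auto simp: indicator_def intro!: ennreal_leI powr_mono2)
          also have "\<dots> \<le> ennreal (W powr p)" by (rule intW)
          finally have "v powr p * T \<le> W powr p" by simp
          then have "(v powr p * T) powr (1 / p) \<le> (W powr p) powr (1 / p)" using T p by (intro powr_mono2) auto
          then have "v * T powr (1 / p) \<le> W" using v T W0 p by (simp add: powr_mult powr_powr)
          from this have "v * T powr (1 / p) * T powr (- 1 / p) \<le> W * T powr (- 1 / p)" by (rule mult_right_mono) simp
          moreover have "v * T powr (1 / p) * T powr (- 1 / p) = v" using T by (simp add: mult.assoc powr_add[symmetric])
          ultimately have "v \<le> T powr (- 1 / p) * W" by (simp only: mult.commute[of W])
          then show False using \<delta> by (simp add: v_def)
        qed
        then obtain t where t: "t \<in> {0<..<T}" "L2_norm \<Omega> (gc t) < v" by blast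
        have "?H x t \<le> C * (T - 0) powr (s - 1 / p) * W"
          unfolding C_def by (rule morrey[OF p s T W0 senW]) (use x t in auto)
        then have H: "L2_norm \<Omega> (\<lambda>u. gc x u - gc t u) \<le> C * T powr (s - 1 / p) * W"
          using x t by (simp add: clamp_to_id)
        have "L2_norm \<Omega> (gc x) \<le> L2_norm \<Omega> (\<lambda>u. gc x u - gc t u) + L2_norm \<Omega> (gc t)"
          using L2_norm_triangle[OF L2_diff[OF L L] L, of x t t] x t by simp
        also have "\<dots> \<le> C * T powr (s - 1 / p) * W + v" using H t by simp
        finally show "L2_norm \<Omega> (gc x) \<le> (C * T powr (s - 1 / p) + T powr (- 1 / p)) * W + \<delta>"
          by (simp add: v_def distrib_right)
      qed
      also have "\<dots> \<le> B * W" using W0 by (intro mult_right_mono) (auto simp: B_def)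
      finally show ?thesis .
    qed
    show ?thesis using h0 hj hsum sup unfolding W_def by (intro exI[of _ h]) blast
  qed
  show ?thesis
    by (rule exI[of _ B], intro conjI allI impI, rule B, elim conjE, rule main)
qed

section \<open>Spectral decomposition of the discrete Laplacian\<close>

text \<open>Gaussian elimination: the equation p is used to eliminate the unknown k, which costs one
  equation and one unknown.\<close>

lemma homogeneous_system_nontrivial:
  fixes a :: "'j \<Rightarrow> 'p \<Rightarrow> real"
  assumes "finite P" "finite J" "card P < card J"
  shows "\<exists>c. (\<exists>j\<in>J. c j \<noteq> 0) \<and> (\<forall>p\<in>P. (\<Sum>j\<in>J. c j * a j p) = 0)"
  using assms
proof (induction P arbitrary: J a rule: finite_induct)
  case empty
  then obtain j where "j \<in> J" by fastforce
  then show ?case by (intro exI[of _ "\<lambda>_. 1"]) auto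
next
  case (insert p P)
  show ?case
  proof (cases "\<forall>j\<in>J. a j p = 0")
    case True
    obtain c where "\<exists>j\<in>J. c j \<noteq> 0" "\<forall>p\<in>P. (\<Sum>j\<in>J. c j * a j p) = 0"
      using insert.IH[of J a] insert.prems insert.hyps by auto
    then show ?thesis using True by (intro exI[of _ c]) auto
  next
    case False
    then obtain k where k: "k \<in> J" "a k p \<noteq> 0" by blast
    define a' where "a' j q = a j q - a j p / a k p * a k q" for j q
    have "card P < card (J - {k})" using insert k by simp
    then obtain c where c: "\<exists>j\<in>J - {k}. c j \<noteq> 0" "\<forall>q\<in>P. (\<Sum>j\<in>J - {k}. c j * a' j q) = 0"
      using insert.IH[of "J - {k}" a'] insert.prems by auto
    define d where "d j = (if j = k then - (\<Sum>j\<in>J - {k}. c j * (a j p / a k p)) else c j)" for j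
    have sum: "(\<Sum>j\<in>J. d j * a j q) = (\<Sum>j\<in>J - {k}. c j * a' j q)" for q
    proof -
      have "(\<Sum>j\<in>J. d j * a j q) = d k * a k q + (\<Sum>j\<in>J - {k}. d j * a j q)" using insert.prems k by (simp add: sum.remove)
      also have "(\<Sum>j\<in>J - {k}. d j * a j q) = (\<Sum>j\<in>J - {k}. c j * a j q)" by (rule sum.cong) (auto simp: d_def)
      also have "d k * a k q = - (\<Sum>j\<in>J - {k}. c j * (a j p / a k p * a k q))" by (simp add: d_def sum_distrib_right mult.assoc)
      finally show ?thesis by (simp add: a'_def right_diff_distrib sum_subtractf)
    qed
    have "(\<Sum>j\<in>J. d j * a j q) = 0" if "q \<in> insert p P" for q
    proof (cases "q = p")
      case True
      have "(\<Sum>j\<in>J - {k}. c j * a' j p) = 0" using k by (intro sum.neutral) (auto simp: a'_def)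
      then show ?thesis using sum True by simp
    next
      case False
      then show ?thesis using sum c(2) that by auto
    qed
    moreover have "\<exists>j\<in>J. d j \<noteq> 0" using c(1) by (auto simp: d_def)
    ultimately show ?thesis by blast
  qed
qed

text \<open>V is a set of functions rather than a type, and equality in it is equality everywhere.
  Finite dimension is expressed by finitely many point evaluations that separate V; for finite
  elements the vertices of the mesh serve.\<close>

locale form_pair =
  fixes V :: "('a \<Rightarrow> real) set" and m a :: "('a \<Rightarrow> real) \<Rightarrow> ('a \<Rightarrow> real) \<Rightarrow> real"
  assumes V_zero: "(\<lambda>x. 0) \<in> V" and V_comb: "u \<in> V \<Longrightarrow> v \<in> V \<Longrightarrow> (\<lambda>x. c * u x + d * v x) \<in> V"
    and m_comb: "u \<in> V \<Longrightarrow> v \<in> V \<Longrightarrow> w \<in> V \<Longrightarrow> m (\<lambda>x. c * u x + d * v x) w = c * m u w + d * m v w"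
    and m_sym: "m u v = m v u" and m_nonneg: "0 \<le> m u u" and m_definite: "u \<in> V \<Longrightarrow> m u u = 0 \<Longrightarrow> u = (\<lambda>x. 0)"
    and a_comb: "u \<in> V \<Longrightarrow> v \<in> V \<Longrightarrow> w \<in> V \<Longrightarrow> a (\<lambda>x. c * u x + d * v x) w = c * a u w + d * a v w"
    and a_sym: "a u v = a v u" and a_nonneg: "0 \<le> a u u"
    and finite_dim: "\<exists>P. finite P \<and> (\<forall>u\<in>V. (\<forall>p\<in>P. u p = 0) \<longrightarrow> u = (\<lambda>x. 0))"
begin

lemma V_sum: "finite I \<Longrightarrow> (\<And>i. i \<in> I \<Longrightarrow> f i \<in> V) \<Longrightarrow> (\<lambda>x. \<Sum>i\<in>I. c i * f i x) \<in> V"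
proof (induction I rule: finite_induct)
  case (insert i I)
  then have "(\<lambda>x. c i * f i x + 1 * (\<Sum>i\<in>I. c i * f i x)) \<in> V" by (intro V_comb) auto
  then show ?case using insert by simp
qed (simp add: V_zero)

lemma form_sum:
  assumes b: "\<And>u v w c d. u \<in> V \<Longrightarrow> v \<in> V \<Longrightarrow> w \<in> V \<Longrightarrow> b (\<lambda>x. c * u x + d * v x) w = c * b u w + d * b v w"
    and "finite I" "\<And>i. i \<in> I \<Longrightarrow> f i \<in> V" "w \<in> V"
  shows "b (\<lambda>x. \<Sum>i\<in>I. c i * f i x) w = (\<Sum>i\<in>I. c i * (b (f i) w :: real))"
  using assms(2,3)
proof (induction I rule: finite_induct)
  case empty
  have "b (\<lambda>x. 0 * (\<lambda>x. 0) x + 0 * (\<lambda>x. 0) x) w = 0" using b[OF V_zero V_zero assms(4), of 0 0] by simp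
  then show ?case by simp
next
  case (insert i I)
  have "b (\<lambda>x. c i * f i x + 1 * (\<Sum>i\<in>I. c i * f i x)) w = c i * b (f i) w + 1 * b (\<lambda>x. \<Sum>i\<in>I. c i * f i x) w"
    by (rule b) (use insert assms(4) V_sum[of I f c] in auto)
  then show ?case using insert by simp
qed

lemma m_sum: "finite I \<Longrightarrow> (\<And>i. i \<in> I \<Longrightarrow> f i \<in> V) \<Longrightarrow> w \<in> V \<Longrightarrow> m (\<lambda>x. \<Sum>i\<in>I. c i * f i x) w = (\<Sum>i\<in>I. c i * m (f i) w)"
  by (rule form_sum) (auto intro: m_comb)

lemma a_sum: "finite I \<Longrightarrow> (\<And>i. i \<in> I \<Longrightarrow> f i \<in> V) \<Longrightarrow> w \<in> V \<Longrightarrow> a (\<lambda>x. \<Sum>i\<in>I. c i * f i x) w = (\<Sum>i\<in>I. c i * a (f i) w)"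
  by (rule form_sum) (auto intro: a_comb)

definition orthonormal :: "nat \<Rightarrow> (nat \<Rightarrow> 'a \<Rightarrow> real) \<Rightarrow> bool" where
  "orthonormal k e \<longleftrightarrow> (\<forall>i<k. e i \<in> V) \<and> (\<forall>i<k. \<forall>j<k. m (e i) (e j) = (if i = j then 1 else 0))"

definition orth_residual :: "nat \<Rightarrow> (nat \<Rightarrow> 'a \<Rightarrow> real) \<Rightarrow> ('a \<Rightarrow> real) \<Rightarrow> 'a \<Rightarrow> real" where
  "orth_residual k e v = (\<lambda>x. v x - (\<Sum>i<k. m v (e i) * e i x))"

lemma orthonormal_coeff:
  assumes "orthonormal k e" "j < k"
  shows "m (\<lambda>x. \<Sum>i<k. c i * e i x) (e j) = c j"
proof -
  have "m (\<lambda>x. \<Sum>i<k. c i * e i x) (e j) = (\<Sum>i<k. c i * m (e i) (e j))"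
    by (rule m_sum) (use assms in \<open>auto simp: orthonormal_def\<close>)
  also have "\<dots> = (\<Sum>i<k. if i = j then c i else 0)" by (rule sum.cong) (use assms in \<open>auto simp: orthonormal_def\<close>)
  finally show ?thesis using assms by simp
qed

lemma orth_residual:
  assumes "orthonormal k e" "v \<in> V"
  shows "orth_residual k e v \<in> V" "j < k \<Longrightarrow> m (orth_residual k e v) (e j) = 0" "v = (\<lambda>x. orth_residual k e v x + (\<Sum>i<k. m v (e i) * e i x))"
proof -
  have S: "(\<lambda>x. \<Sum>i<k. m v (e i) * e i x) \<in> V" by (rule V_sum) (use assms in \<open>auto simp: orthonormal_def\<close>)
  have eq: "orth_residual k e v = (\<lambda>x. 1 * v x + (-1) * (\<Sum>i<k. m v (e i) * e i x))" by (simp add: orth_residual_def)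
  show "orth_residual k e v \<in> V" unfolding eq by (rule V_comb[OF assms(2) S])
  show "m (orth_residual k e v) (e j) = 0" if "j < k"
    unfolding eq using m_comb[OF assms(2) S, of "e j" 1 "-1"] orthonormal_coeff[OF assms(1) that] assms(1) that by (simp add: orthonormal_def)
  show "v = (\<lambda>x. orth_residual k e v x + (\<Sum>i<k. m v (e i) * e i x))" by (simp add: orth_residual_def)
qed

text \<open>An orthonormal system with more members than separating points would have a nontrivial
  combination that vanishes at all of them and hence vanishes.\<close>

lemma orthonormal_bound: "\<exists>n. \<forall>k e. orthonormal k e \<longrightarrow> k \<le> n"
proof -
  obtain P where P: "finite P" "\<And>u. u \<in> V \<Longrightarrow> (\<forall>p\<in>P. u p = 0) \<Longrightarrow> u = (\<lambda>x. 0)" using finite_dim by blast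
  have "k \<le> card P" if on: "orthonormal k e" for k e
  proof (rule ccontr)
    assume "\<not> k \<le> card P"
    then obtain c where c: "\<exists>j\<in>{..<k}. c j \<noteq> 0" "\<forall>p\<in>P. (\<Sum>j<k. c j * e j p) = 0"
      using homogeneous_system_nontrivial[of P "{..<k}" e] P(1) by auto
    have "(\<lambda>x. \<Sum>j<k. c j * e j x) = (\<lambda>x. 0)"
      by (rule P(2)) (use c(2) on in \<open>auto intro!: V_sum simp: orthonormal_def\<close>)
    then have "c j = m (\<lambda>x. 0) (e j)" if "j < k" for j using orthonormal_coeff[OF on that, of c] by simp
    moreover have "m (\<lambda>x. 0) (e j) = 0" if "j < k" for j
      using m_comb[OF V_zero V_zero, of "e j" 0 0] on that by (simp add: orthonormal_def)
    ultimately show False using c(1) by auto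
  qed
  then show ?thesis by blast
qed

text \<open>The summand \<open>0 * v x\<close> brings the function into the literal form of
  \<open>V_comb\<close> and \<open>m_comb\<close>.\<close>

lemma normalize:
  assumes "v \<in> V" "m v v \<noteq> 0"
  defines "w \<equiv> \<lambda>x. (1 / sqrt (m v v)) * v x + 0 * v x"
  shows "w \<in> V" "m w w = 1" "u \<in> V \<Longrightarrow> m w u = m v u / sqrt (m v v)" "a w w = a v v / m v v"
proof -
  have pos: "0 < m v v" using m_nonneg[of v] assms(2) by simp
  show w: "w \<in> V" unfolding w_def by (rule V_comb[OF assms(1,1)])
  show mw: "m w u = m v u / sqrt (m v v)" if "u \<in> V" for u unfolding w_def using m_comb[OF assms(1,1) that, of "1 / sqrt (m v v)" 0] by simp
  have aw: "a w u = a v u / sqrt (m v v)" if "u \<in> V" for u unfolding w_def using a_comb[OF assms(1,1) that, of "1 / sqrt (m v v)" 0] by simp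
  have "m w w = m v w / sqrt (m v v)" by (rule mw[OF w])
  also have "m v w = m v v / sqrt (m v v)" unfolding m_sym[of v w] by (rule mw[OF assms(1)])
  finally show "m w w = 1" using pos by (simp add: real_sqrt_mult_self)
  have "a w w = a v w / sqrt (m v v)" by (rule aw[OF w])
  also have "a v w = a v v / sqrt (m v v)" unfolding a_sym[of v w] by (rule aw[OF assms(1)])
  finally show "a w w = a v v / m v v" using pos by (simp add: real_sqrt_mult_self)
qed

lemma orthonormal_extend:
  assumes on: "orthonormal k e" and w: "w \<in> V" "m w w = 1" "\<And>j. j < k \<Longrightarrow> m w (e j) = 0"
  shows "orthonormal (Suc k) (e(k := w))"
  unfolding orthonormal_def
proof (intro conjI allI impI)
  fix i j assume ij: "i < Suc k" "j < Suc k"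
  show "m ((e(k := w)) i) ((e(k := w)) j) = (if i = j then 1 else 0)"
    using ij on w m_sym[of "e i" w] by (cases "i = k"; cases "j = k") (auto simp: orthonormal_def less_Suc_eq)
qed (use on w in \<open>auto simp: orthonormal_def less_Suc_eq\<close>)

text \<open>Among all orthonormal systems with property \<open>Q\<close> one takes a longest.\<close>

lemma maximal_ON:
  assumes "\<And>e k w. orthonormal k e \<Longrightarrow> (\<And>i. i < k \<Longrightarrow> Q (e i)) \<Longrightarrow> \<exists>v\<in>V. orth_residual k e v \<noteq> (\<lambda>x. 0) \<Longrightarrow> \<exists>w\<in>V. m w w = 1 \<and> (\<forall>j<k. m w (e j) = 0) \<and> Q w"
  shows "\<exists>k e. orthonormal k e \<and> (\<forall>i<k. Q (e i)) \<and> (\<forall>v\<in>V. v = (\<lambda>x. \<Sum>i<k. m v (e i) * e i x))"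
proof -
  obtain n where n: "\<And>k e. orthonormal k e \<Longrightarrow> k \<le> n" using orthonormal_bound by blast
  define A where "A k \<longleftrightarrow> (\<exists>e. orthonormal k e \<and> (\<forall>i<k. Q (e i)))" for k
  have "A 0" by (auto simp: A_def orthonormal_def)
  moreover have "\<forall>k. A k \<longrightarrow> k \<le> n" using n by (auto simp: A_def)
  ultimately obtain k where k: "A k" "\<And>l. A l \<Longrightarrow> l \<le> k"
    using GreatestI_nat[of A 0 n] Greatest_le_nat[of A _ n] by blast
  then obtain e where e: "orthonormal k e" "\<And>i. i < k \<Longrightarrow> Q (e i)" by (auto simp: A_def)
  have "orth_residual k e v = (\<lambda>x. 0)" if v: "v \<in> V" for v
  proof (rule ccontr)
    assume "orth_residual k e v \<noteq> (\<lambda>x. 0)"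
    then obtain w where w: "w \<in> V" "m w w = 1" "\<And>j. j < k \<Longrightarrow> m w (e j) = 0" "Q w" using assms[OF e] v by blast
    have "A (Suc k)" unfolding A_def
      using orthonormal_extend[OF e(1) w(1,2,3)] e(2) w(4) by (intro exI[of _ "e(k := w)"]) (auto simp: less_Suc_eq)
    with k(2) show False by fastforce
  qed
  then have "v = (\<lambda>x. \<Sum>i<k. m v (e i) * e i x)" if "v \<in> V" for v using orth_residual(3)[OF e(1) that] that by simp
  with e show ?thesis by blast
qed

lemma orthonormal_basis: "\<exists>k e. orthonormal k e \<and> (\<forall>v\<in>V. v = (\<lambda>x. \<Sum>i<k. m v (e i) * e i x))"
proof -
  have "\<exists>k e. orthonormal k e \<and> (\<forall>i<k. True) \<and> (\<forall>v\<in>V. v = (\<lambda>x. \<Sum>i<k. m v (e i) * e i x))"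
  proof (rule maximal_ON)
    fix e k assume on: "orthonormal k e" and "\<exists>v\<in>V. orth_residual k e v \<noteq> (\<lambda>x. 0)"
    then obtain v where v: "v \<in> V" "orth_residual k e v \<noteq> (\<lambda>x. 0)" by blast
    have r: "orth_residual k e v \<in> V" "m (orth_residual k e v) (orth_residual k e v) \<noteq> 0" using orth_residual(1)[OF on v(1)] m_definite v(2) by auto
    show "\<exists>w\<in>V. m w w = 1 \<and> (\<forall>j<k. m w (e j) = 0) \<and> True"
      using normalize[OF r] orth_residual(2)[OF on v(1)] on
      by (intro bexI[of _ "\<lambda>x. (1 / sqrt (m (orth_residual k e v) (orth_residual k e v))) * orth_residual k e v x + 0 * orth_residual k e v x"]) (auto simp: orthonormal_def)
  qed
  then show ?thesis by simp
qed

definition eigenfunction :: "('a \<Rightarrow> real) \<Rightarrow> bool" where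
  "eigenfunction w \<longleftrightarrow> (\<exists>\<kappa>\<ge>0. \<forall>v\<in>V. a w v = \<kappa> * m w v)"

text \<open>Bolzano-Weierstrass, one coordinate after another.\<close>

lemma compact_sequence:
  fixes c :: "nat \<Rightarrow> nat \<Rightarrow> real"
  assumes "\<And>n i. i < k \<Longrightarrow> \<bar>c n i\<bar> \<le> (1::real)"
  shows "\<exists>l r. strict_mono (r :: nat \<Rightarrow> nat) \<and> (\<forall>i<k. (\<lambda>n. c (r n) i) \<longlonglongrightarrow> l i)"
  using assms
proof (induction k)
  case 0
  show ?case by (rule exI[of _ "\<lambda>_. 0"], rule exI[of _ id]) (auto simp: strict_mono_def)
next
  case (Suc k)
  then obtain l r where lr: "strict_mono (r :: nat \<Rightarrow> nat)" "\<And>i. i < k \<Longrightarrow> (\<lambda>n. c (r n) i) \<longlonglongrightarrow> l i" by (metis less_Suc_eq)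
  have "\<forall>n. c (r n) k \<in> {-1..1}" using Suc.prems[of k] by (auto simp: abs_le_iff minus_le_iff)
  moreover have "seq_compact {-1..1::real}" by (simp add: compact_imp_seq_compact)
  ultimately obtain y s where ys: "strict_mono (s :: nat \<Rightarrow> nat)" "((\<lambda>n. c (r n) k) \<circ> s) \<longlonglongrightarrow> y"
    unfolding seq_compact_def by metis
  show ?case
  proof (intro exI conjI allI impI)
    show "strict_mono (r \<circ> s)" using lr(1) ys(1) by (rule strict_mono_o)
    fix i assume i: "i < Suc k"
    show "(\<lambda>n. c ((r \<circ> s) n) i) \<longlonglongrightarrow> (l(k := y)) i"
      using i ys(2) LIMSEQ_subseq_LIMSEQ[OF lr(2) ys(1)] by (cases "i = k") (auto simp: o_def less_Suc_eq)
  qed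
qed

lemma form_double_sum:
  assumes "finite I" "\<And>i. i \<in> I \<Longrightarrow> f i \<in> V"
  shows "m (\<lambda>x. \<Sum>i\<in>I. c i * f i x) (\<lambda>x. \<Sum>i\<in>I. c i * f i x) = (\<Sum>i\<in>I. \<Sum>j\<in>I. c i * c j * m (f i) (f j))"
    and "a (\<lambda>x. \<Sum>i\<in>I. c i * f i x) (\<lambda>x. \<Sum>i\<in>I. c i * f i x) = (\<Sum>i\<in>I. \<Sum>j\<in>I. c i * c j * a (f i) (f j))"
proof -
  let ?s = "\<lambda>x. \<Sum>i\<in>I. c i * f i x"
  have s: "?s \<in> V" by (rule V_sum[OF assms])
  have "m (f i) ?s = (\<Sum>j\<in>I. c j * m (f i) (f j))" if "i \<in> I" for i
    unfolding m_sym[of "f i"] using m_sum[OF assms assms(2)[OF that]] by simp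
  then show "m ?s ?s = (\<Sum>i\<in>I. \<Sum>j\<in>I. c i * c j * m (f i) (f j))"
    using m_sum[OF assms s] by (simp add: sum_distrib_left mult.assoc)
  have "a (f i) ?s = (\<Sum>j\<in>I. c j * a (f i) (f j))" if "i \<in> I" for i
    unfolding a_sym[of "f i"] using a_sum[OF assms assms(2)[OF that]] by simp
  then show "a ?s ?s = (\<Sum>i\<in>I. \<Sum>j\<in>I. c i * c j * a (f i) (f j))"
    using a_sum[OF assms s] by (simp add: sum_distrib_left mult.assoc)
qed

text \<open>The next eigenvector minimises the Rayleigh quotient on the orthogonal complement of the previous ones.\<close>

lemma next_eigenvector:
  assumes on: "orthonormal k e" and eig: "\<And>i. i < k \<Longrightarrow> eigenfunction (e i)" and ex: "\<exists>v\<in>V. orth_residual k e v \<noteq> (\<lambda>x. 0)"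
  shows "\<exists>w\<in>V. m w w = 1 \<and> (\<forall>j<k. m w (e j) = 0) \<and> eigenfunction w"
proof -
  define W where "W = {w \<in> V. m w w = 1 \<and> (\<forall>j<k. m w (e j) = 0)}"
  obtain v where v: "v \<in> V" "orth_residual k e v \<noteq> (\<lambda>x. 0)" using ex by blast
  have r: "orth_residual k e v \<in> V" "m (orth_residual k e v) (orth_residual k e v) \<noteq> 0" using orth_residual(1)[OF on v(1)] m_definite v(2) by auto
  have scaled: "\<exists>w\<in>W. a w w = a u u / m u u" if "u \<in> V" "m u u \<noteq> 0" "\<And>j. j < k \<Longrightarrow> m u (e j) = 0" for u
    using normalize[OF that(1,2)] that(3) on
    by (intro bexI[of _ "\<lambda>x. (1 / sqrt (m u u)) * u x + 0 * u x"]) (auto simp: W_def orthonormal_def)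
  have ne: "W \<noteq> {}" using scaled[OF r] orth_residual(2)[OF on v(1)] by blast
  define \<kappa> where "\<kappa> = Inf ((\<lambda>w. a w w) ` W)"
  have bb: "bdd_below ((\<lambda>w. a w w) ` W)" using a_nonneg by (auto intro!: bdd_belowI[of _ 0])
  have \<kappa>0: "0 \<le> \<kappa>" unfolding \<kappa>_def using ne a_nonneg by (intro cInf_greatest) auto
  have "\<exists>w\<in>W. a w w < \<kappa> + 1 / real (Suc n)" for n
  proof -
    have "Inf ((\<lambda>w. a w w) ` W) < \<kappa> + 1 / real (Suc n)" by (simp add: \<kappa>_def)
    then show ?thesis using cInf_lessD[of "(\<lambda>w. a w w) ` W"] ne by auto
  qed
  then obtain w where w: "\<And>n. w n \<in> W" "\<And>n. a (w n) (w n) < \<kappa> + 1 / real (Suc n)" by metis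
  have lower: "\<kappa> \<le> a u u" if "u \<in> W" for u unfolding \<kappa>_def using that bb by (intro cInf_lower) auto
  \<comment> \<open>A basis without spectral meaning that supplies coordinates: the coefficients of
    the minimising sequence are bounded by 1, so a subsequence of them converges, and both forms are
    continuous in the coefficients.\<close>
  obtain N f where f: "orthonormal N f" "\<And>v. v \<in> V \<Longrightarrow> v = (\<lambda>x. \<Sum>i<N. m v (f i) * f i x)" using orthonormal_basis by blast
  have fV: "\<And>i. i \<in> {..<N} \<Longrightarrow> f i \<in> V" using f(1) by (auto simp: orthonormal_def)
  have dm: "m (\<lambda>x. \<Sum>i<N. c i * f i x) (\<lambda>x. \<Sum>i<N. c i * f i x) = (\<Sum>i<N. \<Sum>j<N. c i * c j * m (f i) (f j))"
    "a (\<lambda>x. \<Sum>i<N. c i * f i x) (\<lambda>x. \<Sum>i<N. c i * f i x) = (\<Sum>i<N. \<Sum>j<N. c i * c j * a (f i) (f j))" for c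
    by (rule form_double_sum; use fV in simp)+
  have ms: "m (\<lambda>x. \<Sum>i<N. c i * f i x) v = (\<Sum>i<N. c i * m (f i) v)" if "v \<in> V" for c v
    by (rule m_sum) (use fV that in auto)
  define c where "c n i = m (w n) (f i)" for n i
  have wV: "w n \<in> V" for n using w(1)[of n] by (simp add: W_def)
  have wc: "w n = (\<lambda>x. \<Sum>i<N. c n i * f i x)" for n unfolding c_def by (rule f(2)[OF wV])
  have mw: "m (w n) (w n) = (\<Sum>i<N. \<Sum>j<N. c n i * c n j * m (f i) (f j))"
    and aw: "a (w n) (w n) = (\<Sum>i<N. \<Sum>j<N. c n i * c n j * a (f i) (f j))" for n
    using dm[of "c n"] unfolding wc[symmetric] by auto
  have cbound: "\<bar>c n i\<bar> \<le> 1" if i: "i < N" for n i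
  proof -
    have "(c n i)\<^sup>2 \<le> (\<Sum>i<N. (c n i)\<^sup>2)" using i by (intro member_le_sum) auto
    also have "\<dots> = (\<Sum>i<N. \<Sum>j<N. c n i * c n j * m (f i) (f j))"
    proof (rule sum.cong[OF refl])
      fix i assume "i \<in> {..<N}"
      then have "(\<Sum>j<N. c n i * c n j * m (f i) (f j)) = (\<Sum>j<N. if j = i then (c n i)\<^sup>2 else 0)"
        using f(1) by (intro sum.cong) (auto simp: orthonormal_def power2_eq_square)
      then show "(c n i)\<^sup>2 = (\<Sum>j<N. c n i * c n j * m (f i) (f j))" using \<open>i \<in> {..<N}\<close> by simp
    qed
    also have "\<dots> = 1" using mw[of n] w(1)[of n] by (simp add: W_def)
    finally show ?thesis by (simp add: abs_square_le_1)
  qed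
  obtain l r where lr: "strict_mono (r :: nat \<Rightarrow> nat)" "\<And>i. i < N \<Longrightarrow> (\<lambda>n. c (r n) i) \<longlonglongrightarrow> l i"
    using compact_sequence[where k = N and c = c] cbound by blast
  define z where "z = (\<lambda>x. \<Sum>i<N. l i * f i x)"
  have zV: "z \<in> V" unfolding z_def by (rule V_sum[OF finite_lessThan fV])
  have "(\<lambda>n. m (w (r n)) (w (r n))) \<longlonglongrightarrow> m z z"
    unfolding mw z_def dm(1)[of l] by (intro tendsto_sum tendsto_mult lr(2) tendsto_const) auto
  moreover have "(\<lambda>n. m (w (r n)) (w (r n))) = (\<lambda>n. 1)" using w(1) by (simp add: W_def)
  ultimately have mz: "m z z = 1" by (simp add: LIMSEQ_const_iff)
  have "(\<lambda>n. a (w (r n)) (w (r n))) \<longlonglongrightarrow> a z z"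
    unfolding aw z_def dm(2)[of l] by (intro tendsto_sum tendsto_mult lr(2) tendsto_const) auto
  moreover have "(\<lambda>n. \<kappa> + 1 / real (Suc (r n))) \<longlonglongrightarrow> \<kappa> + 0"
  proof (rule tendsto_add[OF tendsto_const])
    have "(\<lambda>n. 1 / real (Suc n)) \<longlonglongrightarrow> 0" by (rule LIMSEQ_Suc[OF lim_1_over_n])
    from LIMSEQ_subseq_LIMSEQ[OF this lr(1)] show "(\<lambda>n. 1 / real (Suc (r n))) \<longlonglongrightarrow> 0" by (simp add: o_def)
  qed
  ultimately have "a z z \<le> \<kappa> + 0" by (rule LIMSEQ_le) (use w(2) less_imp_le in blast)
  have ze: "m z (e j) = 0" if j: "j < k" for j
  proof -
    have eV: "e j \<in> V" using on j by (simp add: orthonormal_def)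
    have "(\<lambda>n. \<Sum>i<N. c (r n) i * m (f i) (e j)) \<longlonglongrightarrow> (\<Sum>i<N. l i * m (f i) (e j))"
      by (intro tendsto_sum tendsto_mult lr(2) tendsto_const) auto
    moreover have "(\<Sum>i<N. c (r n) i * m (f i) (e j)) = 0" for n
      using ms[OF eV, of "c (r n)"] w(1)[of "r n"] j unfolding wc[symmetric] by (simp add: W_def)
    ultimately have "(\<Sum>i<N. l i * m (f i) (e j)) = 0" by (simp add: LIMSEQ_const_iff)
    then show ?thesis unfolding z_def using ms[OF eV, of l] by simp
  qed
  have "z \<in> W" using zV mz ze by (simp add: W_def)
  with \<open>a z z \<le> \<kappa> + 0\<close> lower have az: "a z z = \<kappa>" by force
  have quot: "\<kappa> * m u u \<le> a u u" if u: "u \<in> V" "\<And>j. j < k \<Longrightarrow> m u (e j) = 0" for u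
  proof (cases "m u u = 0")
    case True
    then show ?thesis using a_nonneg by simp
  next
    case False
    then obtain w where "w \<in> W" "a w w = a u u / m u u" using scaled[OF u(1) False u(2)] by blast
    then have "\<kappa> \<le> a u u / m u u" using lower by force
    then show ?thesis using False m_nonneg[of u] by (simp add: field_simps)
  qed
  \<comment> \<open>The first variation of the quotient at its minimiser z in an admissible
    direction y.\<close>
  have ortho: "a z y = 0" if y: "y \<in> V" "\<And>j. j < k \<Longrightarrow> m y (e j) = 0" "m z y = 0" for y
  proof -
    have ineq: "0 \<le> 2 * t * a z y + t\<^sup>2 * (a y y - \<kappa> * m y y)" for t
    proof -
      let ?u = "\<lambda>x. 1 * z x + t * y x"
      have u: "?u \<in> V" by (rule V_comb[OF zV y(1)])
      have "m ?u (e j) = 0" if "j < k" for j using m_comb[OF zV y(1), of "e j" 1 t] ze[OF that] y(2)[OF that] on that by (simp add: orthonormal_def)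
      from quot[OF u this] have "\<kappa> * m ?u ?u \<le> a ?u ?u" .
      moreover have "m ?u ?u = 1 + t\<^sup>2 * m y y"
        using m_comb[OF zV y(1) u, of 1 t] m_comb[OF zV y(1) zV, of 1 t] m_comb[OF zV y(1) y(1), of 1 t]
          m_sym[of z ?u] m_sym[of y ?u] m_sym[of y z] mz y(3) by (simp add: power2_eq_square)
      moreover have "a ?u ?u = \<kappa> + 2 * t * a z y + t\<^sup>2 * a y y"
        using a_comb[OF zV y(1) u, of 1 t] a_comb[OF zV y(1) zV, of 1 t] a_comb[OF zV y(1) y(1), of 1 t]
          a_sym[of z ?u] a_sym[of y ?u] a_sym[of y z] az by (simp add: power2_eq_square algebra_simps)
      ultimately show ?thesis by (simp add: algebra_simps)
    qed
    \<comment> \<open>Inserting t = -a(z,y)/q into \<open>ineq\<close> leaves 0 \<le> -a(z,y)^2/q.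
      The added 1 makes q positive, and q dominates the coefficient of t^2.\<close>
    define q where "q = \<bar>a y y - \<kappa> * m y y\<bar> + 1"
    have q: "0 < q" by (simp add: q_def)
    have "0 \<le> 2 * (- a z y / q) * a z y + (- a z y / q)\<^sup>2 * (a y y - \<kappa> * m y y)" by (rule ineq)
    also have "\<dots> \<le> 2 * (- a z y / q) * a z y + (- a z y / q)\<^sup>2 * q" by (intro add_left_mono mult_left_mono) (auto simp: q_def)
    also have "\<dots> = - (a z y)\<^sup>2 / q" using q by (simp add: power2_eq_square field_simps)
    finally show ?thesis using q by (simp add: zero_le_divide_iff divide_le_0_iff)
  qed
  \<comment> \<open>Every u splits into parts along the earlier eigenvectors and along z, and a
    residual. The residual is orthogonal to z in the form a by \<open>ortho\<close>; the earlier
    eigenvectors are so because z is orthogonal to them in the form m.\<close>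
  have "a z u = \<kappa> * m z u" if u: "u \<in> V" for u
  proof -
    let ?on = "orthonormal (Suc k) (e(k := z))"
    have on': ?on by (rule orthonormal_extend[OF on zV mz ze])
    let ?e = "e(k := z)"
    let ?y = "orth_residual (Suc k) ?e u"
    have yV: "?y \<in> V" by (rule orth_residual(1)[OF on' u])
    have y0: "m ?y (?e j) = 0" if "j < Suc k" for j by (rule orth_residual(2)[OF on' u that])
    have "a z ?y = 0"
    proof (rule ortho[OF yV])
      show "m ?y (e j) = 0" if "j < k" for j using y0[of j] that by simp
      show "m z ?y = 0" using y0[of k] m_sym by simp
    qed
    have eV: "\<And>i. i \<in> {..<Suc k} \<Longrightarrow> ?e i \<in> V" using on' by (auto simp: orthonormal_def)
    have aze: "a (?e i) z = 0" if "i < k" for i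
    proof -
      have "eigenfunction (e i)" by (rule eig[OF that])
      then obtain \<kappa>' where "\<forall>v\<in>V. a (e i) v = \<kappa>' * m (e i) v" by (auto simp: eigenfunction_def)
      then show ?thesis using zV ze[OF that] m_sym that by simp
    qed
    let ?s = "\<lambda>x. \<Sum>i<Suc k. m u (?e i) * ?e i x"
    have sV: "?s \<in> V" by (rule V_sum[OF finite_lessThan eV])
    have "a u z = a (\<lambda>x. 1 * ?y x + 1 * ?s x) z" using orth_residual(3)[OF on' u] by simp
    also have "\<dots> = a ?y z + a ?s z" using a_comb[OF yV sV zV, of 1 1] by simp
    also have "a ?s z = (\<Sum>i<Suc k. m u (?e i) * a (?e i) z)" by (rule a_sum[OF finite_lessThan eV zV])
    also have "\<dots> = m u z * \<kappa>" using aze az by simp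
    finally have "a u z = a ?y z + m u z * \<kappa>" .
    moreover have "a ?y z = 0" using \<open>a z ?y = 0\<close> a_sym[of ?y z] by (simp only:)
    ultimately have "a u z = m u z * \<kappa>" by (simp only: add_0_left)
    then show ?thesis using a_sym[of z u] m_sym[of z u] by (simp only: mult.commute)
  qed
  then have "eigenfunction z" unfolding eigenfunction_def using \<kappa>0 by blast
  with zV mz ze show ?thesis by blast
qed

theorem spectral_decomposition:
  "\<exists>k e \<kappa>. orthonormal k e \<and> (\<forall>i<k. 0 \<le> \<kappa> i \<and> (\<forall>v\<in>V. a (e i) v = \<kappa> i * m (e i) v)) \<and> (\<forall>v\<in>V. v = (\<lambda>x. \<Sum>i<k. m v (e i) * e i x))"
proof -
  obtain k e where ke: "orthonormal k e" "\<forall>i<k. eigenfunction (e i)" "\<forall>v\<in>V. v = (\<lambda>x. \<Sum>i<k. m v (e i) * e i x)"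
    using maximal_ON[of eigenfunction] next_eigenvector by blast
  then have "\<forall>i. \<exists>\<kappa>. i < k \<longrightarrow> 0 \<le> \<kappa> \<and> (\<forall>v\<in>V. a (e i) v = \<kappa> * m (e i) v)" by (auto simp: eigenfunction_def)
  then obtain \<kappa> where "\<forall>i. i < k \<longrightarrow> 0 \<le> \<kappa> i \<and> (\<forall>v\<in>V. a (e i) v = \<kappa> i * m (e i) v)" by metis
  with ke show ?thesis by blast
qed

end

section \<open>The finite element space as an instance\<close>

context
  fixes \<Omega> :: "'a::euclidean_space set" and \<T> :: "'a set set"
  assumes dom: "convex_polyhedral_domain \<Omega>" and tri: "fe_triangulation \<Omega> \<T>"
begin

lemma domain_facts:
  shows "open \<Omega>" "bounded \<Omega>" "compact (closure \<Omega>)" "\<Omega> \<in> sets lebesgue" "\<Omega> \<in> lmeasurable" "finite_measure (lebesgue_on \<Omega>)"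
    "\<Union>\<T> = closure \<Omega>" "finite \<T>"
proof -
  show o: "open \<Omega>" and c: "compact (closure \<Omega>)"
    using dom unfolding convex_polyhedral_domain_def by (blast intro: polytope_imp_compact)+
  show b: "bounded \<Omega>" by (rule bounded_subset[OF compact_imp_bounded[OF c] closure_subset])
  show lm: "\<Omega> \<in> lmeasurable" by (rule lmeasurable_open[OF b o])
  then show "\<Omega> \<in> sets lebesgue" by (rule fmeasurableD)
  show "finite_measure (lebesgue_on \<Omega>)" by (rule finite_measure_lebesgue_on[OF lm])
  show "\<Union>\<T> = closure \<Omega>" "finite \<T>" using tri by (auto simp: fe_triangulation_def triangulation_def)
qed

lemma simplex_facts:
  assumes "K \<in> \<T>" shows "compact K" "convex K" "negligible (K - interior K)"
proof -
  have s: "int DIM('a) simplex K" using tri assms by (auto simp: fe_triangulation_def)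
  show c: "compact K" by (rule compact_simplex[OF s])
  show v: "convex K" by (rule convex_simplex[OF s])
  have "negligible (frontier K)" by (rule negligible_convex_frontier[OF v])
  moreover have "closure K = K" using c by (simp add: compact_imp_closed)
  ultimately show "negligible (K - interior K)" by (simp add: frontier_def)
qed

lemma negligible_skeleton: "negligible (\<Omega> - \<Union>(interior ` \<T>))"
proof (rule negligible_subset)
  show "negligible (\<Union>K\<in>\<T>. K - interior K)"
    using domain_facts(8) simplex_facts(3) by (intro negligible_Union) auto
  show "\<Omega> - \<Union>(interior ` \<T>) \<subseteq> (\<Union>K\<in>\<T>. K - interior K)"
  proof
    fix x assume x: "x \<in> \<Omega> - \<Union>(interior ` \<T>)"
    then have "x \<in> \<Union>\<T>" using domain_facts(7) closure_subset by auto
    with x show "x \<in> (\<Union>K\<in>\<T>. K - interior K)" by auto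
  qed
qed

lemma AE_interior: "AE x in lebesgue_on \<Omega>. \<exists>K\<in>\<T>. x \<in> interior K"
proof -
  have "AE x in lebesgue. x \<notin> \<Omega> - \<Union>(interior ` \<T>)"
    by (rule AE_not_in) (use negligible_skeleton in \<open>simp only: negligible_iff_null_sets\<close>)
  then have "AE x in lebesgue. x \<in> \<Omega> \<longrightarrow> (\<exists>K\<in>\<T>. x \<in> interior K)" by eventually_elim auto
  then show ?thesis using domain_facts(4) by (subst AE_restrict_space_iff) auto
qed

text \<open>On the skeleton f is arbitrary. That set is negligible, so all its subsets are Lebesgue
  measurable, and only the interiors of the simplices remain to be checked.\<close>

lemma piecewise_constant_integrable:
  fixes f :: "'a \<Rightarrow> real"
  assumes f: "\<And>K x. K \<in> \<T> \<Longrightarrow> x \<in> interior K \<Longrightarrow> f x = c K"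
  shows "f \<in> borel_measurable (lebesgue_on \<Omega>)" "integrable (lebesgue_on \<Omega>) f"
proof -
  show m: "f \<in> borel_measurable (lebesgue_on \<Omega>)"
  proof (rule measurableI)
    fix A :: "real set" assume "A \<in> sets borel"
    let ?N = "\<Omega> - \<Union>(interior ` \<T>)"
    have "f -` A \<inter> \<Omega> = (\<Union>K\<in>{K\<in>\<T>. c K \<in> A}. interior K \<inter> \<Omega>) \<union> (f -` A \<inter> ?N)"
      using f by fastforce
    moreover have "f -` A \<inter> ?N \<in> sets lebesgue"
      by (rule negligible_imp_sets[OF negligible_subset[OF negligible_skeleton]]) auto
    moreover have "(\<Union>K\<in>{K\<in>\<T>. c K \<in> A}. interior K \<inter> \<Omega>) \<in> sets lebesgue"
      using domain_facts(1,8) by (intro sets.finite_UN) auto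
    ultimately have "f -` A \<inter> \<Omega> \<in> sets lebesgue" by auto
    then show "f -` A \<inter> space (lebesgue_on \<Omega>) \<in> sets (lebesgue_on \<Omega>)"
      using domain_facts(4) by (simp add: sets_restrict_space_iff)
  qed auto
  have "AE x in lebesgue_on \<Omega>. norm (f x) \<le> (\<Sum>K\<in>\<T>. \<bar>c K\<bar>)"
    using AE_interior
  proof eventually_elim
    fix x assume "\<exists>K\<in>\<T>. x \<in> interior K"
    then obtain K where K: "K \<in> \<T>" "x \<in> interior K" by blast
    have "\<bar>c K\<bar> \<le> (\<Sum>K\<in>\<T>. \<bar>c K\<bar>)" using K domain_facts(8) by (intro member_le_sum) auto
    then show "norm (f x) \<le> (\<Sum>K\<in>\<T>. \<bar>c K\<bar>)" using f[OF K] by simp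
  qed
  then show "integrable (lebesgue_on \<Omega>) f"
    by (rule finite_measure.integrable_const_bound[OF domain_facts(6) _ m])
qed

definition slope :: "('a \<Rightarrow> real) \<Rightarrow> 'a set \<Rightarrow> 'a" where
  "slope v K = (SOME a. \<exists>b. \<forall>x\<in>K. v x = a \<bullet> x + b)"

lemma slope:
  assumes "v \<in> fe_space \<Omega> \<T>" "K \<in> \<T>"
  shows "\<exists>b. \<forall>x\<in>K. v x = slope v K \<bullet> x + b"
  unfolding slope_def by (rule someI_ex) (use assms in \<open>auto simp: fe_space_def\<close>)

lemma grad_eq_slope:
  assumes v: "v \<in> fe_space \<Omega> \<T>" and K: "K \<in> \<T>" and x: "x \<in> interior K"
  shows "grad v x = slope v K"
proof -
  obtain b where b: "\<forall>x\<in>K. v x = slope v K \<bullet> x + b" using slope[OF v K] by blast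
  have "((\<lambda>x. slope v K \<bullet> x + b) has_derivative (\<lambda>h. slope v K \<bullet> h)) (at x)"
    by (auto intro!: derivative_eq_intros)
  then have "(v has_derivative (\<lambda>h. slope v K \<bullet> h)) (at x)"
    by (rule has_derivative_transform_within_open[OF _ open_interior x]) (use b interior_subset[of K] in force)
  then have D: "GDERIV v x :> slope v K" by (simp add: gderiv_def inner_commute)
  have "D' = slope v K" if "GDERIV v x :> D'" for D'
  proof -
    have "(\<lambda>h. h \<bullet> D') = (\<lambda>h. h \<bullet> slope v K)" using has_derivative_unique that D unfolding gderiv_def by blast
    then have "D' \<bullet> D' = D' \<bullet> slope v K" "slope v K \<bullet> D' = slope v K \<bullet> slope v K" by meson+
    then have "(D' - slope v K) \<bullet> (D' - slope v K) = 0" by (simp add: inner_diff_left inner_diff_right)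
    then show ?thesis by simp
  qed
  from D this have "(THE D'. GDERIV v x :> D') = slope v K" by (rule the_equality)
  moreover have "\<exists>D'. GDERIV v x :> D'" using D by blast
  ultimately show ?thesis by (simp only: grad_def if_True)
qed

lemma grad_mult_integrable:
  assumes "u \<in> fe_space \<Omega> \<T>" "v \<in> fe_space \<Omega> \<T>"
  shows "integrable (lebesgue_on \<Omega>) (\<lambda>x. grad u x \<bullet> grad v x)"
  by (rule piecewise_constant_integrable(2)[where c = "\<lambda>K. slope u K \<bullet> slope v K"]) (simp add: grad_eq_slope assms)

lemma fe_space_comb:
  assumes u: "u \<in> fe_space \<Omega> \<T>" and v: "v \<in> fe_space \<Omega> \<T>"
  shows "(\<lambda>x. c * u x + d * v x) \<in> fe_space \<Omega> \<T>"
proof -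
  have "\<exists>a b. \<forall>x\<in>K. c * u x + d * v x = a \<bullet> x + b" if K: "K \<in> \<T>" for K
  proof -
    obtain b where b: "\<forall>x\<in>K. u x = slope u K \<bullet> x + b" using slope[OF u K] by blast
    obtain b' where b': "\<forall>x\<in>K. v x = slope v K \<bullet> x + b'" using slope[OF v K] by blast
    have "c * u x + d * v x = (c *\<^sub>R slope u K + d *\<^sub>R slope v K) \<bullet> x + (c * b + d * b')" if "x \<in> K" for x
      unfolding bspec[OF b that] bspec[OF b' that] by (simp only: inner_add_left inner_scaleR_left distrib_left add_ac)
    then show ?thesis by blast
  qed
  moreover have "continuous_on (closure \<Omega>) (\<lambda>x. c * u x + d * v x)"
    using u v by (intro continuous_intros) (simp_all add: fe_space_def)
  moreover have "c * u x + d * v x = 0" if "x \<notin> \<Omega>" for x using u v that by (simp add: fe_space_def)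
  ultimately show ?thesis unfolding fe_space_def by blast
qed

lemma fe_space_zero: "(\<lambda>x. 0) \<in> fe_space \<Omega> \<T>"
  by (auto simp: fe_space_def intro!: exI[of _ 0])

text \<open>Slopes are chosen separately for each function. That the choices are compatible follows
  because two affine functions that agree on a set with interior have the same slope.\<close>

lemma grad_comb:
  assumes u: "u \<in> fe_space \<Omega> \<T>" and v: "v \<in> fe_space \<Omega> \<T>" and x: "\<exists>K\<in>\<T>. x \<in> interior K"
  shows "grad (\<lambda>x. c * u x + d * v x) x = c *\<^sub>R grad u x + d *\<^sub>R grad v x"
proof -
  obtain K where K: "K \<in> \<T>" "x \<in> interior K" using x by blast
  let ?w = "\<lambda>x. c * u x + d * v x"
  obtain b where b: "\<forall>x\<in>K. u x = slope u K \<bullet> x + b" using slope[OF u K(1)] by blast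
  obtain b' where b': "\<forall>x\<in>K. v x = slope v K \<bullet> x + b'" using slope[OF v K(1)] by blast
  obtain b'' where b'': "\<forall>x\<in>K. ?w x = slope ?w K \<bullet> x + b''" using slope[OF fe_space_comb[OF u v] K(1)] by blast
  let ?a = "c *\<^sub>R slope u K + d *\<^sub>R slope v K"
  have eq: "\<forall>y\<in>K. slope ?w K \<bullet> y + b'' = ?a \<bullet> y + (c * b + d * b')"
  proof
    fix y assume y: "y \<in> K"
    have "slope ?w K \<bullet> y + b'' = c * u y + d * v y" using bspec[OF b'' y] by (simp only:)
    also have "\<dots> = ?a \<bullet> y + (c * b + d * b')"
      unfolding bspec[OF b y] bspec[OF b' y] by (simp only: inner_add_left inner_scaleR_left distrib_left add_ac)
    finally show "slope ?w K \<bullet> y + b'' = ?a \<bullet> y + (c * b + d * b')" .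
  qed
  have "slope ?w K = ?a"
  proof -
    define z where "z = slope ?w K - ?a"
    obtain e where e: "e > 0" "ball x e \<subseteq> K" using K(2) by (auto simp: mem_interior)
    \<comment> \<open>Small enough for x + t z to stay in the ball; the 1 in the denominator covers
      z = 0.\<close>
    define t where "t = e / (2 * (norm z + 1))"
    have t: "0 < t" using e by (simp add: t_def add_nonneg_pos)
    have "norm (t *\<^sub>R z) < e"
    proof -
      have "norm z / (norm z + 1) \<le> 1" using add_nonneg_pos[OF norm_ge_zero[of z] zero_less_one] by (simp add: divide_le_eq_1)
      then have "e / 2 * (norm z / (norm z + 1)) \<le> e / 2 * 1" using e by (intro mult_left_mono) auto
      moreover have "norm (t *\<^sub>R z) = e / 2 * (norm z / (norm z + 1))" using e by (simp add: t_def)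
      ultimately show ?thesis using e by linarith
    qed
    then have "x + t *\<^sub>R z \<in> K" "x \<in> K" using e by (auto simp: dist_norm subset_iff)
    then have "slope ?w K \<bullet> (x + t *\<^sub>R z) + b'' = ?a \<bullet> (x + t *\<^sub>R z) + (c * b + d * b')"
      "slope ?w K \<bullet> x + b'' = ?a \<bullet> x + (c * b + d * b')" using eq by blast+
    then have "slope ?w K \<bullet> (t *\<^sub>R z) = ?a \<bullet> (t *\<^sub>R z)" by (simp only: inner_add_right)
    then have "t * (z \<bullet> z) = 0" by (simp add: z_def inner_diff_left algebra_simps)
    then show ?thesis using t by (simp add: z_def)
  qed
  then show ?thesis using grad_eq_slope[OF fe_space_comb[OF u v] K] grad_eq_slope[OF u K] grad_eq_slope[OF v K] by simp
qed

lemma grad_inner_comb: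
  assumes "u \<in> fe_space \<Omega> \<T>" "v \<in> fe_space \<Omega> \<T>" "w \<in> fe_space \<Omega> \<T>"
  shows "grad_inner \<Omega> (\<lambda>x. c * u x + d * v x) w = c * grad_inner \<Omega> u w + d * grad_inner \<Omega> v w"
proof -
  have "grad_inner \<Omega> (\<lambda>x. c * u x + d * v x) w = (LINT x|lebesgue_on \<Omega>. c * (grad u x \<bullet> grad w x) + d * (grad v x \<bullet> grad w x))"
    unfolding grad_inner_def
  proof (rule integral_cong_AE)
    show "AE x in lebesgue_on \<Omega>. grad (\<lambda>x. c * u x + d * v x) x \<bullet> grad w x = c * (grad u x \<bullet> grad w x) + d * (grad v x \<bullet> grad w x)"
      using AE_interior by eventually_elim (simp add: grad_comb assms inner_add_left)
  qed (use grad_mult_integrable[OF fe_space_comb[OF assms(1,2)] assms(3)] grad_mult_integrable assms in auto)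
  then show ?thesis using grad_mult_integrable assms by (simp add: grad_inner_def)
qed

lemma fe_space_L2:
  assumes "v \<in> fe_space \<Omega> \<T>" shows "v \<in> L2 \<Omega>"
proof -
  have cont: "continuous_on (closure \<Omega>) v" using assms by (simp add: fe_space_def)
  then have m: "v \<in> borel_measurable (lebesgue_on \<Omega>)"
    using domain_facts(4) closure_subset by (intro continuous_imp_measurable_on_sets_lebesgue) (auto intro: continuous_on_subset)
  have "bounded (v ` closure \<Omega>)" by (intro compact_imp_bounded compact_continuous_image cont domain_facts)
  then obtain B where B: "\<forall>x\<in>closure \<Omega>. \<bar>v x\<bar> \<le> B" by (auto simp: bounded_iff)
  have "AE x in lebesgue_on \<Omega>. norm ((v x)\<^sup>2) \<le> B\<^sup>2"
  proof (rule AE_I2)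
    fix x assume "x \<in> space (lebesgue_on \<Omega>)"
    then have "x \<in> closure \<Omega>" using closure_subset by auto
    with B have "\<bar>v x\<bar> \<le> B" by blast
    then have "\<bar>v x\<bar>\<^sup>2 \<le> B\<^sup>2" by (intro power_mono) auto
    then show "norm ((v x)\<^sup>2) \<le> B\<^sup>2" by simp
  qed
  then have "integrable (lebesgue_on \<Omega>) (\<lambda>x. (v x)\<^sup>2)"
    using m by (intro finite_measure.integrable_const_bound[OF domain_facts(6)]) auto
  then show ?thesis using m by (simp add: L2_def)
qed

text \<open>The set where v differs from 0 inside the domain is open and negligible, hence empty.
  With the extension by zero this gives equality everywhere and not just almost everywhere.\<close>

lemma fe_space_definite:
  assumes v: "v \<in> fe_space \<Omega> \<T>" and 0: "L2_inner \<Omega> v v = 0"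
  shows "v = (\<lambda>x. 0)"
proof -
  have "AE x in lebesgue_on \<Omega>. v x * v x = 0"
    using 0 L2_mult_integrable[OF fe_space_L2[OF v] fe_space_L2[OF v]]
    unfolding L2_inner_def by (subst (asm) integral_nonneg_eq_0_iff_AE) auto
  then have "AE x in lebesgue. x \<in> \<Omega> \<longrightarrow> v x * v x = 0" using domain_facts(4) by (subst (asm) AE_restrict_space_iff) auto
  then have "AE x in lebesgue. x \<notin> {x \<in> \<Omega>. v x \<noteq> 0}" by eventually_elim auto
  moreover have op: "open {x \<in> \<Omega>. v x \<noteq> 0}"
  proof -
    have "continuous_on \<Omega> v" using v closure_subset by (auto simp: fe_space_def intro: continuous_on_subset)
    then have "open (\<Omega> \<inter> v -` (- {0}))" by (intro continuous_open_preimage domain_facts) auto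
    moreover have "\<Omega> \<inter> v -` (- {0}) = {x \<in> \<Omega>. v x \<noteq> 0}" by auto
    ultimately show ?thesis by simp
  qed
  ultimately have "negligible {x \<in> \<Omega>. v x \<noteq> 0}" by (simp add: negligible_iff_null_sets AE_iff_null_sets)
  then have "{x \<in> \<Omega>. v x \<noteq> 0} = {}" using op open_not_negligible by blast
  then show ?thesis using v by (auto simp: fe_space_def fun_eq_iff)
qed

text \<open>The points are the vertices of all simplices: an affine function that vanishes at the
  vertices vanishes on their convex hull.\<close>

lemma fe_space_finite_dim: "\<exists>P. finite P \<and> (\<forall>u\<in>fe_space \<Omega> \<T>. (\<forall>p\<in>P. u p = 0) \<longrightarrow> u = (\<lambda>x. 0))"
proof -
  have "\<forall>K\<in>\<T>. \<exists>C. finite C \<and> K = convex hull C"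
    using tri unfolding fe_triangulation_def simplex by blast
  then obtain C where C: "\<And>K. K \<in> \<T> \<Longrightarrow> finite (C K) \<and> K = convex hull (C K)" by metis
  have "u = (\<lambda>x. 0)" if u: "u \<in> fe_space \<Omega> \<T>" and z: "\<forall>p\<in>(\<Union>K\<in>\<T>. C K). u p = 0" for u
  proof
    fix x
    show "u x = 0"
    proof (cases "x \<in> \<Omega>")
      case True
      then have "x \<in> \<Union>\<T>" using domain_facts(7) closure_subset by auto
      then obtain K where K: "K \<in> \<T>" "x \<in> K" by blast
      obtain b where b: "\<forall>x\<in>K. u x = slope u K \<bullet> x + b" using slope[OF u K(1)] by blast
      have CK: "K = convex hull (C K)" using C[OF K(1)] by blast
      have "C K \<subseteq> {y. slope u K \<bullet> y = - b}"
      proof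
        fix y assume y: "y \<in> C K"
        have "y \<in> K" by (subst CK, rule hull_inc[OF y])
        with b have "u y = slope u K \<bullet> y + b" by (rule bspec)
        moreover have "u y = 0" using z y K(1) by blast
        ultimately show "y \<in> {y. slope u K \<bullet> y = - b}" by simp
      qed
      then have "convex hull (C K) \<subseteq> {y. slope u K \<bullet> y = - b}" by (rule hull_minimal) (rule convex_hyperplane)
      then have "slope u K \<bullet> x = - b" using K(2) CK by blast
      then show ?thesis using bspec[OF b K(2)] by simp
    next
      case False
      then show ?thesis using u by (simp add: fe_space_def)
    qed
  qed
  moreover have "finite (\<Union>K\<in>\<T>. C K)" using C domain_facts(8) by auto
  ultimately show ?thesis by blast
qed

lemma form_pair_fe: "form_pair (fe_space \<Omega> \<T>) (L2_inner \<Omega>) (grad_inner \<Omega>)"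
proof
  show "grad_inner \<Omega> u v = grad_inner \<Omega> v u" for u v by (simp add: grad_inner_def inner_commute)
  show "0 \<le> grad_inner \<Omega> u u" for u by (simp add: grad_inner_def)
qed (auto intro: fe_space_zero fe_space_comb L2_inner_combination fe_space_L2 L2_inner_commute L2_inner_nonneg fe_space_definite grad_inner_comb fe_space_finite_dim)

text \<open>Here the definite descriptions in \<open>discrete_laplacian\<close> and
  \<open>L2_projection\<close> are resolved: the expansion in the eigenbasis satisfies the defining
  equation, and definiteness of the inner product makes it the only solution.\<close>

lemma eigenbasis_formulas:
  fixes e :: "nat \<Rightarrow> 'a \<Rightarrow> real" and \<kappa> :: "nat \<Rightarrow> real"
  assumes on: "\<And>i. i < k \<Longrightarrow> e i \<in> fe_space \<Omega> \<T>" "\<And>i j. i < k \<Longrightarrow> j < k \<Longrightarrow> L2_inner \<Omega> (e i) (e j) = (if i = j then 1 else 0)"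
    and eig: "\<And>i v. i < k \<Longrightarrow> v \<in> fe_space \<Omega> \<T> \<Longrightarrow> grad_inner \<Omega> (e i) v = \<kappa> i * L2_inner \<Omega> (e i) v"
    and span: "\<And>v. v \<in> fe_space \<Omega> \<T> \<Longrightarrow> v = (\<lambda>x. \<Sum>i<k. L2_inner \<Omega> v (e i) * e i x)"
  shows "\<And>\<phi>. \<phi> \<in> fe_space \<Omega> \<T> \<Longrightarrow> discrete_laplacian \<Omega> \<T> \<phi> = (\<lambda>x. \<Sum>i<k. (- \<kappa> i * L2_inner \<Omega> \<phi> (e i)) * e i x)"
    and "\<And>f. f \<in> L2 \<Omega> \<Longrightarrow> L2_projection \<Omega> \<T> f = (\<lambda>x. \<Sum>i<k. L2_inner \<Omega> f (e i) * e i x)"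
    and "\<And>c j. j < k \<Longrightarrow> L2_inner \<Omega> (\<lambda>x. \<Sum>i<k. c i * e i x) (e j) = c j"
    and "\<And>f. f \<in> L2 \<Omega> \<Longrightarrow> (\<Sum>i<k. (L2_inner \<Omega> f (e i))\<^sup>2) \<le> (L2_norm \<Omega> f)\<^sup>2"
    and "\<And>v. v \<in> fe_space \<Omega> \<T> \<Longrightarrow> (L2_norm \<Omega> v)\<^sup>2 = (\<Sum>i<k. (L2_inner \<Omega> v (e i))\<^sup>2)"
proof -
  interpret form_pair "fe_space \<Omega> \<T>" "L2_inner \<Omega>" "grad_inner \<Omega>" by (rule form_pair_fe)
  let ?V = "fe_space \<Omega> \<T>" and ?m = "L2_inner \<Omega>"
  have ONe: "orthonormal k e" using on by (simp add: orthonormal_def)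
  have sumV: "(\<lambda>x. \<Sum>i<k. c i * e i x) \<in> ?V" for c by (rule V_sum) (use on in auto)
  show coeff: "?m (\<lambda>x. \<Sum>i<k. c i * e i x) (e j) = c j" if "j < k" for c j by (rule orthonormal_coeff[OF ONe that])
  have msum: "?m (\<lambda>x. \<Sum>i<k. c i * e i x) v = (\<Sum>i<k. c i * ?m (e i) v)" if "v \<in> ?V" for c v
    by (rule m_sum) (use on that in auto)
  \<comment> \<open>\<open>m_sum\<close> covers only pairs from the finite element space, whereas f
    is a general element of \<open>L2 \<Omega>\<close>.\<close>
  have fm: "?m f (\<lambda>x. \<Sum>i<n. c i * e i x) = (\<Sum>i<n. c i * ?m f (e i))" if f: "f \<in> L2 \<Omega>" and "n \<le> k" for f n c
    using \<open>n \<le> k\<close>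
  proof (induction n)
    case (Suc n)
    have s: "(\<lambda>x. \<Sum>i<n. c i * e i x) \<in> L2 \<Omega>" by (rule fe_space_L2, rule V_sum) (use on Suc.prems in auto)
    have "?m (\<lambda>x. 1 * (\<Sum>i<n. c i * e i x) + c n * e n x) f = 1 * ?m (\<lambda>x. \<Sum>i<n. c i * e i x) f + c n * ?m (e n) f"
      by (rule L2_inner_combination[OF s fe_space_L2 f]) (use on Suc.prems in auto)
    then show ?case using Suc by (simp add: L2_inner_commute[of _ f])
  qed (simp add: L2_inner_def)
  have uniq: "w = w'" if w: "w \<in> ?V" "w' \<in> ?V" and eq: "\<And>\<psi>. \<psi> \<in> ?V \<Longrightarrow> ?m w \<psi> = ?m w' \<psi>" for w w'
  proof -
    let ?d = "\<lambda>x. 1 * w x + (-1) * w' x"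
    have d: "?d \<in> ?V" by (rule V_comb[OF w])
    have "?m ?d ?d = 0" using m_comb[OF w d, of 1 "-1"] eq[OF d] by simp
    from m_definite[OF d this] show ?thesis by (auto simp: fun_eq_iff)
  qed
  show "discrete_laplacian \<Omega> \<T> \<phi> = (\<lambda>x. \<Sum>i<k. (- \<kappa> i * ?m \<phi> (e i)) * e i x)" if \<phi>: "\<phi> \<in> ?V" for \<phi>
  proof -
    let ?w = "\<lambda>x. \<Sum>i<k. (- \<kappa> i * ?m \<phi> (e i)) * e i x"
    have w: "?w \<in> ?V \<and> (\<forall>\<psi>\<in>?V. - ?m ?w \<psi> = grad_inner \<Omega> \<phi> \<psi>)"
    proof (intro conjI ballI sumV)
      fix \<psi> assume \<psi>: "\<psi> \<in> ?V"
      have "grad_inner \<Omega> \<phi> \<psi> = grad_inner \<Omega> (\<lambda>x. \<Sum>i<k. ?m \<phi> (e i) * e i x) \<psi>" using span[OF \<phi>] by simp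
      also have "\<dots> = (\<Sum>i<k. ?m \<phi> (e i) * grad_inner \<Omega> (e i) \<psi>)" by (rule a_sum) (use on \<psi> in auto)
      also have "\<dots> = (\<Sum>i<k. ?m \<phi> (e i) * (\<kappa> i * ?m (e i) \<psi>))" using eig \<psi> by (intro sum.cong) auto
      also have "\<dots> = - ?m ?w \<psi>" unfolding msum[OF \<psi>, of "\<lambda>i. - \<kappa> i * ?m \<phi> (e i)"] sum_negf[symmetric]
        by (rule sum.cong) auto
      finally show "- ?m ?w \<psi> = grad_inner \<Omega> \<phi> \<psi>" by simp
    qed
    show ?thesis unfolding discrete_laplacian_def
    proof (rule the_equality, rule w)
      fix w' assume w': "w' \<in> ?V \<and> (\<forall>\<psi>\<in>?V. - ?m w' \<psi> = grad_inner \<Omega> \<phi> \<psi>)"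
      show "w' = ?w"
      proof (rule uniq)
        fix \<psi> assume "\<psi> \<in> ?V"
        then have "- ?m w' \<psi> = - ?m ?w \<psi>" using w w' by simp
        then show "?m w' \<psi> = ?m ?w \<psi>" by simp
      qed (use w w' in auto)
    qed
  qed
  show "L2_projection \<Omega> \<T> f = (\<lambda>x. \<Sum>i<k. ?m f (e i) * e i x)" if f: "f \<in> L2 \<Omega>" for f
  proof -
    let ?w = "\<lambda>x. \<Sum>i<k. ?m f (e i) * e i x"
    have w: "?w \<in> ?V \<and> (\<forall>\<psi>\<in>?V. ?m ?w \<psi> = ?m f \<psi>)"
    proof (intro conjI ballI sumV)
      fix \<psi> assume \<psi>: "\<psi> \<in> ?V"
      have "?m f \<psi> = ?m f (\<lambda>x. \<Sum>i<k. ?m \<psi> (e i) * e i x)" using span[OF \<psi>] by simp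
      also have "\<dots> = (\<Sum>i<k. ?m \<psi> (e i) * ?m f (e i))" by (rule fm[OF f]) simp
      also have "\<dots> = ?m ?w \<psi>" unfolding msum[OF \<psi>, of "\<lambda>i. ?m f (e i)"]
        by (rule sum.cong) (auto simp: L2_inner_commute[of _ \<psi>])
      finally show "?m ?w \<psi> = ?m f \<psi>" by simp
    qed
    show ?thesis unfolding L2_projection_def

    proof (rule the_equality, rule w)
      fix w' assume w': "w' \<in> ?V \<and> (\<forall>\<psi>\<in>?V. ?m w' \<psi> = ?m f \<psi>)"
      show "w' = ?w" by (rule uniq) (use w w' in auto)
    qed
  qed
  show par: "(L2_norm \<Omega> v)\<^sup>2 = (\<Sum>i<k. (?m v (e i))\<^sup>2)" if v: "v \<in> ?V" for v
  proof -
    have "?m v v = ?m (\<lambda>x. \<Sum>i<k. ?m v (e i) * e i x) v" using span[OF v] by simp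
    also have "\<dots> = (\<Sum>i<k. ?m v (e i) * ?m (e i) v)" by (rule msum[OF v])
    also have "\<dots> = (\<Sum>i<k. (?m v (e i))\<^sup>2)"
      by (rule sum.cong[OF refl], unfold power2_eq_square, subst (2) m_sym, rule refl)
    finally show ?thesis by (simp only: L2_norm_square)
  qed
  show "(\<Sum>i<k. (?m f (e i))\<^sup>2) \<le> (L2_norm \<Omega> f)\<^sup>2" if f: "f \<in> L2 \<Omega>" for f
  proof -
    let ?w = "\<lambda>x. \<Sum>i<k. ?m f (e i) * e i x"
    have wL: "?w \<in> L2 \<Omega>" by (rule fe_space_L2[OF sumV])
    have ww: "(L2_norm \<Omega> ?w)\<^sup>2 = (\<Sum>i<k. (?m f (e i))\<^sup>2)" unfolding par[OF sumV] using coeff by (intro sum.cong) auto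
    have fw: "?m f ?w = (L2_norm \<Omega> ?w)\<^sup>2"
      unfolding ww fm[OF f order_refl, of "\<lambda>i. ?m f (e i)"] by (simp add: power2_eq_square)
    have "0 \<le> (L2_norm \<Omega> (\<lambda>x. 1 * f x + (-1) * ?w x))\<^sup>2" by simp
    also have "\<dots> = (L2_norm \<Omega> f)\<^sup>2 - (L2_norm \<Omega> ?w)\<^sup>2"
      unfolding L2_norm_expand[OF f wL] using fw by simp
    finally show ?thesis unfolding ww by simp
  qed
qed

end

section \<open>Reduction to scalar modes\<close>

lemma L2_coefficient_continuous:
  assumes T: "0 < T" and v: "L2_continuous T \<Omega> v" and e: "e \<in> L2 \<Omega>"
  shows "continuous_on UNIV (\<lambda>t. L2_inner \<Omega> (v (clamp_to T t)) e)"
proof -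
  have vL: "v t \<in> L2 \<Omega>" if "t \<in> {0..T}" for t using v that by (simp add: L2_continuous_def)
  have "continuous_on {0..T} (\<lambda>t. L2_inner \<Omega> (v t) e)"
    unfolding continuous_on_def
  proof (intro ballI)
    fix t assume t: "t \<in> {0..T}"
    have "((\<lambda>r. L2_norm \<Omega> (\<lambda>x. v r x - v t x) * L2_norm \<Omega> e) \<longlongrightarrow> 0 * L2_norm \<Omega> e) (at t within {0..T})"
      using v t by (intro tendsto_mult tendsto_const) (simp add: L2_continuous_def)
    then have lim: "((\<lambda>r. L2_norm \<Omega> (\<lambda>x. v r x - v t x) * L2_norm \<Omega> e) \<longlongrightarrow> 0) (at t within {0..T})" by simp
    have "((\<lambda>r. L2_inner \<Omega> (v r) e - L2_inner \<Omega> (v t) e) \<longlongrightarrow> 0) (at t within {0..T})"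
    proof (rule Lim_null_comparison[OF _ lim])
      have "norm (L2_inner \<Omega> (v r) e - L2_inner \<Omega> (v t) e) \<le> L2_norm \<Omega> (\<lambda>x. v r x - v t x) * L2_norm \<Omega> e" if "r \<in> {0..T}" for r
        using L2_Cauchy_Schwarz[OF L2_diff[OF vL[OF that] vL[OF t]] e]
        unfolding L2_inner_diff[OF vL[OF that] vL[OF t] e] real_norm_def .
      then show "\<forall>\<^sub>F r in at t within {0..T}. norm (L2_inner \<Omega> (v r) e - L2_inner \<Omega> (v t) e) \<le> L2_norm \<Omega> (\<lambda>x. v r x - v t x) * L2_norm \<Omega> e"
        unfolding eventually_at_filter by (intro always_eventually) blast
    qed
    then show "((\<lambda>t. L2_inner \<Omega> (v t) e) \<longlongrightarrow> L2_inner \<Omega> (v t) e) (at t within {0..T})" by (rule LIM_zero_cancel)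
  qed
  moreover have "continuous_on UNIV (clamp_to T)" unfolding clamp_to_def by (intro continuous_intros)
  moreover have "clamp_to T ` UNIV \<subseteq> {0..T}" using T by (auto simp: clamp_to_def)
  ultimately show ?thesis by (rule continuous_on_compose2)
qed

text \<open>The defining integral runs over the closed interval, \<open>conv0\<close> over the open
  one; the end points form a null set.\<close>

lemma RL_integral_eq_rconv:
  assumes \<alpha>: "0 < \<alpha>" "\<alpha> < 1" and c: "\<And>i. i < (k::nat) \<Longrightarrow> continuous_on UNIV (c i)"
    and v: "\<And>s. s \<in> {0..r} \<Longrightarrow> v s = (\<Sum>i<k. c i s * w i)" and r: "0 \<le> r"
  shows "1 / Gamma (1 - \<alpha>) * (LINT s:{0..r}|lborel. (r - s) powr (- \<alpha>) * v s) = (\<Sum>i<k. conv0 (rl_kernel (1 - \<alpha>)) (c i) r * w i)"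
proof -
  have cm: "c i \<in> borel_measurable borel" if "i < k" for i by (rule borel_measurable_continuous_onI[OF c[OF that]])
  have G: "0 < Gamma (1 - \<alpha>)" using \<alpha> by (intro Gamma_real_pos) simp
  let ?F = "\<lambda>i s. indicator {0<..<r} s * (rl_kernel (1 - \<alpha>) (r - s) * c i s)"
  have int: "integrable lborel (?F i)" if i: "i < k" for i
  proof (cases "r = 0")
    case False
    have "bounded (c i ` {0..r})" by (intro compact_imp_bounded compact_continuous_image continuous_on_subset[OF c[OF i]]) auto
    then obtain B where B: "\<And>s. s \<in> {0..r} \<Longrightarrow> \<bar>c i s\<bar> \<le> B" unfolding bounded_iff by fastforce
    show ?thesis
      by (rule conv0_integrable[OF rl_kernel_measurable cm[OF i] rl_kernel_integrable B]) (use \<alpha> r False in auto)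
  qed simp
  have "(LINT s:{0..r}|lborel. (r - s) powr (- \<alpha>) * v s) = (LINT s|lborel. indicator {0..r} s * ((r - s) powr (- \<alpha>) * (\<Sum>i<k. c i s * w i)))"
    unfolding set_lebesgue_integral_def by (rule Bochner_Integration.integral_cong) (auto simp: v indicator_def)
  also have "\<dots> = (LINT s|lborel. Gamma (1 - \<alpha>) * (\<Sum>i<k. ?F i s * w i))"
  proof (rule integral_cong_AE)
    have "AE s in lborel. s \<noteq> 0 \<and> s \<noteq> r" using AE_lborel_singleton[of 0] AE_lborel_singleton[of r] by eventually_elim simp
    then show "AE s in lborel. indicator {0..r} s * ((r - s) powr (- \<alpha>) * (\<Sum>i<k. c i s * w i)) = Gamma (1 - \<alpha>) * (\<Sum>i<k. ?F i s * w i)"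
    proof eventually_elim
      case (elim s)
      show ?case
      proof (cases "0 < s \<and> s < r")
        case True
        have "Gamma (1 - \<alpha>) * (?F i s * w i) = (r - s) powr (- \<alpha>) * (c i s * w i)" for i
          using True G by (simp add: rl_kernel_def)
        then have "Gamma (1 - \<alpha>) * (\<Sum>i<k. ?F i s * w i) = (r - s) powr (- \<alpha>) * (\<Sum>i<k. c i s * w i)"
          by (simp only: sum_distrib_left)
        then show ?thesis using True by simp
      qed (use elim in auto)
    qed
  qed (use cm rl_kernel_measurable[measurable] in measurable)
  also have "\<dots> = Gamma (1 - \<alpha>) * (\<Sum>i<k. (LINT s|lborel. ?F i s) * w i)"
    using int by simp
  finally show ?thesis using G by (simp add: conv0_def)
qed

text \<open>The equation holds at each point x separately. It is integrated in time there, and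
  linear independence of the functions e separates the modes afterwards; \<open>volterra_mlk\<close>
  then solves each of them.\<close>

lemma eigenmode_representation:
  fixes c f :: "nat \<Rightarrow> real \<Rightarrow> real" and e :: "nat \<Rightarrow> 'a \<Rightarrow> real"
  assumes \<alpha>: "0 < \<alpha>" "\<alpha> < 1" and \<kappa>: "\<And>i. i < k \<Longrightarrow> 0 \<le> \<kappa> i"
    and c: "\<And>i. i < k \<Longrightarrow> continuous_on UNIV (c i)" and f: "\<And>i. i < k \<Longrightarrow> continuous_on UNIV (f i)"
    and u: "\<And>s x. s \<in> {0..T} \<Longrightarrow> u s x = (\<Sum>i<k. c i s * e i x)"
    and D: "\<And>t x. t \<in> {0<..T} \<Longrightarrow> has_RL_derivative \<alpha> T (\<lambda>r. u r x) (\<Sum>i<k. (f i t - \<kappa> i * c i t) * e i x) t"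
    and indep: "\<And>a b j. (\<lambda>x. \<Sum>i<k. a i * e i x) = (\<lambda>x. \<Sum>i<k. b i * e i x) \<Longrightarrow> j < k \<Longrightarrow> a j = b j"
    and j: "j < k" and t: "0 < t" "t \<le> T"
  shows "c j t = conv0 (ml_kernel \<alpha> (\<kappa> j)) (f j) t"
proof (rule volterra_mlk[OF \<alpha> \<kappa>[OF j] c[OF j] f[OF j] _ t])
  fix t assume t: "0 < t" "t \<le> T"
  have fc: "continuous_on UNIV (\<lambda>s. f i s - \<kappa> i * c i s)" if "i < k" for i
    by (intro continuous_intros c f that)
  have "(\<Sum>i<k. conv0 (rl_kernel (1 - \<alpha>)) (c i) t * e i x) = (\<Sum>i<k. conv0 (rl_kernel 1) (\<lambda>s. f i s - \<kappa> i * c i s) t * e i x)" for x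
  proof -
    define J where "J r = (\<Sum>i<k. conv0 (rl_kernel (1 - \<alpha>)) (c i) r * e i x)" for r
    have JRL: "J r = 1 / Gamma (1 - \<alpha>) * (LINT s:{0..r}|lborel. (r - s) powr (- \<alpha>) * u s x)" if "r \<in> {0..T}" for r
      unfolding J_def by (rule RL_integral_eq_rconv[OF \<alpha> c, symmetric]) (use u that in auto)
    have cont: "continuous_on {0..t} J" unfolding J_def
      by (intro continuous_intros continuous_at_imp_continuous_on ballI conv0_isCont rl_kernel_measurable rl_kernel_integrable c) (use \<alpha> in auto)
    have J0: "J 0 = 0" by (simp add: J_def conv0_def)
    have "(J has_vector_derivative (\<Sum>i<k. (f i r - \<kappa> i * c i r) * e i x)) (at r)" if r: "r \<in> {0<..<t}" for r
    proof -
      have "r \<in> {0<..T}" using r t by simp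
      from D[OF this, of x] have "(J has_vector_derivative (\<Sum>i<k. (f i r - \<kappa> i * c i r) * e i x)) (at r within {0..T})"
        unfolding has_RL_derivative_def has_real_derivative_iff_has_vector_derivative
        by (rule has_vector_derivative_transform[rotated 2]) (use r t JRL in auto)
      moreover have "at r within {0..T} = at r" using r t by (intro at_within_Icc_at) auto
      ultimately show ?thesis by simp
    qed
    \<comment> \<open>Derivatives are available in the open interval only. Continuity of the
      fractional integral up to time 0, where it vanishes, is what excludes the homogeneous solution
      t^(alpha-1).\<close>
    from fundamental_theorem_of_calculus_interior[OF less_imp_le[OF t(1)] cont this]
    have "((\<lambda>r. \<Sum>i<k. (f i r - \<kappa> i * c i r) * e i x) has_integral J t) {0..t}" unfolding J0 by simp
    moreover have "((\<lambda>r. \<Sum>i<k. (f i r - \<kappa> i * c i r) * e i x) has_integral (\<Sum>i<k. integral {0..t} (\<lambda>s. f i s - \<kappa> i * c i s) * e i x)) {0..t}"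
      by (intro has_integral_sum has_integral_mult_left integrable_integral integrable_continuous_interval continuous_on_subset[OF fc]) auto
    ultimately have "J t = (\<Sum>i<k. integral {0..t} (\<lambda>s. f i s - \<kappa> i * c i s) * e i x)" by (rule has_integral_unique)
    also have "\<dots> = (\<Sum>i<k. conv0 (rl_kernel 1) (\<lambda>s. f i s - \<kappa> i * c i s) t * e i x)"
      by (rule sum.cong[OF refl]) (use conv0_rl1[OF fc] t in auto)
    finally show ?thesis by (simp only: J_def)
  qed
  then have "(\<lambda>x. \<Sum>i<k. conv0 (rl_kernel (1 - \<alpha>)) (c i) t * e i x) = (\<lambda>x. \<Sum>i<k. conv0 (rl_kernel 1) (\<lambda>s. f i s - \<kappa> i * c i s) t * e i x)" by (rule ext)
  from indep[OF this j] show "conv0 (rl_kernel (1 - \<alpha>)) (c j) t = conv0 (rl_kernel 1) (\<lambda>s. f j s - \<kappa> j * c j s) t" .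
qed

section \<open>Assembling the estimates\<close>

text \<open>All constants are fixed before mesh, step size and data: C from the scheme and alpha, B
  from s, p and T, and c from these. The triangulation only decides which eigenvalues and
  eigenfunctions occur.\<close>

lemma lp_error_estimate:
  fixes \<Omega> :: "'a::euclidean_space set"
  assumes dom: "convex_polyhedral_domain \<Omega>" and T: "0 < T" and \<alpha>: "0 < \<alpha>" "\<alpha> < 1"
    and p: "1 < p" and s: "1 / p < s" "s < 1" and \<beta>: "\<beta> = L1_weight \<alpha> \<or> \<beta> = BE_weight \<alpha>"
  shows "\<exists>c>0. \<forall>\<T> N \<tau> g gc u U.
    fe_triangulation \<Omega> \<T> \<and> 1 \<le> N \<and> \<tau> = T / real N \<and> \<tau> \<le> 1 \<and>
    g \<in> W_space s p T \<Omega> \<and> continuous_representative T \<Omega> g gc \<and>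
    semidiscrete_solution \<alpha> T \<Omega> \<T> gc u \<and> fully_discrete_solution \<beta> \<alpha> \<tau> N \<Omega> \<T> gc U \<longrightarrow>
    (\<tau> * (\<Sum>n=1..N. L2_norm \<Omega> (\<lambda>x. U n x - u (real n * \<tau>) x) powr p)) powr (1 / p)
      \<le> c * \<tau> powr (min (1 / p + \<alpha>) s) * W_norm s p T \<Omega> g"
proof -
  have \<beta>0: "0 < \<beta> 0" using \<beta> L1_weight_0_pos[OF \<alpha>] by auto
  obtain C where C: "0 \<le> C" "\<And>\<mu> n. 0 \<le> \<mu> \<Longrightarrow> 1 \<le> n \<Longrightarrow> \<bar>ml_primitive \<alpha> \<mu> (real n) - resolvent_sum \<beta> \<mu> n\<bar> \<le> C * real n powr (\<alpha> - 1)"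
    using \<beta> L1_error[OF \<alpha>] BE_error[OF \<alpha>] by blast
  obtain B where B: "0 < B" and WB: "\<forall>(\<Omega> :: 'a set) g gc N \<tau>. 1 \<le> N \<and> \<tau> = T / real N \<and> g \<in> W_space s p T \<Omega> \<and> continuous_representative T \<Omega> g gc \<longrightarrow>
    (\<exists>h. (\<forall>j. 0 \<le> h j) \<and>
      (\<forall>j\<in>{1..N}. \<forall>r\<in>{real (j - 1) * \<tau>..real j * \<tau>}. L2_norm \<Omega> (\<lambda>x. gc r x - gc (real j * \<tau>) x) \<le> h j) \<and>
      (\<Sum>j=1..N. h j powr p) \<le> B * \<tau> powr (s * p - 1) * W_norm s p T \<Omega> g powr p \<and>
      (\<forall>t\<in>{0..T}. L2_norm \<Omega> (gc t) \<le> B * W_norm s p T \<Omega> g))"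
    using W_space_estimates[OF p s(1) T] by blast
  define A where "A = C + 1 / Gamma (\<alpha> + 1)"
  have A: "0 \<le> A" using C(1) \<alpha> Gamma_real_pos[of "\<alpha> + 1"] by (simp add: A_def)
  obtain c where c: "0 < c" and cB: "\<forall>N \<tau> h g1 G \<epsilon>. 1 \<le> N \<and> \<tau> = T / real N \<and> \<tau> \<le> 1 \<and> 0 \<le> G \<and> 0 \<le> g1 \<and> g1 \<le> B * G \<and> (\<forall>j. 0 \<le> h j)
     \<and> (\<Sum>j=1..N. h j powr p) \<le> B * \<tau> powr (s * p - 1) * G powr p
     \<and> (\<forall>n\<in>{1..N}. 0 \<le> \<epsilon> n \<and> \<epsilon> n \<le> A * ((\<Sum>j=1..n. \<tau> powr \<alpha> * real (n - j + 1) powr (\<alpha> - 1) * h j) + \<tau> powr \<alpha> * real n powr (\<alpha> - 1) * g1))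
     \<longrightarrow> (\<tau> * (\<Sum>n=1..N. \<epsilon> n powr p)) powr (1 / p) \<le> c * \<tau> powr (min (1 / p + \<alpha>) s) * G"
    using lp_bound[OF \<alpha> p s(2) T A less_imp_le[OF B]] by blast
  have "(\<tau> * (\<Sum>n=1..N. L2_norm \<Omega> (\<lambda>x. U n x - u (real n * \<tau>) x) powr p)) powr (1 / p)
      \<le> c * \<tau> powr (min (1 / p + \<alpha>) s) * W_norm s p T \<Omega> g"
    if tri: "fe_triangulation \<Omega> \<T>" and N: "1 \<le> N" and \<tau>: "\<tau> = T / real N" "\<tau> \<le> 1"
      and g: "g \<in> W_space s p T \<Omega>" and gc: "continuous_representative T \<Omega> g gc"
      and semi: "semidiscrete_solution \<alpha> T \<Omega> \<T> gc u" and full: "fully_discrete_solution \<beta> \<alpha> \<tau> N \<Omega> \<T> gc U"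
    for \<T> N \<tau> g gc u U
  proof -
    define W where "W = W_norm s p T \<Omega> g"
    have W: "0 \<le> W" by (simp add: W_def W_norm_def)
    have \<tau>0: "0 < \<tau>" using T N by (simp add: \<tau>)
    have grid: "real n * \<tau> \<in> {0<..T}" if "n \<in> {1..N}" for n
    proof -
      have "real n * \<tau> \<le> real N * \<tau>" using that \<tau>0 by (intro mult_right_mono) auto
      moreover have "real N * \<tau> = T" using N by (simp add: \<tau>)
      moreover have "0 < real n * \<tau>" using that \<tau>0 by simp
      ultimately show ?thesis by simp
    qed
    obtain h where h: "\<And>j. 0 \<le> h j"
        "\<And>j r. j \<in> {1..N} \<Longrightarrow> r \<in> {real (j - 1) * \<tau>..real j * \<tau>} \<Longrightarrow> L2_norm \<Omega> (\<lambda>x. gc r x - gc (real j * \<tau>) x) \<le> h j"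
        "(\<Sum>j=1..N. h j powr p) \<le> B * \<tau> powr (s * p - 1) * W powr p"
      and g1: "\<And>t. t \<in> {0..T} \<Longrightarrow> L2_norm \<Omega> (gc t) \<le> B * W"
      using WB[rule_format, of N \<tau> g \<Omega> gc] N \<tau>(1) g gc unfolding W_def by blast
    obtain k e \<kappa> where "form_pair.orthonormal (fe_space \<Omega> \<T>) (L2_inner \<Omega>) k e"
        and \<kappa>: "\<And>i. i < k \<Longrightarrow> 0 \<le> \<kappa> i" and eig: "\<And>i v. i < k \<Longrightarrow> v \<in> fe_space \<Omega> \<T> \<Longrightarrow> grad_inner \<Omega> (e i) v = \<kappa> i * L2_inner \<Omega> (e i) v"
        and span: "\<And>v. v \<in> fe_space \<Omega> \<T> \<Longrightarrow> v = (\<lambda>x. \<Sum>i<k. L2_inner \<Omega> v (e i) * e i x)"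
      using form_pair.spectral_decomposition[OF form_pair_fe[OF dom tri]] by blast
    then have on: "\<And>i. i < k \<Longrightarrow> e i \<in> fe_space \<Omega> \<T>" "\<And>i j. i < k \<Longrightarrow> j < k \<Longrightarrow> L2_inner \<Omega> (e i) (e j) = (if i = j then 1 else 0)"
      by (auto simp: form_pair.orthonormal_def[OF form_pair_fe[OF dom tri]])
    have lap: "discrete_laplacian \<Omega> \<T> \<phi> = (\<lambda>x. \<Sum>i<k. (- \<kappa> i * L2_inner \<Omega> \<phi> (e i)) * e i x)" if "\<phi> \<in> fe_space \<Omega> \<T>" for \<phi>
      by (rule eigenbasis_formulas(1)[where e = e and \<kappa> = \<kappa> and k = k]) (fact dom tri on eig span that)+
    have proj: "L2_projection \<Omega> \<T> v = (\<lambda>x. \<Sum>i<k. L2_inner \<Omega> v (e i) * e i x)" if "v \<in> L2 \<Omega>" for v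
      by (rule eigenbasis_formulas(2)[where e = e and \<kappa> = \<kappa> and k = k]) (fact dom tri on eig span that)+
    have coeff: "L2_inner \<Omega> (\<lambda>x. \<Sum>i<k. b i * e i x) (e j) = b j" if "j < k" for b j
      by (rule eigenbasis_formulas(3)[where e = e and \<kappa> = \<kappa> and k = k]) (fact dom tri on eig span that)+
    have bessel: "(\<Sum>i<k. (L2_inner \<Omega> v (e i))\<^sup>2) \<le> (L2_norm \<Omega> v)\<^sup>2" if "v \<in> L2 \<Omega>" for v
      by (rule eigenbasis_formulas(4)[where e = e and \<kappa> = \<kappa> and k = k]) (fact dom tri on eig span that)+
    have parseval: "(L2_norm \<Omega> v)\<^sup>2 = (\<Sum>i<k. (L2_inner \<Omega> v (e i))\<^sup>2)" if "v \<in> fe_space \<Omega> \<T>" for v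
      by (rule eigenbasis_formulas(5)[where e = e and \<kappa> = \<kappa> and k = k]) (fact dom tri on eig span that)+
    have eL: "e i \<in> L2 \<Omega>" if "i < k" for i by (rule fe_space_L2[OF dom tri on(1)[OF that]])
    have gL: "gc t \<in> L2 \<Omega>" if "t \<in> {0..T}" for t using gc that by (simp add: continuous_representative_def L2_continuous_def)
    have uV: "u t \<in> fe_space \<Omega> \<T>" if "t \<in> {0..T}" for t using semi that by (simp add: semidiscrete_solution_def)
    have UV: "U n \<in> fe_space \<Omega> \<T>" if "n \<le> N" for n using full that by (simp add: fully_discrete_solution_def)
    have indep: "a j = b j" if "(\<lambda>x. \<Sum>i<k. a i * e i x) = (\<lambda>x. \<Sum>i<k. b i * e i x)" "j < k" for a b j
      using coeff[OF that(2), of a] coeff[OF that(2), of b] unfolding that(1) by simp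
    define y where "y i t = L2_inner \<Omega> (u (clamp_to T t)) (e i)" for i t
    define f where "f i t = L2_inner \<Omega> (gc (clamp_to T t)) (e i)" for i t
    define V where "V i n = L2_inner \<Omega> (U n) (e i)" for i n
    have y_eq: "y i t = L2_inner \<Omega> (u t) (e i)" and f_eq: "f i t = L2_inner \<Omega> (gc t) (e i)" if "t \<in> {0..T}" for i t
      by (simp_all add: y_def f_def clamp_to_id[OF that])
    have yc: "continuous_on UNIV (y i)" if "i < k" for i
      unfolding y_def by (rule L2_coefficient_continuous[OF T _ eL[OF that]]) (use semi in \<open>simp add: semidiscrete_solution_def\<close>)
    have fc: "continuous_on UNIV (f i)" if "i < k" for i
      unfolding f_def by (rule L2_coefficient_continuous[OF T _ eL[OF that]]) (use gc in \<open>simp add: continuous_representative_def\<close>)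
    have ux: "u t x = (\<Sum>i<k. y i t * e i x)" if "t \<in> {0..T}" for t x
      unfolding y_eq[OF that] by (rule fun_cong[OF span[OF uV[OF that]]])
    have der: "has_RL_derivative \<alpha> T (\<lambda>r. u r x) (\<Sum>i<k. (f i t - \<kappa> i * y i t) * e i x) t" if t: "t \<in> {0<..T}" for t x
    proof -
      have t': "t \<in> {0..T}" using t by simp
      obtain D where D: "has_RL_derivative \<alpha> T (\<lambda>r. u r x) D t" "D - discrete_laplacian \<Omega> \<T> (u t) x = L2_projection \<Omega> \<T> (gc t) x"
        using semi t unfolding semidiscrete_solution_def by blast
      have "D = (\<Sum>i<k. f i t * e i x) + (\<Sum>i<k. (- \<kappa> i * y i t) * e i x)"
        using D(2) unfolding lap[OF uV[OF t']] proj[OF gL[OF t']] y_eq[OF t'] f_eq[OF t'] by linarith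
      also have "\<dots> = (\<Sum>i<k. (f i t - \<kappa> i * y i t) * e i x)"
        unfolding sum.distrib[symmetric] by (rule sum.cong) (simp_all add: algebra_simps)
      finally show ?thesis using D(1) by simp
    qed
    have mode: "y i t = conv0 (ml_kernel \<alpha> (\<kappa> i)) (f i) t" if "i < k" "t \<in> {0<..T}" for i t

    proof (rule eigenmode_representation[where e = e and u = u and c = y and f = f and \<kappa> = \<kappa> and k = k and T = T])
      show "0 < t" "t \<le> T" using that(2) by auto
    qed (fact \<alpha> \<kappa> yc fc ux der indep that(1))+
    have V0: "V i 0 = 0" for i using full by (simp add: fully_discrete_solution_def V_def L2_inner_def)
    have Vstep: "\<tau> powr (- \<alpha>) * (\<Sum>j\<le>n. \<beta> (n - j) * V i j) + \<kappa> i * V i n = f i (real n * \<tau>)" if i: "i < k" and n: "1 \<le> n" "n \<le> N" for i n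
    proof -
      have t: "real n * \<tau> \<in> {0..T}" using grid[of n] n by simp
      have Ux: "U j x = (\<Sum>i<k. V i j * e i x)" if "j \<le> N" for j x
        unfolding V_def by (rule fun_cong[OF span[OF UV[OF that]]])
      have "(\<Sum>i<k. (\<tau> powr (- \<alpha>) * (\<Sum>j\<le>n. \<beta> (n - j) * V i j) + \<kappa> i * V i n) * e i x) = (\<Sum>i<k. f i (real n * \<tau>) * e i x)" for x
      proof -
        have "discrete_derivative \<beta> \<alpha> \<tau> (\<lambda>j. U j x) n - discrete_laplacian \<Omega> \<T> (U n) x = L2_projection \<Omega> \<T> (gc (real n * \<tau>)) x"
          using full n unfolding fully_discrete_solution_def by simp
        then have "discrete_derivative \<beta> \<alpha> \<tau> (\<lambda>j. U j x) n = (\<Sum>i<k. f i (real n * \<tau>) * e i x) + (\<Sum>i<k. (- \<kappa> i * V i n) * e i x)"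
          unfolding lap[OF UV[OF n(2)]] proj[OF gL[OF t]] V_def f_eq[OF t] by linarith
        moreover have "discrete_derivative \<beta> \<alpha> \<tau> (\<lambda>j. U j x) n = (\<Sum>i<k. \<tau> powr (- \<alpha>) * (\<Sum>j\<le>n. \<beta> (n - j) * V i j) * e i x)"
        proof -
          have "(\<Sum>j=0..n. \<beta> (n - j) * U j x) = (\<Sum>j\<le>n. \<Sum>i<k. \<beta> (n - j) * V i j * e i x)"
            unfolding atLeast0AtMost by (rule sum.cong[OF refl]) (use Ux n in \<open>simp add: sum_distrib_left mult.assoc\<close>)
          also have "\<dots> = (\<Sum>i<k. (\<Sum>j\<le>n. \<beta> (n - j) * V i j) * e i x)"
            unfolding sum_distrib_right by (rule sum.swap)
          finally show ?thesis unfolding discrete_derivative_def by (simp only: sum_distrib_left[where A = "{..<k}"] mult.assoc)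
        qed
        ultimately show ?thesis by (simp add: distrib_right sum.distrib sum_negf)
      qed
      then have "(\<lambda>x. \<Sum>i<k. (\<tau> powr (- \<alpha>) * (\<Sum>j\<le>n. \<beta> (n - j) * V i j) + \<kappa> i * V i n) * e i x) = (\<lambda>x. \<Sum>i<k. f i (real n * \<tau>) * e i x)" by (rule ext)
      from indep[OF this i] show ?thesis .
    qed
    \<comment> \<open>Bessel's inequality bounds the oscillation of all modes together by that of g,
      so the number of modes leaves no trace in the constant.\<close>
    have fh: "(\<Sum>i<k. (f i r - f i (real j * \<tau>))\<^sup>2) \<le> (h j)\<^sup>2"
      if j: "1 \<le> j" "j \<le> N" and r: "real (j - 1) * \<tau> \<le> r" "r \<le> real j * \<tau>" for j r
    proof -
      have j': "real j * \<tau> \<in> {0..T}" using grid[of j] j by simp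
      have "0 \<le> real (j - 1) * \<tau>" using \<tau>0 by simp
      then have r': "r \<in> {0..T}" using r j' by simp
      have "(\<Sum>i<k. (f i r - f i (real j * \<tau>))\<^sup>2) = (\<Sum>i<k. (L2_inner \<Omega> (\<lambda>x. gc r x - gc (real j * \<tau>) x) (e i))\<^sup>2)"
        by (rule sum.cong[OF refl]) (simp add: f_eq[OF r'] f_eq[OF j'] L2_inner_diff[OF gL[OF r'] gL[OF j'] eL])
      also have "\<dots> \<le> (L2_norm \<Omega> (\<lambda>x. gc r x - gc (real j * \<tau>) x))\<^sup>2" by (rule bessel[OF L2_diff[OF gL[OF r'] gL[OF j']]])
      also have "\<dots> \<le> (h j)\<^sup>2" by (intro power_mono L2_norm_nonneg h(2)) (use j r in auto)
      finally show ?thesis .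
    qed
    have fg: "(\<Sum>i<k. (f i \<tau>)\<^sup>2) \<le> (B * W)\<^sup>2"
    proof -
      have t: "\<tau> \<in> {0..T}" using grid[of 1] N by simp
      have "(\<Sum>i<k. (f i \<tau>)\<^sup>2) \<le> (L2_norm \<Omega> (gc \<tau>))\<^sup>2" unfolding f_eq[OF t] by (rule bessel[OF gL[OF t]])
      also have "\<dots> \<le> (B * W)\<^sup>2" by (intro power_mono L2_norm_nonneg g1 t)
      finally show ?thesis .
    qed
    have err: "L2_norm \<Omega> (\<lambda>x. U n x - u (real n * \<tau>) x)
        \<le> A * ((\<Sum>j=1..n. \<tau> powr \<alpha> * real (n - j + 1) powr (\<alpha> - 1) * h j) + \<tau> powr \<alpha> * real n powr (\<alpha> - 1) * (B * W))"
      if n: "n \<in> {1..N}" for n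
    proof -
      have t: "real n * \<tau> \<in> {0..T}" and n': "n \<le> N" using grid[OF n] n by auto
      have dV: "(\<lambda>x. U n x - u (real n * \<tau>) x) \<in> fe_space \<Omega> \<T>"
        using fe_space_comb[OF dom tri UV[OF n'] uV[OF t], of 1 "-1"] by simp
      have "(L2_norm \<Omega> (\<lambda>x. U n x - u (real n * \<tau>) x))\<^sup>2 = (\<Sum>i<k. (conv0 (ml_kernel \<alpha> (\<kappa> i)) (f i) (real n * \<tau>) - V i n)\<^sup>2)"
        unfolding parseval[OF dV]
      proof (rule sum.cong[OF refl])
        fix i assume "i \<in> {..<k}"
        then have i: "i < k" by simp
        have "L2_inner \<Omega> (\<lambda>x. U n x - u (real n * \<tau>) x) (e i) = V i n - y i (real n * \<tau>)"
          unfolding V_def y_eq[OF t] by (intro L2_inner_diff eL i fe_space_L2[OF dom tri] UV n' uV t)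
        then show "(L2_inner \<Omega> (\<lambda>x. U n x - u (real n * \<tau>) x) (e i))\<^sup>2 = (conv0 (ml_kernel \<alpha> (\<kappa> i)) (f i) (real n * \<tau>) - V i n)\<^sup>2"
          unfolding mode[OF i grid[OF n]] by (simp only: power2_commute)
      qed
      then have "L2_norm \<Omega> (\<lambda>x. U n x - u (real n * \<tau>) x) = sqrt (\<Sum>i<k. (conv0 (ml_kernel \<alpha> (\<kappa> i)) (f i) (real n * \<tau>) - V i n)\<^sup>2)"
        using L2_norm_nonneg real_sqrt_unique by metis
      also have "sqrt (\<Sum>i<k. (conv0 (ml_kernel \<alpha> (\<kappa> i)) (f i) (real n * \<tau>) - V i n)\<^sup>2)
        \<le> (C + 1 / Gamma (\<alpha> + 1)) * ((\<Sum>j=1..n. \<tau> powr \<alpha> * real (n - j + 1) powr (\<alpha> - 1) * h j) + \<tau> powr \<alpha> * real n powr (\<alpha> - 1) * (B * W))"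
        by (rule vector_error[where N = N and \<beta> = \<beta>, OF \<alpha> \<beta>0 C finite_lessThan _ \<tau>0]) (use \<kappa> fc V0 Vstep n h(1) fh fg B W in auto)
      finally show ?thesis by (simp only: A_def)
    qed
    show ?thesis unfolding W_def[symmetric]
      by (rule cB[rule_format, where h = h and ?g1.0 = "B * W" and N = N]) (use N \<tau> W B h err L2_norm_nonneg in auto)
  qed
  with c show ?thesis by blast
qed

theorem theorem2p3:
  fixes \<Omega> :: "'a::euclidean_space set"
    and T \<alpha> p p' \<kappa> \<kappa>' :: real
    and \<beta> :: "nat \<Rightarrow> real"
  assumes "DIM('a) \<in> {1, 2, 3}"
    and "convex_polyhedral_domain \<Omega>"
    and "0 < T"
    and "0 < \<alpha>" and "\<alpha> < 1"
    and "1 < p" and "1 / p + 1 / p' = 1"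
    and "\<beta> = L1_weight \<alpha> \<or> \<beta> = BE_weight \<alpha>"
  shows "(\<forall>s. 1 / p < s \<and> s < 1 \<longrightarrow>
           (\<exists>c>0. \<forall>\<T> N \<tau> g gc u U.
              fe_triangulation \<Omega> \<T> \<and> shape_regular \<kappa> \<T> \<and> quasi_uniform \<kappa>' \<T> \<and>
              1 \<le> N \<and> \<tau> = T / real N \<and> \<tau> \<le> 1 \<and>
              g \<in> W_space s p T \<Omega> \<and> continuous_representative T \<Omega> g gc \<and>
              semidiscrete_solution \<alpha> T \<Omega> \<T> gc u \<and>
              fully_discrete_solution \<beta> \<alpha> \<tau> N \<Omega> \<T> gc U \<longrightarrow>
              (\<tau> * (\<Sum>n=1..N. L2_norm \<Omega> (\<lambda>x. U n x - u (real n * \<tau>) x) powr p)) powr (1 / p)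
                \<le> c * \<tau> powr (min (1 / p + \<alpha>) s) * W_norm s p T \<Omega> g)) \<and>
         (1 / \<alpha> < p \<and> 0 < \<alpha> \<and> \<alpha> < 1 / p' \<longrightarrow>
           (\<exists>c>0. \<forall>\<T> N \<tau> g gc u U.
              fe_triangulation \<Omega> \<T> \<and> shape_regular \<kappa> \<T> \<and> quasi_uniform \<kappa>' \<T> \<and>
              1 \<le> N \<and> \<tau> = T / real N \<and> \<tau> \<le> 1 \<and>
              g \<in> W_space (1 / p + \<alpha>) p T \<Omega> \<and> continuous_representative T \<Omega> g gc \<and>
              semidiscrete_solution \<alpha> T \<Omega> \<T> gc u \<and>
              fully_discrete_solution \<beta> \<alpha> \<tau> N \<Omega> \<T> gc U \<longrightarrow>
              Max ((\<lambda>n. L2_norm \<Omega> (\<lambda>x. U n x - u (real n * \<tau>) x)) ` {1..N})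
                \<le> c * \<tau> powr \<alpha> * W_norm (1 / p + \<alpha>) p T \<Omega> g))"
proof -
  note \<alpha> = assms(4,5)
  have main: "\<exists>c>0. \<forall>\<T> N \<tau> g gc u U.
              fe_triangulation \<Omega> \<T> \<and> shape_regular \<kappa> \<T> \<and> quasi_uniform \<kappa>' \<T> \<and>
              1 \<le> N \<and> \<tau> = T / real N \<and> \<tau> \<le> 1 \<and>
              g \<in> W_space s p T \<Omega> \<and> continuous_representative T \<Omega> g gc \<and>
              semidiscrete_solution \<alpha> T \<Omega> \<T> gc u \<and>
              fully_discrete_solution \<beta> \<alpha> \<tau> N \<Omega> \<T> gc U \<longrightarrow>
              (\<tau> * (\<Sum>n=1..N. L2_norm \<Omega> (\<lambda>x. U n x - u (real n * \<tau>) x) powr p)) powr (1 / p)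
                \<le> c * \<tau> powr (min (1 / p + \<alpha>) s) * W_norm s p T \<Omega> g"
    if s: "1 / p < s" "s < 1" for s
    using lp_error_estimate[OF assms(2,3) \<alpha> assms(6) s assms(8)] by meson
  have max_le: "Max ((\<lambda>n. \<epsilon> n) ` {1..N}) \<le> c * \<tau> powr \<alpha> * W"
    if N: "1 \<le> N" and \<tau>: "0 < \<tau>" and \<epsilon>: "\<And>n. 0 \<le> \<epsilon> n"
      and le: "(\<tau> * (\<Sum>n=1..N. \<epsilon> n powr p)) powr (1 / p) \<le> c * \<tau> powr (1 / p + \<alpha>) * W"
    for N :: nat and \<tau> c W :: real and \<epsilon> :: "nat \<Rightarrow> real"
  proof -
    have "\<epsilon> n \<le> c * \<tau> powr \<alpha> * W" if n: "n \<in> {1..N}" for n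
    proof -
      have "\<epsilon> n powr p \<le> (\<Sum>n=1..N. \<epsilon> n powr p)" using n by (intro member_le_sum) auto
      then have "(\<tau> * \<epsilon> n powr p) powr (1 / p) \<le> (\<tau> * (\<Sum>n=1..N. \<epsilon> n powr p)) powr (1 / p)"
        using \<tau> assms(6) by (intro powr_mono2 mult_left_mono) auto
      moreover have "(\<tau> * \<epsilon> n powr p) powr (1 / p) = \<tau> powr (1 / p) * \<epsilon> n"
        using \<tau> \<epsilon>[of n] assms(6) by (simp add: powr_mult powr_powr)
      ultimately have "\<tau> powr (1 / p) * \<epsilon> n \<le> \<tau> powr (1 / p) * (c * \<tau> powr \<alpha> * W)"
        using le by (simp add: powr_add mult_ac)
      then show ?thesis using \<tau> by simp
    qed
    then show ?thesis using N by simp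
  qed
  show ?thesis
  proof (intro conjI allI impI)
    fix s assume "1 / p < s \<and> s < 1"
    then show "\<exists>c>0. \<forall>\<T> N \<tau> g gc u U.
              fe_triangulation \<Omega> \<T> \<and> shape_regular \<kappa> \<T> \<and> quasi_uniform \<kappa>' \<T> \<and>
              1 \<le> N \<and> \<tau> = T / real N \<and> \<tau> \<le> 1 \<and>
              g \<in> W_space s p T \<Omega> \<and> continuous_representative T \<Omega> g gc \<and>
              semidiscrete_solution \<alpha> T \<Omega> \<T> gc u \<and>
              fully_discrete_solution \<beta> \<alpha> \<tau> N \<Omega> \<T> gc U \<longrightarrow>
              (\<tau> * (\<Sum>n=1..N. L2_norm \<Omega> (\<lambda>x. U n x - u (real n * \<tau>) x) powr p)) powr (1 / p)
                \<le> c * \<tau> powr (min (1 / p + \<alpha>) s) * W_norm s p T \<Omega> g" using main by blast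
  next
    assume *: "1 / \<alpha> < p \<and> 0 < \<alpha> \<and> \<alpha> < 1 / p'"
    \<comment> \<open>The condition alpha < 1/p' says exactly that 1/p + alpha < 1, so the first
      part applies with this s; the two entries of the minimum then coincide.\<close>
    have s: "1 / p < 1 / p + \<alpha>" "1 / p + \<alpha> < 1" using * assms(7) by linarith+
    obtain c where c: "0 < c" and est: "\<And>\<T> N \<tau> g gc u U.
              fe_triangulation \<Omega> \<T> \<and> shape_regular \<kappa> \<T> \<and> quasi_uniform \<kappa>' \<T> \<and>
              1 \<le> N \<and> \<tau> = T / real N \<and> \<tau> \<le> 1 \<and>
              g \<in> W_space (1 / p + \<alpha>) p T \<Omega> \<and> continuous_representative T \<Omega> g gc \<and>
              semidiscrete_solution \<alpha> T \<Omega> \<T> gc u \<and>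
              fully_discrete_solution \<beta> \<alpha> \<tau> N \<Omega> \<T> gc U \<Longrightarrow>
              (\<tau> * (\<Sum>n=1..N. L2_norm \<Omega> (\<lambda>x. U n x - u (real n * \<tau>) x) powr p)) powr (1 / p)
                \<le> c * \<tau> powr (1 / p + \<alpha>) * W_norm (1 / p + \<alpha>) p T \<Omega> g"
      using main[OF s] unfolding min.idem by meson
    show "\<exists>c>0. \<forall>\<T> N \<tau> g gc u U.
              fe_triangulation \<Omega> \<T> \<and> shape_regular \<kappa> \<T> \<and> quasi_uniform \<kappa>' \<T> \<and>
              1 \<le> N \<and> \<tau> = T / real N \<and> \<tau> \<le> 1 \<and>
              g \<in> W_space (1 / p + \<alpha>) p T \<Omega> \<and> continuous_representative T \<Omega> g gc \<and>
              semidiscrete_solution \<alpha> T \<Omega> \<T> gc u \<and>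
              fully_discrete_solution \<beta> \<alpha> \<tau> N \<Omega> \<T> gc U \<longrightarrow>
              Max ((\<lambda>n. L2_norm \<Omega> (\<lambda>x. U n x - u (real n * \<tau>) x)) ` {1..N})
                \<le> c * \<tau> powr \<alpha> * W_norm (1 / p + \<alpha>) p T \<Omega> g"
    proof (rule exI[of _ c], intro conjI allI impI, rule c, rule max_le, goal_cases)
      case 2
      then show ?case using assms(3) by simp
    next
      case 3
      show ?case by (rule L2_norm_nonneg)
    next
      case 4
      then show ?case by (rule est)
    qed simp
  qed
qed

end
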